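(* Let $(\Sigma,d_\Sigma)$ be a Polish space and let $((x_i^n)_{1\le i\le n})_{n\ge1}$ be a triangular array of elements of $\Sigma$ such that $\frac1n\sum_{i=1}^n\delta_{x_i^n}\to\mu\in M_1(\Sigma)$ weakly. Let $((W_i^n)_{1\le i\le n})_{n\ge1}$ be a triangular array of $\mathbb{R}_+$-valued random variables on a probability space $(\Omega,\mathcal{A},\mathbb{P})$ such that: for every $n\ge1$, $\sum_{i=1}^nW_i^n=n$; for every $n\ge1$ the vector $(W_1^n,\dots,W_n^n)$ is exchangeable; and the sequence $\left(\frac1n\sum_{i=1}^n\delta_{W_i^n}\right)_{n\ge1}$ satisfies an LDP on $M_1^1(\mathbb{R}_+)$ endowed with the distance $W_{1,|\cdot|}$ with good rate function $I^W$. Then the sequence $$\mathcal{V}^n=\frac1n\sum_{i=1}^n\delta_{(W_i^n,x_i^n)},\qquad n\ge1,$$ satisfies an LDP on $\mathcal{M}_1^1(\mathbb{R}_+\times\Sigma)$ endowed with the distance $\Delta$ with good rate function $$\mathcal{J}(\rho;\mu)=\begin{cases}H(\rho\,|\,\rho_1\otimes\mu)+I^W(\rho_1)&\text{if }\rho_2=\mu,\\+\infty&\text{otherwise.}\end{cases}$$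
   Context: LDP: a sequence of Borel probability measures $(P^n)$ on a topological space $\mathcal{Y}$ satisfies an LDP with rate function $I$ if $I:\mathcal{Y}\to[0,\infty]$ is lower semicontinuous and, for every measurable $A\subset\mathcal{Y}$ with interior $A^o$ and closure $\bar A$, $-\inf_{A^o}I\le\liminf_n\frac1n\log P^n(A)\le\limsup_n\frac1n\log P^n(A)\le-\inf_{\bar A}I$. $I$ is good if its level sets $\{I\le\alpha\}$, $\alpha<\infty$, are compact. A sequence of random variables satisfies an LDP if their laws do. $M_1(E)$ denotes the set of Borel probability measures on $E$. $M_1^1(\mathbb{R}_+)=\{\rho\in M_1(\mathbb{R}_+):\int x\,\rho(dx)=1\}$. $W_{1,|\cdot|}(\rho,\gamma)=\inf_\pi\int|x-y|\,\pi(dx,dy)$, the infimum being over couplings $\pi$ of $\rho$ and $\gamma$. For $\rho\in M_1(\mathbb{R}_+\times\Sigma)$, $\rho_1\in M_1(\mathbb{R}_+)$ and $\rho_2\in M_1(\Sigma)$ are its first and second marginals. $\mathcal{M}_1^1(\mathbb{R}_+\times\Sigma)=\{\rho\in M_1(\mathbb{R}_+\times\Sigma):\int_{\mathbb{R}_+}x\,\rho_1(dx)=1\}$, with the distance $\Delta(\rho,\gamma)=W_{1,|\cdot|}(\rho_1,\gamma_1)+\beta_{BL,\delta}(\rho,\gamma)$, where $\delta$ is a metric on $\mathbb{R}_+\times\Sigma$ compatible with the product topology, $\beta_{BL,\delta}(\rho,\gamma)=\sup\{|\int f\,d\rho-\int f\,d\gamma|: f\in C_b(\mathbb{R}_+\times\Sigma),\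 \|f\|_\infty+\|f\|_{L,\delta}\le1\}$ with integrals over $\mathbb{R}_+\times\Sigma$, $C_b$ is the set of bounded continuous real functions, and $\|f\|_{L,\delta}=\sup_{x\ne y}|f(x)-f(y)|/\delta(x,y)$. Relative entropy: $H(\nu|\rho)=\int\log\frac{d\nu}{d\rho}\,d\nu$ if $\nu\ll\rho$, $+\infty$ otherwise. Exchangeable means that the law of $(W_{\sigma(1)}^n,\dots,W_{\sigma(n)}^n)$ is the same for every permutation $\sigma$ of $\{1,\dots,n\}$. *)

theory Defs
  imports "HOL-Probability.Probability"
begin

section \<open>Large deviation principles\<close>

definition borel_of :: "'a topology \<Rightarrow> 'a measure" where
  "borel_of X = sigma (topspace X) {U. openin X U}"

definition elog :: "real \<Rightarrow> ereal" where
  "elog p = (if p = 0 then - \<infinity> else ereal (ln p))"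

definition lower_semicontinuous :: "'a topology \<Rightarrow> ('a \<Rightarrow> ereal) \<Rightarrow> bool" where
  "lower_semicontinuous X I \<longleftrightarrow> (\<forall>a. openin X {y \<in> topspace X. a < I y})"

text \<open>
  A rate function on a space \<open>X\<close> is a total HOL function; only its values on \<open>topspace X\<close>
  are constrained or used.
\<close>

definition rate_function :: "'a topology \<Rightarrow> ('a \<Rightarrow> ereal) \<Rightarrow> bool" where
  "rate_function X I \<longleftrightarrow> (\<forall>y\<in>topspace X. 0 \<le> I y) \<and> lower_semicontinuous X I"

definition good_rate_function :: "'a topology \<Rightarrow> ('a \<Rightarrow> ereal) \<Rightarrow> bool" where
  "good_rate_function X I \<longleftrightarrow>
     rate_function X I \<and> (\<forall>\<alpha>::real. compactin X {y \<in> topspace X. I y \<le> ereal \<alpha>})"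

text \<open>Sequences are indexed from \<open>1\<close>; the value at index \<open>0\<close> is ignored.\<close>

definition LDP :: "'a topology \<Rightarrow> (nat \<Rightarrow> 'a measure) \<Rightarrow> ('a \<Rightarrow> ereal) \<Rightarrow> bool" where
  "LDP X P I \<longleftrightarrow>
     (\<forall>n\<ge>1. prob_space (P n) \<and> sets (P n) = sets (borel_of X)) \<and>
     rate_function X I \<and>
     (\<forall>A\<in>sets (borel_of X).
        - (INF y\<in>X interior_of A. I y) \<le> liminf (\<lambda>n. ereal (1 / real n) * elog (measure (P n) A)) \<and>
        liminf (\<lambda>n. ereal (1 / real n) * elog (measure (P n) A))
          \<le> limsup (\<lambda>n. ereal (1 / real n) * elog (measure (P n) A)) \<and>
        limsup (\<lambda>n. ereal (1 / real n) * elog (measure (P n) A)) \<le> - (INF y\<in>X closure_of A. I y))"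

text \<open>LDP for random elements \<open>V n\<close> of \<open>X\<close> defined on the probability space \<open>M\<close>.\<close>

definition LDP_rv ::
  "'w measure \<Rightarrow> 'a topology \<Rightarrow> (nat \<Rightarrow> 'w \<Rightarrow> 'a) \<Rightarrow> ('a \<Rightarrow> ereal) \<Rightarrow> bool" where
  "LDP_rv M X V I \<longleftrightarrow>
     (\<forall>n\<ge>1. V n \<in> M \<rightarrow>\<^sub>M borel_of X) \<and> LDP X (\<lambda>n. distr M (borel_of X) (V n)) I"


section \<open>Spaces of probability measures\<close>

text \<open>
  Borel probability measures on a subspace \<open>E\<close> of a topological space. They live on the
  measurable space \<open>restrict_space borel E\<close>, so that \<open>space \<rho> = E\<close>.
\<close>

definition borel_probs :: "'a::topological_space set \<Rightarrow> 'a measure set" where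
  "borel_probs E = {\<rho>. prob_space \<rho> \<and> sets \<rho> = sets (restrict_space borel E)}"

abbreviation R_plus :: "real set" where
  "R_plus \<equiv> {0..}"

abbreviation R_plus_times :: "(real \<times> 's) set" where
  "R_plus_times \<equiv> R_plus \<times> UNIV"

definition weakly_converges ::
  "(nat \<Rightarrow> 'a::topological_space measure) \<Rightarrow> 'a measure \<Rightarrow> bool" where
  "weakly_converges \<mu>s \<mu> \<longleftrightarrow>
     (\<forall>f::'a \<Rightarrow> real. continuous_on UNIV f \<and> bounded (range f) \<longrightarrow>
        (\<lambda>n. \<integral>x. f x \<partial>\<mu>s n) \<longlonglongrightarrow> (\<integral>x. f x \<partial>\<mu>))"

text \<open>
  The measure \<open>(1/n) \<Sum>\<^sub>i \<delta>\<^bsub>z i\<^esub>\<close>, \<open>i = 1, \<dots>, n\<close>, on the measurable space \<open>B\<close>,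
  for \<open>n \<ge> 1\<close> and points \<open>z i \<in> space B\<close>.
\<close>

definition empirical_measure :: "'a measure \<Rightarrow> nat \<Rightarrow> (nat \<Rightarrow> 'a) \<Rightarrow> 'a measure" where
  "empirical_measure B n z =
     measure_of (space B) (sets B) (\<lambda>A. (\<Sum>i=1..n. emeasure (return B (z i)) A) / of_nat n)"

definition marginal1 :: "(real \<times> 's::topological_space) measure \<Rightarrow> real measure" where
  "marginal1 \<rho> = distr \<rho> (restrict_space borel R_plus) fst"

definition marginal2 :: "(real \<times> 's::topological_space) measure \<Rightarrow> 's measure" where
  "marginal2 \<rho> = distr \<rho> borel snd"

definition M11 :: "real measure set" where
  "M11 = {\<rho> \<in> borel_probs R_plus. (\<integral>\<^sup>+x. ennreal x \<partial>\<rho>) = 1}"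

definition M11_times :: "(real \<times> 's::topological_space) measure set" where
  "M11_times = {\<rho> \<in> borel_probs R_plus_times. (\<integral>\<^sup>+x. ennreal x \<partial>marginal1 \<rho>) = 1}"


section \<open>The distances\<close>

definition couplings :: "real measure \<Rightarrow> real measure \<Rightarrow> (real \<times> real) measure set" where
  "couplings \<rho> \<gamma> =
     {\<pi> \<in> borel_probs (R_plus \<times> R_plus).
        distr \<pi> (restrict_space borel R_plus) fst = \<rho> \<and>
        distr \<pi> (restrict_space borel R_plus) snd = \<gamma>}"

text \<open>
  Infima and suprema are taken in \<open>[0,\<infinity>]\<close> and then converted to reals; on \<open>M11\<close> and
  \<open>M11_times\<close> they are finite.
\<close>

definition W1 :: "real measure \<Rightarrow> real measure \<Rightarrow> real" where
  "W1 \<rho> \<gamma> =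
     enn2real (INF \<pi>\<in>couplings \<rho> \<gamma>. \<integral>\<^sup>+z. ennreal \<bar>fst z - snd z\<bar> \<partial>\<pi>)"

definition sup_norm :: "'a set \<Rightarrow> ('a \<Rightarrow> real) \<Rightarrow> ennreal" where
  "sup_norm S f = (SUP x\<in>S. ennreal \<bar>f x\<bar>)"

definition lip_seminorm :: "'a metric \<Rightarrow> ('a \<Rightarrow> real) \<Rightarrow> ennreal" where
  "lip_seminorm \<delta> f =
     (SUP (x, y) \<in> {(x, y). x \<in> mspace \<delta> \<and> y \<in> mspace \<delta> \<and> x \<noteq> y}.
        ennreal (\<bar>f x - f y\<bar> / mdist \<delta> x y))"

definition beta_BL ::
  "'a::topological_space metric \<Rightarrow> 'a measure \<Rightarrow> 'a measure \<Rightarrow> real" where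
  "beta_BL \<delta> \<rho> \<gamma> =
     enn2real (SUP f \<in> {f. continuous_on (mspace \<delta>) f \<and> bounded (f ` mspace \<delta>) \<and>
                           sup_norm (mspace \<delta>) f + lip_seminorm \<delta> f \<le> 1}.
       ennreal \<bar>(\<integral>x. f x \<partial>\<rho>) - (\<integral>x. f x \<partial>\<gamma>)\<bar>)"

definition Delta ::
  "(real \<times> 's::topological_space) metric \<Rightarrow> (real \<times> 's) measure \<Rightarrow> (real \<times> 's) measure \<Rightarrow> real" where
  "Delta \<delta> \<rho> \<gamma> = W1 (marginal1 \<rho>) (marginal1 \<gamma>) + beta_BL \<delta> \<rho> \<gamma>"

definition M11_topology :: "real measure topology" where
  "M11_topology = Metric_space.mtopology M11 W1"

definition M11_times_topology ::
  "(real \<times> 's::topological_space) metric \<Rightarrow> (real \<times> 's) measure topology" where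
  "M11_times_topology \<delta> = Metric_space.mtopology M11_times (Delta \<delta>)"


section \<open>Relative entropy and the rate function\<close>

text \<open>
  Extended Lebesgue integral, positive part minus negative part. In
  \<open>relative_entropy\<close> the negative part is finite for probability measures, as
  \<open>t ln t \<ge> - 1 / e\<close>, so no \<open>\<infinity> - \<infinity>\<close> arises there.
\<close>

definition ext_integral :: "'a measure \<Rightarrow> ('a \<Rightarrow> real) \<Rightarrow> ereal" where
  "ext_integral \<nu> g =
     enn2ereal (\<integral>\<^sup>+x. ennreal (g x) \<partial>\<nu>) - enn2ereal (\<integral>\<^sup>+x. ennreal (- g x) \<partial>\<nu>)"

definition relative_entropy :: "'a measure \<Rightarrow> 'a measure \<Rightarrow> ereal" where
  "relative_entropy \<nu> \<rho> =
     (if absolutely_continuous \<rho> \<nu>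
      then ext_integral \<nu> (\<lambda>x. ln (enn2real (RN_deriv \<rho> \<nu> x))) else \<infinity>)"

definition rate_J ::
  "(real measure \<Rightarrow> ereal) \<Rightarrow> 's::topological_space measure \<Rightarrow> (real \<times> 's) measure \<Rightarrow> ereal" where
  "rate_J I_W \<mu> \<rho> =
     (if marginal2 \<rho> = \<mu>
      then relative_entropy \<rho> (marginal1 \<rho> \<Otimes>\<^sub>M \<mu>) + I_W (marginal1 \<rho>) else \<infinity>)"


section \<open>Exchangeability\<close>

definition exchangeable :: "'w measure \<Rightarrow> nat \<Rightarrow> (nat \<Rightarrow> 'w \<Rightarrow> real) \<Rightarrow> bool" where
  "exchangeable M n W \<longleftrightarrow>
     (\<forall>\<sigma>. \<sigma> permutes {1..n} \<longrightarrow>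
        distr M (\<Pi>\<^sub>M i\<in>{1..n}. borel) (\<lambda>\<omega>. \<lambda>i\<in>{1..n}. W (\<sigma> i) \<omega>) =
        distr M (\<Pi>\<^sub>M i\<in>{1..n}. borel) (\<lambda>\<omega>. \<lambda>i\<in>{1..n}. W i \<omega>))"

end

theory Submission
  imports Defs
begin

text \<open>
  By exchangeability, given the weights the measure \<open>\<V>\<^sup>n\<close> is the empirical measure of a uniformly
  random matching of the \<open>W\<^sub>i\<close> with the \<open>x\<^sub>i\<close>. Once both sides are given finitely many labels, the
  number of permutations that realise a given contingency table is a quotient of products of
  factorials, so by Stirling it is \<open>n! exp (- n MI + o(n))\<close> with \<open>MI\<close> the mutual information of the
  normalised table. The entropy \<open>H(\<rho> | \<rho>\<^sub>1 \<otimes> \<rho>\<^sub>2)\<close> is the supremum of these mutual informations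
  over labellings whose cells are continuity sets, and fine labellings of this kind control the
  bounded Lipschitz distance. This gives the bounds for small balls and for open sets. They extend to
  closed sets because a sequence of measures whose first marginals converge in \<open>W\<^sub>1\<close> and
  whose second marginals converge weakly is relatively compact for \<open>\<Delta>\<close>, while the level sets of
  \<open>I\<^sup>W\<close> are compact.
\<close>

section \<open>Permutations with a prescribed contingency table\<close>

text \<open>Of the weights only exchangeability and their large deviation principle are available.
  So every permutation count is made uniform over the weight vectors in question and averaged
  afterwards; all estimates on the matching are deterministic. The cells must be continuity sets on
  both factors, since the masses of other cells do not pass to weak limits. That such cells still
  exhaust the entropy is proved by duality: the algebra which they form generates the Borel sets. In
  the compactness argument tightness comes from the two marginals separately. A cluster point is
  sought for the masses of all sets at once, which calls for a filter in place of a subsequence, and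
  Caratheodory's theorem turns it into a measure. For closed sets the compact level sets of
  \<open>I_W\<close> do the work of exponential tightness: the part of the set whose first marginals
  lie in such a level set is covered by finitely many small balls, and the rest can be reached only
  by weights that stay away from the level set.\<close>

definition tables :: "'s set \<Rightarrow> ('t \<Rightarrow> nat) \<Rightarrow> ('s \<Rightarrow> nat) \<Rightarrow> ('s \<Rightarrow> 't) \<Rightarrow> nat \<Rightarrow> nat \<Rightarrow> nat" where
  "tables S a b \<sigma> i j = card {s\<in>S. a (\<sigma> s) = i \<and> b s = j}"

text \<open>Source and target are kept apart because the count is proved by removing a point
  \<open>s\<close> from \<open>S\<close> and its image, an arbitrary \<open>t\<close>, from
  \<open>T\<close>. Extensional functions make the set finite.\<close>

definition table_bijs ::
  "nat set \<Rightarrow> nat set \<Rightarrow> ('t \<Rightarrow> nat) \<Rightarrow> ('s \<Rightarrow> nat) \<Rightarrow> 's set \<Rightarrow> 't set \<Rightarrow> (nat \<Rightarrow> nat \<Rightarrow> nat) \<Rightarrow> ('s \<Rightarrow> 't) set" where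
  "table_bijs I J a b S T N =
     {\<sigma> \<in> S \<rightarrow>\<^sub>E T. bij_betw \<sigma> S T \<and> (\<forall>i\<in>I. \<forall>j\<in>J. tables S a b \<sigma> i j = N i j)}"

lemma finite_table_bijs: "finite S \<Longrightarrow> finite T \<Longrightarrow> finite (table_bijs I J a b S T N)"
  unfolding table_bijs_def by (rule finite_subset[of _ "S \<rightarrow>\<^sub>E T"]) (auto intro: finite_PiE)

lemma tables_insert:
  assumes "finite S" "s \<notin> S"
  shows "tables (insert s S) a b \<sigma> i j = tables S a b \<sigma> i j + of_bool (a (\<sigma> s) = i \<and> b s = j)"
proof -
  have "{u\<in>insert s S. a (\<sigma> u) = i \<and> b u = j} =
     (if a (\<sigma> s) = i \<and> b s = j then insert s {u\<in>S. a (\<sigma> u) = i \<and> b u = j} else {u\<in>S. a (\<sigma> u) = i \<and> b u = j})"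
    by auto
  then show ?thesis using assms by (auto simp: tables_def)
qed

lemma tables_cong: "(\<And>s. s \<in> S \<Longrightarrow> \<sigma> s = \<tau> s) \<Longrightarrow> tables S a b \<sigma> i j = tables S a b \<tau> i j"
  unfolding tables_def by (rule arg_cong[where f=card]) auto

text \<open>Classify by the image \<open>t\<close> of the new point \<open>s\<close>. It uses up one
  unit of the cell \<open>(a t, b s)\<close>, so only those \<open>t\<close> occur whose cell is not
  yet exhausted; on them the natural subtraction in \<open>N'\<close> is a true one.\<close>

lemma card_table_bijs_insert:
  fixes N :: "nat \<Rightarrow> nat \<Rightarrow> nat"
  assumes S: "finite S" "s \<notin> S" and T: "finite T" and I: "a ` T \<subseteq> I" and J: "b s \<in> J"
  defines "N' \<equiv> \<lambda>t i j. if i = a t \<and> j = b s then N i j - 1 else N i j"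
  shows "card (table_bijs I J a b (insert s S) T N) =
     (\<Sum>t\<in>{t\<in>T. N (a t) (b s) \<ge> 1}. card (table_bijs I J a b S (T - {t}) (N' t)))"
proof -
  let ?T' = "{t\<in>T. N (a t) (b s) \<ge> 1}"
  let ?Q = "SIGMA t:?T'. table_bijs I J a b S (T - {t}) (N' t)"
  let ?f = "\<lambda>\<sigma>. (\<sigma> s, restrict \<sigma> S)" and ?g = "\<lambda>(t, \<tau>). \<tau>(s := t)"
  have "bij_betw ?f (table_bijs I J a b (insert s S) T N) ?Q"
  proof (rule bij_betw_byWitness[where f'="?g"])
    show "\<forall>\<sigma>\<in>table_bijs I J a b (insert s S) T N. ?g (?f \<sigma>) = \<sigma>"
      by (auto simp: table_bijs_def fun_eq_iff PiE_def extensional_def)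
    show "\<forall>p\<in>?Q. ?f (?g p) = p"
      using S by (auto simp: table_bijs_def fun_eq_iff PiE_def extensional_def)
    show "?f ` table_bijs I J a b (insert s S) T N \<subseteq> ?Q"
    proof safe
      fix \<sigma> assume \<sigma>: "\<sigma> \<in> table_bijs I J a b (insert s S) T N"
      then have tb: "\<And>i j. i\<in>I \<Longrightarrow> j\<in>J \<Longrightarrow> tables S a b \<sigma> i j + of_bool (a (\<sigma> s) = i \<and> b s = j) = N i j"
        using S by (auto simp: table_bijs_def tables_insert)
      show "\<sigma> s \<in> T" using \<sigma> by (auto simp: table_bijs_def)
      then show "1 \<le> N (a (\<sigma> s)) (b s)" using tb[of "a (\<sigma> s)" "b s"] I J by auto
      have bij: "bij_betw \<sigma> (insert s S) T" using \<sigma> by (auto simp: table_bijs_def)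
      then have "bij_betw \<sigma> S (T - {\<sigma> s})"
        using S by (simp add: bij_betw_def inj_on_insert) (auto, metis imageI)
      then have "bij_betw (restrict \<sigma> S) S (T - {\<sigma> s})"
        by (subst bij_betw_cong[where g=\<sigma>]) auto
      moreover have "restrict \<sigma> S \<in> S \<rightarrow>\<^sub>E T - {\<sigma> s}"
        using \<open>bij_betw \<sigma> S (T - {\<sigma> s})\<close> by (auto simp: bij_betw_def)
      moreover have "tables S a b (restrict \<sigma> S) i j = N' (\<sigma> s) i j" if "i \<in> I" "j \<in> J" for i j
        using tb[OF that] by (subst tables_cong[where \<tau>=\<sigma>]) (auto simp: N'_def split: if_splits)
      ultimately show "restrict \<sigma> S \<in> table_bijs I J a b S (T - {\<sigma> s}) (N' (\<sigma> s))"
        by (auto simp: table_bijs_def)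
    qed
    show "?g ` ?Q \<subseteq> table_bijs I J a b (insert s S) T N"
    proof safe
      fix t \<tau> assume t: "t \<in> T" "1 \<le> N (a t) (b s)" and \<tau>: "\<tau> \<in> table_bijs I J a b S (T - {t}) (N' t)"
      have bij: "bij_betw \<tau> S (T - {t})" using \<tau> by (auto simp: table_bijs_def)
      have "bij_betw (\<tau>(s:=t)) S (T - {t})"
        using S by (subst bij_betw_cong[where g=\<tau>]) (auto intro: bij)
      then have "bij_betw (\<tau>(s:=t)) (insert s S) T"
        using S t by (auto simp: bij_betw_def)
      moreover have "\<tau>(s:=t) \<in> insert s S \<rightarrow>\<^sub>E T"
        using \<tau> t by (auto simp: table_bijs_def PiE_def extensional_def Pi_def)
      moreover have "tables (insert s S) a b (\<tau>(s:=t)) i j = N i j" if "i \<in> I" "j \<in> J" for i j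
      proof -
        have "tables S a b (\<tau>(s:=t)) i j = tables S a b \<tau> i j"
          using S by (intro tables_cong) auto
        also have "\<dots> = N' t i j" using \<tau> that by (auto simp: table_bijs_def)
        finally show ?thesis using t S by (auto simp: tables_insert N'_def)
      qed
      ultimately show "\<tau>(s:=t) \<in> table_bijs I J a b (insert s S) T N"
        by (auto simp: table_bijs_def)
    qed
  qed
  then have "card (table_bijs I J a b (insert s S) T N) = card ?Q"
    by (rule bij_betw_same_card)
  also have "\<dots> = (\<Sum>t\<in>?T'. card (table_bijs I J a b S (T - {t}) (N' t)))"
    using S T by (subst card_SigmaI) (auto intro!: finite_table_bijs)
  finally show ?thesis .
qed

lemma prod_fact_remove:
  assumes "finite K" "k0 \<in> K" "f k0 = Suc (g k0)" "\<And>k. k \<in> K \<Longrightarrow> k \<noteq> k0 \<Longrightarrow> f k = g k"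
  shows "(\<Prod>k\<in>K. fact (f k) :: real) = real (f k0) * (\<Prod>k\<in>K. fact (g k))"
proof -
  have "(\<Prod>k\<in>K. fact (f k) :: real) = fact (f k0) * (\<Prod>k\<in>K-{k0}. fact (f k))"
    using assms by (intro prod.remove) auto
  also have "(\<Prod>k\<in>K-{k0}. fact (f k) :: real) = (\<Prod>k\<in>K-{k0}. fact (g k))"
    using assms by (intro prod.cong) auto
  also have "(fact (f k0) :: real) = real (f k0) * fact (g k0)" using assms by simp
  also have "real (f k0) * fact (g k0) * (\<Prod>k\<in>K-{k0}. fact (g k) :: real) = real (f k0) * (\<Prod>k\<in>K. fact (g k))"
    using assms prod.remove[of K k0 "\<lambda>k. fact (g k) :: real"] by simp
  finally show ?thesis .
qed

text \<open>The multinomial count with the denominator multiplied out. In the induction the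
  bijections that send \<open>s\<close> to \<open>t\<close> make up the share N(a t, b s) / (r(a t)
  c(b s)) of the claimed value. For a fixed label i there are r(i) choices of \<open>t\<close>,
  which together contribute N(i, b s) / c(b s), and these fractions add up to 1 by the column
  margin.\<close>

lemma card_table_bijs:
  assumes fin: "finite I" "finite J" and "finite S" "finite T"
    and "a ` T \<subseteq> I" "b ` S \<subseteq> J"
    and "\<And>i. i \<in> I \<Longrightarrow> (\<Sum>j\<in>J. N i j) = card {t\<in>T. a t = i}"
    and "\<And>j. j \<in> J \<Longrightarrow> (\<Sum>i\<in>I. N i j) = card {s\<in>S. b s = j}"
  shows "real (card (table_bijs I J a b S T N)) * (\<Prod>(i,j)\<in>I\<times>J. fact (N i j)) =
     (\<Prod>i\<in>I. fact (card {t\<in>T. a t = i})) * (\<Prod>j\<in>J. fact (card {s\<in>S. b s = j}))"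
  using assms(3-)
proof (induction S arbitrary: T N rule: finite_induct)
  case empty
  have N0: "N i j = 0" if "i\<in>I" "j\<in>J" for i j
    using empty.prems(5)[of j] that fin by simp
  then have "card {t\<in>T. a t = i} = 0" if "i\<in>I" for i
    using empty.prems(4)[OF that] that by simp
  then have "{t\<in>T. a t = i} = {}" if "i\<in>I" for i
    using that empty.prems(1) by simp
  then have "T = {}" using empty.prems(2) by (auto simp: image_subset_iff)
  then have "table_bijs I J a b {} T N = {\<lambda>_. undefined}"
    using N0 by (auto simp: table_bijs_def tables_def bij_betw_def)
  moreover have "(\<Prod>(i,j)\<in>I\<times>J. fact (N i j) :: real) = 1"
    using N0 by (intro prod.neutral) auto
  ultimately show ?case using \<open>T = {}\<close> by simp
next
  case (insert s S)
  let ?j = "b s"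
  let ?T' = "{t\<in>T. N (a t) ?j \<ge> 1}"
  define N' where "N' = (\<lambda>t i j. if i = a t \<and> j = ?j then N i j - 1 else N i j)"
  define PN :: real where "PN = (\<Prod>(i,j)\<in>I\<times>J. fact (N i j))"
  define r where "r i = card {t\<in>T. a t = i}" for i
  define c where "c j = card {u\<in>insert s S. b u = j}" for j
  define PR :: real where "PR = (\<Prod>i\<in>I. fact (r i))"
  define PC :: real where "PC = (\<Prod>j\<in>J. fact (c j))"
  have jJ: "?j \<in> J" using insert by auto
  have cS: "c j = card {u\<in>S. b u = j} + of_bool (j = ?j)" for j
  proof -
    have "{u\<in>insert s S. b u = j} = (if j = ?j then insert s {u\<in>S. b u = j} else {u\<in>S. b u = j})" by auto
    then show ?thesis using insert by (simp add: c_def)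
  qed
  have PC: "PC = real (c ?j) * (\<Prod>j\<in>J. fact (card {u\<in>S. b u = j}))"
    unfolding PC_def by (rule prod_fact_remove) (use fin jJ cS in auto)
  have step: "real (card (table_bijs I J a b S (T - {t}) (N' t))) * PN
      = real (N (a t) ?j) / real (r (a t)) * (PR * PC / real (c ?j))" if t: "t \<in> ?T'" for t
  proof -
    have iI: "a t \<in> I" using t insert by auto
    have rT: "r i = card {u\<in>T-{t}. a u = i} + of_bool (i = a t)" for i
    proof -
      have "{u\<in>T. a u = i} = (if i = a t then insert t {u\<in>T-{t}. a u = i} else {u\<in>T-{t}. a u = i})" using t by auto
      then show ?thesis using insert by (simp add: r_def)
    qed
    have PR: "PR = real (r (a t)) * (\<Prod>i\<in>I. fact (card {u\<in>T-{t}. a u = i}))"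
      unfolding PR_def by (rule prod_fact_remove) (use fin iI rT in auto)
    have PN: "PN = real (N (a t) ?j) * (\<Prod>(i,j)\<in>I\<times>J. fact (N' t i j))"
    proof -
      have "(\<Prod>k\<in>I\<times>J. fact ((\<lambda>(i,j). N i j) k) :: real) =
          real ((\<lambda>(i,j). N i j) (a t, ?j)) * (\<Prod>k\<in>I\<times>J. fact ((\<lambda>(i,j). N' t i j) k))"
        by (rule prod_fact_remove) (use fin jJ iI t in \<open>auto simp: N'_def split: if_splits\<close>)
      then show ?thesis by (simp add: PN_def case_prod_unfold)
    qed
    have dec: "(\<Sum>k\<in>K. f k - of_bool (k = k0)) = (\<Sum>k\<in>K. f k) - of_bool (k0 \<in> K)"
      if "finite K" "f k0 \<ge> (1::nat)" for K :: "nat set" and k0 f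
    proof (cases "k0 \<in> K")
      case True
      have "(\<Sum>k\<in>K. f k - of_bool (k = k0)) = (f k0 - 1) + (\<Sum>k\<in>K-{k0}. f k - of_bool (k = k0))"
        using that True by (subst sum.remove[of K k0]) auto
      also have "(\<Sum>k\<in>K-{k0}. f k - of_bool (k = k0)) = (\<Sum>k\<in>K-{k0}. f k)" by (intro sum.cong) auto
      finally show ?thesis using that True by (subst (2) sum.remove[of K k0]) auto
    qed (auto intro!: sum.cong)
    have "(\<Sum>j\<in>J. N' t i j) = card {u\<in>T-{t}. a u = i}" if i: "i \<in> I" for i
    proof (cases "i = a t")
      case True
      have "(\<Sum>j\<in>J. N' t i j) = (\<Sum>j\<in>J. N i j - of_bool (j = ?j))"
        using True by (intro sum.cong) (auto simp: N'_def)
      also have "\<dots> = r i - 1" using dec[of J "N i" ?j] fin t True jJ insert.prems(4)[OF i] by (auto simp: r_def)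
      finally show ?thesis using rT[of i] True by simp
    next
      case False
      have "(\<Sum>j\<in>J. N' t i j) = (\<Sum>j\<in>J. N i j)" using False by (intro sum.cong) (auto simp: N'_def)
      then show ?thesis using rT[of i] False insert.prems(4)[OF i] by (simp add: r_def)
    qed
    moreover have "(\<Sum>i\<in>I. N' t i j) = card {u\<in>S. b u = j}" if j: "j \<in> J" for j
    proof (cases "j = ?j")
      case True
      have "(\<Sum>i\<in>I. N' t i j) = (\<Sum>i\<in>I. N i j - of_bool (i = a t))"
        using True by (intro sum.cong) (auto simp: N'_def)
      also have "\<dots> = c j - 1" using dec[of I "\<lambda>i. N i j" "a t"] fin t True iI insert.prems(5)[OF j] by (auto simp: c_def)
      finally show ?thesis using cS[of j] True by simp
    next
      case False
      have "(\<Sum>i\<in>I. N' t i j) = (\<Sum>i\<in>I. N i j)" using False by (intro sum.cong) (auto simp: N'_def)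
      then show ?thesis using cS[of j] False insert.prems(5)[OF j] by (simp add: c_def)
    qed
    ultimately have IH: "real (card (table_bijs I J a b S (T-{t}) (N' t))) * (\<Prod>(i,j)\<in>I\<times>J. fact (N' t i j)) =
        (\<Prod>i\<in>I. fact (card {u\<in>T-{t}. a u = i})) * (\<Prod>j\<in>J. fact (card {u\<in>S. b u = j}))"
      using insert.prems by (intro insert.IH) auto
    have "r (a t) \<noteq> 0" "c ?j \<noteq> 0" using rT[of "a t"] cS[of ?j] by auto
    then show ?thesis unfolding PN PR PC using IH by (simp add: field_simps)
  qed
  have "real (card (table_bijs I J a b (insert s S) T N)) * PN =
     (\<Sum>t\<in>?T'. real (card (table_bijs I J a b S (T - {t}) (N' t))) * PN)"
    using card_table_bijs_insert[of S s T a I b J N] insert jJ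
    by (simp add: N'_def sum_distrib_right)
  also have "\<dots> = (\<Sum>t\<in>?T'. real (N (a t) ?j) / real (r (a t)) * (PR * PC / real (c ?j)))"
    by (intro sum.cong refl step)
  also have "\<dots> = (\<Sum>t\<in>?T'. real (N (a t) ?j) / real (r (a t))) * (PR * PC / real (c ?j))"
    by (rule sum_distrib_right[symmetric])
  \<comment> \<open>Targets whose cell is exhausted contribute 0, so the sum may run over all of
    \<open>T\<close>.\<close>
  also have "(\<Sum>t\<in>?T'. real (N (a t) ?j) / real (r (a t))) = (\<Sum>t\<in>T. real (N (a t) ?j) / real (r (a t)))"
    using insert by (intro sum.mono_neutral_left) auto
  also have "\<dots> = (\<Sum>i\<in>I. \<Sum>t\<in>{t\<in>T. a t = i}. real (N (a t) ?j) / real (r (a t)))"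
    using insert fin by (subst sum.group) auto
  also have "\<dots> = (\<Sum>i\<in>I. real (N i ?j))"
  proof (intro sum.cong refl)
    fix i assume i: "i \<in> I"
    have "(\<Sum>t\<in>{t\<in>T. a t = i}. real (N (a t) ?j) / real (r (a t))) = (\<Sum>t\<in>{t\<in>T. a t = i}. real (N i ?j) / real (r i))"
      by (intro sum.cong) auto
    also have "\<dots> = real (r i) * (real (N i ?j) / real (r i))" by (simp add: r_def)
    also have "\<dots> = real (N i ?j)"
    proof (cases "r i = 0")
      \<comment> \<open>An empty row has only zero entries, so the quotient by
        \<open>r i = 0\<close> does no harm.\<close>
      case True
      then have "(\<Sum>j\<in>J. N i j) = 0" using insert.prems(4)[OF i] by (simp add: r_def)
      then show ?thesis using fin jJ True by simp
    qed simp
    finally show "(\<Sum>t\<in>{t\<in>T. a t = i}. real (N (a t) ?j) / real (r (a t))) = real (N i ?j)" .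
  qed
  also have "\<dots> = real (c ?j)" using insert.prems(5)[OF jJ] by (simp add: c_def flip: of_nat_sum)
  also have "real (c ?j) * (PR * PC / real (c ?j)) = PR * PC"
    using cS[of ?j] by simp
  finally show ?case unfolding PN_def PR_def PC_def r_def c_def .
qed

section \<open>Mutual information of tables and Stirling's bounds\<close>

definition xlnx :: "real \<Rightarrow> real" where "xlnx t = t * ln t"

lemma xlnx_0 [simp]: "xlnx 0 = 0" and xlnx_1 [simp]: "xlnx 1 = 0"
  by (simp_all add: xlnx_def)

text \<open>The delicate point is 0: the bound ln u \<le> u at u = 1 / sqrt |s| gives |s ln |s||
  \<le> 2 sqrt |s| for |s| < 1.\<close>

lemma isCont_xlnx: "isCont xlnx t"
proof (cases "t = 0")
  case True
  have "(\<lambda>s::real. s * ln \<bar>s\<bar>) \<midarrow>0\<rightarrow> 0"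
  proof (rule tendsto_rabs_zero_cancel)
    have "((\<lambda>s::real. \<bar>s\<bar> * \<bar>ln \<bar>s\<bar>\<bar>) \<longlongrightarrow> 0) (at 0)"
    proof (rule tendsto_sandwich[OF _ _ tendsto_const])
      have "\<bar>s\<bar> * \<bar>ln \<bar>s\<bar>\<bar> \<le> 2 * sqrt \<bar>s\<bar>" if "s \<noteq> 0" "\<bar>s\<bar> < 1" for s :: real
      proof -
        have p: "0 < sqrt \<bar>s\<bar>" using that by simp
        have "\<bar>ln \<bar>s\<bar>\<bar> = 2 * ln (inverse (sqrt \<bar>s\<bar>))"
          using that by (simp add: ln_inverse ln_sqrt)
        also have "\<dots> \<le> 2 * inverse (sqrt \<bar>s\<bar>)"
          using p by (intro mult_left_mono ln_bound) auto
        finally have "\<bar>s\<bar> * \<bar>ln \<bar>s\<bar>\<bar> \<le> \<bar>s\<bar> * (2 * inverse (sqrt \<bar>s\<bar>))" by (intro mult_left_mono) auto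
        also have "\<dots> = 2 * sqrt \<bar>s\<bar>" using p real_sqrt_mult_self[of s] by (simp add: field_simps)
        finally show ?thesis .
      qed
      then show "\<forall>\<^sub>F s::real in at 0. \<bar>s\<bar> * \<bar>ln \<bar>s\<bar>\<bar> \<le> 2 * sqrt \<bar>s\<bar>"
        unfolding eventually_at by (intro exI[of _ 1]) auto
      show "((\<lambda>s::real. 2 * sqrt \<bar>s\<bar>) \<longlongrightarrow> 0) (at 0)"
        by (intro tendsto_eq_intros) auto
    qed auto
    then show "((\<lambda>s::real. \<bar>s * ln \<bar>s\<bar>\<bar>) \<longlongrightarrow> 0) (at 0)" by (simp add: abs_mult)
  qed
  then have "xlnx \<midarrow>0\<rightarrow> 0"
    unfolding xlnx_def by (simp add: abs_if ln_minus if_distrib cong: if_cong)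
  then show ?thesis using True by (simp add: isCont_def)
next
  case False
  then show ?thesis unfolding xlnx_def by (intro continuous_intros) auto
qed

text \<open>
  The mutual information of a probability table, that is, its relative entropy with respect to
  the product of its marginals.
\<close>

definition MI :: "nat set \<Rightarrow> nat set \<Rightarrow> (nat \<Rightarrow> nat \<Rightarrow> real) \<Rightarrow> real" where
  "MI I J p = (\<Sum>i\<in>I. \<Sum>j\<in>J. xlnx (p i j)) - (\<Sum>i\<in>I. xlnx (\<Sum>j\<in>J. p i j))
     - (\<Sum>j\<in>J. xlnx (\<Sum>i\<in>I. p i j))"

lemma tendsto_MI:
  assumes "\<And>i j. i \<in> I \<Longrightarrow> j \<in> J \<Longrightarrow> ((\<lambda>m. q m i j) \<longlongrightarrow> p i j) F"
  shows "((\<lambda>m. MI I J (q m)) \<longlongrightarrow> MI I J p) F"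
  unfolding MI_def
  by (intro tendsto_intros isCont_tendsto_compose[OF isCont_xlnx] assms)

text \<open>The form with explicit \<open>d\<close> follows by contradiction from sequential
  continuity: a failure for every d = 1 / (k + 1) would give tables that converge to
  \<open>p\<close> entry by entry.\<close>

lemma MI_close:
  assumes "e > 0" and fin: "finite I" "finite J"
  obtains d where "d > 0"
    "\<And>q. (\<And>i j. i \<in> I \<Longrightarrow> j \<in> J \<Longrightarrow> \<bar>q i j - p i j\<bar> < d) \<Longrightarrow> \<bar>MI I J q - MI I J p\<bar> < e"
proof (rule ccontr)
  assume "\<not> thesis"
  then have "\<forall>n::nat. \<exists>q. (\<forall>i\<in>I. \<forall>j\<in>J. \<bar>q i j - p i j\<bar> < 1 / real (Suc n)) \<and> \<not> \<bar>MI I J q - MI I J p\<bar> < e"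
    using that by (metis divide_pos_pos of_nat_0_less_iff zero_less_Suc zero_less_one)
  then obtain q where q: "\<And>n i j. i \<in> I \<Longrightarrow> j \<in> J \<Longrightarrow> \<bar>q n i j - p i j\<bar> < 1 / real (Suc n)"
    and no: "\<And>n. \<not> \<bar>MI I J (q n) - MI I J p\<bar> < e" by metis
  have "(\<lambda>n. q n i j) \<longlonglongrightarrow> p i j" if "i \<in> I" "j \<in> J" for i j
  proof (subst LIM_zero_iff[symmetric], rule tendsto_rabs_zero_cancel, rule tendsto_sandwich[OF _ _ tendsto_const])
    show "\<forall>\<^sub>F n in sequentially. \<bar>q n i j - p i j\<bar> \<le> 1 / real (Suc n)"
      using q[OF that] by (auto intro!: always_eventually less_imp_le)
    show "(\<lambda>n. 1 / real (Suc n)) \<longlonglongrightarrow> 0" using LIMSEQ_inverse_real_of_nat by (simp add: inverse_eq_divide)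
  qed auto
  then have "(\<lambda>n. MI I J (q n)) \<longlonglongrightarrow> MI I J p" by (rule tendsto_MI)
  then have "\<forall>\<^sub>F n in sequentially. dist (MI I J (q n)) (MI I J p) < e"
    using \<open>e > 0\<close> by (rule tendstoD)
  then show False using no by (auto simp: dist_real_def eventually_sequentially)
qed

text \<open>Errors of order o(n) in ln n! are affordable, so elementary inductions take the place of
  the sharp Stirling formula. Here the step amounts to ln (1 + 1/n) \<le> 1/n.\<close>

lemma ln_fact_lower: "xlnx (real n) - real n \<le> ln (fact n)"
proof (induction n)
  case (Suc n)
  have "xlnx (real (Suc n)) - real (Suc n) \<le> xlnx (real n) - real n + ln (real (Suc n))"
  proof (cases "n = 0")
    case False
    have "real n * (ln (real (Suc n)) - ln (real n)) \<le> 1"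
    proof -
      have "ln (real (Suc n)) - ln (real n) = ln (1 + 1 / real n)"
        using False by (subst ln_divide_pos[symmetric]) (auto simp: field_simps)
      also have "\<dots> \<le> 1 / real n" by (rule ln_add_one_self_le_self) auto
      finally show ?thesis using False by (simp add: field_simps)
    qed
    then show ?thesis by (simp add: xlnx_def algebra_simps)
  qed (simp add: xlnx_def)
  with Suc have "xlnx (real (Suc n)) - real (Suc n) \<le> ln (fact n) + ln (real (Suc n))" by simp
  also have "\<dots> = ln (fact (Suc n))" by (simp add: ln_mult del: of_nat_Suc)
  finally show ?case .
qed simp

text \<open>The step amounts to (n + 1) (ln (n + 1) - ln n) \<ge> 1, which is ln u \<le> u - 1 at u
  = n / (n + 1).\<close>

lemma ln_fact_upper_aux: "n \<ge> 1 \<Longrightarrow> ln (fact n) \<le> xlnx (real n) - real n + ln (real n) + 1"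
proof (induction n rule: nat_induct_at_least)
  case (Suc n)
  have "1 \<le> (real n + 1) * (ln (real (Suc n)) - ln (real n))"
  proof -
    have "ln (real n) - ln (real (Suc n)) = ln (real n / real (Suc n))"
      using Suc by (subst ln_divide_pos[symmetric]) auto
    also have "\<dots> \<le> real n / real (Suc n) - 1" using Suc by (intro ln_le_minus_one) auto
    also have "\<dots> = - 1 / real (Suc n)" by (simp add: field_simps)
    finally show ?thesis by (simp add: field_simps)
  qed
  then have "xlnx (real n) - real n + ln (real n) + 1 + ln (real (Suc n)) \<le>
       xlnx (real (Suc n)) - real (Suc n) + ln (real (Suc n)) + 1"
    by (simp add: xlnx_def algebra_simps)
  moreover have "ln (fact (Suc n) :: real) = ln (fact n) + ln (real (Suc n))"
    by (simp add: ln_mult del: of_nat_Suc)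
  ultimately show ?case using Suc by simp
qed simp

text \<open>The shift by 1 inside the logarithm covers n = 0 and makes the error monotone and
  nonnegative.\<close>

definition fact_error :: "nat \<Rightarrow> real" where "fact_error n = ln (real n + 1) + 1"

lemma fact_error_mono: "m \<le> n \<Longrightarrow> fact_error m \<le> fact_error n"
  by (simp add: fact_error_def)

lemma fact_error_nonneg: "0 \<le> fact_error n"
  by (simp add: fact_error_def)

lemma ln_fact_upper: "ln (fact n) \<le> xlnx (real n) - real n + fact_error n"
proof (cases "n = 0")
  case False
  then have "ln (fact n) \<le> xlnx (real n) - real n + ln (real n) + 1" by (intro ln_fact_upper_aux) simp
  also have "ln (real n) \<le> ln (real n + 1)" using False by simp
  finally show ?thesis by (simp add: fact_error_def)
qed (simp add: fact_error_def)

lemma fact_error_sublinear: "(\<lambda>n. fact_error n / real n) \<longlonglongrightarrow> 0"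
proof (rule tendsto_sandwich[OF _ _ tendsto_const])
  have "fact_error n / real n \<le> ln (real n) / real n + 2 * (1 / real n)" if "n \<ge> 1" for n
  proof -
    have "ln (real n + 1) \<le> ln (real n * 2)" using that by simp
    also have "\<dots> = ln (real n) + ln 2" using that by (simp add: ln_mult)
    also have "ln 2 \<le> (1::real)" using ln_2_less_1 by simp
    finally have "fact_error n \<le> ln (real n) + 2" by (simp add: fact_error_def)
    then show ?thesis using that by (simp add: field_simps)
  qed
  then show "\<forall>\<^sub>F n in sequentially. fact_error n / real n \<le> ln (real n) / real n + 2 * (1 / real n)"
    by (auto simp: eventually_sequentially)
  show "(\<lambda>n. ln (real n) / real n + 2 * (1 / real n)) \<longlonglongrightarrow> 0"
    using tendsto_add[OF lim_ln_over_n tendsto_mult[OF tendsto_const[of 2] lim_1_over_n]] by simp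
qed (auto simp: fact_error_nonneg)

lemma eventually_fact_error_le:
  assumes "e > 0"
  shows "\<forall>\<^sub>F n in sequentially. K * fact_error n \<le> e * real n"
proof -
  have "(\<lambda>n. K * (fact_error n / real n)) \<longlonglongrightarrow> K * 0" by (intro tendsto_intros fact_error_sublinear)
  then have "\<forall>\<^sub>F n in sequentially. K * (fact_error n / real n) < e" using assms by (intro order_tendstoD) auto
  then show ?thesis using eventually_gt_at_top[of 0]
    by eventually_elim (auto simp: field_simps)
qed

text \<open>Normalising a table of total n subtracts n ln n from the joint term and from each of the
  two margin terms, which leaves one n ln n with positive sign.\<close>

lemma MI_scale:
  assumes "n > 0" "finite I" "finite J" "(\<Sum>i\<in>I. \<Sum>j\<in>J. N i j) = real n" "\<And>i j. N i j \<ge> 0"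
  shows "real n * MI I J (\<lambda>i j. N i j / real n) = (\<Sum>i\<in>I. \<Sum>j\<in>J. xlnx (N i j))
     - (\<Sum>i\<in>I. xlnx (\<Sum>j\<in>J. N i j)) - (\<Sum>j\<in>J. xlnx (\<Sum>i\<in>I. N i j)) + xlnx (real n)"
proof -
  have x: "real n * xlnx (t / real n) = xlnx t - t * ln (real n)" for t
    using assms(1) by (simp add: xlnx_def ln_div algebra_simps)
  have "real n * MI I J (\<lambda>i j. N i j / real n) =
     (\<Sum>i\<in>I. \<Sum>j\<in>J. xlnx (N i j) - N i j * ln (real n))
     - (\<Sum>i\<in>I. xlnx (\<Sum>j\<in>J. N i j) - (\<Sum>j\<in>J. N i j) * ln (real n))
     - (\<Sum>j\<in>J. xlnx (\<Sum>i\<in>I. N i j) - (\<Sum>i\<in>I. N i j) * ln (real n))"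
    unfolding MI_def by (simp add: right_diff_distrib sum_distrib_left x flip: sum_divide_distrib)
  also have "\<dots> = (\<Sum>i\<in>I. \<Sum>j\<in>J. xlnx (N i j)) - (\<Sum>i\<in>I. \<Sum>j\<in>J. N i j) * ln (real n)
     - (\<Sum>i\<in>I. xlnx (\<Sum>j\<in>J. N i j)) + (\<Sum>i\<in>I. \<Sum>j\<in>J. N i j) * ln (real n)
     - (\<Sum>j\<in>J. xlnx (\<Sum>i\<in>I. N i j)) + (\<Sum>j\<in>J. \<Sum>i\<in>I. N i j) * ln (real n)"
    by (simp add: sum_subtractf sum_distrib_right)
  also have "(\<Sum>j\<in>J. \<Sum>i\<in>I. N i j) = real n" using assms(4) by (subst sum.swap)
  finally show ?thesis using assms(4) by (simp add: xlnx_def)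
qed

text \<open>One \<open>fact_error\<close> for each factorial in the exact count, and one for n!
  itself.\<close>

definition table_error :: "nat set \<Rightarrow> nat set \<Rightarrow> real" where
  "table_error I J = real (card I * card J + card I + card J + 1)"

text \<open>In the logarithm of the exact count the linear terms of Stirling's bounds sum to - n,
  the same as in ln n!. The terms x ln x sum to n ln n - n m by \<open>MI_scale\<close>. What
  remains is one error per factorial.\<close>

lemma card_table_bijs_bounds:
  assumes fin: "finite I" "finite J" "finite S" "finite T"
    and n: "card S = n" "card T = n" "n > 0" and ab: "a ` T \<subseteq> I" "b ` S \<subseteq> J"
    and N1: "\<And>i. i \<in> I \<Longrightarrow> (\<Sum>j\<in>J. N i j) = card {t\<in>T. a t = i}"
    and N2: "\<And>j. j \<in> J \<Longrightarrow> (\<Sum>i\<in>I. N i j) = card {s\<in>S. b s = j}"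
  defines "m \<equiv> MI I J (\<lambda>i j. real (N i j) / real n)"
  shows "real (card (table_bijs I J a b S T N)) \<le> fact n * exp (- real n * m + table_error I J * fact_error n)" (is ?up)
    and "fact n * exp (- real n * m - table_error I J * fact_error n) \<le> real (card (table_bijs I J a b S T N))" (is ?lo)
proof -
  define r where "r i = card {t\<in>T. a t = i}" for i
  define c where "c j = card {s\<in>S. b s = j}" for j
  define C where "C = real (card (table_bijs I J a b S T N))"
  have eq: "C * (\<Prod>(i,j)\<in>I\<times>J. fact (N i j)) = (\<Prod>i\<in>I. fact (r i)) * (\<Prod>j\<in>J. fact (c j))"
    unfolding C_def r_def c_def by (rule card_table_bijs) (use assms in auto)
  have pos: "(\<Prod>k\<in>K. fact (f k) :: real) > 0" for K and f :: "'x \<Rightarrow> nat" by (intro prod_pos) auto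
  have "C * (\<Prod>(i,j)\<in>I\<times>J. fact (N i j)) > 0" unfolding eq using pos by (intro mult_pos_pos) auto
  then have Cpos: "C > 0" using pos[of "\<lambda>(i,j). N i j" "I\<times>J"] by (simp add: zero_less_mult_iff case_prod_unfold)
  have "ln C + (\<Sum>(i,j)\<in>I\<times>J. ln (fact (N i j))) = (\<Sum>i\<in>I. ln (fact (r i))) + (\<Sum>j\<in>J. ln (fact (c j)))"
    using arg_cong[OF eq, of ln] Cpos pos[of "\<lambda>(i,j). N i j" "I\<times>J"] pos[of r I] pos[of c J] fin
    by (simp add: ln_mult ln_prod case_prod_unfold)
  then have lnC: "ln C = (\<Sum>i\<in>I. ln (fact (r i))) + (\<Sum>j\<in>J. ln (fact (c j))) - (\<Sum>i\<in>I. \<Sum>j\<in>J. ln (fact (N i j)))"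
    by (simp add: sum.cartesian_product)
  have sr: "(\<Sum>i\<in>I. r i) = n"
    using sum.group[of T I a "\<lambda>_. 1::nat"] fin ab n by (simp add: r_def)
  have sc: "(\<Sum>j\<in>J. c j) = n"
    using sum.group[of S J b "\<lambda>_. 1::nat"] fin ab n by (simp add: c_def)
  have sN: "(\<Sum>i\<in>I. \<Sum>j\<in>J. N i j) = n" using sr N1 by (simp add: r_def)
  have rn: "r i \<le> n" for i unfolding r_def using fin n by (metis (no_types, lifting) card_mono mem_Collect_eq subsetI)
  have cn: "c i \<le> n" for i unfolding c_def using fin n by (metis (no_types, lifting) card_mono mem_Collect_eq subsetI)
  have Nn: "N i j \<le> n" if "i \<in> I" "j \<in> J" for i j
    using rn[of i] N1[OF that(1)] member_le_sum[OF that(2), of "N i"] fin by (simp add: r_def)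
  have sc_: "(\<Sum>i\<in>I. \<Sum>j\<in>J. real (N i j)) = real n" using sN by (metis (mono_tags, lifting) of_nat_sum sum.cong)
  have "real n * m = (\<Sum>i\<in>I. \<Sum>j\<in>J. xlnx (real (N i j))) - (\<Sum>i\<in>I. xlnx (\<Sum>j\<in>J. real (N i j)))
     - (\<Sum>j\<in>J. xlnx (\<Sum>i\<in>I. real (N i j))) + xlnx (real n)"
    unfolding m_def by (rule MI_scale) (use n fin sc_ in auto)
  also have "(\<Sum>i\<in>I. xlnx (\<Sum>j\<in>J. real (N i j))) = (\<Sum>i\<in>I. xlnx (real (r i)))"
    using N1 by (intro sum.cong refl) (simp add: r_def flip: of_nat_sum)
  also have "(\<Sum>j\<in>J. xlnx (\<Sum>i\<in>I. real (N i j))) = (\<Sum>j\<in>J. xlnx (real (c j)))"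
    using N2 by (intro sum.cong refl) (simp add: c_def flip: of_nat_sum)
  finally have m: "real n * m = (\<Sum>i\<in>I. \<Sum>j\<in>J. xlnx (real (N i j))) - (\<Sum>i\<in>I. xlnx (real (r i)))
     - (\<Sum>j\<in>J. xlnx (real (c j))) + xlnx (real n)" .
  have up: "(\<Sum>k\<in>K. ln (fact (f k))) \<le> (\<Sum>k\<in>K. xlnx (real (f k))) - (\<Sum>k\<in>K. real (f k)) + real (card K) * fact_error n"
    if "\<And>k. k \<in> K \<Longrightarrow> f k \<le> n" for K :: "nat set" and f
  proof -
    have "(\<Sum>k\<in>K. ln (fact (f k))) \<le> (\<Sum>k\<in>K. xlnx (real (f k)) - real (f k) + fact_error n)"
      by (intro sum_mono order.trans[OF ln_fact_upper]) (use that fact_error_mono in auto)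
    then show ?thesis by (simp add: sum.distrib sum_subtractf)
  qed
  have lo: "(\<Sum>k\<in>K. xlnx (real (f k))) - (\<Sum>k\<in>K. real (f k)) \<le> (\<Sum>k\<in>K. ln (fact (f k)))"
    for K :: "nat set" and f
    unfolding sum_subtractf[symmetric] by (intro sum_mono ln_fact_lower)
  have upN: "(\<Sum>i\<in>I. \<Sum>j\<in>J. ln (fact (N i j))) \<le>
      (\<Sum>i\<in>I. \<Sum>j\<in>J. xlnx (real (N i j))) - real n + real (card I * card J) * fact_error n"
  proof -
    have "(\<Sum>i\<in>I. \<Sum>j\<in>J. ln (fact (N i j))) \<le>
        (\<Sum>i\<in>I. (\<Sum>j\<in>J. xlnx (real (N i j))) - (\<Sum>j\<in>J. real (N i j)) + real (card J) * fact_error n)"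
      by (intro sum_mono up Nn)
    then show ?thesis by (simp add: sum.distrib sum_subtractf sc_)
  qed
  have loN: "(\<Sum>i\<in>I. \<Sum>j\<in>J. xlnx (real (N i j))) - real n \<le> (\<Sum>i\<in>I. \<Sum>j\<in>J. ln (fact (N i j)))"
  proof -
    have "(\<Sum>i\<in>I. (\<Sum>j\<in>J. xlnx (real (N i j))) - (\<Sum>j\<in>J. real (N i j))) \<le> (\<Sum>i\<in>I. \<Sum>j\<in>J. ln (fact (N i j)))"
      by (intro sum_mono lo)
    then show ?thesis by (simp add: sum_subtractf sc_)
  qed
  have srr: "(\<Sum>i\<in>I. real (r i)) = real n" "(\<Sum>j\<in>J. real (c j)) = real n"
    using sr sc by (simp_all flip: of_nat_sum)
  have table_error: "table_error I J * fact_error n = real (card I * card J) * fact_error n + real (card I) * fact_error n + real (card J) * fact_error n + fact_error n"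
    by (simp add: table_error_def algebra_simps)
  have p: "0 \<le> real (card I * card J) * fact_error n" "0 \<le> real (card I) * fact_error n" "0 \<le> real (card J) * fact_error n" "0 \<le> fact_error n"
    using fact_error_nonneg by (simp_all del: of_nat_mult)
  have "ln C \<le> ln (fact n) + (- real n * m + table_error I J * fact_error n)"
    using lnC m up[of I r, OF rn] up[of J c, OF cn] loN srr ln_fact_lower[of n] table_error p by linarith
  moreover have "ln C \<ge> ln (fact n) + (- real n * m - table_error I J * fact_error n)"
    using lnC m lo[of r I] lo[of c J] upN srr ln_fact_upper[of n] table_error p by linarith
  ultimately have "exp (ln C) \<le> exp (ln (fact n) + (- real n * m + table_error I J * fact_error n))"
    "exp (ln (fact n) + (- real n * m - table_error I J * fact_error n)) \<le> exp (ln C)" by simp_all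
  then show ?up ?lo using Cpos unfolding C_def exp_add by simp_all
qed

section \<open>Counting permutations by their tables: the upper bound\<close>

lemma card_permutes_tables:
  assumes "finite S"
  shows "card {\<sigma>. \<sigma> permutes S \<and> (\<forall>i\<in>I. \<forall>j\<in>J. tables S a b \<sigma> i j = N i j)} = card (table_bijs I J a b S S N)"
proof (rule bij_betw_same_card[where f="\<lambda>\<sigma>. restrict \<sigma> S"], rule bij_betw_byWitness[where f'="\<lambda>\<tau> s. if s \<in> S then \<tau> s else s"])
  \<comment> \<open>The two encodings differ only outside \<open>S\<close>, where a permutation is
    the identity and an extensional function is \<open>undefined\<close>.\<close>
  let ?A = "{\<sigma>. \<sigma> permutes S \<and> (\<forall>i\<in>I. \<forall>j\<in>J. tables S a b \<sigma> i j = N i j)}"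
  show "\<forall>\<sigma>\<in>?A. (\<lambda>s. if s \<in> S then restrict \<sigma> S s else s) = \<sigma>"
    by (auto simp: fun_eq_iff permutes_def)
  show "\<forall>\<tau>\<in>table_bijs I J a b S S N. restrict (\<lambda>s. if s \<in> S then \<tau> s else s) S = \<tau>"
    by (auto simp: table_bijs_def fun_eq_iff PiE_def extensional_def)
  show "(\<lambda>\<sigma>. restrict \<sigma> S) ` ?A \<subseteq> table_bijs I J a b S S N"
  proof safe
    fix \<sigma> assume \<sigma>: "\<sigma> permutes S" "\<forall>i\<in>I. \<forall>j\<in>J. tables S a b \<sigma> i j = N i j"
    have "bij_betw (restrict \<sigma> S) S S"
      using permutes_imp_bij[OF \<sigma>(1)] by (subst bij_betw_cong[where g=\<sigma>]) auto
    moreover have "tables S a b (restrict \<sigma> S) i j = tables S a b \<sigma> i j" for i j by (rule tables_cong) simp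
    ultimately show "restrict \<sigma> S \<in> table_bijs I J a b S S N"
      using \<sigma> by (auto simp: table_bijs_def permutes_in_image)
  qed
  show "(\<lambda>\<tau> s. if s \<in> S then \<tau> s else s) ` table_bijs I J a b S S N \<subseteq> ?A"
  proof safe
    fix \<tau> assume \<tau>: "\<tau> \<in> table_bijs I J a b S S N"
    have "bij_betw (\<lambda>s. if s \<in> S then \<tau> s else s) S S"
      using \<tau> by (subst bij_betw_cong[where g=\<tau>]) (auto simp: table_bijs_def)
    then show "(\<lambda>s. if s \<in> S then \<tau> s else s) permutes S" by (rule bij_imp_permutes) auto
    have "tables S a b (\<lambda>s. if s \<in> S then \<tau> s else s) i j = tables S a b \<tau> i j" for i j
      by (rule tables_cong) simp
    then show "tables S a b (\<lambda>s. if s \<in> S then \<tau> s else s) i j = N i j" if "i \<in> I" "j \<in> J" for i j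
      using \<tau> that by (auto simp: table_bijs_def)
  qed
qed

text \<open>All permutations share the margins given by the labels alone, so the exact count applies
  to each table that occurs.\<close>

lemma tables_margins:
  assumes "finite S" "\<sigma> permutes S" "finite I" "finite J" "a ` S \<subseteq> I" "b ` S \<subseteq> J"
  shows "(\<Sum>j\<in>J. tables S a b \<sigma> i j) = card {t\<in>S. a t = i}"
    and "(\<Sum>i\<in>I. tables S a b \<sigma> i j) = card {s\<in>S. b s = j}"
proof -
  have "(\<Sum>j\<in>J. tables S a b \<sigma> i j) = (\<Sum>j\<in>J. \<Sum>s\<in>{s\<in>{s\<in>S. a (\<sigma> s) = i}. b s = j}. 1)"
    unfolding tables_def by (auto intro!: sum.cong arg_cong[where f=card])
  also have "\<dots> = (\<Sum>s\<in>{s\<in>S. a (\<sigma> s) = i}. 1)" using assms by (intro sum.group) auto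
  also have "\<dots> = card {s\<in>S. a (\<sigma> s) = i}" by simp
  also have "\<dots> = card {t\<in>S. a t = i}"
  proof (rule bij_betw_same_card[of \<sigma>])
    have "\<sigma> ` {s\<in>S. a (\<sigma> s) = i} = {t\<in>S. a t = i}"
    proof safe
      fix t assume t: "t \<in> S" "i = a t"
      then obtain s where "s \<in> S" "t = \<sigma> s" using permutes_image[OF assms(2)] by blast
      then show "t \<in> \<sigma> ` {s\<in>S. a (\<sigma> s) = a t}" by auto
    qed (use permutes_in_image[OF assms(2)] in auto)
    then show "bij_betw \<sigma> {s\<in>S. a (\<sigma> s) = i} {t\<in>S. a t = i}"
      using permutes_inj_on[OF assms(2)] by (auto simp: bij_betw_def)
  qed
  finally show "(\<Sum>j\<in>J. tables S a b \<sigma> i j) = card {t\<in>S. a t = i}" .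
  have "(\<Sum>i\<in>I. tables S a b \<sigma> i j) = (\<Sum>i\<in>I. \<Sum>s\<in>{s\<in>{s\<in>S. b s = j}. a (\<sigma> s) = i}. 1)"
    unfolding tables_def by (auto intro!: sum.cong arg_cong[where f=card])
  also have "\<dots> = (\<Sum>s\<in>{s\<in>S. b s = j}. 1)"
    using assms by (intro sum.group) (auto simp: permutes_in_image)
  finally show "(\<Sum>i\<in>I. tables S a b \<sigma> i j) = card {s\<in>S. b s = j}" by simp
qed

definition ptab :: "nat \<Rightarrow> (nat \<Rightarrow> nat) \<Rightarrow> (nat \<Rightarrow> nat) \<Rightarrow> (nat \<Rightarrow> nat) \<Rightarrow> nat \<Rightarrow> nat \<Rightarrow> real" where
  "ptab n a b \<sigma> i j = real (tables {1..n} a b \<sigma> i j) / real n"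

text \<open>The method of types: at most (n + 1) to the power |I| |J| tables occur, and each one
  with mutual information above \<open>h\<close> is realised by at most n! exp (- n h + o(n))
  permutations. One of the two error terms pays for the number of tables, the other for Stirling's
  bounds.\<close>

lemma card_permutes_MI_upper:
  assumes fin: "finite I" "finite J" and n: "n \<ge> 1" and ab: "a ` {1..n} \<subseteq> I" "b ` {1..n} \<subseteq> J"
  shows "real (card {\<sigma>. \<sigma> permutes {1..n} \<and> h < MI I J (ptab n a b \<sigma>)})
      \<le> fact n * exp (- real n * h + 2 * table_error I J * fact_error n)"
proof -
  let ?S = "{1..n}"
  define A where "A = {\<sigma>. \<sigma> permutes ?S \<and> h < MI I J (ptab n a b \<sigma>)}"
  \<comment> \<open>The table as an extensional function, which leaves only finitely many possible
    values.\<close>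
  define key where "key \<sigma> = (\<lambda>(i,j)\<in>I\<times>J. tables ?S a b \<sigma> i j)" for \<sigma>
  have finA: "finite A" unfolding A_def by (rule finite_subset[OF _ finite_permutations[of ?S]]) auto
  have "tables ?S a b \<sigma> i j \<le> n" for \<sigma> i j
    unfolding tables_def by (rule order_trans[OF card_mono[of ?S]]) auto
  then have "key ` A \<subseteq> I\<times>J \<rightarrow>\<^sub>E {..n}" by (auto simp: key_def split: if_splits)
  then have "card (key ` A) \<le> card (I\<times>J \<rightarrow>\<^sub>E {..n})" using fin by (intro card_mono finite_PiE) auto
  also have "\<dots> = (n+1) ^ (card I * card J)" using fin by (simp add: card_PiE card_cartesian_product)
  finally have "real (card (key ` A)) \<le> (real n + 1) ^ (card I * card J)"
    by (metis (mono_tags) of_nat_1 of_nat_add of_nat_le_iff of_nat_power)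
  also have "\<dots> = exp (real (card I * card J) * ln (real n + 1))"
    by (simp add: exp_of_nat_mult add_nonneg_pos del: of_nat_mult)
  also have "\<dots> \<le> exp (table_error I J * fact_error n)"
    unfolding exp_le_cancel_iff by (intro mult_mono) (auto simp: table_error_def fact_error_def)
  finally have keys: "real (card (key ` A)) \<le> exp (table_error I J * fact_error n)" .
  have fib: "real (card {\<sigma>\<in>A. key \<sigma> = k}) \<le> fact n * exp (- real n * h + table_error I J * fact_error n)" if k: "k \<in> key ` A" for k
  proof -
    obtain \<sigma>0 where s0: "\<sigma>0 permutes ?S" "h < MI I J (ptab n a b \<sigma>0)" "k = key \<sigma>0"
      using k by (auto simp: A_def)
    let ?N = "tables ?S a b \<sigma>0"
    have "card {\<sigma>\<in>A. key \<sigma> = k} \<le> card {\<sigma>. \<sigma> permutes ?S \<and> (\<forall>i\<in>I. \<forall>j\<in>J. tables ?S a b \<sigma> i j = ?N i j)}"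
    proof (rule card_mono)
      show "finite {\<sigma>. \<sigma> permutes ?S \<and> (\<forall>i\<in>I. \<forall>j\<in>J. tables ?S a b \<sigma> i j = ?N i j)}"
        by (rule finite_subset[OF _ finite_permutations[of ?S]]) auto
      show "{\<sigma>\<in>A. key \<sigma> = k} \<subseteq> {\<sigma>. \<sigma> permutes ?S \<and> (\<forall>i\<in>I. \<forall>j\<in>J. tables ?S a b \<sigma> i j = ?N i j)}"
      proof safe
        fix \<sigma> i j assume "\<sigma> \<in> A" "k = key \<sigma>" "i \<in> I" "j \<in> J"
        then have "key \<sigma> (i,j) = key \<sigma>0 (i,j)" using s0 by simp
        then show "tables ?S a b \<sigma> i j = ?N i j" using \<open>i \<in> I\<close> \<open>j \<in> J\<close> by (simp add: key_def)
      qed (auto simp: A_def)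
    qed
    also have "\<dots> = card (table_bijs I J a b ?S ?S ?N)" by (rule card_permutes_tables) simp
    also have "real \<dots> \<le> fact n * exp (- real n * MI I J (\<lambda>i j. real (?N i j) / real n) + table_error I J * fact_error n)"
      using tables_margins[OF _ s0(1) fin ab] n ab by (intro card_table_bijs_bounds fin) auto
    also have "(\<lambda>i j. real (?N i j) / real n) = ptab n a b \<sigma>0" by (simp add: ptab_def fun_eq_iff)
    also have "fact n * exp (- real n * MI I J (ptab n a b \<sigma>0) + table_error I J * fact_error n)
        \<le> fact n * exp (- real n * h + table_error I J * fact_error n)"
      using s0 n by (intro mult_left_mono) auto
    finally show ?thesis by simp
  qed
  have "real (card A) = (\<Sum>k\<in>key ` A. real (card {\<sigma>\<in>A. key \<sigma> = k}))"
    using sum.group[OF finA, of "key ` A" key "\<lambda>_. 1::real"] finA by simp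
  also have "\<dots> \<le> (\<Sum>k\<in>key ` A. fact n * exp (- real n * h + table_error I J * fact_error n))"
    by (intro sum_mono fib)
  also have "\<dots> = real (card (key ` A)) * (fact n * exp (- real n * h + table_error I J * fact_error n))" by simp
  also have "\<dots> \<le> exp (table_error I J * fact_error n) * (fact n * exp (- real n * h + table_error I J * fact_error n))"
    by (intro mult_right_mono keys) auto
  also have "\<dots> = fact n * exp (- real n * h + 2 * table_error I J * fact_error n)"
    by (simp add: algebra_simps flip: exp_add)
  finally show ?thesis unfolding A_def .
qed

section \<open>Integer tables with prescribed margins, and the lower bound for permutation
  counts\<close>

lemma sum_decrement:
  fixes f :: "'k \<Rightarrow> nat"
  assumes "finite K" "k \<in> K" "f k > 0"
  shows "sum f K = Suc (sum (f(k := f k - 1)) K)"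
proof -
  have "sum (f(k := f k - 1)) K = f k - 1 + sum (f(k := f k - 1)) (K - {k})"
    using assms by (subst sum.remove[of K k]) auto
  also have "sum (f(k := f k - 1)) (K - {k}) = sum f (K - {k})" by (intro sum.cong) auto
  finally show ?thesis using assms by (simp add: sum.remove[of K k f])
qed

text \<open>Induction on the total: while it is positive, some row and some column still have mass,
  and one unit is placed in their common cell.\<close>

lemma table_with_margins:
  fixes r c :: "nat \<Rightarrow> nat"
  assumes "finite I" "finite J" "(\<Sum>i\<in>I. r i) = (\<Sum>j\<in>J. c j)"
  shows "\<exists>N. (\<forall>i\<in>I. (\<Sum>j\<in>J. N i j) = r i) \<and> (\<forall>j\<in>J. (\<Sum>i\<in>I. N i j) = c j)"
  using assms(3)
proof (induction "\<Sum>i\<in>I. r i" arbitrary: r c)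
  case 0
  then show ?case using assms by (intro exI[of _ "\<lambda>_ _. 0"]) auto
next
  case (Suc k)
  obtain i0 where i0: "i0 \<in> I" "r i0 > 0" using Suc.hyps(2) assms(1) by (metis gr0I nat.distinct(1) sum.neutral)
  obtain j0 where j0: "j0 \<in> J" "c j0 > 0" using Suc.hyps(2) Suc.prems assms(2) by (metis gr0I nat.distinct(1) sum.neutral)
  have r: "sum r I = Suc (sum (r(i0 := r i0 - 1)) I)"
    using i0 assms(1) by (intro sum_decrement) auto
  have c: "sum c J = Suc (sum (c(j0 := c j0 - 1)) J)"
    using j0 assms(2) by (intro sum_decrement) auto
  obtain N where N: "\<forall>i\<in>I. (\<Sum>j\<in>J. N i j) = (r(i0 := r i0 - 1)) i" "\<forall>j\<in>J. (\<Sum>i\<in>I. N i j) = (c(j0 := c j0 - 1)) j"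
    using Suc.hyps(1)[of "r(i0 := r i0 - 1)" "c(j0 := c j0 - 1)"] Suc.hyps(2) Suc.prems r c by auto
  define N' where "N' = (\<lambda>i j. N i j + of_bool (i = i0 \<and> j = j0))"
  have "(\<Sum>j\<in>J. N' i j) = (\<Sum>j\<in>J. N i j) + of_bool (i = i0)" for i
  proof -
    have "(\<Sum>j\<in>J. of_bool (i = i0 \<and> j = j0)) = (\<Sum>j\<in>J. if j = j0 then of_bool (i = i0) else (0::nat))"
      by (intro sum.cong) auto
    also have "\<dots> = of_bool (i = i0)" using j0 assms by simp
    finally show ?thesis by (simp add: N'_def sum.distrib)
  qed
  moreover have "(\<Sum>i\<in>I. N' i j) = (\<Sum>i\<in>I. N i j) + of_bool (j = j0)" for j
  proof -
    have "(\<Sum>i\<in>I. of_bool (i = i0 \<and> j = j0)) = (\<Sum>i\<in>I. if i = i0 then of_bool (j = j0) else (0::nat))"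
      by (intro sum.cong) auto
    also have "\<dots> = of_bool (j = j0)" using i0 assms by simp
    finally show ?thesis by (simp add: N'_def sum.distrib)
  qed
  ultimately show ?case using N i0 j0 by (intro exI[of _ N']) auto
qed

text \<open>Lower every entry of \<open>p\<close> by \<open>d\<close>, truncate at 0 and round n
  times the result down. The margins of this table stay below \<open>r\<close> and \<open>c\<close>,
  and \<open>table_with_margins\<close> fills in what is missing. This bounds each entry from below.
  Both normalised tables have total 1, so an excess in one cell is balanced by deficits in the
  others; hence the factor |I| |J| in the upper bound.\<close>

lemma table_near:
  fixes I J :: "nat set"
  assumes fin: "finite I" "finite J" and p: "\<And>i j. p i j \<ge> 0" "(\<Sum>i\<in>I. \<Sum>j\<in>J. p i j) = 1"
    and n: "n \<ge> 1" and rc: "(\<Sum>i\<in>I. r i) = n" "(\<Sum>j\<in>J. c j) = n" and d: "d > 0"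
    and r: "\<And>i. i \<in> I \<Longrightarrow> \<bar>real (r i) / real n - (\<Sum>j\<in>J. p i j)\<bar> < d"
    and c: "\<And>j. j \<in> J \<Longrightarrow> \<bar>real (c j) / real n - (\<Sum>i\<in>I. p i j)\<bar> < d"
  obtains N where "\<And>i. i \<in> I \<Longrightarrow> (\<Sum>j\<in>J. N i j) = r i" "\<And>j. j \<in> J \<Longrightarrow> (\<Sum>i\<in>I. N i j) = c j"
    "\<And>i j. i \<in> I \<Longrightarrow> j \<in> J \<Longrightarrow> \<bar>real (N i j) / real n - p i j\<bar> \<le> real (card I * card J) * (d + 1 / real n)"
proof -
  define q where "q i j = max 0 (p i j - d)" for i j
  define N0 where "N0 i j = nat \<lfloor>real n * q i j\<rfloor>" for i j
  have q0: "q i j \<ge> 0" for i j by (simp add: q_def)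
  have N0le: "real (N0 i j) \<le> real n * q i j" for i j
    using n q0[of i j] by (simp add: N0_def)
  \<comment> \<open>If one term reaches \<open>d\<close>, it alone accounts for the loss of
    \<open>d\<close>; if none does, the left side is 0.\<close>
  have qsum: "(\<Sum>k\<in>K. max 0 (f k - d)) \<le> max 0 ((\<Sum>k\<in>K. f k) - d)" if "finite K" "\<And>k. f k \<ge> 0" for K :: "nat set" and f
  proof (cases "\<exists>k\<in>K. f k \<ge> d")
    case True
    then obtain k0 where k0: "k0 \<in> K" "f k0 \<ge> d" by auto
    have "(\<Sum>k\<in>K. max 0 (f k - d)) = max 0 (f k0 - d) + (\<Sum>k\<in>K-{k0}. max 0 (f k - d))"
      using that k0 by (intro sum.remove)
    also have "\<dots> \<le> (f k0 - d) + (\<Sum>k\<in>K-{k0}. f k)"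
      using k0 d that(2) by (intro add_mono sum_mono) (auto simp: max_def intro: order_trans[of _ 0])
    also have "\<dots> = (\<Sum>k\<in>K. f k) - d" using that k0 by (simp add: sum.remove[of K k0 f])
    finally show ?thesis by simp
  next
    case False
    then have "(\<Sum>k\<in>K. max 0 (f k - d)) = 0" by (intro sum.neutral) (auto simp: max_def not_le)
    then show ?thesis by simp
  qed
  have N0r: "(\<Sum>j\<in>J. N0 i j) \<le> r i" if "i \<in> I" for i
  proof -
    have "real (\<Sum>j\<in>J. N0 i j) \<le> (\<Sum>j\<in>J. real n * q i j)" unfolding of_nat_sum by (intro sum_mono N0le)
    also have "\<dots> = real n * (\<Sum>j\<in>J. q i j)" by (simp add: sum_distrib_left)
    also have "\<dots> \<le> real n * max 0 ((\<Sum>j\<in>J. p i j) - d)"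
      unfolding q_def by (rule mult_left_mono[OF qsum[of J "p i"]]) (use fin p in simp_all)
    also have "\<dots> \<le> real n * (real (r i) / real n)" using r[OF that] by (intro mult_left_mono) auto
    also have "\<dots> = real (r i)" using n by simp
    finally show ?thesis by (simp only: of_nat_le_iff)
  qed
  have N0c: "(\<Sum>i\<in>I. N0 i j) \<le> c j" if "j \<in> J" for j
  proof -
    have "real (\<Sum>i\<in>I. N0 i j) \<le> (\<Sum>i\<in>I. real n * q i j)" unfolding of_nat_sum by (intro sum_mono N0le)
    also have "\<dots> = real n * (\<Sum>i\<in>I. q i j)" by (simp add: sum_distrib_left)
    also have "\<dots> \<le> real n * max 0 ((\<Sum>i\<in>I. p i j) - d)"
      unfolding q_def by (rule mult_left_mono[OF qsum]) (use fin p in simp_all)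
    also have "\<dots> \<le> real n * (real (c j) / real n)" using c[OF that] by (intro mult_left_mono) auto
    also have "\<dots> = real (c j)" using n by simp
    finally show ?thesis by (simp only: of_nat_le_iff)
  qed
  have "(\<Sum>i\<in>I. r i - (\<Sum>j\<in>J. N0 i j)) = n - (\<Sum>i\<in>I. \<Sum>j\<in>J. N0 i j)"
    using N0r rc by (subst sum_subtractf_nat) auto
  moreover have "(\<Sum>j\<in>J. c j - (\<Sum>i\<in>I. N0 i j)) = n - (\<Sum>j\<in>J. \<Sum>i\<in>I. N0 i j)"
    using N0c rc by (subst sum_subtractf_nat) auto
  ultimately obtain N1 where N1: "\<forall>i\<in>I. (\<Sum>j\<in>J. N1 i j) = r i - (\<Sum>j\<in>J. N0 i j)"
     "\<forall>j\<in>J. (\<Sum>i\<in>I. N1 i j) = c j - (\<Sum>i\<in>I. N0 i j)"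
    using table_with_margins[OF fin, of "\<lambda>i. r i - (\<Sum>j\<in>J. N0 i j)" "\<lambda>j. c j - (\<Sum>i\<in>I. N0 i j)"] 
      sum.swap[of N0 J I] by auto
  define N where "N i j = N0 i j + N1 i j" for i j
  have NI: "(\<Sum>j\<in>J. N i j) = r i" if "i \<in> I" for i using that N1 N0r[OF that] by (simp add: N_def sum.distrib)
  have NJ: "(\<Sum>i\<in>I. N i j) = c j" if "j \<in> J" for j using that N1 N0c[OF that] by (simp add: N_def sum.distrib)
  have lo: "real (N i j) / real n \<ge> p i j - (d + 1 / real n)" for i j
  proof -
    have "real n * q i j - 1 \<le> real (N0 i j)" unfolding N0_def by linarith
    then have "real n * (p i j - d) - 1 \<le> real (N i j)"
      using mult_left_mono[of "p i j - d" "q i j" "real n"] by (simp add: q_def N_def)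
    then have "(real n * (p i j - d) - 1) / real n \<le> real (N i j) / real n" by (rule divide_right_mono) simp
    also have "(real n * (p i j - d) - 1) / real n = p i j - (d + 1 / real n)" using n by (simp add: field_simps)
    finally show ?thesis .
  qed
  have sumN: "(\<Sum>(i,j)\<in>I\<times>J. real (N i j) / real n) = 1"
  proof -
    have "(\<Sum>(i,j)\<in>I\<times>J. real (N i j) / real n) = (\<Sum>i\<in>I. real (\<Sum>j\<in>J. N i j)) / real n"
      by (simp add: sum_divide_distrib flip: sum.cartesian_product)
    also have "(\<Sum>i\<in>I. real (\<Sum>j\<in>J. N i j)) = real (\<Sum>i\<in>I. r i)" using NI by simp
    finally show ?thesis using rc n by simp
  qed
  have "\<bar>real (N i j) / real n - p i j\<bar> \<le> real (card I * card J) * (d + 1 / real n)" if ij: "i \<in> I" "j \<in> J" for i j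
  proof (rule abs_leI)
    let ?f = "\<lambda>(i,j). real (N i j) / real n - p i j" and ?e = "d + 1 / real n"
    have e: "0 \<le> ?e" using d by simp
    have "card I * card J > 0" using ij fin by (auto simp: card_gt_0_iff)
    then have "1 \<le> real (card I * card J)" by linarith
    from mult_right_mono[OF this e] have one: "?e \<le> real (card I * card J) * ?e" by (simp only: mult_1)
    show "- (real (N i j) / real n - p i j) \<le> real (card I * card J) * ?e" using lo[of i j] one by linarith
    have "(\<Sum>k\<in>I\<times>J. ?f k) = 0" using sumN p by (simp add: sum_subtractf case_prod_unfold sum.cartesian_product)
    moreover have "(\<Sum>k\<in>I\<times>J. ?f k) = ?f (i,j) + (\<Sum>k\<in>I\<times>J-{(i,j)}. ?f k)"
      using ij fin by (intro sum.remove) auto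
    moreover have "(\<Sum>k\<in>I\<times>J-{(i,j)}. - ?e) \<le> (\<Sum>k\<in>I\<times>J-{(i,j)}. ?f k)"
      using lo by (intro sum_mono) (auto simp: algebra_simps)
    moreover have "(\<Sum>k\<in>I\<times>J-{(i,j)}. - ?e) = - (real (card (I\<times>J-{(i,j)})) * ?e)"
      by (simp only: sum_constant mult_minus_right)
    moreover have "real (card (I\<times>J-{(i,j)})) * ?e \<le> real (card I * card J) * ?e"
      using fin ij e by (intro mult_right_mono) (auto simp: card_cartesian_product card_Diff_subset simp del: of_nat_mult)
    ultimately show "real (N i j) / real n - p i j \<le> real (card I * card J) * ?e"
      unfolding prod.case by linarith
  qed
  then show thesis using that NI NJ by blast
qed

text \<open>A single integer table near \<open>p\<close> suffices, and continuity of
  \<open>MI\<close> controls its exponent. The constants \<open>d\<close> and \<open>n0\<close> are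
  fixed before the labels \<open>a\<close> and \<open>b\<close>, because \<open>a\<close> will be
  read off from random weights and the bound must hold for all of them at once.\<close>

lemma card_permutes_lower:
  assumes fin: "finite I" "finite J" and p: "\<And>i j. p i j \<ge> 0" "(\<Sum>i\<in>I. \<Sum>j\<in>J. p i j) = 1" and e: "e > 0"
  obtains d n0 where "d > 0"
    "\<And>n a b. n \<ge> n0 \<Longrightarrow> a ` {1..n} \<subseteq> I \<Longrightarrow> b ` {1..n} \<subseteq> J \<Longrightarrow>
       (\<And>i. i \<in> I \<Longrightarrow> \<bar>real (card {s\<in>{1..n}. a s = i}) / real n - (\<Sum>j\<in>J. p i j)\<bar> < d) \<Longrightarrow>
       (\<And>j. j \<in> J \<Longrightarrow> \<bar>real (card {s\<in>{1..n}. b s = j}) / real n - (\<Sum>i\<in>I. p i j)\<bar> < d) \<Longrightarrow>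
       fact n * exp (- real n * (MI I J p + e)) \<le>
         real (card {\<sigma>. \<sigma> permutes {1..n} \<and> (\<forall>i\<in>I. \<forall>j\<in>J. \<bar>ptab n a b \<sigma> i j - p i j\<bar> < e)})"
proof -
  obtain d1 where d1: "d1 > 0" "\<And>q. (\<And>i j. i \<in> I \<Longrightarrow> j \<in> J \<Longrightarrow> \<bar>q i j - p i j\<bar> < d1) \<Longrightarrow> \<bar>MI I J q - MI I J p\<bar> < e/2"
    using MI_close[of "e/2" I J p] e fin by auto
  define K where "K = real (card I * card J) + 1"
  \<comment> \<open>Chosen so that K (d + d) = \<open>min e d1\<close>; the second \<open>d\<close>
    dominates 1/n from \<open>n0\<close> on.\<close>
  define d where "d = min e d1 / (2 * K)"
  have K: "K > 0" by (simp add: K_def add_nonneg_pos del: of_nat_mult)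
  have d: "d > 0" using e d1 K by (simp add: d_def)
  have "\<forall>\<^sub>F n in sequentially. 1 / real n < d" using d by (intro order_tendstoD[OF lim_1_over_n]) 
  moreover have "\<forall>\<^sub>F n in sequentially. table_error I J * fact_error n \<le> e/2 * real n" using e by (intro eventually_fact_error_le) simp
  ultimately have "\<forall>\<^sub>F n in sequentially. 1 / real n < d \<and> table_error I J * fact_error n \<le> e/2 * real n \<and> n \<ge> 1"
    using eventually_ge_at_top[of 1] by eventually_elim auto
  then obtain n0 where n0: "\<And>n. n \<ge> n0 \<Longrightarrow> 1 / real n < d \<and> table_error I J * fact_error n \<le> e/2 * real n \<and> n \<ge> 1"
    by (auto simp: eventually_sequentially)
  show thesis
  proof (rule that[OF d])
    fix n a b assume n: "n \<ge> n0" and ab: "a ` {1..n} \<subseteq> I" "b ` {1..n} \<subseteq> J"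
      and r: "\<And>i. i \<in> I \<Longrightarrow> \<bar>real (card {s\<in>{1..n}. a s = i}) / real n - (\<Sum>j\<in>J. p i j)\<bar> < d"
      and c: "\<And>j. j \<in> J \<Longrightarrow> \<bar>real (card {s\<in>{1..n}. b s = j}) / real n - (\<Sum>i\<in>I. p i j)\<bar> < d"
    note n' = n0[OF n]
    have sr: "(\<Sum>i\<in>I. card {s\<in>{1..n}. a s = i}) = n"
      using sum.group[of "{1..n}" I a "\<lambda>_. 1::nat"] fin ab by simp
    have sc: "(\<Sum>j\<in>J. card {s\<in>{1..n}. b s = j}) = n"
      using sum.group[of "{1..n}" J b "\<lambda>_. 1::nat"] fin ab by simp
    obtain N where N: "\<And>i. i \<in> I \<Longrightarrow> (\<Sum>j\<in>J. N i j) = card {s\<in>{1..n}. a s = i}" "\<And>j. j \<in> J \<Longrightarrow> (\<Sum>i\<in>I. N i j) = card {s\<in>{1..n}. b s = j}"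
      "\<And>i j. i \<in> I \<Longrightarrow> j \<in> J \<Longrightarrow> \<bar>real (N i j) / real n - p i j\<bar> \<le> real (card I * card J) * (d + 1 / real n)"
      using table_near[OF fin p _ sr sc d r c] n' by blast
    have near: "\<bar>real (N i j) / real n - p i j\<bar> < min e d1" if "i \<in> I" "j \<in> J" for i j
    proof -
      have "\<bar>real (N i j) / real n - p i j\<bar> \<le> real (card I * card J) * (d + 1 / real n)" using N(3) that .
      also have "\<dots> < K * (d + d)"
        using n' d by (intro mult_strict_mono add_strict_left_mono) (auto simp: K_def simp del: of_nat_mult)
      also have "\<dots> = min e d1" using K by (simp add: d_def)
      finally show ?thesis .
    qed
    have MIN: "MI I J (\<lambda>i j. real (N i j) / real n) < MI I J p + e/2"
    proof -
      have "\<bar>MI I J (\<lambda>i j. real (N i j) / real n) - MI I J p\<bar> < e/2"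
        by (rule d1(2)) (use near in \<open>simp only: min_less_iff_conj\<close>)
      then show ?thesis by linarith
    qed
    have "fact n * exp (- real n * (MI I J p + e)) \<le> fact n * exp (- real n * MI I J (\<lambda>i j. real (N i j) / real n) - table_error I J * fact_error n)"
    proof (intro mult_left_mono, unfold exp_le_cancel_iff)
      have "real n * MI I J (\<lambda>i j. real (N i j) / real n) \<le> real n * (MI I J p + e/2)"
        using MIN by (intro mult_left_mono) auto
      then show "- real n * (MI I J p + e) \<le> - real n * MI I J (\<lambda>i j. real (N i j) / real n) - table_error I J * fact_error n"
        using n' by (simp add: algebra_simps)
    qed auto
    also have "\<dots> \<le> real (card (table_bijs I J a b {1..n} {1..n} N))"
      using N n' ab fin by (intro card_table_bijs_bounds) auto
    also have "\<dots> = real (card {\<sigma>. \<sigma> permutes {1..n} \<and> (\<forall>i\<in>I. \<forall>j\<in>J. tables {1..n} a b \<sigma> i j = N i j)})"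
      by (subst card_permutes_tables) auto
    also have "\<dots> \<le> real (card {\<sigma>. \<sigma> permutes {1..n} \<and> (\<forall>i\<in>I. \<forall>j\<in>J. \<bar>ptab n a b \<sigma> i j - p i j\<bar> < e)})"
    proof (intro of_nat_mono card_mono)
      show "finite {\<sigma>. \<sigma> permutes {1..n} \<and> (\<forall>i\<in>I. \<forall>j\<in>J. \<bar>ptab n a b \<sigma> i j - p i j\<bar> < e)}"
        by (rule finite_subset[OF _ finite_permutations[of "{1..n}"]]) auto
    qed (use near in \<open>auto simp: ptab_def\<close>)
    finally show "fact n * exp (- real n * (MI I J p + e)) \<le>
         real (card {\<sigma>. \<sigma> permutes {1..n} \<and> (\<forall>i\<in>I. \<forall>j\<in>J. \<bar>ptab n a b \<sigma> i j - p i j\<bar> < e)})" .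
  qed
qed

section \<open>The Donsker--Varadhan inequality\<close>

text \<open>An integrable minorant makes the negative part finite, so the difference in
  \<open>ext_integral\<close> is meaningful even when the positive part is infinite.\<close>

lemma ext_integral_ge:
  assumes f: "f \<in> borel_measurable N" and psi: "integrable N \<psi>" and le: "AE x in N. \<psi> x \<le> f x"
  shows "ereal (\<integral>x. \<psi> x \<partial>N) \<le> ext_integral N f"
proof -
  have "(\<integral>\<^sup>+x. ennreal (- f x) \<partial>N) \<le> (\<integral>\<^sup>+x. ennreal (norm (\<psi> x)) \<partial>N)"
    using le by (intro nn_integral_mono_AE) (auto intro!: ennreal_leI)
  also have "\<dots> < \<infinity>" using psi by (simp add: integrable_iff_bounded)
  finally have neg: "(\<integral>\<^sup>+x. ennreal (- f x) \<partial>N) < \<infinity>" .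
  show ?thesis
  proof (cases "(\<integral>\<^sup>+x. ennreal (f x) \<partial>N) = \<infinity>")
    case True
    then have "ext_integral N f = \<infinity>"
      using neg unfolding ext_integral_def by (cases "\<integral>\<^sup>+x. ennreal (- f x) \<partial>N") auto
    then show ?thesis by simp
  next
    case False
    have int: "integrable N f" unfolding real_integrable_def using f neg False by auto
    have "ext_integral N f = ereal (\<integral>x. f x \<partial>N)"
      unfolding ext_integral_def real_lebesgue_integral_def[OF int]
      using neg False by (cases "\<integral>\<^sup>+x. ennreal (f x) \<partial>N"; cases "\<integral>\<^sup>+x. ennreal (- f x) \<partial>N") auto
    then show ?thesis using integral_mono_AE[OF psi int le] by simp
  qed
qed

locale prob_pair = R: prob_space R + P: prob_space P for R P :: "'a measure" +
  assumes sets_eq: "sets R = sets P"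
begin

lemma space_eq: "space R = space P"
  using sets_eq by (rule sets_eq_imp_space_eq)

lemma measurable_eq: "measurable R N = measurable P N"
  by (rule measurable_cong_sets) (auto simp: sets_eq)

text \<open>\<open>RN_deriv\<close> is finite \<open>P\<close>-almost everywhere, so its real-valued
  version is still a density. Its zeros are null under \<open>R\<close>, though possibly not under
  \<open>P\<close>.\<close>

lemma density_exists:
  assumes ac: "absolutely_continuous P R"
  defines "g \<equiv> \<lambda>x. enn2real (RN_deriv P R x)"
  shows "g \<in> borel_measurable P" "R = density P (\<lambda>x. ennreal (g x))" "AE x in R. g x > 0"
proof -
  show g: "g \<in> borel_measurable P" unfolding g_def by measurable
  have "AE x in P. RN_deriv P R x = ennreal (g x)"
    using P.RN_deriv_finite[OF R.sigma_finite_measure_axioms ac sets_eq]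
    by eventually_elim (simp add: g_def ennreal_enn2real_if)
  then have "density P (RN_deriv P R) = density P (\<lambda>x. ennreal (g x))"
    using g by (intro density_cong) auto
  then show eq: "R = density P (\<lambda>x. ennreal (g x))"
    using P.density_RN_deriv[OF ac sets_eq] by simp
  have "AE x in density P (\<lambda>x. ennreal (g x)). g x > 0"
    using g by (subst AE_density) (auto simp: ennreal_eq_0_iff not_less)
  then show "AE x in R. g x > 0" by (simp only: eq[symmetric])
qed

text \<open>Coarse-graining decreases entropy. With \<open>g\<close> the density and
  \<open>h\<close> the ratio of the cell masses, ln g \<ge> ln h + 1 - h / g holds
  \<open>R\<close>-almost everywhere by ln u \<le> u - 1. The \<open>R\<close>-integral of h / g is
  at most the \<open>P\<close>-integral of \<open>h\<close>, hence at most 1, and the integral of ln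
  h is the finite sum.\<close>

lemma cell_entropy_le:
  assumes c: "c \<in> R \<rightarrow>\<^sub>M count_space UNIV" and K: "finite K" "c ` space R \<subseteq> K"
  defines "r \<equiv> \<lambda>k. measure R (c -` {k} \<inter> space R)" and "p \<equiv> \<lambda>k. measure P (c -` {k} \<inter> space R)"
  shows "ereal (\<Sum>k\<in>K. r k * ln (r k / p k)) \<le> relative_entropy R P"
proof (cases "absolutely_continuous P R")
  case False
  then show ?thesis by (simp add: relative_entropy_def)
next
  case ac: True
  define g where "g x = enn2real (RN_deriv P R x)" for x
  note g = density_exists[OF ac, folded g_def]
  have [measurable]: "g \<in> borel_measurable P" "g \<in> borel_measurable R" using g measurable_eq by auto
  have g0: "g x \<ge> 0" for x by (simp add: g_def)
  have cs [measurable]: "c -` {k} \<inter> space R \<in> sets R" for k using measurable_sets[OF c, of "{k}"] by simp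
  then have csP: "c -` {k} \<inter> space R \<in> sets P" for k by (simp add: sets_eq)
  define h where "h x = r (c x) / p (c x)" for x
  have hsum: "h x = (\<Sum>k\<in>K. r k / p k * indicator (c -` {k} \<inter> space R) x)" if "x \<in> space R" for x
    using that K by (subst sum.remove[of K "c x"]) (auto simp: h_def indicator_def intro!: sum.neutral)
  have lnh: "ln (h x) = (\<Sum>k\<in>K. ln (r k / p k) * indicator (c -` {k} \<inter> space R) x)" if "x \<in> space R" for x
    using that K by (subst sum.remove[of K "c x"]) (auto simp: h_def indicator_def intro!: sum.neutral)
  have hm [measurable]: "h \<in> borel_measurable R" 
    by (subst measurable_cong[OF hsum]) measurable
  have hmP [measurable]: "h \<in> borel_measurable P" by (rule hm[unfolded measurable_eq])
  have h0: "h x \<ge> 0" for x by (simp add: h_def r_def p_def)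
  have hb: "AE x in R. h x > 0"
  proof -
    \<comment> \<open>Cells of \<open>R\<close>-mass 0 are left out, and a cell of
      \<open>P\<close>-mass 0 has \<open>R\<close>-mass 0 by absolute continuity. So almost
      everywhere neither the logarithm nor the quotient meets 0.\<close>
    have "AE x in R. \<forall>k\<in>K. r k = 0 \<longrightarrow> x \<notin> c -` {k} \<inter> space R"
    proof (intro AE_finite_allI K AE_impI)
      fix k assume "r k = 0"
      then have "c -` {k} \<inter> space R \<in> null_sets R" unfolding r_def using cs by (auto simp: R.emeasure_eq_measure null_sets_def)
      then show "AE x in R. x \<notin> c -` {k} \<inter> space R" by (rule AE_not_in)
    qed
    then show ?thesis using AE_space
    proof (eventually_elim, goal_cases)
      case (1 x)
      show ?case
      proof -
        have rk: "r (c x) \<noteq> 0" using 1 K by auto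
        have "p (c x) \<noteq> 0"
        proof
          assume "p (c x) = 0"
          then have "c -` {c x} \<inter> space R \<in> null_sets P" unfolding p_def using csP by (auto simp: P.emeasure_eq_measure null_sets_def)
          then have "c -` {c x} \<inter> space R \<in> null_sets R" using ac by (auto simp: absolutely_continuous_def)
          then show False using rk unfolding r_def by (simp add: null_setsD1 measure_def)
        qed
        then show ?thesis using rk by (simp add: h_def r_def p_def less_le)
      qed
    qed
  qed
  have hg: "(\<integral>\<^sup>+x. ennreal (h x / g x) \<partial>R) \<le> 1"
  proof -
    have "(\<integral>\<^sup>+x. ennreal (h x / g x) \<partial>R) = (\<integral>\<^sup>+x. ennreal (g x) * ennreal (h x / g x) \<partial>P)"
      by (subst g(2), subst nn_integral_density) auto
    also have "\<dots> \<le> (\<integral>\<^sup>+x. ennreal (h x) \<partial>P)"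
      by (intro nn_integral_mono) (auto simp: g_def h0 simp flip: ennreal_mult)
    also have "\<dots> = (\<integral>\<^sup>+x. (\<Sum>k\<in>K. ennreal (r k / p k) * indicator (c -` {k} \<inter> space R) x) \<partial>P)"
    proof (intro nn_integral_cong)
      fix x assume "x \<in> space P"
      then have "h x = (\<Sum>k\<in>K. r k / p k * indicator (c -` {k} \<inter> space R) x)" using hsum space_eq by auto
      moreover have "(\<Sum>k\<in>K. ennreal (r k / p k) * indicator (c -` {k} \<inter> space R) x)
          = (\<Sum>k\<in>K. ennreal (r k / p k * indicator (c -` {k} \<inter> space R) x))"
        by (intro sum.cong) (auto simp: indicator_def)
      ultimately show "ennreal (h x) = (\<Sum>k\<in>K. ennreal (r k / p k) * indicator (c -` {k} \<inter> space R) x)"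
        by (subst (asm) sum_ennreal) (auto simp: r_def p_def)
    qed
    also have "\<dots> = (\<Sum>k\<in>K. ennreal (r k / p k) * ennreal (p k))"
      using csP by (subst nn_integral_sum) (auto simp: nn_integral_cmult p_def P.emeasure_eq_measure intro!: sum.cong)
    also have "\<dots> = ennreal (\<Sum>k\<in>K. r k / p k * p k)"
    proof -
      have "(\<Sum>k\<in>K. ennreal (r k / p k) * ennreal (p k)) = (\<Sum>k\<in>K. ennreal (r k / p k * p k))"
        by (intro sum.cong refl ennreal_mult[symmetric]) (auto simp: r_def p_def)
      also have "\<dots> = ennreal (\<Sum>k\<in>K. r k / p k * p k)"
        by (intro sum_ennreal) (auto simp: r_def p_def)
      finally show ?thesis .
    qed
    also have "(\<Sum>k\<in>K. r k / p k * p k) \<le> (\<Sum>k\<in>K. r k)"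
      by (intro sum_mono) (auto simp: r_def)
    also have "\<dots> \<le> 1"
    proof -
      have "(\<Sum>k\<in>K. r k) = measure R (\<Union>k\<in>K. c -` {k} \<inter> space R)"
        unfolding r_def using K by (intro R.finite_measure_finite_Union[symmetric]) (auto simp: disjoint_family_on_def)
      then show ?thesis by simp
    qed
    finally show ?thesis by (simp add: ennreal_leI)
  qed
  have ihg: "integrable R (\<lambda>x. h x / g x)"
    using hg by (intro integrableI_nonneg) (auto simp: h0 g0 less_top[symmetric] top_unique)
  have ilnh: "integrable R (\<lambda>x. ln (h x))"
    by (subst Bochner_Integration.integrable_cong[OF refl lnh], assumption)
       (auto intro!: Bochner_Integration.integrable_sum integrable_mult_right integrable_real_indicator simp: less_top[symmetric])
  have "ereal (\<integral>x. ln (h x) + 1 - h x / g x \<partial>R) \<le> ext_integral R (\<lambda>x. ln (g x))"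
  proof (rule ext_integral_ge)
    show "integrable R (\<lambda>x. ln (h x) + 1 - h x / g x)" using ihg ilnh by auto
    show "AE x in R. ln (h x) + 1 - h x / g x \<le> ln (g x)"
      using hb g(3)
    proof eventually_elim
      fix x assume *: "0 < h x" "0 < g x"
      then have "ln (h x / g x) \<le> h x / g x - 1" by (intro ln_le_minus_one) auto
      then show "ln (h x) + 1 - h x / g x \<le> ln (g x)" using * by (simp add: ln_div)
    qed
  qed auto
  also have "ext_integral R (\<lambda>x. ln (g x)) = relative_entropy R P"
    using ac by (simp add: relative_entropy_def g_def)
  finally have *: "ereal (\<integral>x. ln (h x) + 1 - h x / g x \<partial>R) \<le> relative_entropy R P" .
  have "(\<integral>x. ln (h x) \<partial>R) = (\<integral>x. (\<Sum>k\<in>K. ln (r k / p k) * indicator (c -` {k} \<inter> space R) x) \<partial>R)"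
    by (intro Bochner_Integration.integral_cong refl lnh)
  also have "\<dots> = (\<Sum>k\<in>K. ln (r k / p k) * r k)"
    by (subst Bochner_Integration.integral_sum)
       (auto simp: r_def less_top[symmetric] intro!: integrable_mult_right integrable_real_indicator)
  finally have 1: "(\<integral>x. ln (h x) \<partial>R) = (\<Sum>k\<in>K. r k * ln (r k / p k))" by (simp add: mult.commute)
  have 2: "(\<integral>x. h x / g x \<partial>R) \<le> 1"
    using hg by (subst integral_eq_nn_integral) (auto simp: h0 g0 intro!: enn2real_leI)
  have "(\<integral>x. ln (h x) + 1 - h x / g x \<partial>R) = (\<integral>x. ln (h x) \<partial>R) + 1 - (\<integral>x. h x / g x \<partial>R)"
    using ihg ilnh by (simp add: R.prob_space)
  then have "(\<Sum>k\<in>K. r k * ln (r k / p k)) \<le> (\<integral>x. ln (h x) + 1 - h x / g x \<partial>R)" using 1 2 by simp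
  then show ?thesis using * by (meson ereal_less_eq(3) order_trans)
qed

text \<open>The Donsker--Varadhan bound, with \<open>s\<close> in the place of \<open>H(R | P)\<close>.\<close>

definition DV :: "real \<Rightarrow> ('a \<Rightarrow> real) \<Rightarrow> bool" where
  "DV s f \<longleftrightarrow> (\<integral>x. f x \<partial>R) \<le> s + ln (\<integral>x. exp (f x) \<partial>P)"

text \<open>Rounding \<open>f\<close> down to multiples of \<open>e\<close> gives a simple function.
  The left side loses at most \<open>e\<close>, and the exponential integral on the right only
  decreases.\<close>

lemma DV_bounded:
  assumes simple: "\<And>f. simple_function R f \<Longrightarrow> DV s f"
    and f: "f \<in> borel_measurable R" and B: "\<And>x. x \<in> space R \<Longrightarrow> \<bar>f x\<bar> \<le> B"
  shows "DV s f"
  unfolding DV_def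
proof (rule field_le_epsilon)
  fix e :: real assume e: "e > 0"
  define F where "F x = real_of_int \<lfloor>f x / e\<rfloor> * e" for x
  have F1: "F x \<le> f x" "f x \<le> F x + e" for x
  proof -
    have "real_of_int \<lfloor>f x / e\<rfloor> \<le> f x / e" "f x / e \<le> real_of_int \<lfloor>f x / e\<rfloor> + 1" by linarith+
    then have "real_of_int \<lfloor>f x / e\<rfloor> * e \<le> f x" "f x \<le> (real_of_int \<lfloor>f x / e\<rfloor> + 1) * e"
      unfolding pos_le_divide_eq[OF e] pos_divide_le_eq[OF e] .
    then show "F x \<le> f x" "f x \<le> F x + e" unfolding F_def by (simp_all add: distrib_right)
  qed
  have Fm: "F \<in> borel_measurable R" unfolding F_def using f by measurable
  have fin: "finite (F ` space R)"
  proof (rule finite_subset)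
    show "F ` space R \<subseteq> (\<lambda>k. real_of_int k * e) ` {\<lfloor>- B / e\<rfloor>..\<lfloor>B / e\<rfloor>}"
    proof safe
      fix x assume x: "x \<in> space R"
      have "- B \<le> f x" "f x \<le> B" using B[OF x] by linarith+
      then have "- B / e \<le> f x / e" "f x / e \<le> B / e" using e by (intro divide_right_mono; simp)+
      then have "\<lfloor>f x / e\<rfloor> \<in> {\<lfloor>- B / e\<rfloor>..\<lfloor>B / e\<rfloor>}" by (auto intro: floor_mono)
      then show "F x \<in> (\<lambda>k. real_of_int k * e) ` {\<lfloor>- B / e\<rfloor>..\<lfloor>B / e\<rfloor>}" by (auto simp: F_def)
    qed
  qed auto
  have sF: "simple_function R F"
    using Fm fin by (simp add: simple_function_borel_measurable)
  have Bn: "0 \<le> B" if "x \<in> space R" for x using B[OF that] by linarith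
  have iF: "integrable R F" 
    using Fm B F1 e by (intro R.integrable_const_bound[where B="B + e"] AE_I2) (auto simp: abs_le_iff, (smt (verit))+)
  have if_: "integrable R f" using f B by (intro R.integrable_const_bound[where B=B] AE_I2) auto
  have m: "F \<in> borel_measurable P" "f \<in> borel_measurable P" using Fm f measurable_eq by auto
  have ief: "integrable P (\<lambda>x. exp (f x))"
    using m B by (intro P.integrable_const_bound[where B="exp B"] AE_I2) (auto simp: space_eq[symmetric] abs_le_iff)
  have ieF: "integrable P (\<lambda>x. exp (F x))"
    using m B F1 order_trans[OF F1(1)] by (intro P.integrable_const_bound[where B="exp B"] AE_I2) (auto simp: space_eq[symmetric] abs_le_iff)
  have pos: "(\<integral>x. exp (F x) \<partial>P) > 0"
  proof -
    have "0 < exp (- B - e)" by simp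
    also have "\<dots> = (\<integral>x. exp (- B - e) \<partial>P)" by (simp add: P.prob_space)
    also have "\<dots> \<le> (\<integral>x. exp (F x) \<partial>P)"
    proof (rule integral_mono[OF _ ieF])
      fix x assume "x \<in> space P"
      then have "\<bar>f x\<bar> \<le> B" using B space_eq by auto
      then show "exp (- B - e) \<le> exp (F x)" using F1[of x] by auto
    qed simp
    finally show ?thesis .
  qed
  have "(\<integral>x. f x \<partial>R) \<le> (\<integral>x. F x + e \<partial>R)"
    using if_ iF F1 by (intro integral_mono) auto
  also have "\<dots> = (\<integral>x. F x \<partial>R) + e" using iF by (simp add: R.prob_space)
  also have "(\<integral>x. F x \<partial>R) \<le> s + ln (\<integral>x. exp (F x) \<partial>P)" using simple[OF sF] by (simp add: DV_def)
  also have "ln (\<integral>x. exp (F x) \<partial>P) \<le> ln (\<integral>x. exp (f x) \<partial>P)"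
    using pos F1 ief ieF by (intro ln_mono integral_mono) auto
  finally show "(\<integral>x. f x \<partial>R) \<le> s + ln (\<integral>x. exp (f x) \<partial>P) + e" by simp
qed

text \<open>The converse half of the duality. Large multiples of the indicator of a
  \<open>P\<close>-null set force absolute continuity. Then the logarithm of the density, truncated
  to [- ln M, ln M], is a bounded test function whose exponential has \<open>P\<close>-integral at
  most 1 + 1/M. As M grows, the positive part of the logarithm is reached by monotone convergence;
  its negative part is integrable since - t ln t \<le> 1.\<close>

lemma relative_entropy_le:
  assumes simple: "\<And>f. simple_function R f \<Longrightarrow> DV s f"
  shows "relative_entropy R P \<le> ereal s"
proof -
  have ac: "absolutely_continuous P R"
    unfolding absolutely_continuous_def
  proof
    fix N assume N: "N \<in> null_sets P"
    then have NR: "N \<in> sets R" by (auto simp: sets_eq)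
    have "t * measure R N \<le> s" for t
    proof -
      have "DV s (\<lambda>x. t * indicator N x)" using NR by (intro simple) auto
      moreover have "(\<integral>x. exp (t * indicator N x) \<partial>P) = (\<integral>x. 1 \<partial>P)"
      proof (intro integral_cong_AE)
        show "AE x in P. exp (t * indicator N x) = 1" using AE_not_in[OF N] by eventually_elim simp
      qed (use NR sets_eq in auto)
      ultimately show ?thesis using NR by (simp add: DV_def P.prob_space)
    qed
    \<comment> \<open>This multiple would give |s| + 1 \<le> s.\<close>
    from this[of "(\<bar>s\<bar> + 1) / measure R N"] have "measure R N = 0" by (cases "measure R N = 0") auto
    then show "N \<in> null_sets R" using NR by (auto simp: R.emeasure_eq_measure null_sets_def)
  qed
  define g where "g x = enn2real (RN_deriv P R x)" for x
  note g = density_exists[OF ac, folded g_def]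
  have [measurable]: "g \<in> borel_measurable P" "g \<in> borel_measurable R" using g measurable_eq by auto
  have g0: "g x \<ge> 0" for x by (simp add: g_def)
  define n where "n x = max 0 (- ln (g x))" for x
  have [measurable]: "n \<in> borel_measurable P" "n \<in> borel_measurable R" unfolding n_def by measurable
  have nint: "(\<integral>\<^sup>+x. ennreal (n x) \<partial>R) \<le> 1"
  proof -
    have "(\<integral>\<^sup>+x. ennreal (n x) \<partial>R) = (\<integral>\<^sup>+x. ennreal (g x) * ennreal (n x) \<partial>P)"
      by (subst g(2), subst nn_integral_density) auto
    also have "\<dots> \<le> (\<integral>\<^sup>+x. 1 \<partial>P)"
    proof (intro nn_integral_mono)
      fix x
      have "g x * n x \<le> 1"
      proof (cases "g x = 0")
        case False
        then have gp: "g x > 0" using g0[of x] by simp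
        have "- ln (g x) = ln (1 / g x)" using gp by (simp add: ln_div)
        also have "\<dots> \<le> 1 / g x - 1" using gp by (intro ln_le_minus_one) auto
        finally have "g x * (- ln (g x)) \<le> g x * (1 / g x - 1)" using gp by (intro mult_left_mono) auto
        also have "\<dots> \<le> 1" using gp by (simp add: field_simps)
        finally show ?thesis by (simp add: n_def max_def)
      qed simp
      then show "ennreal (g x) * ennreal (n x) \<le> 1"
        using g0 by (subst ennreal_mult[symmetric]) (auto simp: n_def)
    qed
    finally show ?thesis by (simp add: P.emeasure_space_1)
  qed
  have nI: "integrable R n"
    using nint by (intro integrableI_nonneg) (auto simp: n_def less_top[symmetric] top_unique)
  define nn where "nn = (\<integral>x. n x \<partial>R)"
  have pos: "(\<integral>\<^sup>+x. ennreal (min (ln (real (Suc m))) (ln (g x))) \<partial>R) \<le> ennreal (s + ln (1 + 1 / real (Suc m)) + nn)" for m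
  proof -
    let ?M = "real (Suc m)"
    define f where "f x = ln (min ?M (max (g x) (1 / ?M)))" for x
    have fm [measurable]: "f \<in> borel_measurable R" "f \<in> borel_measurable P" unfolding f_def by measurable
    have Mp: "0 < min ?M (max (g x) (1 / ?M))" for x by (auto simp: less_max_iff_disj)
    have fb: "\<bar>f x\<bar> \<le> ln ?M" for x
    proof -
      have "1 / ?M \<le> ?M" by (simp add: field_simps)
      then have "1 / ?M \<le> min ?M (max (g x) (1 / ?M))" by simp
      then have "ln (1 / ?M) \<le> f x" unfolding f_def by (intro ln_mono) auto
      moreover have "f x \<le> ln ?M" unfolding f_def using Mp by (intro ln_mono) auto
      ultimately show ?thesis by (simp add: ln_div abs_le_iff)
    qed
    have "DV s f" using fb by (intro DV_bounded[OF simple]) auto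
    then have "(\<integral>x. f x \<partial>R) \<le> s + ln (\<integral>x. exp (f x) \<partial>P)" by (simp add: DV_def)
    also have "(\<integral>x. exp (f x) \<partial>P) \<le> 1 + 1 / ?M"
    proof -
      have eg: "ennreal (\<integral>x. g x \<partial>P) = 1" and ig: "integrable P g"
      proof -
        have "(\<integral>\<^sup>+x. ennreal (g x) \<partial>P) = emeasure R (space R)"
        proof -
          have "emeasure R (space P) = emeasure (density P (\<lambda>x. ennreal (g x))) (space P)"
            by (simp only: g(2)[symmetric])
          also have "\<dots> = (\<integral>\<^sup>+x. ennreal (g x) \<partial>P)"
            by (subst emeasure_density) (auto intro!: nn_integral_cong)
          finally show ?thesis by (simp add: space_eq)
        qed
        then have 1: "(\<integral>\<^sup>+x. ennreal (g x) \<partial>P) = 1" by (simp add: R.emeasure_space_1)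
        then show ig: "integrable P g" using g0 by (intro integrableI_nonneg) auto
        show "ennreal (\<integral>x. g x \<partial>P) = 1" using 1 g0 by (subst nn_integral_eq_integral[symmetric]) (auto intro: ig)
      qed
      have "(\<integral>x. exp (f x) \<partial>P) \<le> (\<integral>x. g x + 1 / ?M \<partial>P)"
      proof (rule integral_mono)
        show "integrable P (\<lambda>x. exp (f x))"
          using fb by (intro P.integrable_const_bound[where B="exp (ln ?M)"] AE_I2) (auto simp: abs_le_iff simp del: exp_ln)
        show "exp (f x) \<le> g x + 1 / ?M" for x
        proof -
          have "exp (f x) = min ?M (max (g x) (1 / ?M))" unfolding f_def using Mp[of x] by (rule exp_ln)
          also have "\<dots> \<le> max (g x) (1 / ?M)" by (rule min.cobounded2)
          also have "\<dots> \<le> g x + 1 / ?M" using g0[of x] by simp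
          finally show ?thesis .
        qed
      qed (use ig in auto)
      also have "\<dots> = (\<integral>x. g x \<partial>P) + 1 / ?M" using ig by (simp add: P.prob_space)
      also have "(\<integral>x. g x \<partial>P) = 1" using eg by (metis ennreal_eq_1)
      finally show ?thesis .
    qed
    then have "ln (\<integral>x. exp (f x) \<partial>P) \<le> ln (1 + 1 / ?M)"
    proof (rule ln_mono)
      have "exp (- ln ?M) \<le> (\<integral>x. exp (f x) \<partial>P)"
      proof -
        have "exp (- ln ?M) = (\<integral>x. exp (- ln ?M) \<partial>P)" by (simp add: P.prob_space)
        also have "\<dots> \<le> (\<integral>x. exp (f x) \<partial>P)"
        proof (rule integral_mono)
          show "integrable P (\<lambda>x. exp (f x))"
            using fb by (intro P.integrable_const_bound[where B="exp (ln ?M)"] AE_I2) (auto simp: abs_le_iff simp del: exp_ln)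
          show "exp (- ln ?M) \<le> exp (f x)" for x using fb[of x] unfolding exp_le_cancel_iff by linarith
        qed simp
        finally show ?thesis .
      qed
      then show "0 < (\<integral>x. exp (f x) \<partial>P)" using exp_gt_zero[of "- ln ?M"] by linarith
    qed
    finally have A: "(\<integral>x. f x \<partial>R) \<le> s + ln (1 + 1 / ?M)" by simp
    have fI: "integrable R f" using fb by (intro R.integrable_const_bound[where B="ln ?M"] AE_I2) auto
    have "(\<integral>\<^sup>+x. ennreal (min (ln ?M) (ln (g x))) \<partial>R) \<le> (\<integral>\<^sup>+x. ennreal (f x + n x) \<partial>R)"
    proof (intro nn_integral_mono_AE)
      show "AE x in R. ennreal (min (ln ?M) (ln (g x))) \<le> ennreal (f x + n x)"
        using g(3)
      proof eventually_elim
        fix x assume gx: "0 < g x"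
        have "min (ln ?M) (ln (g x)) \<le> f x"
        proof -
          have "min (ln ?M) (ln (g x)) = ln (min ?M (g x))" using gx by (auto simp: min_def)
          also have "\<dots> \<le> f x" unfolding f_def using gx by (intro ln_mono) auto
          finally show ?thesis .
        qed
        moreover have "n x \<ge> 0" by (simp add: n_def)
        ultimately show "ennreal (min (ln ?M) (ln (g x))) \<le> ennreal (f x + n x)" by (intro ennreal_leI) linarith
      qed
    qed
    \<comment> \<open>\<open>n\<close> is the negative part of the logarithm of \<open>g\<close>.
      Adding it makes the integrand nonnegative almost everywhere, so the extended integral becomes
      a real one.\<close>
    also have "\<dots> = ennreal (\<integral>x. f x + n x \<partial>R)"
    proof (rule nn_integral_eq_integral)
      show "integrable R (\<lambda>x. f x + n x)" using fI nI by auto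
      show "AE x in R. 0 \<le> f x + n x" using g(3)
      proof eventually_elim
        fix x assume gx: "0 < g x"
        show "0 \<le> f x + n x"
        proof (cases "g x \<ge> 1")
          case True
          then have "0 \<le> f x" unfolding f_def by (intro ln_ge_zero) auto
          then show ?thesis by (simp add: n_def)
        next
          case False
          then have "ln (g x) \<le> f x" unfolding f_def using gx by (intro ln_mono) auto
          then show ?thesis by (simp add: n_def)
        qed
      qed
    qed
    also have "(\<integral>x. f x + n x \<partial>R) = (\<integral>x. f x \<partial>R) + nn" using fI nI by (simp add: nn_def)
    finally show ?thesis using A by (meson add_right_mono ennreal_leI order_trans)
  qed
  have "(\<integral>\<^sup>+x. ennreal (ln (g x)) \<partial>R) = (\<integral>\<^sup>+x. (SUP m. ennreal (min (ln (real (Suc m))) (ln (g x)))) \<partial>R)"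
  proof (intro nn_integral_cong antisym)
    fix x
    obtain m where "g x \<le> real m" using real_arch_simple by blast
    then have "ln (g x) \<le> ln (real (Suc m))"
      using g0[of x] by (cases "g x = 0") (auto intro!: ln_mono)
    then have "ennreal (ln (g x)) \<le> ennreal (min (ln (real (Suc m))) (ln (g x)))" by simp
    then show "ennreal (ln (g x)) \<le> (SUP m. ennreal (min (ln (real (Suc m))) (ln (g x))))"
      by (rule SUP_upper2[rotated]) simp
    show "(SUP m. ennreal (min (ln (real (Suc m))) (ln (g x)))) \<le> ennreal (ln (g x))"
      by (intro SUP_least ennreal_leI) simp
  qed
  also have "\<dots> = (SUP m. \<integral>\<^sup>+x. ennreal (min (ln (real (Suc m))) (ln (g x))) \<partial>R)"
  proof (rule nn_integral_monotone_convergence_SUP)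
    show "incseq (\<lambda>m x. ennreal (min (ln (real (Suc m))) (ln (g x))))"
      by (auto simp: incseq_def le_fun_def intro!: ennreal_leI min.mono)
  qed measurable
  also have "\<dots> \<le> ennreal (s + nn)"
  proof (rule SUP_least)
    fix m0 :: nat
    have le: "(\<integral>\<^sup>+x. ennreal (min (ln (real (Suc m0))) (ln (g x))) \<partial>R) \<le> ennreal (s + ln (1 + 1 / real (Suc m)) + nn)"
      if "m \<ge> m0" for m
      by (rule order_trans[OF _ pos[of m]]) (use that in \<open>auto intro!: nn_integral_mono ennreal_leI min.mono\<close>)
    have "(\<lambda>m. s + ln (1 + 1 / real (Suc m)) + nn) \<longlonglongrightarrow> s + ln (1 + 0) + nn"
      using LIMSEQ_inverse_real_of_nat by (intro tendsto_intros) (auto simp: inverse_eq_divide)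
    then have "(\<lambda>m. ennreal (s + ln (1 + 1 / real (Suc m)) + nn)) \<longlonglongrightarrow> ennreal (s + nn)"
      by (intro tendsto_ennrealI) simp
    then show "(\<integral>\<^sup>+x. ennreal (min (ln (real (Suc m0))) (ln (g x))) \<partial>R) \<le> ennreal (s + nn)"
      by (rule LIMSEQ_le_const) (use le in blast)
  qed
  finally have P: "(\<integral>\<^sup>+x. ennreal (ln (g x)) \<partial>R) \<le> ennreal (s + nn)" .
  have s0: "s \<ge> 0"
  proof -
    have "DV s (\<lambda>_. 0)" by (intro simple) auto
    then show ?thesis by (simp add: DV_def P.prob_space)
  qed
  have nn0: "nn \<ge> 0" unfolding nn_def by (intro integral_nonneg_AE) (auto simp: n_def)
  have N: "(\<integral>\<^sup>+x. ennreal (- ln (g x)) \<partial>R) = ennreal nn"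
  proof -
    have "(\<integral>\<^sup>+x. ennreal (- ln (g x)) \<partial>R) = (\<integral>\<^sup>+x. ennreal (n x) \<partial>R)"
      by (intro nn_integral_cong) (auto simp: n_def max_def ennreal_neg)
    then show ?thesis unfolding nn_def using nI by (subst nn_integral_eq_integral[symmetric]) (auto simp: n_def)
  qed
  have "relative_entropy R P = ext_integral R (\<lambda>x. ln (g x))" using ac by (simp add: relative_entropy_def g_def)
  also have "\<dots> = enn2ereal (\<integral>\<^sup>+x. ennreal (ln (g x)) \<partial>R) - ereal nn"
    unfolding ext_integral_def N using nn0 by (simp add: enn2ereal_ennreal)
  also have "\<dots> \<le> ereal (s + nn) - ereal nn"
  proof (rule ereal_minus_mono)
    have "enn2ereal (\<integral>\<^sup>+x. ennreal (ln (g x)) \<partial>R) \<le> enn2ereal (ennreal (s + nn))"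
      using P by (simp add: less_eq_ennreal.rep_eq)
    then show "enn2ereal (\<integral>\<^sup>+x. ennreal (ln (g x)) \<partial>R) \<le> ereal (s + nn)"
      using s0 nn0 by (simp add: enn2ereal_ennreal del: ennreal_plus)
  qed simp
  finally show ?thesis by simp
qed

end

text \<open>From exp (v - u) \<ge> 1 + (v - u), multiplied by exp u.\<close>

lemma exp_diff_le:
  fixes u v B :: real
  assumes "u \<le> B" 
  shows "exp u \<le> exp v + exp B * \<bar>u - v\<bar>"
proof (cases "u \<le> v")
  case True
  then have "exp u \<le> exp v" by simp
  then show ?thesis by (simp add: add_increasing2)
next
  case False
  have "exp u * (1 + (v - u)) \<le> exp u * exp (v - u)" by (intro mult_left_mono) auto
  also have "\<dots> = exp v" by (simp flip: exp_add)
  finally have "exp u \<le> exp v + exp u * (u - v)" by (simp add: algebra_simps)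
  also have "exp u * (u - v) \<le> exp B * (u - v)" using False assms by (intro mult_right_mono) auto
  finally show ?thesis using False by simp
qed

section \<open>From a generating algebra to all simple functions\<close>

context prob_pair
begin

text \<open>The approximating set has to serve \<open>R\<close> and \<open>P\<close> at the same
  time, because \<open>DV\<close> integrates against both measures.\<close>

lemma algebra_approx:
  assumes alg: "algebra (space R) \<R>" and gen: "sets R = sigma_sets (space R) \<R>"
    and E: "E \<in> sets R" and e: "e > 0"
  shows "\<exists>A\<in>\<R>. measure R ((E - A) \<union> (A - E)) < e \<and> measure P ((E - A) \<union> (A - E)) < e"
proof -
  interpret algebra "space R" \<R> by fact
  have RR: "\<R> \<subseteq> sets R" using gen by auto
  from E have "E \<in> sigma_sets (space R) \<R>" using gen by simp
  then show ?thesis using e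
  proof (induction arbitrary: e)
    case (Basic a)
    then show ?case by (intro bexI[of _ a]) auto
  next
    case Empty
    then show ?case by (intro bexI[of _ "{}"]) auto
  next
    case (Compl a)
    then obtain A where A: "A \<in> \<R>" "measure R ((a - A) \<union> (A - a)) < e" "measure P ((a - A) \<union> (A - a)) < e" by blast
    have "(space R - a - (space R - A)) \<union> (space R - A - (space R - a)) = (a - A) \<union> (A - a)"
      using A(1) sets_into_space Compl(1) sigma_sets_into_sp[OF space_closed] by blast
    then show ?case using A by (intro bexI[of _ "space R - A"]) auto
  next
    case (Union a)
    have am: "a i \<in> sets R" for i using Union(1)[of i] gen by simp
    have am': "a i \<in> sets P" for i using am sets_eq by simp
    have UU: "(\<Union>n. \<Union>i<n. a i) = (\<Union>i. a i)" by auto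
    have l1: "(\<lambda>n. measure R (\<Union>i<n. a i)) \<longlonglongrightarrow> measure R (\<Union>n. \<Union>i<n. a i)"
      by (intro R.finite_Lim_measure_incseq) (auto simp: incseq_def am intro: less_le_trans)
    have l2: "(\<lambda>n. measure P (\<Union>i<n. a i)) \<longlonglongrightarrow> measure P (\<Union>n. \<Union>i<n. a i)"
      by (intro P.finite_Lim_measure_incseq) (auto simp: incseq_def am' intro: less_le_trans)
    have "\<forall>\<^sub>F n in sequentially. dist (measure R (\<Union>i<n. a i)) (measure R (\<Union>i. a i)) < e/2"
      "\<forall>\<^sub>F n in sequentially. dist (measure P (\<Union>i<n. a i)) (measure P (\<Union>i. a i)) < e/2"
      using tendstoD[OF l1[unfolded UU], of "e/2"] tendstoD[OF l2[unfolded UU], of "e/2"] Union.prems by simp_all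
    then have "\<forall>\<^sub>F n in sequentially. dist (measure R (\<Union>i<n. a i)) (measure R (\<Union>i. a i)) < e/2 \<and>
       dist (measure P (\<Union>i<n. a i)) (measure P (\<Union>i. a i)) < e/2" by eventually_elim simp
    then obtain n where n: "dist (measure R (\<Union>i<n. a i)) (measure R (\<Union>i. a i)) < e/2"
       "dist (measure P (\<Union>i<n. a i)) (measure P (\<Union>i. a i)) < e/2"
      by (auto simp: eventually_sequentially)
    \<comment> \<open>The \<open>n\<close> symmetric differences together then cost at most e / 2;
      \<open>Suc n\<close> covers the case n = 0.\<close>
    define d where "d = e / (2 * real (Suc n))"
    have d: "d > 0" using Union.prems by (simp add: d_def)
    have "\<forall>i. \<exists>A\<in>\<R>. measure R ((a i - A) \<union> (A - a i)) < d \<and> measure P ((a i - A) \<union> (A - a i)) < d"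
      using Union.IH d by blast
    then obtain A where A: "\<And>i. A i \<in> \<R>" "\<And>i. measure R ((a i - A i) \<union> (A i - a i)) < d"
      "\<And>i. measure P ((a i - A i) \<union> (A i - a i)) < d" by metis
    have Am: "A i \<in> sets R" "A i \<in> sets P" for i using A(1) RR sets_eq by auto
    let ?U = "\<Union>i. a i" and ?B = "\<Union>i<n. A i"
    have sub: "(?U - ?B) \<union> (?B - ?U) \<subseteq> (?U - (\<Union>i<n. a i)) \<union> (\<Union>i<n. (a i - A i) \<union> (A i - a i))" by auto
    have bound: "measure N ((?U - ?B) \<union> (?B - ?U)) < e"
      if "finite_measure N" and aN: "\<And>i. a i \<in> sets N" and AN: "\<And>i. A i \<in> sets N"
        and n: "dist (measure N (\<Union>i<n. a i)) (measure N ?U) < e/2" and AA: "\<And>i. measure N ((a i - A i) \<union> (A i - a i)) < d" for N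
    proof -
      interpret N: finite_measure N by fact
      have "measure N ((?U - ?B) \<union> (?B - ?U)) \<le> measure N ((?U - (\<Union>i<n. a i)) \<union> (\<Union>i<n. (a i - A i) \<union> (A i - a i)))"
        using aN AN by (intro N.finite_measure_mono sub) auto
      also have "\<dots> \<le> measure N (?U - (\<Union>i<n. a i)) + measure N (\<Union>i<n. (a i - A i) \<union> (A i - a i))"
        using aN AN by (intro measure_Un_le) auto
      also have "measure N (?U - (\<Union>i<n. a i)) = measure N ?U - measure N (\<Union>i<n. a i)"
        using aN by (intro N.finite_measure_Diff) auto
      also have "\<dots> < e/2" using n unfolding dist_real_def by linarith
      also have "measure N (\<Union>i<n. (a i - A i) \<union> (A i - a i)) \<le> (\<Sum>i<n. measure N ((a i - A i) \<union> (A i - a i)))"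
        using aN AN by (intro N.finite_measure_subadditive_finite) auto
      also have "\<dots> \<le> (\<Sum>i<n. d)" by (intro sum_mono less_imp_le AA)
      also have "\<dots> \<le> e/2" using Union.prems by (simp add: d_def field_simps)
      finally show ?thesis by simp
    qed
    have "?B \<in> \<R>" using A(1) by auto
    moreover have "measure R ((?U - ?B) \<union> (?B - ?U)) < e"
      by (rule bound) (use am Am n A R.finite_measure_axioms in auto)
    moreover have "measure P ((?U - ?B) \<union> (?B - ?U)) < e"
      by (rule bound) (use am' Am n A P.finite_measure_axioms in auto)
    ultimately show ?case by blast
  qed
qed

text \<open>Replace each level set of \<open>f\<close> by a nearby member of the algebra. With
  \<open>B\<close> from the proof, the left side changes by at most B e and the exponential integral
  by at most exp B times B e; then e tends to 0.\<close>

lemma DV_simple: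
  assumes alg: "algebra (space R) \<R>" and gen: "sets R = sigma_sets (space R) \<R>"
    and dv: "\<And>V A. finite V \<Longrightarrow> (\<And>v::real. v \<in> V \<Longrightarrow> A v \<in> \<R>) \<Longrightarrow> DV s (\<lambda>x. \<Sum>v\<in>V. v * indicator (A v) x)"
    and f: "simple_function R f"
  shows "DV s f"
proof -
  define V where "V = f ` space R"
  define E where "E v = f -` {v} \<inter> space R" for v
  have V: "finite V" using f by (simp add: V_def simple_function_def)
  have E: "E v \<in> sets R" for v unfolding E_def using f by (metis simple_functionD(2))
  have RR: "\<R> \<subseteq> sets R" using gen by auto
  have fx: "f x = (\<Sum>v\<in>V. v * indicator (E v) x)" if "x \<in> space R" for x
  proof -
    have "(\<Sum>v\<in>V. v * indicator (E v) x) = (\<Sum>v\<in>V. if v = f x then v else 0)"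
      using that by (intro sum.cong) (auto simp: E_def indicator_def)
    then show ?thesis using that V by (simp add: V_def)
  qed
  \<comment> \<open>The sum of the absolute values and not their maximum, since the approximating
    sets may overlap.\<close>
  define B where "B = (\<Sum>v\<in>V. \<bar>v\<bar>)"
  have B0: "B \<ge> 0" by (simp add: B_def sum_nonneg)
  have ind: "\<bar>\<Sum>v\<in>V. v * indicator (S v) x\<bar> \<le> B" for S :: "real \<Rightarrow> 'a set" and x
    unfolding B_def by (rule order_trans[OF sum_abs]) (auto intro!: sum_mono simp: indicator_def)
  have fB: "\<bar>f x\<bar> \<le> B" if "x \<in> space R" for x using fx[OF that] ind by simp
  have fm: "f \<in> borel_measurable R" "f \<in> borel_measurable P"
    using f measurable_eq by (auto intro: borel_measurable_simple_function)
  have If: "integrable R f" using fB fm by (intro R.integrable_const_bound[where B=B] AE_I2) auto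
  have expB: "integrable P (\<lambda>x. exp (g x))" if "g \<in> borel_measurable P" "\<And>x. x \<in> space P \<Longrightarrow> \<bar>g x\<bar> \<le> B" for g
    using that by (intro P.integrable_const_bound[where B="exp B"] AE_I2) (auto simp: abs_le_iff)
  have Ie: "integrable P (\<lambda>x. exp (f x))" using fm fB space_eq by (intro expB) auto
  have main: "(\<integral>x. f x \<partial>R) \<le> s + ln ((\<integral>x. exp (f x) \<partial>P) + exp B * (B * e)) + B * e" if e: "e > 0" for e
  proof -
    have "\<forall>v. \<exists>A\<in>\<R>. measure R ((E v - A) \<union> (A - E v)) < e \<and> measure P ((E v - A) \<union> (A - E v)) < e"
      using algebra_approx[OF alg gen E e] by blast
    then obtain A where A: "\<And>v. A v \<in> \<R>" "\<And>v. measure R ((E v - A v) \<union> (A v - E v)) < e"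
      "\<And>v. measure P ((E v - A v) \<union> (A v - E v)) < e" by metis
    have Am: "A v \<in> sets R" "A v \<in> sets P" for v using A(1) RR sets_eq by auto
    have Em: "E v \<in> sets P" for v using E sets_eq by auto
    define h where "h x = (\<Sum>v\<in>V. v * indicator (A v) x)" for x
    define D where "D x = (\<Sum>v\<in>V. \<bar>v\<bar> * indicator ((E v - A v) \<union> (A v - E v)) x)" for x
    have hm [measurable]: "h \<in> borel_measurable R" "h \<in> borel_measurable P" unfolding h_def using Am by measurable
    have hB: "\<bar>h x\<bar> \<le> B" for x unfolding h_def by (rule ind)
    have fh: "\<bar>f x - h x\<bar> \<le> D x" if "x \<in> space R" for x
    proof -
      have "f x - h x = (\<Sum>v\<in>V. v * indicator (E v) x - v * indicator (A v) x)"
        using fx[OF that] by (simp add: h_def sum_subtractf)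
      also have "\<bar>\<dots>\<bar> \<le> (\<Sum>v\<in>V. \<bar>v * indicator (E v) x - v * indicator (A v) x\<bar>)" by (rule sum_abs)
      also have "\<dots> \<le> D x" unfolding D_def by (intro sum_mono) (auto simp: indicator_def)
      finally show ?thesis .
    qed
    have D: "integrable N D \<and> (\<integral>x. D x \<partial>N) \<le> B * e"
      if "finite_measure N" "\<And>v. E v \<in> sets N" "\<And>v. A v \<in> sets N" "\<And>v. measure N ((E v - A v) \<union> (A v - E v)) < e" for N
    proof -
      interpret N: finite_measure N by fact
      have i: "integrable N (\<lambda>x. \<bar>v\<bar> * indicator ((E v - A v) \<union> (A v - E v)) x)" for v
        using that by (intro integrable_mult_right integrable_real_indicator) (auto simp: less_top[symmetric])
      have "(\<integral>x. D x \<partial>N) = (\<Sum>v\<in>V. \<bar>v\<bar> * measure N ((E v - A v) \<union> (A v - E v)))"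
        unfolding D_def using that by (subst Bochner_Integration.integral_sum[OF i]) auto
      also have "\<dots> \<le> (\<Sum>v\<in>V. \<bar>v\<bar> * e)" by (intro sum_mono mult_left_mono less_imp_le[OF that(4)]) auto
      finally show ?thesis using i unfolding D_def by (auto simp: B_def sum_distrib_right intro!: Bochner_Integration.integrable_sum)
    qed
    have DR: "integrable R D" "(\<integral>x. D x \<partial>R) \<le> B * e" using D[OF R.finite_measure_axioms E] Am A by auto
    have DP: "integrable P D" "(\<integral>x. D x \<partial>P) \<le> B * e" using D[OF P.finite_measure_axioms Em] Am A by auto
    have Ih: "integrable R h" using hB by (intro R.integrable_const_bound[where B=B] AE_I2) auto
    have Ieh: "integrable P (\<lambda>x. exp (h x))" using hB by (intro expB) auto
    have pos: "0 < (\<integral>x. exp (h x) \<partial>P)"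
    proof -
      have "0 < exp (- B)" by simp
      also have "exp (- B) = (\<integral>x. exp (- B) \<partial>P)" by (simp add: P.prob_space)
      also have "\<dots> \<le> (\<integral>x. exp (h x) \<partial>P)"
        using hB by (intro integral_mono Ieh) (auto simp: abs_le_iff intro: minus_le_iff[THEN iffD1])
      finally show ?thesis .
    qed
    have "(\<integral>x. f x \<partial>R) \<le> (\<integral>x. h x + D x \<partial>R)"
      using If Ih DR fh by (intro integral_mono) (auto simp: abs_le_iff algebra_simps)
    also have "\<dots> = (\<integral>x. h x \<partial>R) + (\<integral>x. D x \<partial>R)" using Ih DR by simp
    also have "\<dots> \<le> (\<integral>x. h x \<partial>R) + B * e" using DR by simp
    also have "(\<integral>x. h x \<partial>R) \<le> s + ln (\<integral>x. exp (h x) \<partial>P)"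
      using dv[OF V, of A] A(1) by (simp add: DV_def h_def)
    also have "ln (\<integral>x. exp (h x) \<partial>P) \<le> ln ((\<integral>x. exp (f x) \<partial>P) + exp B * (B * e))"
    proof (rule ln_mono[OF _ pos])
      have "(\<integral>x. exp (h x) \<partial>P) \<le> (\<integral>x. exp (f x) + exp B * D x \<partial>P)"
      proof (intro integral_mono Ieh)
        fix x assume x: "x \<in> space P"
        have "exp (h x) \<le> exp (f x) + exp B * \<bar>h x - f x\<bar>"
          using hB[of x] by (intro exp_diff_le) (simp add: abs_le_iff)
        also have "\<bar>h x - f x\<bar> \<le> D x" using fh[of x] x space_eq by (simp add: abs_minus_commute)
        finally show "exp (h x) \<le> exp (f x) + exp B * D x" by simp
      qed (use Ie DP in auto)
      also have "\<dots> = (\<integral>x. exp (f x) \<partial>P) + exp B * (\<integral>x. D x \<partial>P)" using Ie DP by simp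
      also have "\<dots> \<le> (\<integral>x. exp (f x) \<partial>P) + exp B * (B * e)" using DP by simp
      finally show "(\<integral>x. exp (h x) \<partial>P) \<le> (\<integral>x. exp (f x) \<partial>P) + exp B * (B * e)" .
    qed
    finally show ?thesis by simp
  qed
  have posf: "0 < (\<integral>x. exp (f x) \<partial>P)"
  proof -
    have "0 < exp (- B)" by simp
    also have "exp (- B) = (\<integral>x. exp (- B) \<partial>P)" by (simp add: P.prob_space)
    also have "\<dots> \<le> (\<integral>x. exp (f x) \<partial>P)"
    proof (intro integral_mono Ie)
      fix x assume "x \<in> space P"
      then have "\<bar>f x\<bar> \<le> B" using fB space_eq by auto
      then show "exp (- B) \<le> exp (f x)" by simp
    qed simp
    finally show ?thesis .
  qed
  have "(\<lambda>n. s + ln ((\<integral>x. exp (f x) \<partial>P) + exp B * (B * (1 / real (Suc n)))) + B * (1 / real (Suc n)))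
     \<longlonglongrightarrow> s + ln ((\<integral>x. exp (f x) \<partial>P) + exp B * (B * 0)) + B * 0"
    using LIMSEQ_inverse_real_of_nat posf by (intro tendsto_intros) (auto simp: inverse_eq_divide)
  then have "(\<integral>x. f x \<partial>R) \<le> s + ln ((\<integral>x. exp (f x) \<partial>P) + exp B * (B * 0)) + B * 0"
    by (rule LIMSEQ_le_const) (intro exI[of _ 0] allI impI main, simp)
  then show ?thesis by (simp add: DV_def)
qed

text \<open>The finite Gibbs inequality. Apply ln u \<le> u - 1 to u = exp (F k) p k / (Z r k),
  weight with \<open>r k\<close> and sum over the cells: the right side becomes 1 - 1. Cells with
  \<open>r k = 0\<close> drop out, and on the others \<open>ac\<close> makes \<open>p k\<close>
  positive.\<close>

lemma DV_cells:
  assumes c: "c \<in> R \<rightarrow>\<^sub>M count_space UNIV" and K: "finite K" "c ` space R \<subseteq> K"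
  defines "r \<equiv> \<lambda>k. measure R (c -` {k} \<inter> space R)" and "p \<equiv> \<lambda>k. measure P (c -` {k} \<inter> space R)"
  assumes ac: "\<And>k. k \<in> K \<Longrightarrow> p k = 0 \<Longrightarrow> r k = 0"
  shows "DV (\<Sum>k\<in>K. r k * ln (r k / p k)) (\<lambda>x. F (c x))"
proof -
  have cs [measurable]: "c -` {k} \<inter> space R \<in> sets R" for k using measurable_sets[OF c, of "{k}"] by simp
  then have csP [measurable]: "c -` {k} \<inter> space R \<in> sets P" for k by (simp add: sets_eq)
  have split: "G (c x) = (\<Sum>k\<in>K. G k * indicator (c -` {k} \<inter> space R) x)" if "x \<in> space R" for x and G :: "_ \<Rightarrow> real"
    using that K by (subst sum.remove[of K "c x"]) (auto simp: indicator_def intro!: sum.neutral)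
  have intR: "(\<integral>x. G (c x) \<partial>R) = (\<Sum>k\<in>K. G k * r k)" for G :: "_ \<Rightarrow> real"
  proof -
    have "(\<integral>x. G (c x) \<partial>R) = (\<integral>x. (\<Sum>k\<in>K. G k * indicator (c -` {k} \<inter> space R) x) \<partial>R)"
      by (intro Bochner_Integration.integral_cong refl split)
    also have "\<dots> = (\<Sum>k\<in>K. G k * r k)"
      by (subst Bochner_Integration.integral_sum)
         (auto simp: r_def less_top[symmetric] intro!: integrable_mult_right integrable_real_indicator)
    finally show ?thesis .
  qed
  have intP: "(\<integral>x. G (c x) \<partial>P) = (\<Sum>k\<in>K. G k * p k)" for G :: "_ \<Rightarrow> real"
  proof -
    have "(\<integral>x. G (c x) \<partial>P) = (\<integral>x. (\<Sum>k\<in>K. G k * indicator (c -` {k} \<inter> space R) x) \<partial>P)"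
      using space_eq by (intro Bochner_Integration.integral_cong refl split) auto
    also have "\<dots> = (\<Sum>k\<in>K. G k * p k)"
      using csP by (subst Bochner_Integration.integral_sum)
         (auto simp: p_def less_top[symmetric] space_eq intro!: integrable_mult_right integrable_real_indicator)
    finally show ?thesis .
  qed
  have r1: "(\<Sum>k\<in>K. r k) = 1" using intR[of "\<lambda>_. 1"] by (simp add: R.prob_space)
  have rp: "r k \<ge> 0" "p k \<ge> 0" for k by (auto simp: r_def p_def)
  define Z where "Z = (\<Sum>k\<in>K. exp (F k) * p k)"
  have "\<exists>k\<in>K. r k \<noteq> 0" using r1 by (metis sum.neutral zero_neq_one)
  then obtain k0 where "k0 \<in> K" "p k0 \<noteq> 0" using ac by auto
  then have Z: "Z > 0" unfolding Z_def using K rp by (intro sum_pos2[of K k0]) (auto simp: less_le)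
  have "(\<Sum>k\<in>K. r k * (F k - ln Z) - r k * ln (r k / p k)) \<le> (\<Sum>k\<in>K. exp (F k) * p k / Z - r k)"
  proof (rule sum_mono)
    fix k assume k: "k \<in> K"
    show "r k * (F k - ln Z) - r k * ln (r k / p k) \<le> exp (F k) * p k / Z - r k"
    proof (cases "r k = 0")
      case True
      then show ?thesis using Z rp by simp
    next
      case False
      then have pos: "r k > 0" "p k > 0" using ac[OF k] rp[of k] by (auto simp: less_le)
      have "ln (exp (F k) * p k / (Z * r k)) \<le> exp (F k) * p k / (Z * r k) - 1"
        using pos Z by (intro ln_le_minus_one) auto
      moreover have "ln (exp (F k) * p k / (Z * r k)) = F k - ln Z - ln (r k / p k)"
        using pos Z by (simp add: ln_div ln_mult)
      ultimately have "r k * (F k - ln Z - ln (r k / p k)) \<le> r k * (exp (F k) * p k / (Z * r k) - 1)"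
        using pos by (intro mult_left_mono) auto
      also have "r k * (exp (F k) * p k / (Z * r k) - 1) = exp (F k) * p k / Z - r k"
        using pos Z by (simp add: field_simps)
      finally show ?thesis by (simp add: right_diff_distrib)
    qed
  qed
  also have "\<dots> = 0" using Z r1 by (simp add: sum_subtractf Z_def flip: sum_divide_distrib)
  finally have "(\<Sum>k\<in>K. r k * F k) - ln Z \<le> (\<Sum>k\<in>K. r k * ln (r k / p k))"
    using r1 by (simp add: sum_subtractf right_diff_distrib flip: sum_distrib_right)
  then show ?thesis unfolding DV_def intR intP[of "\<lambda>k. exp (F k)"] Z_def by (simp add: mult.commute)
qed

end

section \<open>Continuity labellings\<close>

lemma borel_probsD:
  assumes "\<rho> \<in> borel_probs E"
  shows "prob_space \<rho>" "sets \<rho> = sets (restrict_space borel E)" "space \<rho> = E"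
proof -
  show "prob_space \<rho>" and s: "sets \<rho> = sets (restrict_space borel E)"
    using assms by (auto simp: borel_probs_def)
  show "space \<rho> = E" using sets_eq_imp_space_eq[OF s] by (simp add: space_restrict_space)
qed

lemma borel_probs_UNIV: "\<rho> \<in> borel_probs UNIV \<longleftrightarrow> prob_space \<rho> \<and> sets \<rho> = sets borel"
  by (simp add: borel_probs_def)

lemma closed_R_plus_times: "closed (R_plus_times :: (real \<times> 's::topological_space) set)"
  by (intro closed_Times) auto

lemma R_plus_times_sets [measurable]: "(R_plus_times :: (real \<times> 's::topological_space) set) \<in> sets borel"
  using closed_R_plus_times by (rule borel_closed)

lemma fst_measurable_R_plus [measurable]:
  "fst \<in> restrict_space borel (R_plus_times :: (real \<times> 's::topological_space) set) \<rightarrow>\<^sub>M restrict_space borel R_plus"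
  by (rule measurable_restrict_space3[OF borel_measurable_continuous_onI[OF continuous_on_fst[OF continuous_on_id]]]) auto

lemma snd_measurable_R_plus [measurable]:
  "snd \<in> restrict_space borel (R_plus_times :: (real \<times> 's::topological_space) set) \<rightarrow>\<^sub>M borel"
  by (rule measurable_restrict_space1[OF borel_measurable_continuous_onI[OF continuous_on_snd[OF continuous_on_id]]])

text \<open>Second countability identifies the Borel sets of the product with the product
  sigma-algebra. This puts a measure on pairs and the product of its marginals on the same
  sigma-algebra, as relative entropy requires.\<close>

lemma sets_pair_R_plus:
  "sets (restrict_space borel R_plus \<Otimes>\<^sub>M (borel :: 's::second_countable_topology measure))
     = sets (restrict_space borel (R_plus_times :: (real \<times> 's) set))"
proof -
  let ?P = "restrict_space borel R_plus \<Otimes>\<^sub>M (borel :: 's measure)"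
  let ?Q = "restrict_space borel (R_plus_times :: (real \<times> 's) set)"
  have sp: "space ?P = R_plus_times" "space ?Q = R_plus_times"
    by (simp_all add: space_pair_measure space_restrict_space)
  have "(\<lambda>z. (fst z, snd z)) \<in> ?Q \<rightarrow>\<^sub>M ?P" by (rule measurable_Pair) measurable
  then have 1: "(\<lambda>z. z) \<in> ?Q \<rightarrow>\<^sub>M ?P" by simp
  have f: "fst \<in> ?P \<rightarrow>\<^sub>M borel"
    using measurable_fst[of "restrict_space borel R_plus" "borel :: 's measure"]
    by (rule measurable_compose) (rule measurable_restrict_space1, simp)
  have "(\<lambda>z. (fst z, snd z)) \<in> ?P \<rightarrow>\<^sub>M (borel \<Otimes>\<^sub>M borel)"
    by (rule measurable_Pair[OF f]) simp
  then have "(\<lambda>z. z) \<in> ?P \<rightarrow>\<^sub>M borel" by (simp add: borel_prod)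
  then have 2: "(\<lambda>z. z) \<in> ?P \<rightarrow>\<^sub>M ?Q"
    by (rule measurable_restrict_space2[rotated]) (auto simp: sp)
  show ?thesis
  proof (intro equalityI subsetI)
    fix A assume A: "A \<in> sets ?P"
    then have "A \<subseteq> R_plus_times" using sets.sets_into_space[of A ?P] sp by simp
    then show "A \<in> sets ?Q" using measurable_sets[OF 1 A] sp by (simp add: Int_absorb2)
  next
    fix A assume A: "A \<in> sets ?Q"
    then have "A \<subseteq> R_plus_times" using sets.sets_into_space[of A ?Q] sp by simp
    then show "A \<in> sets ?P" using measurable_sets[OF 2 A] sp by (simp add: Int_absorb2)
  qed
qed

lemma marginal1_borel_probs:
  fixes \<rho> :: "(real \<times> 's::topological_space) measure"
  assumes "\<rho> \<in> borel_probs R_plus_times"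
  shows "marginal1 \<rho> \<in> borel_probs R_plus"
proof -
  note r = borel_probsD[OF assms]
  interpret prob_space \<rho> by fact
  have "fst \<in> \<rho> \<rightarrow>\<^sub>M restrict_space borel R_plus" by (subst measurable_cong_sets[OF r(2) refl]) simp
  then show ?thesis unfolding borel_probs_def marginal1_def using prob_space_distr by auto
qed

lemma marginal2_borel_probs:
  fixes \<rho> :: "(real \<times> 's::topological_space) measure"
  assumes "\<rho> \<in> borel_probs R_plus_times"
  shows "marginal2 \<rho> \<in> borel_probs UNIV"
proof -
  note r = borel_probsD[OF assms]
  interpret prob_space \<rho> by fact
  have "snd \<in> \<rho> \<rightarrow>\<^sub>M borel" by (subst measurable_cong_sets[OF r(2) refl]) simp
  then show ?thesis unfolding borel_probs_UNIV marginal2_def using prob_space_distr by auto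
qed

lemma measure_marginal1:
  fixes \<rho> :: "(real \<times> 's::topological_space) measure"
  assumes "\<rho> \<in> borel_probs R_plus_times" and "A \<in> sets (restrict_space borel R_plus)"
  shows "measure (marginal1 \<rho>) A = measure \<rho> (A \<times> UNIV)"
proof -
  note r = borel_probsD[OF assms(1)]
  have m: "fst \<in> \<rho> \<rightarrow>\<^sub>M restrict_space borel R_plus" by (subst measurable_cong_sets[OF r(2) refl]) simp
  have "A \<subseteq> R_plus" using sets.sets_into_space[OF assms(2)] by (simp add: space_restrict_space)
  then have "fst -` A \<inter> space \<rho> = A \<times> UNIV" using r by auto
  then show ?thesis unfolding marginal1_def using measure_distr[OF m assms(2)] by simp
qed

lemma measure_marginal2:
  fixes \<rho> :: "(real \<times> 's::topological_space) measure"
  assumes "\<rho> \<in> borel_probs R_plus_times" and "B \<in> sets borel"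
  shows "measure (marginal2 \<rho>) B = measure \<rho> (R_plus \<times> B)"
proof -
  note r = borel_probsD[OF assms(1)]
  have m: "snd \<in> \<rho> \<rightarrow>\<^sub>M borel" by (subst measurable_cong_sets[OF r(2) refl]) simp
  have "snd -` B \<inter> space \<rho> = R_plus \<times> B" using r by auto
  then show ?thesis unfolding marginal2_def using measure_distr[OF m assms(2)] by simp
qed

text \<open>
  A \<open>\<nu>\<close>-continuity labelling is a finite measurable partition whose cells are continuity sets of
  \<open>\<nu>\<close>; the partition is given by a label function.
\<close>

definition loc_const :: "'a::topological_space set \<Rightarrow> ('a \<Rightarrow> nat) \<Rightarrow> 'a \<Rightarrow> bool" where
  "loc_const E a z \<longleftrightarrow> (\<exists>U. open U \<and> z \<in> U \<and> (\<forall>y\<in>U\<inter>E. a y = a z))"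

definition clab :: "'a::topological_space measure \<Rightarrow> ('a \<Rightarrow> nat) \<Rightarrow> bool" where
  "clab \<nu> a \<longleftrightarrow> finite (a ` space \<nu>) \<and> a \<in> \<nu> \<rightarrow>\<^sub>M count_space UNIV \<and>
     (AE z in \<nu>. loc_const (space \<nu>) a z)"

lemma clab_const: "clab \<nu> (\<lambda>_. k)"
  by (auto simp: clab_def loc_const_def image_constant_conv intro!: exI[of _ UNIV])

lemma clab_pair:
  assumes "clab \<nu> a" "clab \<nu> a'"
  shows "clab \<nu> (\<lambda>x. prod_encode (a x, a' x))"
  unfolding clab_def
proof (intro conjI)
  show "finite ((\<lambda>x. prod_encode (a x, a' x)) ` space \<nu>)"
    using assms by - (rule finite_subset[of _ "prod_encode ` (a ` space \<nu> \<times> a' ` space \<nu>)"], auto simp: clab_def)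
  have [measurable]: "a \<in> \<nu> \<rightarrow>\<^sub>M count_space UNIV" "a' \<in> \<nu> \<rightarrow>\<^sub>M count_space UNIV" using assms by (auto simp: clab_def)
  show "(\<lambda>x. prod_encode (a x, a' x)) \<in> \<nu> \<rightarrow>\<^sub>M count_space UNIV" by measurable
  have "AE z in \<nu>. loc_const (space \<nu>) a z" "AE z in \<nu>. loc_const (space \<nu>) a' z" using assms by (auto simp: clab_def)
  then show "AE z in \<nu>. loc_const (space \<nu>) (\<lambda>x. prod_encode (a x, a' x)) z"
  proof eventually_elim
    fix z assume "loc_const (space \<nu>) a z" "loc_const (space \<nu>) a' z"
    then obtain U U' where "open U" "z \<in> U" "\<forall>y\<in>U \<inter> space \<nu>. a y = a z"
       "open U'" "z \<in> U'" "\<forall>y\<in>U' \<inter> space \<nu>. a' y = a' z" by (auto simp: loc_const_def)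
    then show "loc_const (space \<nu>) (\<lambda>x. prod_encode (a x, a' x)) z"
      unfolding loc_const_def by (intro exI[of _ "U \<inter> U'"]) auto
  qed
qed

text \<open>Distinct level sets of \<open>g\<close> are disjoint, so only countably many of them
  carry mass. At any other level \<open>r\<close> the boundary between the two cells is
  null.\<close>

lemma clab_threshold:
  fixes g :: "'a::topological_space \<Rightarrow> real"
  assumes \<nu>: "\<nu> \<in> borel_probs E" and g: "continuous_on UNIV g" and "u < v"
  obtains r where "u < r" "r < v" "clab \<nu> (\<lambda>x. of_bool (g x < r))"
proof -
  note n = borel_probsD[OF \<nu>]
  interpret prob_space \<nu> by fact
  have gm [measurable]: "g \<in> \<nu> \<rightarrow>\<^sub>M borel"
    by (subst measurable_cong_sets[OF n(2) refl]) (intro measurable_restrict_space1 borel_measurable_continuous_onI g)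
  interpret D: finite_measure "distr \<nu> borel g" by (rule finite_measure_distr) measurable
  have "countable {r. measure (distr \<nu> borel g) {r} \<noteq> 0}" by (rule D.countable_support)
  then obtain r where r: "u < r" "r < v" "measure (distr \<nu> borel g) {r} = 0"
    using open_minus_countable[of "{r. measure (distr \<nu> borel g) {r} \<noteq> 0}" "{u<..<v}"] \<open>u < v\<close> by auto
  have "measure \<nu> (g -` {r} \<inter> space \<nu>) = 0" using r by (simp add: measure_distr)
  then have "g -` {r} \<inter> space \<nu> \<in> null_sets \<nu>" by (auto simp: null_sets_def emeasure_eq_measure intro!: measurable_sets[OF gm])
  then have "AE z in \<nu>. z \<notin> g -` {r} \<inter> space \<nu>" by (rule AE_not_in)
  then have "AE z in \<nu>. loc_const (space \<nu>) (\<lambda>x. of_bool (g x < r)) z" using AE_space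
  proof eventually_elim
    fix z assume z: "z \<notin> g -` {r} \<inter> space \<nu>" "z \<in> space \<nu>"
    have "open (g -` {..<r})" "open (g -` {r<..})" using g by (auto intro!: open_vimage)
    then show "loc_const (space \<nu>) (\<lambda>x. of_bool (g x < r)) z"
    proof (cases "g z < r")
      case True
      then show ?thesis using \<open>open (g -` {..<r})\<close> unfolding loc_const_def by (intro exI[of _ "g -` {..<r}"]) auto
    next
      case False
      then show ?thesis using z \<open>open (g -` {r<..})\<close> unfolding loc_const_def by (intro exI[of _ "g -` {r<..}"]) auto
    qed
  qed
  moreover have "(\<lambda>x. of_bool (g x < r)) \<in> \<nu> \<rightarrow>\<^sub>M count_space UNIV"
    unfolding of_bool_def by measurable
  moreover have "finite ((\<lambda>x. of_bool (g x < r) :: nat) ` space \<nu>)"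
    by (rule finite_subset[of _ "{0,1}"]) auto
  ultimately show thesis using that r by (auto simp: clab_def)
qed

text \<open>With a distance function as \<open>g\<close>, balls of suitable radius show that open
  continuity sets form a base.\<close>

lemma clab_ball:
  fixes x :: "'a::metric_space"
  assumes "\<nu> \<in> borel_probs E" "open U" "x \<in> U"
  obtains A where "open A" "x \<in> A" "A \<subseteq> U" "clab \<nu> (\<lambda>y. of_bool (y \<in> A))"
proof -
  obtain e where e: "e > 0" "ball x e \<subseteq> U" using assms openE by blast
  have "continuous_on UNIV (\<lambda>y. dist x y)" by (intro continuous_intros)
  from clab_threshold[OF assms(1) this e(1)] obtain r
    where r: "0 < r" "r < e" "clab \<nu> (\<lambda>y. of_bool (dist x y < r))" .
  show thesis
    by (rule that[of "ball x r"]) (use r e in auto)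
qed

section \<open>The algebra of sets described by pairs of labels\<close>

definition labset :: "(real \<Rightarrow> nat) \<Rightarrow> ('s \<Rightarrow> nat) \<Rightarrow> (nat \<times> nat) set \<Rightarrow> (real \<times> 's) set" where
  "labset a b S = {z \<in> R_plus_times. (a (fst z), b (snd z)) \<in> S}"

definition ltab :: "(real \<times> 's) measure \<Rightarrow> (real \<Rightarrow> nat) \<Rightarrow> ('s \<Rightarrow> nat) \<Rightarrow> nat \<Rightarrow> nat \<Rightarrow> real" where
  "ltab \<rho> a b i j = measure \<rho> (labset a b {(i, j)})"

definition labalg :: "real measure \<Rightarrow> 's::topological_space measure \<Rightarrow> (real \<times> 's) set set" where
  "labalg \<nu> \<mu> = {labset a b S |a b S. clab \<nu> a \<and> clab \<mu> b}"

text \<open>Boxes with continuity sets as sides form a base of the product, and the Lindelof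
  property extracts a countable cover.\<close>

lemma box_cover:
  fixes W :: "(real \<times> 's::polish_space) set"
  assumes \<nu>: "\<nu> \<in> borel_probs E" and \<mu>: "\<mu> \<in> borel_probs E'" and W: "open W"
  obtains F where "countable F" "\<Union>((\<lambda>(A,B). A \<times> B) ` F) = W"
    "\<And>A B. (A,B) \<in> F \<Longrightarrow> open A \<and> open B \<and> clab \<nu> (\<lambda>y. of_bool (y \<in> A)) \<and> clab \<mu> (\<lambda>y. of_bool (y \<in> B))"
proof -
  define G where "G = {(A,B). A \<times> B \<subseteq> W \<and> open A \<and> open B \<and> clab \<nu> (\<lambda>y. of_bool (y \<in> A)) \<and> clab \<mu> (\<lambda>y. of_bool (y \<in> B))}"
  have "open S" if "S \<in> (\<lambda>(A,B). A \<times> B) ` G" for S using that by (auto simp: G_def intro: open_Times)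
  then obtain F' where F': "F' \<subseteq> (\<lambda>(A,B). A \<times> B) ` G" "countable F'" "\<Union>F' = \<Union>((\<lambda>(A,B). A \<times> B) ` G)"
    by (rule Lindelof)
  then obtain F where F: "countable F" "F \<subseteq> G" "F' = (\<lambda>(A,B). A \<times> B) ` F"
    using countable_subset_image[of F' "\<lambda>(A,B). A \<times> B" G] by auto
  have "W \<subseteq> \<Union>((\<lambda>(A,B). A \<times> B) ` G)"
  proof
    fix z assume "z \<in> W"
    then obtain U V where UV: "open U" "open V" "z \<in> U \<times> V" "U \<times> V \<subseteq> W" using W open_prod_elim by metis
    have zU: "fst z \<in> U" "snd z \<in> V" using UV by auto
    obtain A where A: "open A" "fst z \<in> A" "A \<subseteq> U" "clab \<nu> (\<lambda>y. of_bool (y \<in> A))"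
      using clab_ball[OF \<nu> UV(1) zU(1)] by metis
    obtain B where B: "open B" "snd z \<in> B" "B \<subseteq> V" "clab \<mu> (\<lambda>y. of_bool (y \<in> B))"
      using clab_ball[OF \<mu> UV(2) zU(2)] by metis
    have "(A,B) \<in> G" using A B UV by (auto simp: G_def)
    moreover have "z \<in> A \<times> B" using A B by (simp add: mem_Times_iff)
    ultimately show "z \<in> \<Union>((\<lambda>(A,B). A \<times> B) ` G)" by blast
  qed
  moreover have "\<Union>((\<lambda>(A,B). A \<times> B) ` G) \<subseteq> W" by (auto simp: G_def)
  ultimately show thesis using F F' by (intro that[of F]) (auto simp: G_def)
qed

lemma lab_measurable:
  fixes \<rho> :: "(real \<times> 's::topological_space) measure" and a b :: "_ \<Rightarrow> nat"
  assumes r: "sets \<rho> = sets (restrict_space borel R_plus_times)"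
    and a: "a \<in> restrict_space borel R_plus \<rightarrow>\<^sub>M count_space UNIV" and b: "b \<in> borel \<rightarrow>\<^sub>M count_space UNIV"
  shows "(\<lambda>z. (a (fst z), b (snd z))) \<in> \<rho> \<rightarrow>\<^sub>M count_space UNIV"
proof -
  have [measurable]: "(\<lambda>z. a (fst z)) \<in> \<rho> \<rightarrow>\<^sub>M count_space UNIV" "(\<lambda>z. b (snd z)) \<in> \<rho> \<rightarrow>\<^sub>M count_space UNIV"
    by (subst measurable_cong_sets[OF r refl]; rule measurable_compose[OF _ a] measurable_compose[OF _ b]; measurable)+
  have "(\<lambda>z. (a (fst z), b (snd z))) \<in> \<rho> \<rightarrow>\<^sub>M count_space UNIV \<Otimes>\<^sub>M count_space UNIV"
    by (rule measurable_Pair) measurable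
  then show ?thesis by (simp add: pair_measure_countable)
qed

lemma clab_measurable:
  "\<nu> \<in> borel_probs E \<Longrightarrow> clab \<nu> a \<Longrightarrow> a \<in> restrict_space borel E \<rightarrow>\<^sub>M count_space UNIV"
  by (auto simp: clab_def dest!: borel_probsD(2) cong: measurable_cong_sets)

lemma clab_measurable_UNIV:
  "\<nu> \<in> borel_probs UNIV \<Longrightarrow> clab \<nu> a \<Longrightarrow> a \<in> borel \<rightarrow>\<^sub>M count_space UNIV"
  using clab_measurable[of \<nu> UNIV a] by simp

lemma labset_sets:
  fixes \<rho> :: "(real \<times> 's::topological_space) measure"
  assumes r: "sets \<rho> = sets (restrict_space borel R_plus_times)"
    and "a \<in> restrict_space borel R_plus \<rightarrow>\<^sub>M count_space UNIV" and "b \<in> borel \<rightarrow>\<^sub>M count_space UNIV"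
  shows "labset a b S \<in> sets \<rho>"
proof -
  have "space \<rho> = R_plus_times" using sets_eq_imp_space_eq[OF r] by (simp add: space_restrict_space)
  then have "labset a b S = (\<lambda>z. (a (fst z), b (snd z))) -` S \<inter> space \<rho>" by (auto simp: labset_def)
  then show ?thesis using measurable_sets[OF lab_measurable[OF assms], of S] by simp
qed

text \<open>A common refinement. Both factors encode pairs of labels by \<open>prod_encode\<close>,
  which is why the same decodings \<open>p\<close> and \<open>p'\<close> serve on both.\<close>

lemma labalg_pair:
  assumes "clab \<nu> a" "clab \<mu> b" "clab \<nu> a'" "clab \<mu> b'"
  obtains a'' b'' p p' where "clab \<nu> a''" "clab \<mu> b''"
    "\<And>w. a w = p (a'' w)" "\<And>w. a' w = p' (a'' w)" "\<And>y. b y = p (b'' y)" "\<And>y. b' y = p' (b'' y)"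
  by (rule that[of "\<lambda>x. prod_encode (a x, a' x)" "\<lambda>x. prod_encode (b x, b' x)" "\<lambda>k. fst (prod_decode k)" "\<lambda>k. snd (prod_decode k)"])
     (auto intro: clab_pair assms)

lemma algebra_labalg: "algebra (R_plus_times :: (real \<times> 's::topological_space) set) (labalg \<nu> (\<mu> :: 's measure))"
proof (subst algebra_iff_Un, intro conjI ballI)
  show "labalg \<nu> \<mu> \<subseteq> Pow R_plus_times" by (auto simp: labalg_def labset_def)
  have "{} = labset (\<lambda>_. 0) (\<lambda>_::'s. 0) {}" by (auto simp: labset_def)
  then show "{} \<in> labalg \<nu> \<mu>" unfolding labalg_def by (blast intro: clab_const)
next
  fix R assume "R \<in> labalg \<nu> \<mu>"
  then obtain a b S where *: "R = labset a b S" "clab \<nu> a" "clab \<mu> b" by (auto simp: labalg_def)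
  then have "R_plus_times - R = labset a b (- S)" by (auto simp: labset_def)
  then show "R_plus_times - R \<in> labalg \<nu> \<mu>" using * by (auto simp: labalg_def)
next
  fix R R' assume "R \<in> labalg \<nu> \<mu>" "R' \<in> labalg \<nu> \<mu>"
  then obtain a b S a' b' S' where *: "R = labset a b S" "clab \<nu> a" "clab \<mu> b" "R' = labset a' b' S'" "clab \<nu> a'" "clab \<mu> b'"
    by (auto simp: labalg_def)
  obtain a'' b'' p p' where **: "clab \<nu> a''" "clab \<mu> b''"
    "\<And>w. a w = p (a'' w)" "\<And>w. a' w = p' (a'' w)" "\<And>y. b y = p (b'' y)" "\<And>y. b' y = p' (b'' y)"
    using labalg_pair[OF *(2,3,5,6)] by metis
  have "R \<union> R' = labset a'' b'' {(i,j). (p i, p j) \<in> S \<or> (p' i, p' j) \<in> S'}"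
    using * ** by (auto simp: labset_def)
  then show "R \<union> R' \<in> labalg \<nu> \<mu>" using ** by (auto simp: labalg_def)
qed

text \<open>An open set is a countable union of boxes from \<open>box_cover\<close>, and each such
  box is a single cell of two-valued labellings.\<close>

lemma sigma_labalg:
  fixes \<mu> :: "'s::polish_space measure"
  assumes \<nu>: "\<nu> \<in> borel_probs R_plus" and \<mu>: "\<mu> \<in> borel_probs UNIV"
  shows "sigma_sets R_plus_times (labalg \<nu> \<mu>) = sets (restrict_space borel R_plus_times)"
proof
  have "labalg \<nu> \<mu> \<subseteq> sets (restrict_space borel R_plus_times)"
    unfolding labalg_def using clab_measurable[OF \<nu>] clab_measurable_UNIV[OF \<mu>]
    by (auto intro!: labset_sets)
  then show "sigma_sets R_plus_times (labalg \<nu> \<mu>) \<subseteq> sets (restrict_space borel R_plus_times)"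
    using sets.sigma_sets_subset[of "labalg \<nu> \<mu>" "restrict_space borel R_plus_times"] by (simp add: space_restrict_space)
  interpret algebra "R_plus_times :: (real \<times> 's) set" "labalg \<nu> \<mu>" by (rule algebra_labalg)
  have op: "R_plus_times \<inter> W \<in> sigma_sets R_plus_times (labalg \<nu> \<mu>)" if W: "open W" for W
  proof -
    obtain F where F: "countable F" "\<Union>((\<lambda>(A,B). A \<times> B) ` F) = W"
      "\<And>A B. (A,B) \<in> F \<Longrightarrow> open A \<and> open B \<and> clab \<nu> (\<lambda>y. of_bool (y \<in> A)) \<and> clab \<mu> (\<lambda>y. of_bool (y \<in> B))"
      using box_cover[OF \<nu> \<mu> W] by metis
    have box: "R_plus_times \<inter> (A \<times> B) \<in> labalg \<nu> \<mu>" if "(A,B) \<in> F" for A B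
    proof -
      have "R_plus_times \<inter> (A \<times> B) = labset (\<lambda>y. of_bool (y \<in> A)) (\<lambda>y. of_bool (y \<in> B)) {(1,1)}"
        by (auto simp: labset_def)
      then show ?thesis using F(3)[OF that] by (auto simp: labalg_def)
    qed
    have "R_plus_times \<inter> W = (\<Union>p\<in>F. R_plus_times \<inter> (case p of (A,B) \<Rightarrow> A \<times> B))" using F(2) by auto
    also have "\<dots> \<in> sigma_sets R_plus_times (labalg \<nu> \<mu>)"
      using F(1) box by (intro sigma_sets_UNION) (auto intro!: sigma_sets.Basic)
    finally show ?thesis .
  qed
  have "sets (restrict_space borel R_plus_times) = (\<inter>) R_plus_times ` sigma_sets UNIV {W :: (real \<times> 's) set. open W}"
    by (simp add: sets_restrict_space borel_def)
  also have "\<dots> = sigma_sets R_plus_times ((\<inter>) R_plus_times ` {W. open W})"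
    using R_plus_times_sets[where 's='s] by (subst sigma_sets_Int) (auto simp: borel_def)
  also have "\<dots> \<subseteq> sigma_sets R_plus_times (labalg \<nu> \<mu>)"
    using op by (intro sigma_sets_mono) auto
  finally show "sets (restrict_space borel R_plus_times) \<subseteq> sigma_sets R_plus_times (labalg \<nu> \<mu>)" .
qed

section \<open>Mutual information as coarse-grained entropy\<close>

lemma MI_eq_sum:
  assumes fin: "finite I" "finite J" and p: "\<And>i j. p i j \<ge> 0"
  shows "MI I J p = (\<Sum>(i,j)\<in>I\<times>J. p i j * ln (p i j / ((\<Sum>j\<in>J. p i j) * (\<Sum>i\<in>I. p i j))))"
proof -
  define r where "r i = (\<Sum>j\<in>J. p i j)" for i
  define c where "c j = (\<Sum>i\<in>I. p i j)" for j
  have *: "p i j * ln (p i j / (r i * c j)) = xlnx (p i j) - p i j * ln (r i) - p i j * ln (c j)"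
    if "i \<in> I" "j \<in> J" for i j
  proof (cases "p i j = 0")
    case False
    then have pos: "p i j > 0" using p[of i j] by simp
    have "r i > 0" unfolding r_def using pos that fin p by (intro sum_pos2[of J j]) auto
    moreover have "c j > 0" unfolding c_def using pos that fin p by (intro sum_pos2[of I i]) auto
    ultimately show ?thesis using pos by (simp add: xlnx_def ln_div ln_mult algebra_simps)
  qed simp
  have "(\<Sum>(i,j)\<in>I\<times>J. p i j * ln (p i j / (r i * c j))) = (\<Sum>i\<in>I. \<Sum>j\<in>J. p i j * ln (p i j / (r i * c j)))"
    by (simp add: sum.cartesian_product)
  also have "\<dots> = (\<Sum>i\<in>I. \<Sum>j\<in>J. xlnx (p i j) - p i j * ln (r i) - p i j * ln (c j))"
    by (intro sum.cong refl *)
  also have "\<dots> = (\<Sum>i\<in>I. \<Sum>j\<in>J. xlnx (p i j)) - (\<Sum>i\<in>I. \<Sum>j\<in>J. p i j * ln (r i)) - (\<Sum>i\<in>I. \<Sum>j\<in>J. p i j * ln (c j))"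
    by (simp add: sum_subtractf)
  also have "(\<Sum>i\<in>I. \<Sum>j\<in>J. p i j * ln (r i)) = (\<Sum>i\<in>I. xlnx (r i))"
    by (simp add: xlnx_def r_def sum_distrib_right)
  also have "(\<Sum>i\<in>I. \<Sum>j\<in>J. p i j * ln (c j)) = (\<Sum>j\<in>J. xlnx (c j))"
    by (subst sum.swap) (simp add: xlnx_def c_def sum_distrib_right)
  finally show ?thesis by (simp add: MI_def r_def c_def)
qed

lemma ltab_nonneg: "ltab \<rho> a b i j \<ge> 0"
  by (simp add: ltab_def)

lemma ltab_sums:
  fixes \<rho> :: "(real \<times> 's::topological_space) measure" and a b :: "_ \<Rightarrow> nat"
  assumes \<rho>: "\<rho> \<in> borel_probs R_plus_times" and fin: "finite I" "finite J" and IJ: "a ` R_plus \<subseteq> I" "range b \<subseteq> J"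
    and m: "a \<in> restrict_space borel R_plus \<rightarrow>\<^sub>M count_space UNIV" "b \<in> borel \<rightarrow>\<^sub>M count_space UNIV"
  shows "(\<Sum>j\<in>J. ltab \<rho> a b i j) = measure (marginal1 \<rho>) {w\<in>R_plus. a w = i}"
    and "(\<Sum>i\<in>I. ltab \<rho> a b i j) = measure (marginal2 \<rho>) {y. b y = j}"
    and "(\<Sum>i\<in>I. \<Sum>j\<in>J. ltab \<rho> a b i j) = 1"
    and "{w\<in>R_plus. a w = i} \<in> sets (restrict_space borel R_plus)" "{y. b y = j} \<in> sets borel"
proof -
  note r = borel_probsD[OF \<rho>]
  interpret prob_space \<rho> by fact
  have ls: "labset a b S \<in> sets \<rho>" for S by (rule labset_sets[OF r(2) m])
  show as: "{w\<in>R_plus. a w = i} \<in> sets (restrict_space borel R_plus)" for i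
    using measurable_sets[OF m(1), of "{i}"] by (simp add: space_restrict_space vimage_def Int_def conj_commute)
  show bs: "{y. b y = j} \<in> sets borel" for j
    using measurable_sets[OF m(2), of "{j}"] by (simp add: vimage_def)
  have "(\<Sum>j\<in>J. ltab \<rho> a b i j) = measure \<rho> (\<Union>j\<in>J. labset a b {(i,j)})" for i
    unfolding ltab_def
    by (rule finite_measure_finite_Union[symmetric])
       (use fin ls in \<open>auto simp: disjoint_family_on_def, auto simp: labset_def\<close>)
  moreover have "(\<Union>j\<in>J. labset a b {(i,j)}) = {w\<in>R_plus. a w = i} \<times> UNIV" for i
    using IJ by (auto simp: labset_def)
  ultimately show s1: "(\<Sum>j\<in>J. ltab \<rho> a b i j) = measure (marginal1 \<rho>) {w\<in>R_plus. a w = i}" for i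
    using measure_marginal1[OF \<rho> as] by simp
  have "(\<Sum>i\<in>I. ltab \<rho> a b i j) = measure \<rho> (\<Union>i\<in>I. labset a b {(i,j)})"
    unfolding ltab_def
    by (rule finite_measure_finite_Union[symmetric])
       (use fin ls in \<open>auto simp: disjoint_family_on_def, auto simp: labset_def\<close>)
  moreover have "(\<Union>i\<in>I. labset a b {(i,j)}) = R_plus \<times> {y. b y = j}"
    using IJ by (auto simp: labset_def)
  ultimately show "(\<Sum>i\<in>I. ltab \<rho> a b i j) = measure (marginal2 \<rho>) {y. b y = j}"
    using measure_marginal2[OF \<rho> bs] by simp
  interpret M: prob_space "marginal1 \<rho>" using borel_probsD(1)[OF marginal1_borel_probs[OF \<rho>]] .
  have ss: "sets (marginal1 \<rho>) = sets (restrict_space borel R_plus)" "space (marginal1 \<rho>) = R_plus"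
    using borel_probsD[OF marginal1_borel_probs[OF \<rho>]] by auto
  have "(\<Sum>i\<in>I. measure (marginal1 \<rho>) {w\<in>R_plus. a w = i}) = measure (marginal1 \<rho>) (\<Union>i\<in>I. {w\<in>R_plus. a w = i})"
    using fin as ss by (intro M.finite_measure_finite_Union[symmetric]) (auto simp: disjoint_family_on_def)
  also have "(\<Union>i\<in>I. {w\<in>R_plus. a w = i}) = space (marginal1 \<rho>)" using IJ ss by auto
  finally show "(\<Sum>i\<in>I. \<Sum>j\<in>J. ltab \<rho> a b i j) = 1" by (simp add: s1 M.prob_space)
qed

lemma prob_pair_marginals:
  fixes \<rho> :: "(real \<times> 's::polish_space) measure"
  assumes \<rho>: "\<rho> \<in> borel_probs R_plus_times"
  shows "prob_pair \<rho> (marginal1 \<rho> \<Otimes>\<^sub>M marginal2 \<rho>)"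
proof -
  note r = borel_probsD[OF \<rho>]
  note m1 = borel_probsD[OF marginal1_borel_probs[OF \<rho>]] and m2 = borel_probsD[OF marginal2_borel_probs[OF \<rho>]]
  interpret R: prob_space \<rho> by fact
  interpret A: prob_space "marginal1 \<rho>" by fact
  interpret B: prob_space "marginal2 \<rho>" by fact
  interpret P: pair_prob_space "marginal1 \<rho>" "marginal2 \<rho>" ..
  have "sets (marginal1 \<rho> \<Otimes>\<^sub>M marginal2 \<rho>) = sets (restrict_space borel R_plus \<Otimes>\<^sub>M (borel :: 's measure))"
    using m1 m2 by (intro sets_pair_measure_cong) auto
  then show ?thesis using r sets_pair_R_plus by unfold_locales auto
qed

lemma product_cell:
  fixes \<rho> :: "(real \<times> 's::polish_space) measure" and a b :: "_ \<Rightarrow> nat"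
  assumes \<rho>: "\<rho> \<in> borel_probs R_plus_times" and fin: "finite I" "finite J" and IJ: "a ` R_plus \<subseteq> I" "range b \<subseteq> J"
    and m: "a \<in> restrict_space borel R_plus \<rightarrow>\<^sub>M count_space UNIV" "b \<in> borel \<rightarrow>\<^sub>M count_space UNIV"
  shows "measure (marginal1 \<rho> \<Otimes>\<^sub>M marginal2 \<rho>) (labset a b {(i,j)}) = (\<Sum>j\<in>J. ltab \<rho> a b i j) * (\<Sum>i\<in>I. ltab \<rho> a b i j)"
proof -
  note m1 = borel_probsD[OF marginal1_borel_probs[OF \<rho>]] and m2 = borel_probsD[OF marginal2_borel_probs[OF \<rho>]]
  interpret A: prob_space "marginal1 \<rho>" by fact
  interpret B: prob_space "marginal2 \<rho>" by fact
  interpret P: pair_prob_space "marginal1 \<rho>" "marginal2 \<rho>" ..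
  note s = ltab_sums[OF assms]
  have "labset a b {(i,j)} = {w\<in>R_plus. a w = i} \<times> {y. b y = j}" by (auto simp: labset_def)
  then have "emeasure (marginal1 \<rho> \<Otimes>\<^sub>M marginal2 \<rho>) (labset a b {(i,j)})
      = emeasure (marginal1 \<rho>) {w\<in>R_plus. a w = i} * emeasure (marginal2 \<rho>) {y. b y = j}"
    using s(4,5) m1 m2 by (simp add: B.emeasure_pair_measure_Times)
  then show ?thesis unfolding s(1,2) by (simp add: measure_def enn2real_mult)
qed

text \<open>The dictionary between the cell masses of \<open>prob_pair\<close> and label tables. The
  second claim is the absolute continuity that \<open>DV_cells\<close> asks for.\<close>

lemma cells_eq_MI:
  fixes \<rho> :: "(real \<times> 's::polish_space) measure" and a b :: "_ \<Rightarrow> nat"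
  assumes \<rho>: "\<rho> \<in> borel_probs R_plus_times" and fin: "finite I" "finite J" and IJ: "a ` R_plus \<subseteq> I" "range b \<subseteq> J"
    and m: "a \<in> restrict_space borel R_plus \<rightarrow>\<^sub>M count_space UNIV" "b \<in> borel \<rightarrow>\<^sub>M count_space UNIV"
  defines "c \<equiv> \<lambda>z. (a (fst z), b (snd z))"
  defines "r \<equiv> \<lambda>k. measure \<rho> (c -` {k} \<inter> space \<rho>)" and "p \<equiv> \<lambda>k. measure (marginal1 \<rho> \<Otimes>\<^sub>M marginal2 \<rho>) (c -` {k} \<inter> space \<rho>)"
  shows "(\<Sum>k\<in>I\<times>J. r k * ln (r k / p k)) = MI I J (ltab \<rho> a b)"
    and "\<And>k. k \<in> I\<times>J \<Longrightarrow> p k = 0 \<Longrightarrow> r k = 0"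
proof -
  have cell: "c -` {(i,j)} \<inter> space \<rho> = labset a b {(i,j)}" for i j
    using borel_probsD(3)[OF \<rho>] by (auto simp: c_def labset_def)
  have rk: "r (i,j) = ltab \<rho> a b i j" for i j by (simp add: r_def cell ltab_def)
  have pk: "p (i,j) = (\<Sum>j\<in>J. ltab \<rho> a b i j) * (\<Sum>i\<in>I. ltab \<rho> a b i j)" for i j
    unfolding p_def cell by (rule product_cell[OF \<rho> fin IJ m])
  show "(\<Sum>k\<in>I\<times>J. r k * ln (r k / p k)) = MI I J (ltab \<rho> a b)"
    unfolding MI_eq_sum[OF fin ltab_nonneg] by (intro sum.cong refl) (auto simp: rk pk)
  fix k assume k: "k \<in> I\<times>J" "p k = 0"
  then obtain i j where ij: "k = (i,j)" "i \<in> I" "j \<in> J" by auto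
  have "ltab \<rho> a b i j \<le> (\<Sum>j\<in>J. ltab \<rho> a b i j)"
    by (rule member_le_sum) (use ij fin in \<open>auto simp: ltab_nonneg\<close>)
  moreover have "ltab \<rho> a b i j \<le> (\<Sum>i\<in>I. ltab \<rho> a b i j)"
    by (rule member_le_sum[of i I "\<lambda>i. ltab \<rho> a b i j"]) (use ij fin in \<open>auto simp: ltab_nonneg\<close>)
  moreover have "(\<Sum>j\<in>J. ltab \<rho> a b i j) = 0 \<or> (\<Sum>i\<in>I. ltab \<rho> a b i j) = 0" using k ij by (simp add: pk)
  ultimately show "r k = 0" using ltab_nonneg[of \<rho> a b i j] unfolding ij(1) rk by linarith
qed

text \<open>Stated for measurable labellings, because it will be applied to measures near
  \<open>\<rho>\<close> with cells that are continuity sets of \<open>\<rho>\<close> and perhaps not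
  of these measures.\<close>

lemma MI_le_entropy:
  fixes \<rho> :: "(real \<times> 's::polish_space) measure" and a b :: "_ \<Rightarrow> nat"
  assumes \<rho>: "\<rho> \<in> borel_probs R_plus_times" and fin: "finite I" "finite J" and IJ: "a ` R_plus \<subseteq> I" "range b \<subseteq> J"
    and m: "a \<in> restrict_space borel R_plus \<rightarrow>\<^sub>M count_space UNIV" "b \<in> borel \<rightarrow>\<^sub>M count_space UNIV"
  shows "ereal (MI I J (ltab \<rho> a b)) \<le> relative_entropy \<rho> (marginal1 \<rho> \<Otimes>\<^sub>M marginal2 \<rho>)"
proof -
  interpret prob_pair \<rho> "marginal1 \<rho> \<Otimes>\<^sub>M marginal2 \<rho>" by (rule prob_pair_marginals[OF \<rho>])
  show ?thesis
    unfolding cells_eq_MI(1)[OF assms, symmetric]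
    by (rule cell_entropy_le[OF lab_measurable[OF borel_probsD(2)[OF \<rho>] m]])
       (use fin IJ borel_probsD(3)[OF \<rho>] in auto)
qed

text \<open>The labelling with one cell has mutual information 0.\<close>

lemma entropy_nonneg:
  fixes \<rho> :: "(real \<times> 's::polish_space) measure"
  assumes \<rho>: "\<rho> \<in> borel_probs R_plus_times"
  shows "0 \<le> relative_entropy \<rho> (marginal1 \<rho> \<Otimes>\<^sub>M marginal2 \<rho>)"
proof -
  have "labset (\<lambda>_. 0) (\<lambda>_. 0) {(0,0)} = space \<rho>" using borel_probsD(3)[OF \<rho>] by (auto simp: labset_def)
  then have "ltab \<rho> (\<lambda>_. 0) (\<lambda>_. 0) 0 0 = 1"
    using prob_space.prob_space[OF borel_probsD(1)[OF \<rho>]] by (simp add: ltab_def)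
  then have "MI {0} {0} (ltab \<rho> (\<lambda>_. 0) (\<lambda>_. 0)) = 0" by (simp add: MI_def)
  then show ?thesis using MI_le_entropy[OF \<rho>, of "{0}" "{0}" "\<lambda>_. 0" "\<lambda>_. 0"] by (simp add: image_subset_iff zero_ereal_def)
qed

lemma clab_finite_range:
  "\<nu> \<in> borel_probs R_plus \<Longrightarrow> clab \<nu> a \<Longrightarrow> finite (a ` R_plus)"
  "\<mu> \<in> borel_probs UNIV \<Longrightarrow> clab \<mu> b \<Longrightarrow> finite (range b)"
  by (auto simp: clab_def dest!: borel_probsD(3))

text \<open>By repeated common refinement a combination of indicators of labelled sets is a function
  of one pair of labels. This is the form in which \<open>DV_cells\<close> can be applied.\<close>

lemma labalg_sum:
  fixes A :: "real \<Rightarrow> (real \<times> 's::topological_space) set"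
  assumes "finite V" "\<And>v. v \<in> V \<Longrightarrow> A v \<in> labalg \<nu> \<mu>"
  shows "\<exists>a b F. clab \<nu> a \<and> clab \<mu> b \<and> (\<forall>z\<in>R_plus_times. (\<Sum>v\<in>V. v * indicator (A v) z) = F (a (fst z), b (snd z)))"
  using assms
proof (induction V rule: finite_induct)
  case empty
  show ?case by (rule exI[of _ "\<lambda>_. 0"], rule exI[of _ "\<lambda>_. 0"], rule exI[of _ "\<lambda>_. 0"]) (auto intro: clab_const)
next
  case (insert v V)
  then obtain a b F where *: "clab \<nu> a" "clab \<mu> b" "\<And>z. z\<in>R_plus_times \<Longrightarrow> (\<Sum>v\<in>V. v * indicator (A v) z) = F (a (fst z), b (snd z))" 
    by (metis insert_iff)
  obtain a' b' S where **: "A v = labset a' b' S" "clab \<nu> a'" "clab \<mu> b'" using insert.prems[of v] by (auto simp: labalg_def)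
  obtain a'' b'' p p' where ***: "clab \<nu> a''" "clab \<mu> b''"
    "\<And>w. a w = p (a'' w)" "\<And>w. a' w = p' (a'' w)" "\<And>y. b y = p (b'' y)" "\<And>y. b' y = p' (b'' y)"
    using labalg_pair[OF *(1,2) **(2,3)] by metis
  have "(\<Sum>v\<in>insert v V. v * indicator (A v) z) =
      (\<lambda>(i,j). v * indicator S (p' i, p' j) + F (p i, p j)) (a'' (fst z), b'' (snd z))" if "z \<in> R_plus_times" for z
    using insert *(3)[OF that] *** ** that by (auto simp: labset_def indicator_def)
  then show ?case using ***(1,2) by blast
qed

text \<open>Cells with null boundary already exhaust the entropy: for functions of the labels the
  Gibbs inequality gives \<open>DV\<close>, and since the labelled sets generate the Borel sets,
  \<open>DV\<close> extends to all simple functions.\<close>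

lemma entropy_le_MI:
  fixes \<rho> :: "(real \<times> 's::polish_space) measure"
  assumes \<rho>: "\<rho> \<in> borel_probs R_plus_times"
    and s: "\<And>a b. clab (marginal1 \<rho>) a \<Longrightarrow> clab (marginal2 \<rho>) b \<Longrightarrow> MI (a ` R_plus) (range b) (ltab \<rho> a b) \<le> s"
  shows "relative_entropy \<rho> (marginal1 \<rho> \<Otimes>\<^sub>M marginal2 \<rho>) \<le> ereal s"
proof -
  interpret prob_pair \<rho> "marginal1 \<rho> \<Otimes>\<^sub>M marginal2 \<rho>" by (rule prob_pair_marginals[OF \<rho>])
  note r = borel_probsD[OF \<rho>] and n = marginal1_borel_probs[OF \<rho>] and m = marginal2_borel_probs[OF \<rho>]
  let ?R = "labalg (marginal1 \<rho>) (marginal2 \<rho>)"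
  have alg: "algebra (space \<rho>) ?R" unfolding r(3) by (rule algebra_labalg)
  have gen: "sets \<rho> = sigma_sets (space \<rho>) ?R" unfolding r(2,3) by (rule sigma_labalg[OF n m, symmetric])
  show ?thesis
  proof (rule relative_entropy_le, rule DV_simple[OF alg gen])
    fix V and A :: "real \<Rightarrow> (real \<times> 's) set"
    assume V: "finite V" "\<And>v. v \<in> V \<Longrightarrow> A v \<in> ?R"
    obtain a b F where ab: "clab (marginal1 \<rho>) a" "clab (marginal2 \<rho>) b"
      and F: "\<forall>z\<in>R_plus_times. (\<Sum>v\<in>V. v * indicator (A v) z) = F (a (fst z), b (snd z))"
      using labalg_sum[of V A "marginal1 \<rho>" "marginal2 \<rho>", OF V] by blast
    note fin = clab_finite_range(1)[OF n ab(1)] clab_finite_range(2)[OF m ab(2)]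
    note mm = clab_measurable[OF n ab(1)] clab_measurable_UNIV[OF m ab(2)]
    have "DV (MI (a ` R_plus) (range b) (ltab \<rho> a b)) (\<lambda>z. F (a (fst z), b (snd z)))"
      unfolding cells_eq_MI(1)[OF \<rho> fin order_refl order_refl mm, symmetric]
      using cells_eq_MI(2)[OF \<rho> fin order_refl order_refl mm] fin
      by (intro DV_cells[where c="\<lambda>z. (a (fst z), b (snd z))" and F=F] lab_measurable[OF r(2) mm]) (auto simp: r(3))
    moreover have "(\<integral>z. F (a (fst z), b (snd z)) \<partial>\<rho>) = (\<integral>z. (\<Sum>v\<in>V. v * indicator (A v) z) \<partial>\<rho>)"
      by (rule Bochner_Integration.integral_cong[OF refl]) (use F in \<open>simp only: r(3)\<close>)
    moreover have "(\<integral>z. exp (F (a (fst z), b (snd z))) \<partial>(marginal1 \<rho> \<Otimes>\<^sub>M marginal2 \<rho>)) = (\<integral>z. exp (\<Sum>v\<in>V. v * indicator (A v) z) \<partial>(marginal1 \<rho> \<Otimes>\<^sub>M marginal2 \<rho>))"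
      by (rule Bochner_Integration.integral_cong[OF refl]) (use F in \<open>simp only: space_eq[symmetric] r(3)\<close>)
    ultimately show "DV s (\<lambda>z. \<Sum>v\<in>V. v * indicator (A v) z)"
      using s[OF ab] by (simp add: DV_def)
  qed
qed

section \<open>Weak convergence\<close>

text \<open>
  The portmanteau form of weak convergence on a subspace \<open>E\<close>, along a filter so that it
  applies to the subfilters produced by \<open>cluster_filter\<close>.
\<close>

definition wconv :: "'a::topological_space set \<Rightarrow> 'i filter \<Rightarrow> ('i \<Rightarrow> 'a measure) \<Rightarrow> 'a measure \<Rightarrow> bool" where
  "wconv E F P Q \<longleftrightarrow>
     (\<forall>U. open U \<longrightarrow> (\<forall>c<measure Q (U \<inter> E). \<forall>\<^sub>F m in F. c < measure (P m) (U \<inter> E)))"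

lemma wconv_mono: "wconv E F P Q \<Longrightarrow> F' \<le> F \<Longrightarrow> wconv E F' P Q"
  unfolding wconv_def by (meson filter_leD)

lemma Int_sets_restrict_borel: "U \<in> sets borel \<Longrightarrow> U \<inter> E \<in> sets (restrict_space borel E)"
  by (subst Int_commute, unfold sets_restrict_space, rule imageI)

text \<open>Almost every point of the labelled set is interior to it relative to \<open>E\<close>.
  So there is an open \<open>U\<close> whose trace on \<open>E\<close> lies in the set and carries
  its full \<open>Q\<close>-mass, and \<open>wconv\<close> applies to \<open>U\<close>.\<close>

lemma wconv_cell_lower:
  assumes Q: "Q \<in> borel_probs E" and P: "\<And>m. P m \<in> borel_probs E" and w: "wconv E F P Q"
    and a: "clab Q a" and c: "c < measure Q {z\<in>E. a z \<in> S}"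
  shows "\<forall>\<^sub>F m in F. c < measure (P m) {z\<in>E. a z \<in> S}"
proof -
  note q = borel_probsD[OF Q] and p = borel_probsD[OF P]
  interpret Q: prob_space Q by fact
  interpret P: prob_space "P m" for m by fact
  define U where "U = \<Union>{V. open V \<and> (\<forall>y\<in>V\<inter>E. a y \<in> S)}"
  have U: "open U" unfolding U_def by auto
  have UE: "U \<inter> E \<subseteq> {z\<in>E. a z \<in> S}" by (auto simp: U_def)
  have "{z\<in>E. a z \<in> S} = a -` S \<inter> space (restrict_space borel E)" by (auto simp: space_restrict_space)
  then have S: "{z\<in>E. a z \<in> S} \<in> sets (restrict_space borel E)"
    using measurable_sets[OF clab_measurable[OF Q a], of S] by simp
  have Us: "U \<inter> E \<in> sets (restrict_space borel E)"
    using U by (intro Int_sets_restrict_borel borel_open)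
  have "AE z in Q. loc_const E a z" using a q by (auto simp: clab_def)
  then have "AE z in Q. z \<in> {z\<in>E. a z \<in> S} \<longrightarrow> z \<in> U \<inter> E"
  proof eventually_elim
    fix z assume "loc_const E a z"
    then obtain V where V: "open V" "z \<in> V" "\<forall>y\<in>V\<inter>E. a y = a z" unfolding loc_const_def by blast
    show "z \<in> {z\<in>E. a z \<in> S} \<longrightarrow> z \<in> U \<inter> E"
    proof
      assume z: "z \<in> {z\<in>E. a z \<in> S}"
      then have "a z \<in> S" by blast
      then have "\<forall>y\<in>V\<inter>E. a y \<in> S" using V(3) by metis
      then have "V \<in> {V. open V \<and> (\<forall>y\<in>V\<inter>E. a y \<in> S)}" using V(1) by blast
      then show "z \<in> U \<inter> E" using z V(2) unfolding U_def by blast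
    qed
  qed
  then have "measure Q {z\<in>E. a z \<in> S} \<le> measure Q (U \<inter> E)"
    using Us q by (intro Q.finite_measure_mono_AE) auto
  then have "\<forall>\<^sub>F m in F. c < measure (P m) (U \<inter> E)" using w U c by (auto simp: wconv_def)
  then show ?thesis
  proof eventually_elim
    case (elim m)
    also have "measure (P m) (U \<inter> E) \<le> measure (P m) {z\<in>E. a z \<in> S}"
      using UE S p by (intro P.finite_measure_mono) auto
    finally show ?case .
  qed
qed

text \<open>The lower bound for the labels outside \<open>S\<close> is the upper bound for those in
  \<open>S\<close>.\<close>

lemma wconv_cell:
  assumes Q: "Q \<in> borel_probs E" and P: "\<And>m. P m \<in> borel_probs E" and w: "wconv E F P Q"
    and a: "clab Q a"
  shows "((\<lambda>m. measure (P m) {z\<in>E. a z \<in> S}) \<longlongrightarrow> measure Q {z\<in>E. a z \<in> S}) F"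
proof (rule order_tendstoI)
  fix c assume "c < measure Q {z\<in>E. a z \<in> S}"
  then show "\<forall>\<^sub>F m in F. c < measure (P m) {z\<in>E. a z \<in> S}" by (rule wconv_cell_lower[OF Q P w a])
next
  fix c assume c: "measure Q {z\<in>E. a z \<in> S} < c"
  have compl: "measure N {z\<in>E. a z \<in> - S} = 1 - measure N {z\<in>E. a z \<in> S}" if N: "N \<in> borel_probs E" for N
  proof -
    interpret N: prob_space N using borel_probsD[OF N] by simp
    have "{z\<in>E. a z \<in> S} = a -` S \<inter> space (restrict_space borel E)" by (auto simp: space_restrict_space)
    then have S: "{z\<in>E. a z \<in> S} \<in> sets N"
      using measurable_sets[OF clab_measurable[OF Q a], of S] borel_probsD(2)[OF N] by simp
    have "{z\<in>E. a z \<in> - S} = space N - {z\<in>E. a z \<in> S}" using borel_probsD(3)[OF N] by auto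
    then show ?thesis using N.prob_compl[OF S] by simp
  qed
  have "\<forall>\<^sub>F m in F. 1 - c < measure (P m) {z\<in>E. a z \<in> - S}"
    by (rule wconv_cell_lower[OF Q P w a]) (use c compl[OF Q] in linarith)
  then show "\<forall>\<^sub>F m in F. measure (P m) {z\<in>E. a z \<in> S} < c"
  proof eventually_elim
    case (elim m)
    then show ?case using compl[OF P, of m] by linarith
  qed
qed

text \<open>By dominated convergence one of the \<open>f k\<close> has a \<open>Q\<close>-integral
  above \<open>c\<close>. Its integrals converge along the filter, and they bound the mass of
  \<open>U\<close> from below.\<close>

lemma wconvI_test:
  fixes Q :: "'a::topological_space measure"
  assumes Q: "Q \<in> borel_probs E" and P: "\<And>m. P m \<in> borel_probs E"
    and test: "\<And>U. open U \<Longrightarrow> \<exists>f :: nat \<Rightarrow> 'a \<Rightarrow> real. \<forall>k. f k \<in> borel_measurable (restrict_space borel E) \<and>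
       (\<forall>z\<in>E. 0 \<le> f k z \<and> f k z \<le> indicator U z) \<and> (\<forall>z\<in>E. (\<lambda>k. f k z) \<longlonglongrightarrow> indicator U z) \<and>
       ((\<lambda>m. \<integral>z. f k z \<partial>P m) \<longlongrightarrow> (\<integral>z. f k z \<partial>Q)) F"
  shows "wconv E F P Q"
  unfolding wconv_def
proof (intro allI impI)
  fix U :: "'a::topological_space set" and c assume U: "open U" and c: "c < measure Q (U \<inter> E)"
  note q = borel_probsD[OF Q] and p = borel_probsD[OF P]
  interpret Q: prob_space Q by fact
  interpret P: prob_space "P m" for m by fact
  obtain f :: "nat \<Rightarrow> 'a \<Rightarrow> real" where ff: "\<forall>k. f k \<in> borel_measurable (restrict_space borel E) \<and>
       (\<forall>z\<in>E. 0 \<le> f k z \<and> f k z \<le> indicator U z) \<and> (\<forall>z\<in>E. (\<lambda>k. f k z) \<longlonglongrightarrow> indicator U z) \<and>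
       ((\<lambda>m. \<integral>z. f k z \<partial>P m) \<longlongrightarrow> (\<integral>z. f k z \<partial>Q)) F"
    using test[OF U] by blast
  have fm: "\<And>k. f k \<in> borel_measurable (restrict_space borel E)"
    and f: "\<And>k z. z \<in> E \<Longrightarrow> 0 \<le> f k z" "\<And>k z. z \<in> E \<Longrightarrow> f k z \<le> indicator U z" "\<And>z. z \<in> E \<Longrightarrow> (\<lambda>k. f k z) \<longlonglongrightarrow> indicator U z"
    and lim: "\<And>k. ((\<lambda>m. \<integral>z. f k z \<partial>P m) \<longlongrightarrow> (\<integral>z. f k z \<partial>Q)) F"
    using ff by blast+
  have Us: "U \<inter> E \<in> sets (restrict_space borel E)"
    using U by (intro Int_sets_restrict_borel borel_open)
  have fmQ: "f k \<in> borel_measurable Q" and fmP: "f k \<in> borel_measurable (P m)" for k m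
    using fm q(2) p(2) by (auto cong: measurable_cong_sets)
  have iU: "(\<integral>z. indicator U z \<partial>N) = measure N (U \<inter> E)" if "space N = E" for N :: "'a measure"
  proof -
    have "(\<integral>z. indicator U z \<partial>N) = (\<integral>z. indicator (U \<inter> E) z \<partial>N)"
      using that by (intro Bochner_Integration.integral_cong) (auto simp: indicator_def)
    then show ?thesis using that by (simp add: Int_absorb2)
  qed
  have mU: "(indicator U :: _ \<Rightarrow> real) \<in> borel_measurable N" if "sets N = sets (restrict_space borel E)" for N :: "'a measure"
    using that U by (subst measurable_cong_sets[OF that refl]) (auto intro: measurable_restrict_space1 borel_measurable_indicator)
  have "(\<lambda>k. \<integral>z. f k z \<partial>Q) \<longlonglongrightarrow> (\<integral>z. indicator U z \<partial>Q)"
  proof (rule integral_dominated_convergence[where w="\<lambda>_. 1"])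
    show "AE x in Q. norm (f k x) \<le> 1" for k
    proof (rule AE_I2)
      fix x assume "x \<in> space Q"
      then have x: "x \<in> E" using q by simp
      have "f k x \<le> indicator U x" using f(2)[OF x] .
      also have "\<dots> \<le> 1" by (simp add: indicator_def)
      finally show "norm (f k x) \<le> 1" using f(1)[OF x] by simp
    qed
  qed (use f fmQ mU[OF q(2)] q in auto)
  then have "\<forall>\<^sub>F k in sequentially. c < (\<integral>z. f k z \<partial>Q)"
    using c iU[OF q(3)] by (intro order_tendstoD(1)) auto
  then obtain k where "c < (\<integral>z. f k z \<partial>Q)" by (auto simp: eventually_sequentially)
  then have "\<forall>\<^sub>F m in F. c < (\<integral>z. f k z \<partial>P m)" using lim by (intro order_tendstoD(1)) auto
  then show "\<forall>\<^sub>F m in F. c < measure (P m) (U \<inter> E)"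
  proof eventually_elim
    case (elim m)
    also have "(\<integral>z. f k z \<partial>P m) \<le> (\<integral>z. indicator U z \<partial>P m)"
    proof (rule integral_mono)
      show "integrable (P m) (f k)"
      proof (intro P.integrable_const_bound[where B=1] AE_I2 fmP)
        fix x assume "x \<in> space (P m)"
        then have x: "x \<in> E" using p(3) by simp
        have "f k x \<le> indicator U x" using f(2)[OF x] .
        also have "\<dots> \<le> 1" by (simp add: indicator_def)
        finally show "norm (f k x) \<le> 1" using f(1)[OF x] by simp
      qed
      show "integrable (P m) (indicator U :: _ \<Rightarrow> real)"
        using mU[OF p(2)] by (intro P.integrable_const_bound[where B=1] AE_I2) (auto simp: indicator_def)
    qed (use f p in auto)
    also have "\<dots> = measure (P m) (U \<inter> E)" by (rule iU[OF p(3)])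
    finally show ?case .
  qed
qed

text \<open>The functions min 1 (k D), where \<open>D\<close> is the distance to the complement of
  \<open>V\<close>. The setting is \<open>Metric_space\<close> because they are applied both to the
  metric of a type and to \<delta> on its carrier.\<close>

lemma (in Metric_space) bump_functions:
  assumes "openin mtopology V"
  shows "\<exists>f :: nat \<Rightarrow> 'a \<Rightarrow> real. \<forall>k. (\<forall>x\<in>M. 0 \<le> f k x \<and> f k x \<le> indicator V x) \<and>
     (\<forall>x\<in>M. \<forall>y\<in>M. \<bar>f k x - f k y\<bar> \<le> real k * d x y) \<and> (\<forall>x\<in>M. (\<lambda>k. f k x) \<longlonglongrightarrow> indicator V x)"
proof (cases "M - V = {}")
  \<comment> \<open>Here the distance to the complement would be an infimum over the empty
    set.\<close>
  case True
  then show ?thesis by (intro exI[of _ "\<lambda>k x. 1"]) (auto simp: indicator_def)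
next
  case False
  define D where "D x = (INF y\<in>M-V. d x y)" for x
  have bdd: "bdd_below (d x ` (M - V))" for x by (rule bdd_belowI[of _ 0]) auto
  have Dpos: "0 \<le> D x" for x unfolding D_def using False by (intro cINF_greatest) auto
  have D0: "D x = 0" if "x \<in> M - V" for x
    using cINF_lower[OF bdd, of x x] that Dpos[of x] by (auto simp: D_def)
  have Dlip: "D x \<le> D y + d x y" if "x \<in> M" "y \<in> M" for x y
  proof -
    have "D x - d x y \<le> d y z" if z: "z \<in> M - V" for z
    proof -
      have "D x \<le> d x z" unfolding D_def by (intro cINF_lower bdd z)
      also have "\<dots> \<le> d x y + d y z" using z \<open>x \<in> M\<close> \<open>y \<in> M\<close> by (intro triangle) auto
      finally show ?thesis by simp
    qed
    then have "D x - d x y \<le> D y" unfolding D_def[of y] using False by (intro cINF_greatest) auto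
    then show ?thesis by simp
  qed
  have Dlip': "\<bar>D x - D y\<bar> \<le> d x y" if "x \<in> M" "y \<in> M" for x y
    using Dlip[OF that] Dlip[OF that(2,1)] commute by (simp add: abs_le_iff)
  have DV: "D x > 0" if x: "x \<in> M" "x \<in> V" for x
  proof -
    obtain r where r: "r > 0" "mball x r \<subseteq> V" using assms x by (auto simp: openin_mtopology)
    have "r \<le> D x" unfolding D_def
    proof (rule cINF_greatest)
      fix y assume "y \<in> M - V"
      then show "r \<le> d x y" using r x by (force simp: not_less[symmetric])
    qed (use False in auto)
    then show ?thesis using r by simp
  qed
  define f where "f k x = min 1 (real k * D x)" for k x
  have "\<bar>min 1 u - min 1 v\<bar> \<le> \<bar>u - v\<bar>" for u v :: real by (auto simp: min_def)
  then have "\<bar>f k x - f k y\<bar> \<le> \<bar>real k * D x - real k * D y\<bar>" for k x y by (simp add: f_def)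
  then have lip: "\<bar>f k x - f k y\<bar> \<le> real k * d x y" if "x \<in> M" "y \<in> M" for k x y
    using Dlip'[OF that] by (fold right_diff_distrib, simp add: abs_mult) (meson mult_left_mono of_nat_0_le_iff order_trans)
  have "(\<lambda>k. f k x) \<longlonglongrightarrow> indicator V x" if "x \<in> M" for x
  proof (cases "x \<in> V")
    case True
    obtain k0 where k0: "1 / D x \<le> real k0" using real_arch_simple by blast
    have "f k x = 1" if "k \<ge> k0" for k
    proof -
      have "1 / D x \<le> real k" using k0 that by simp
      then have "1 \<le> real k * D x" using DV[OF \<open>x \<in> M\<close> True] by (simp add: field_simps)
      then show ?thesis by (simp add: f_def)
    qed
    then show ?thesis using True by (intro tendsto_eventually) (auto simp: eventually_sequentially)
  next
    case False
    then show ?thesis using D0[of x] that by (simp add: f_def)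
  qed
  moreover have "0 \<le> f k x \<and> f k x \<le> indicator V x" if "x \<in> M" for k x
    using D0[of x] Dpos[of x] that by (auto simp: f_def indicator_def)
  ultimately show ?thesis using lip by (intro exI[of _ f]) auto
qed

text \<open>Lipschitz functions with values in [0,1] suffice as tests, since the bump functions are
  of this kind.\<close>

lemma wconv_UNIV_testI:
  fixes Q :: "'a::metric_space measure"
  assumes Q: "Q \<in> borel_probs E" and P: "\<And>m. P m \<in> borel_probs E"
    and lim: "\<And>f :: 'a \<Rightarrow> real. \<And>L. (\<And>x. 0 \<le> f x) \<Longrightarrow> (\<And>x. f x \<le> 1) \<Longrightarrow> (\<And>x y. \<bar>f x - f y\<bar> \<le> L * dist x y) \<Longrightarrow> continuous_on UNIV f \<Longrightarrow>
       ((\<lambda>m. \<integral>z. f z \<partial>P m) \<longlongrightarrow> (\<integral>z. f z \<partial>Q)) F"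
  shows "wconv E F P Q"
proof (rule wconvI_test[OF Q P])
  fix U :: "'a set" assume U: "open U"
  have "openin Met_TC.mtopology U" using U by simp
  from Met_TC.bump_functions[OF this] obtain f where f: "\<And>k x. 0 \<le> f k x" "\<And>k x. f k x \<le> indicator U x"
    "\<And>k x y. \<bar>f k x - f k y\<bar> \<le> real k * dist x y" "\<And>x. (\<lambda>k. f k x) \<longlonglongrightarrow> indicator U x" by (auto, metis)
  have cont: "continuous_on UNIV (f k)" for k
  proof (rule lipschitz_on_continuous_on)
    show "(real k)-lipschitz_on UNIV (f k)" using f(3) by (intro lipschitz_onI) (auto simp: dist_real_def)
  qed
  show "\<exists>f :: nat \<Rightarrow> 'a \<Rightarrow> real. \<forall>k. f k \<in> borel_measurable (restrict_space borel E) \<and>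
       (\<forall>z\<in>E. 0 \<le> f k z \<and> f k z \<le> indicator U z) \<and> (\<forall>z\<in>E. (\<lambda>k. f k z) \<longlonglongrightarrow> indicator U z) \<and>
       ((\<lambda>m. \<integral>z. f k z \<partial>P m) \<longlongrightarrow> (\<integral>z. f k z \<partial>Q)) F"
  proof (intro exI[of _ f] allI conjI ballI f)
    fix k
    show "f k \<in> borel_measurable (restrict_space borel E)"
      by (intro measurable_restrict_space1 borel_measurable_continuous_onI cont)
    have "f k x \<le> 1" for x using f(2)[of k x] by (auto simp: indicator_def split: if_splits intro: order_trans)
    then show "((\<lambda>m. \<integral>z. f k z \<partial>P m) \<longlongrightarrow> (\<integral>z. f k z \<partial>Q)) F"
      by (intro lim[where L="real k"] f cont)
  qed
qed

lemma weakly_converges_wconv: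
  fixes Q :: "'a::metric_space measure"
  assumes Q: "Q \<in> borel_probs UNIV" and P: "\<And>m. P m \<in> borel_probs UNIV" and w: "weakly_converges P Q"
  shows "wconv UNIV sequentially P Q"
proof (rule wconv_UNIV_testI[OF Q P])
  fix f :: "'a \<Rightarrow> real" assume f: "\<And>x. 0 \<le> f x" "\<And>x. f x \<le> 1" "continuous_on UNIV f"
  have "bounded (range f)" using f by (intro boundedI[of _ 1]) auto
  then show "(\<lambda>m. \<integral>z. f z \<partial>P m) \<longlonglongrightarrow> (\<integral>z. f z \<partial>Q)" using w f by (auto simp: weakly_converges_def)
qed

lemma borel_probs_eqI:
  assumes "P \<in> borel_probs E" "Q \<in> borel_probs E" and E: "E \<in> sets borel"
    and eq: "\<And>U. open U \<Longrightarrow> measure P (U \<inter> E) = measure Q (U \<inter> E)"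
  shows "P = Q"
proof -
  note p = borel_probsD[OF assms(1)] and q = borel_probsD[OF assms(2)]
  interpret P: prob_space P by fact
  interpret Q: prob_space Q by fact
  let ?G = "(\<inter>) E ` {U. open U}"
  have "sets (restrict_space borel E) = (\<inter>) E ` sigma_sets UNIV {U. open U}"
    by (simp add: sets_restrict_space borel_def)
  also have "\<dots> = sigma_sets E ?G"
    using E by (subst sigma_sets_Int) (auto simp: borel_def)
  finally have gen: "sets (restrict_space borel E) = sigma_sets E ?G" .
  show ?thesis
  proof (rule measure_eqI_generator_eq[where E="?G" and \<Omega>=E and A="\<lambda>_. E"])
    show "Int_stable ?G"
    proof (rule Int_stableI)
      fix A B assume "A \<in> ?G" "B \<in> ?G"
      then obtain U V where "open U" "open V" "A = E \<inter> U" "B = E \<inter> V" by auto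
      then have "A \<inter> B = E \<inter> (U \<inter> V)" "open (U \<inter> V)" by auto
      then show "A \<inter> B \<in> ?G" by blast
    qed
    show "emeasure P X = emeasure Q X" if "X \<in> ?G" for X
      using that eq by (auto simp: P.emeasure_eq_measure Q.emeasure_eq_measure Int_commute)
    have "E = E \<inter> UNIV" by simp
    then show "range (\<lambda>_. E) \<subseteq> ?G" by blast
  qed (use p q gen in auto)
qed

text \<open>Uniqueness of weak limits in the form of a constant family. It gives
  \<open>Q \<le> P\<close> on open sets and so \<open>P \<le> Q\<close> on closed ones; an open set
  is an increasing union of closed sets, hence both inequalities hold on it.\<close>

lemma wconv_const_eq:
  fixes P :: "'a::metric_space measure"
  assumes P: "P \<in> borel_probs E" and Q: "Q \<in> borel_probs E" and E: "E \<in> sets borel"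
    and w: "wconv E F (\<lambda>_. P) Q" and F: "F \<noteq> bot"
  shows "P = Q"
proof (rule borel_probs_eqI[OF P Q E])
  note p = borel_probsD[OF P] and q = borel_probsD[OF Q]
  interpret P: prob_space P by fact
  interpret Q: prob_space Q by fact
  have le: "measure Q (U \<inter> E) \<le> measure P (U \<inter> E)" if "open U" for U
  proof (rule ccontr)
    assume "\<not> measure Q (U \<inter> E) \<le> measure P (U \<inter> E)"
    then have "measure P (U \<inter> E) < measure Q (U \<inter> E)" by simp
    then have "\<forall>\<^sub>F m in F. measure P (U \<inter> E) < measure P (U \<inter> E)" using w that unfolding wconv_def by blast
    then show False using F by simp
  qed
  fix U :: "'a set" assume U: "open U"
  have sP: "B \<inter> E \<in> sets P" if "B \<in> sets borel" for B unfolding p(2) using that by (rule Int_sets_restrict_borel)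
  have sQ: "B \<inter> E \<in> sets Q" if "B \<in> sets borel" for B unfolding q(2) using that by (rule Int_sets_restrict_borel)
  have closed: "measure P (C \<inter> E) \<le> measure Q (C \<inter> E)" if C: "closed C" for C
  proof -
    have CC: "C \<inter> E = space P - (- C \<inter> E)" "C \<inter> E = space Q - (- C \<inter> E)" using p(3) q(3) by auto
    have "- C \<inter> E \<in> sets P" "- C \<inter> E \<in> sets Q" using C by (auto intro: sP sQ borel_open)
    then have "measure P (C \<inter> E) = 1 - measure P (- C \<inter> E)" "measure Q (C \<inter> E) = 1 - measure Q (- C \<inter> E)"
      using P.prob_compl Q.prob_compl CC by metis+
    then show ?thesis using le[of "- C"] C by (simp add: open_Compl)
  qed
  show "measure P (U \<inter> E) = measure Q (U \<inter> E)"
  proof (cases "U = UNIV")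
    case True
    then show ?thesis using P.prob_space Q.prob_space p q by simp
  next
    case False
    define C where "C k = {x. 1 / real (Suc k) \<le> infdist x (- U)}" for k
    have cl: "closed (C k)" for k unfolding C_def by (intro closed_Collect_le continuous_intros)
    have "(\<Union>k. C k) = U"
    proof safe
      fix x k assume "x \<in> C k"
      then have "infdist x (- U) > 0" unfolding C_def by (smt (verit) mem_Collect_eq divide_pos_pos of_nat_0_less_iff zero_less_Suc)
      then show "x \<in> U" by (metis ComplI infdist_zero less_irrefl)
    next
      fix x assume "x \<in> U"
      then have "infdist x (- U) > 0"
        using U False by (subst infdist_pos_not_in_closed) (auto simp: closed_Compl)
      then obtain k where "inverse (real (Suc k)) < infdist x (- U)" using reals_Archimedean by blast
      then show "x \<in> (\<Union>k. C k)" by (auto simp: C_def inverse_eq_divide intro!: exI[of _ k])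
    qed
    then have UC: "(\<Union>k. C k \<inter> E) = U \<inter> E" by auto
    have "incseq (\<lambda>k. C k \<inter> E)"
      unfolding incseq_def C_def by (auto intro: order_trans[rotated] simp: frac_le)
    then have "(\<lambda>k. measure P (C k \<inter> E)) \<longlonglongrightarrow> measure P (\<Union>k. C k \<inter> E)"
      using cl by (intro P.finite_Lim_measure_incseq) (auto intro: sP borel_closed)
    moreover have "measure P (C k \<inter> E) \<le> measure Q (U \<inter> E)" for k
    proof -
      have "measure P (C k \<inter> E) \<le> measure Q (C k \<inter> E)" by (rule closed[OF cl])
      also have "\<dots> \<le> measure Q (U \<inter> E)"
        using UC U by (intro Q.finite_measure_mono) (auto intro: sQ borel_open)
      finally show ?thesis .
    qed
    ultimately have "measure P (U \<inter> E) \<le> measure Q (U \<inter> E)"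
      unfolding UC by (intro LIMSEQ_le_const2) auto
    then show ?thesis using le[OF U] by simp
  qed
qed

section \<open>The distance \<open>W\<^sub>1\<close>\<close>

text \<open>|u - v| is the length of the set of thresholds \<open>t\<close> that separate
  \<open>u\<close> from \<open>v\<close>; integrate over the probability space and exchange the
  integrals.\<close>

lemma nn_integral_abs_diff:
  assumes "prob_space N" and X [measurable]: "X \<in> borel_measurable N" and Y [measurable]: "Y \<in> borel_measurable N"
  shows "(\<integral>\<^sup>+z. ennreal \<bar>X z - Y z\<bar> \<partial>N) = (\<integral>\<^sup>+t. emeasure N {z\<in>space N. (X z \<le> t) \<noteq> (Y z \<le> t)} \<partial>lborel)"
proof -
  interpret N: prob_space N by fact
  interpret pair_sigma_finite N lborel ..
  have ab: "ennreal \<bar>u - v\<bar> = (\<integral>\<^sup>+t. indicator {t. (u \<le> t) \<noteq> (v \<le> t)} t \<partial>lborel)" for u v :: real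
  proof -
    have "{t. (u \<le> t) \<noteq> (v \<le> t)} = {min u v..<max u v}" by (auto simp: min_def max_def)
    then have "(\<integral>\<^sup>+t. indicator {t. (u \<le> t) \<noteq> (v \<le> t)} t \<partial>lborel) = emeasure lborel {min u v..<max u v}"
      by simp
    also have "\<dots> = ennreal (max u v - min u v)" by (subst emeasure_lborel_Ico) auto
    also have "max u v - min u v = \<bar>u - v\<bar>" by (auto simp: min_def max_def)
    finally show ?thesis by simp
  qed
  have "(\<integral>\<^sup>+z. ennreal \<bar>X z - Y z\<bar> \<partial>N) = (\<integral>\<^sup>+z. (\<integral>\<^sup>+t. indicator {t. (X z \<le> t) \<noteq> (Y z \<le> t)} t \<partial>lborel) \<partial>N)"
    by (simp only: ab)
  also have "\<dots> = (\<integral>\<^sup>+z. (\<integral>\<^sup>+t. (if (X z \<le> t) \<noteq> (Y z \<le> t) then 1 else 0) \<partial>lborel) \<partial>N)"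
    by (intro nn_integral_cong) (auto simp: indicator_def)
  also have "\<dots> = (\<integral>\<^sup>+t. (\<integral>\<^sup>+z. (if (X z \<le> t) \<noteq> (Y z \<le> t) then 1 else 0) \<partial>N) \<partial>lborel)"
    by (rule Fubini'[symmetric]) measurable
  also have "\<dots> = (\<integral>\<^sup>+t. emeasure N {z\<in>space N. (X z \<le> t) \<noteq> (Y z \<le> t)} \<partial>lborel)"
  proof (intro nn_integral_cong)
    fix t
    have "(\<integral>\<^sup>+z. (if (X z \<le> t) \<noteq> (Y z \<le> t) then 1 else 0) \<partial>N) = (\<integral>\<^sup>+z. indicator {z\<in>space N. (X z \<le> t) \<noteq> (Y z \<le> t)} z \<partial>N)"
      by (intro nn_integral_cong) (auto simp: indicator_def)
    also have "\<dots> = emeasure N {z\<in>space N. (X z \<le> t) \<noteq> (Y z \<le> t)}" by (intro nn_integral_indicator) measurable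
    finally show "(\<integral>\<^sup>+z. (if (X z \<le> t) \<noteq> (Y z \<le> t) then 1 else 0) \<partial>N) = emeasure N {z\<in>space N. (X z \<le> t) \<noteq> (Y z \<le> t)}" .
  qed
  finally show ?thesis .
qed

definition Rcdf :: "real measure \<Rightarrow> real \<Rightarrow> real" where
  "Rcdf \<rho> t = measure \<rho> {x\<in>R_plus. x \<le> t}"

lemma id_measurable_R_plus:
  assumes "\<rho> \<in> borel_probs (E::real set)" shows "(\<lambda>x. x) \<in> borel_measurable \<rho>"
  by (subst measurable_cong_sets[OF borel_probsD(2)[OF assms] refl]) (rule measurable_restrict_space1, simp)

text \<open>The pseudo-inverse of the distribution function, on the unit interval with Lebesgue
  measure. The equivalence in its third clause is what makes the cost of the quantile coupling
  computable.\<close>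

lemma Rcdf_quantile:
  assumes \<rho>: "\<rho> \<in> borel_probs R_plus"
  shows "\<exists>q. q \<in> borel_measurable (restrict_space lborel {0<..<1}) \<and> (\<forall>u\<in>{0<..<1}. 0 \<le> q u) \<and>
    (\<forall>u\<in>{0<..<1}. \<forall>t. q u \<le> t \<longleftrightarrow> u \<le> Rcdf \<rho> t) \<and>
    distr (restrict_space lborel {0<..<1}) (restrict_space borel R_plus) q = \<rho>"
proof -
  note r = borel_probsD[OF \<rho>]
  interpret R: prob_space \<rho> by fact
  have idm [measurable]: "(\<lambda>x. x) \<in> borel_measurable \<rho>" by (rule id_measurable_R_plus[OF \<rho>])
  define M where "M = distr \<rho> borel (\<lambda>x. x)"
  interpret M: real_distribution M
    unfolding M_def by (intro real_distribution.intro R.prob_space_distr idm) (auto intro!: real_distribution_axioms.intro)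
  interpret M: cdf_distribution M ..
  have C: "cdf M t = Rcdf \<rho> t" for t
  proof -
    have "cdf M t = measure \<rho> ({..t} \<inter> space \<rho>)" unfolding cdf_def M_def by (subst measure_distr) (auto simp: vimage_def)
    also have "{..t} \<inter> space \<rho> = {x\<in>R_plus. x \<le> t}" using r by auto
    finally show ?thesis by (simp add: Rcdf_def)
  qed
  let ?\<Omega> = "restrict_space lborel {0<..<1::real}"
  have q1: "M.I \<in> borel_measurable ?\<Omega>"
    using M.measurable_CI by (simp cong: measurable_cong_sets add: sets_restrict_space)
  have q3: "M.I u \<le> t \<longleftrightarrow> u \<le> Rcdf \<rho> t" if "u \<in> {0<..<1}" for u t
    using M.pseudoinverse[of u t] that C by auto
  have q2: "0 \<le> M.I u" if u: "u \<in> {0<..<1}" for u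
  proof (rule ccontr)
    assume "\<not> 0 \<le> M.I u"
    moreover have "Rcdf \<rho> (M.I u) = 0" if "M.I u < 0"
    proof -
      have "{x\<in>R_plus. x \<le> M.I u} = {}" using that by auto
      then show ?thesis by (simp only: Rcdf_def measure_empty)
    qed
    ultimately show False using q3[OF u, of "M.I u"] u by auto
  qed
  have dM: "distr ?\<Omega> borel M.I = M" by (rule M.distr_I_eq_M)
  have "distr ?\<Omega> (restrict_space borel R_plus) M.I = \<rho>"
  proof (rule measure_eqI)
    show "sets (distr ?\<Omega> (restrict_space borel R_plus) M.I) = sets \<rho>" using r by simp
    fix A assume "A \<in> sets (distr ?\<Omega> (restrict_space borel R_plus) M.I)"
    then have A: "A \<in> sets (restrict_space borel R_plus)" by simp
    then have Ab: "A \<in> sets borel" "A \<subseteq> R_plus" by (auto simp: sets_restrict_space_iff)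
    have m: "M.I \<in> ?\<Omega> \<rightarrow>\<^sub>M restrict_space borel R_plus"
      using q1 q2 by (intro measurable_restrict_space2) (auto simp: space_restrict_space)
    have "emeasure (distr ?\<Omega> (restrict_space borel R_plus) M.I) A = emeasure (distr ?\<Omega> borel M.I) A"
      using A Ab m q1 by (simp add: emeasure_distr)
    also have "\<dots> = emeasure M A" by (simp only: dM)
    also have "\<dots> = emeasure \<rho> (A \<inter> space \<rho>)" unfolding M_def using Ab by (subst emeasure_distr) (auto simp: vimage_def)
    also have "A \<inter> space \<rho> = A" using Ab r by auto
    finally show "emeasure (distr ?\<Omega> (restrict_space borel R_plus) M.I) A = emeasure \<rho> A" .
  qed
  then show ?thesis using q1 q2 q3 by blast
qed

lemma couplingsD:
  assumes "\<pi> \<in> couplings \<rho> \<gamma>"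
  shows "prob_space \<pi>" "fst \<in> \<pi> \<rightarrow>\<^sub>M restrict_space borel R_plus" "snd \<in> \<pi> \<rightarrow>\<^sub>M restrict_space borel R_plus"
    "distr \<pi> (restrict_space borel R_plus) fst = \<rho>" "distr \<pi> (restrict_space borel R_plus) snd = \<gamma>"
proof -
  have b: "\<pi> \<in> borel_probs (R_plus \<times> R_plus)" using assms by (simp add: couplings_def)
  show "prob_space \<pi>" using borel_probsD[OF b] by simp
  show "fst \<in> \<pi> \<rightarrow>\<^sub>M restrict_space borel R_plus"
    by (subst measurable_cong_sets[OF borel_probsD(2)[OF b] refl],
        rule measurable_restrict_space3[OF borel_measurable_continuous_onI[OF continuous_on_fst[OF continuous_on_id]]]) auto
  show "snd \<in> \<pi> \<rightarrow>\<^sub>M restrict_space borel R_plus"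
    by (subst measurable_cong_sets[OF borel_probsD(2)[OF b] refl],
        rule measurable_restrict_space3[OF borel_measurable_continuous_onI[OF continuous_on_snd[OF continuous_on_id]]]) auto
  show "distr \<pi> (restrict_space borel R_plus) fst = \<rho>" "distr \<pi> (restrict_space borel R_plus) snd = \<gamma>"
    using assms by (auto simp: couplings_def)
qed

lemma measurable_R_plus_borel: "f \<in> N \<rightarrow>\<^sub>M restrict_space borel (E :: real set) \<Longrightarrow> f \<in> borel_measurable N"
  by (rule measurable_compose[of f N "restrict_space borel E" "\<lambda>x. x"]) (auto intro: measurable_restrict_space1)

text \<open>Whatever the coupling, a threshold \<open>t\<close> separates the two coordinates with
  probability at least the difference of the distribution functions at \<open>t\<close>.\<close>

lemma coupling_cost_ge:
  assumes \<pi>: "\<pi> \<in> couplings \<rho> \<gamma>"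
  shows "(\<integral>\<^sup>+t. ennreal \<bar>Rcdf \<rho> t - Rcdf \<gamma> t\<bar> \<partial>lborel) \<le> (\<integral>\<^sup>+z. ennreal \<bar>fst z - snd z\<bar> \<partial>\<pi>)"
proof -
  note c = couplingsD[OF \<pi>]
  interpret P: prob_space \<pi> by fact
  have m [measurable]: "fst \<in> borel_measurable \<pi>" "snd \<in> borel_measurable \<pi>" using c by (auto intro: measurable_R_plus_borel)
  have S: "{x\<in>R_plus. x \<le> t} \<in> sets (restrict_space borel R_plus)" for t :: real
    by (auto simp: sets_restrict_space_iff)
  have R: "Rcdf \<rho> t = measure \<pi> {z\<in>space \<pi>. fst z \<le> t}" for t
  proof -
    have "Rcdf \<rho> t = measure \<pi> (fst -` {x\<in>R_plus. x \<le> t} \<inter> space \<pi>)" unfolding Rcdf_def c(4)[symmetric] by (rule measure_distr[OF c(2) S])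
    also have "fst -` {x\<in>R_plus. x \<le> t} \<inter> space \<pi> = {z\<in>space \<pi>. fst z \<le> t}"
      using measurable_space[OF c(2)] by (auto simp: space_restrict_space)
    finally show ?thesis .
  qed
  have G: "Rcdf \<gamma> t = measure \<pi> {z\<in>space \<pi>. snd z \<le> t}" for t
  proof -
    have "Rcdf \<gamma> t = measure \<pi> (snd -` {x\<in>R_plus. x \<le> t} \<inter> space \<pi>)" unfolding Rcdf_def c(5)[symmetric] by (rule measure_distr[OF c(3) S])
    also have "snd -` {x\<in>R_plus. x \<le> t} \<inter> space \<pi> = {z\<in>space \<pi>. snd z \<le> t}"
      using measurable_space[OF c(3)] by (auto simp: space_restrict_space)
    finally show ?thesis .
  qed
  have "\<bar>Rcdf \<rho> t - Rcdf \<gamma> t\<bar> \<le> measure \<pi> {z\<in>space \<pi>. (fst z \<le> t) \<noteq> (snd z \<le> t)}" for t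
  proof -
    let ?A = "{z\<in>space \<pi>. fst z \<le> t}" and ?B = "{z\<in>space \<pi>. snd z \<le> t}" and ?D = "{z\<in>space \<pi>. (fst z \<le> t) \<noteq> (snd z \<le> t)}"
    have ms: "?A \<in> sets \<pi>" "?B \<in> sets \<pi>" "?D \<in> sets \<pi>" by measurable
    have "measure \<pi> ?A \<le> measure \<pi> (?B \<union> ?D)" using ms by (intro P.finite_measure_mono) auto
    also have "\<dots> \<le> measure \<pi> ?B + measure \<pi> ?D" using ms by (intro measure_Un_le) auto
    finally have 1: "measure \<pi> ?A \<le> measure \<pi> ?B + measure \<pi> ?D" .
    have "measure \<pi> ?B \<le> measure \<pi> (?A \<union> ?D)" using ms by (intro P.finite_measure_mono) auto
    also have "\<dots> \<le> measure \<pi> ?A + measure \<pi> ?D" using ms by (intro measure_Un_le) auto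
    finally show ?thesis using 1 unfolding R G by linarith
  qed
  then show ?thesis unfolding nn_integral_abs_diff[OF c(1) m]
    by (intro nn_integral_mono) (auto simp: P.emeasure_eq_measure intro!: ennreal_leI)
qed

lemma M11_D: "\<rho> \<in> M11 \<Longrightarrow> \<rho> \<in> borel_probs R_plus" "\<rho> \<in> M11 \<Longrightarrow> (\<integral>\<^sup>+x. ennreal x \<partial>\<rho>) = 1"
  by (auto simp: M11_def)

text \<open>Both quantile functions are driven by the same uniform \<open>u\<close>. A threshold
  \<open>t\<close> separates them exactly when \<open>u\<close> lies between the two distribution
  functions at \<open>t\<close>, so the lower bound for couplings is attained.\<close>

lemma quantile_coupling:
  assumes \<rho>: "\<rho> \<in> borel_probs R_plus" and \<gamma>: "\<gamma> \<in> borel_probs R_plus"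
  obtains \<pi> where "\<pi> \<in> couplings \<rho> \<gamma>"
    "(\<integral>\<^sup>+z. ennreal \<bar>fst z - snd z\<bar> \<partial>\<pi>) = (\<integral>\<^sup>+t. ennreal \<bar>Rcdf \<rho> t - Rcdf \<gamma> t\<bar> \<partial>lborel)"
proof -
  let ?\<Omega> = "restrict_space lborel {0<..<1::real}"
  obtain q where "q \<in> borel_measurable ?\<Omega> \<and> (\<forall>u\<in>{0<..<1}. 0 \<le> q u) \<and> (\<forall>u\<in>{0<..<1}. \<forall>t. q u \<le> t \<longleftrightarrow> u \<le> Rcdf \<rho> t) \<and>
    distr ?\<Omega> (restrict_space borel R_plus) q = \<rho>" using Rcdf_quantile[OF \<rho>] by blast
  then have q: "q \<in> borel_measurable ?\<Omega>" "\<And>u. u \<in> {0<..<1} \<Longrightarrow> 0 \<le> q u" "\<And>u t. u \<in> {0<..<1} \<Longrightarrow> q u \<le> t \<longleftrightarrow> u \<le> Rcdf \<rho> t"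
    "distr ?\<Omega> (restrict_space borel R_plus) q = \<rho>" by blast+
  obtain q' where "q' \<in> borel_measurable ?\<Omega> \<and> (\<forall>u\<in>{0<..<1}. 0 \<le> q' u) \<and> (\<forall>u\<in>{0<..<1}. \<forall>t. q' u \<le> t \<longleftrightarrow> u \<le> Rcdf \<gamma> t) \<and>
    distr ?\<Omega> (restrict_space borel R_plus) q' = \<gamma>" using Rcdf_quantile[OF \<gamma>] by blast
  then have q': "q' \<in> borel_measurable ?\<Omega>" "\<And>u. u \<in> {0<..<1} \<Longrightarrow> 0 \<le> q' u" "\<And>u t. u \<in> {0<..<1} \<Longrightarrow> q' u \<le> t \<longleftrightarrow> u \<le> Rcdf \<gamma> t"
    "distr ?\<Omega> (restrict_space borel R_plus) q' = \<gamma>" by blast+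
  have sp: "space ?\<Omega> = {0<..<1}" by (simp add: space_restrict_space)
  have O: "prob_space ?\<Omega>" by (auto simp: space_restrict_space emeasure_restrict_space intro!: prob_spaceI)
  interpret O: prob_space ?\<Omega> by (rule O)
  have [measurable]: "q \<in> borel_measurable ?\<Omega>" "q' \<in> borel_measurable ?\<Omega>" using q q' by auto
  let ?B = "restrict_space borel (R_plus \<times> R_plus) :: (real \<times> real) measure"
  have "(\<lambda>u. (q u, q' u)) \<in> ?\<Omega> \<rightarrow>\<^sub>M borel" by measurable
  then have qq: "(\<lambda>u. (q u, q' u)) \<in> ?\<Omega> \<rightarrow>\<^sub>M ?B"
    using q(2) q'(2) sp by (intro measurable_restrict_space2) auto
  have fm: "fst \<in> ?B \<rightarrow>\<^sub>M restrict_space borel R_plus"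
    by (rule measurable_restrict_space3[OF borel_measurable_continuous_onI[OF continuous_on_fst[OF continuous_on_id]]]) auto
  have sm: "snd \<in> ?B \<rightarrow>\<^sub>M restrict_space borel R_plus"
    by (rule measurable_restrict_space3[OF borel_measurable_continuous_onI[OF continuous_on_snd[OF continuous_on_id]]]) auto
  define \<pi> where "\<pi> = distr ?\<Omega> ?B (\<lambda>u. (q u, q' u))"
  have c: "\<pi> \<in> couplings \<rho> \<gamma>"
    unfolding couplings_def borel_probs_def \<pi>_def using O.prob_space_distr[OF qq] q(4) q'(4)
    by (auto simp: distr_distr[OF fm qq] distr_distr[OF sm qq] comp_def)
  have R01: "0 \<le> Rcdf \<nu> t" "Rcdf \<nu> t \<le> 1" if "\<nu> \<in> borel_probs R_plus" for \<nu> t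
    using prob_space.prob_le_1[OF borel_probsD(1)[OF that]] by (auto simp: Rcdf_def)
  have "(\<integral>\<^sup>+z. ennreal \<bar>fst z - snd z\<bar> \<partial>\<pi>) = (\<integral>\<^sup>+u. ennreal \<bar>q u - q' u\<bar> \<partial>?\<Omega>)"
  proof -
    have "(\<lambda>z. ennreal \<bar>fst z - snd z\<bar>) \<in> borel_measurable ?B"
      using measurable_R_plus_borel[OF fm] measurable_R_plus_borel[OF sm] by measurable
    then show ?thesis unfolding \<pi>_def by (subst nn_integral_distr[OF qq]) auto
  qed
  also have "\<dots> = (\<integral>\<^sup>+t. emeasure ?\<Omega> {u\<in>space ?\<Omega>. (q u \<le> t) \<noteq> (q' u \<le> t)} \<partial>lborel)"
    by (rule nn_integral_abs_diff[OF O]) measurable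
  also have "\<dots> = (\<integral>\<^sup>+t. ennreal \<bar>Rcdf \<rho> t - Rcdf \<gamma> t\<bar> \<partial>lborel)"
  proof (intro nn_integral_cong)
    fix t
    let ?F = "Rcdf \<rho> t" and ?G = "Rcdf \<gamma> t"
    have "{u\<in>space ?\<Omega>. (q u \<le> t) \<noteq> (q' u \<le> t)} = {u\<in>{0<..<1}. (u \<le> ?F) \<noteq> (u \<le> ?G)}"
      using q(3) q'(3) sp by auto
    then have "emeasure ?\<Omega> {u\<in>space ?\<Omega>. (q u \<le> t) \<noteq> (q' u \<le> t)} = emeasure ?\<Omega> {u\<in>{0<..<1}. (u \<le> ?F) \<noteq> (u \<le> ?G)}"
      by (simp only:)
    also have "\<dots> = emeasure lborel {u\<in>{0<..<1}. (u \<le> ?F) \<noteq> (u \<le> ?G)}"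
      by (subst emeasure_restrict_space) auto
    also have "\<dots> = emeasure lborel {min ?F ?G<..max ?F ?G}"
    proof (rule emeasure_eq_AE)
      \<comment> \<open>The two sets can differ only at 1, which the open unit interval
        omits.\<close>
      show "AE u in lborel. (u \<in> {u\<in>{0<..<1}. (u \<le> ?F) \<noteq> (u \<le> ?G)}) = (u \<in> {min ?F ?G<..max ?F ?G})"
        using AE_lborel_singleton[of 1] by eventually_elim (use R01[OF \<rho>, of t] R01[OF \<gamma>, of t] in \<open>auto simp: min_def max_def split: if_splits\<close>)
    qed auto
    also have "\<dots> = ennreal (max ?F ?G - min ?F ?G)" by (subst emeasure_lborel_Ioc) auto
    also have "max ?F ?G - min ?F ?G = \<bar>?F - ?G\<bar>" by (auto simp: min_def max_def)
    finally show "emeasure ?\<Omega> {u\<in>space ?\<Omega>. (q u \<le> t) \<noteq> (q' u \<le> t)} = ennreal \<bar>?F - ?G\<bar>" .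
  qed
  finally show thesis by (rule that[OF c])
qed

lemma coupling_cost_finite:
  assumes "\<pi> \<in> couplings \<rho> \<gamma>" "\<rho> \<in> M11" "\<gamma> \<in> M11"
  shows "(\<integral>\<^sup>+z. ennreal \<bar>fst z - snd z\<bar> \<partial>\<pi>) \<le> 2"
proof -
  note c = couplingsD[OF assms(1)]
  have m [measurable]: "fst \<in> borel_measurable \<pi>" "snd \<in> borel_measurable \<pi>" using c by (auto intro: measurable_R_plus_borel)
  have pos: "0 \<le> fst z" "0 \<le> snd z" if "z \<in> space \<pi>" for z
    using measurable_space[OF c(2) that] measurable_space[OF c(3) that] by (auto simp: space_restrict_space)
  have em: "(\<lambda>x. ennreal x) \<in> borel_measurable (restrict_space borel R_plus)"
    by (intro measurable_restrict_space1) measurable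
  have "(\<integral>\<^sup>+z. ennreal \<bar>fst z - snd z\<bar> \<partial>\<pi>) \<le> (\<integral>\<^sup>+z. ennreal (fst z) + ennreal (snd z) \<partial>\<pi>)"
  proof (intro nn_integral_mono)
    fix z assume z: "z \<in> space \<pi>"
    have "ennreal \<bar>fst z - snd z\<bar> \<le> ennreal (fst z + snd z)" using pos[OF z] by (intro ennreal_leI) auto
    also have "\<dots> = ennreal (fst z) + ennreal (snd z)" using pos[OF z] by (rule ennreal_plus)
    finally show "ennreal \<bar>fst z - snd z\<bar> \<le> ennreal (fst z) + ennreal (snd z)" .
  qed
  also have "\<dots> = (\<integral>\<^sup>+z. ennreal (fst z) \<partial>\<pi>) + (\<integral>\<^sup>+z. ennreal (snd z) \<partial>\<pi>)"
    by (rule nn_integral_add) measurable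
  also have "(\<integral>\<^sup>+z. ennreal (fst z) \<partial>\<pi>) = (\<integral>\<^sup>+x. ennreal x \<partial>\<rho>)"
    unfolding c(4)[symmetric] by (subst nn_integral_distr[OF c(2)]) (use em in auto)
  also have "(\<integral>\<^sup>+z. ennreal (snd z) \<partial>\<pi>) = (\<integral>\<^sup>+x. ennreal x \<partial>\<gamma>)"
    unfolding c(5)[symmetric] by (subst nn_integral_distr[OF c(3)]) (use em in auto)
  finally show ?thesis using assms by (simp add: M11_D one_add_one)
qed

text \<open>The lower bound for couplings and its attainment meet. Both means are 1, so the value is
  at most 2 and \<open>enn2real\<close> loses nothing. The formula makes the triangle inequality a
  pointwise one.\<close>

lemma W1_eq:
  assumes "\<rho> \<in> M11" "\<gamma> \<in> M11"
  shows "ennreal (W1 \<rho> \<gamma>) = (\<integral>\<^sup>+t. ennreal \<bar>Rcdf \<rho> t - Rcdf \<gamma> t\<bar> \<partial>lborel)"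
    and "ennreal (W1 \<rho> \<gamma>) = (INF \<pi>\<in>couplings \<rho> \<gamma>. \<integral>\<^sup>+z. ennreal \<bar>fst z - snd z\<bar> \<partial>\<pi>)"
proof -
  let ?w = "\<integral>\<^sup>+t. ennreal \<bar>Rcdf \<rho> t - Rcdf \<gamma> t\<bar> \<partial>lborel"
  obtain \<pi> where \<pi>: "\<pi> \<in> couplings \<rho> \<gamma>" "(\<integral>\<^sup>+z. ennreal \<bar>fst z - snd z\<bar> \<partial>\<pi>) = ?w"
    by (rule quantile_coupling[OF M11_D(1)[OF assms(1)] M11_D(1)[OF assms(2)]])
  have eq: "(INF \<pi>\<in>couplings \<rho> \<gamma>. \<integral>\<^sup>+z. ennreal \<bar>fst z - snd z\<bar> \<partial>\<pi>) = ?w"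
    using \<pi> coupling_cost_ge by (intro antisym INF_greatest) (auto intro: INF_lower2)
  have "?w \<le> 2" using coupling_cost_finite[OF \<pi>(1) assms] \<pi>(2) by simp
  then have "?w \<noteq> \<infinity>" by (auto simp: top_unique)
  then show "ennreal (W1 \<rho> \<gamma>) = ?w" unfolding W1_def eq by (simp add: ennreal_enn2real_if)
  then show "ennreal (W1 \<rho> \<gamma>) = (INF \<pi>\<in>couplings \<rho> \<gamma>. \<integral>\<^sup>+z. ennreal \<bar>fst z - snd z\<bar> \<partial>\<pi>)" using eq by simp
qed

lemma W1_nonneg: "0 \<le> W1 \<rho> \<gamma>"
  by (simp add: W1_def)

lemma W1_le_cost:
  assumes "\<rho> \<in> M11" "\<gamma> \<in> M11" "\<pi> \<in> couplings \<rho> \<gamma>" "(\<integral>\<^sup>+z. ennreal \<bar>fst z - snd z\<bar> \<partial>\<pi>) \<le> ennreal c" "c \<ge> 0"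
  shows "W1 \<rho> \<gamma> \<le> c"
proof -
  have "ennreal (W1 \<rho> \<gamma>) \<le> ennreal c" unfolding W1_eq(2)[OF assms(1,2)] using assms(3,4) by (rule INF_lower2)
  then show ?thesis using assms(5) by simp
qed

lemma Rcdf_measurable:
  assumes \<rho>: "\<rho> \<in> borel_probs R_plus"
  shows "Rcdf \<rho> \<in> borel_measurable borel"
proof (rule borel_measurable_mono)
  interpret prob_space \<rho> using borel_probsD[OF \<rho>] by simp
  show "mono (Rcdf \<rho>)" unfolding mono_def Rcdf_def
  proof (intro allI impI)
    fix s t :: real assume "s \<le> t"
    have "{x\<in>R_plus. x \<le> t} \<in> sets \<rho>" unfolding borel_probsD(2)[OF \<rho>] by (auto simp: sets_restrict_space_iff)
    then show "measure \<rho> {x\<in>R_plus. x \<le> s} \<le> measure \<rho> {x\<in>R_plus. x \<le> t}"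
      using \<open>s \<le> t\<close> by (intro finite_measure_mono) auto
  qed
qed

lemma W1_triangle:
  assumes "\<rho> \<in> M11" "\<gamma> \<in> M11" "\<theta> \<in> M11"
  shows "W1 \<rho> \<theta> \<le> W1 \<rho> \<gamma> + W1 \<gamma> \<theta>"
proof -
  have [measurable]: "Rcdf \<rho> \<in> borel_measurable borel" "Rcdf \<gamma> \<in> borel_measurable borel" "Rcdf \<theta> \<in> borel_measurable borel"
    using assms M11_D Rcdf_measurable by auto
  have "ennreal (W1 \<rho> \<theta>) \<le> (\<integral>\<^sup>+t. ennreal \<bar>Rcdf \<rho> t - Rcdf \<gamma> t\<bar> + ennreal \<bar>Rcdf \<gamma> t - Rcdf \<theta> t\<bar> \<partial>lborel)"
    unfolding W1_eq(1)[OF assms(1,3)]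
  proof (intro nn_integral_mono)
    fix t :: real
    have "ennreal \<bar>Rcdf \<rho> t - Rcdf \<theta> t\<bar> \<le> ennreal (\<bar>Rcdf \<rho> t - Rcdf \<gamma> t\<bar> + \<bar>Rcdf \<gamma> t - Rcdf \<theta> t\<bar>)"
      by (intro ennreal_leI) simp
    also have "\<dots> = ennreal \<bar>Rcdf \<rho> t - Rcdf \<gamma> t\<bar> + ennreal \<bar>Rcdf \<gamma> t - Rcdf \<theta> t\<bar>"
      by (intro ennreal_plus) auto
    finally show "ennreal \<bar>Rcdf \<rho> t - Rcdf \<theta> t\<bar> \<le> ennreal \<bar>Rcdf \<rho> t - Rcdf \<gamma> t\<bar> + ennreal \<bar>Rcdf \<gamma> t - Rcdf \<theta> t\<bar>" .
  qed
  also have "\<dots> = ennreal (W1 \<rho> \<gamma>) + ennreal (W1 \<gamma> \<theta>)"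
    unfolding W1_eq(1)[OF assms(1,2)] W1_eq(1)[OF assms(2,3)] by (rule nn_integral_add) measurable
  finally show ?thesis by (simp add: W1_nonneg flip: ennreal_plus)
qed

lemma couplings_swap:
  assumes \<pi>: "\<pi> \<in> couplings \<rho> \<gamma>"
  shows "\<exists>\<pi>'\<in>couplings \<gamma> \<rho>. (\<integral>\<^sup>+z. ennreal \<bar>fst z - snd z\<bar> \<partial>\<pi>') = (\<integral>\<^sup>+z. ennreal \<bar>fst z - snd z\<bar> \<partial>\<pi>)"
proof -
  note c = couplingsD[OF \<pi>]
  interpret P: prob_space \<pi> by fact
  let ?B = "restrict_space borel (R_plus \<times> R_plus) :: (real \<times> real) measure"
  have m [measurable]: "fst \<in> borel_measurable \<pi>" "snd \<in> borel_measurable \<pi>" using c by (auto intro: measurable_R_plus_borel)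
  have "(\<lambda>z. (snd z, fst z)) \<in> \<pi> \<rightarrow>\<^sub>M borel" by measurable
  moreover have "(snd z, fst z) \<in> R_plus \<times> R_plus" if "z \<in> space \<pi>" for z
    using measurable_space[OF c(2) that] measurable_space[OF c(3) that] by (auto simp: space_restrict_space)
  ultimately have s: "(\<lambda>z. (snd z, fst z)) \<in> \<pi> \<rightarrow>\<^sub>M ?B" by (intro measurable_restrict_space2) auto
  have fm: "fst \<in> ?B \<rightarrow>\<^sub>M restrict_space borel R_plus"
    by (rule measurable_restrict_space3[OF borel_measurable_continuous_onI[OF continuous_on_fst[OF continuous_on_id]]]) auto
  have sm: "snd \<in> ?B \<rightarrow>\<^sub>M restrict_space borel R_plus"
    by (rule measurable_restrict_space3[OF borel_measurable_continuous_onI[OF continuous_on_snd[OF continuous_on_id]]]) auto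
  define \<pi>' where "\<pi>' = distr \<pi> ?B (\<lambda>z. (snd z, fst z))"
  have "\<pi>' \<in> couplings \<gamma> \<rho>"
    unfolding couplings_def borel_probs_def \<pi>'_def using P.prob_space_distr[OF s] c(4,5)
    by (auto simp: distr_distr[OF fm s] distr_distr[OF sm s] comp_def)
  moreover have "(\<lambda>z. ennreal \<bar>fst z - snd z\<bar>) \<in> borel_measurable ?B"
    using measurable_R_plus_borel[OF fm] measurable_R_plus_borel[OF sm] by measurable
  then have "(\<integral>\<^sup>+z. ennreal \<bar>fst z - snd z\<bar> \<partial>\<pi>') = (\<integral>\<^sup>+z. ennreal \<bar>snd z - fst z\<bar> \<partial>\<pi>)"
    unfolding \<pi>'_def by (subst nn_integral_distr[OF s]) auto
  ultimately show ?thesis by (auto simp: abs_minus_commute)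
qed

lemma W1_commute: "W1 \<rho> \<gamma> = W1 \<gamma> \<rho>"
proof -
  have le: "(INF \<pi>\<in>couplings \<rho> \<gamma>. \<integral>\<^sup>+z. ennreal \<bar>fst z - snd z\<bar> \<partial>\<pi>) \<le> (INF \<pi>\<in>couplings \<gamma> \<rho>. \<integral>\<^sup>+z. ennreal \<bar>fst z - snd z\<bar> \<partial>\<pi>)" for \<rho> \<gamma>
  proof (rule INF_greatest)
    fix \<pi> assume "\<pi> \<in> couplings \<gamma> \<rho>"
    from couplings_swap[OF this] obtain \<pi>' where "\<pi>' \<in> couplings \<rho> \<gamma>"
      "(\<integral>\<^sup>+z. ennreal \<bar>fst z - snd z\<bar> \<partial>\<pi>') = (\<integral>\<^sup>+z. ennreal \<bar>fst z - snd z\<bar> \<partial>\<pi>)" by blast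
    then show "(INF \<pi>\<in>couplings \<rho> \<gamma>. \<integral>\<^sup>+z. ennreal \<bar>fst z - snd z\<bar> \<partial>\<pi>) \<le> (\<integral>\<^sup>+z. ennreal \<bar>fst z - snd z\<bar> \<partial>\<pi>)"
      by (metis (no_types, lifting) INF_lower)
  qed
  then show ?thesis unfolding W1_def by (intro arg_cong[where f=enn2real] antisym le)
qed

lemma W1_self: "\<rho> \<in> M11 \<Longrightarrow> W1 \<rho> \<rho> = 0"
  using W1_eq(1)[of \<rho> \<rho>] W1_nonneg[of \<rho> \<rho>] by simp

text \<open>The easy half of Kantorovich duality, evaluated on the optimal coupling.\<close>

lemma W1_lipschitz:
  assumes \<rho>: "\<rho> \<in> M11" and \<gamma>: "\<gamma> \<in> M11" and f: "continuous_on UNIV f" "\<And>x. \<bar>f x\<bar> \<le> 1"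
    "\<And>x y. \<bar>f x - f y\<bar> \<le> L * \<bar>x - y\<bar>" and L: "L \<ge> 0"
  shows "\<bar>(\<integral>x. f x \<partial>\<rho>) - (\<integral>x. f x \<partial>\<gamma>)\<bar> \<le> L * W1 \<rho> \<gamma>"
proof -
  obtain \<pi> where \<pi>: "\<pi> \<in> couplings \<rho> \<gamma>" and
    "(\<integral>\<^sup>+z. ennreal \<bar>fst z - snd z\<bar> \<partial>\<pi>) = (\<integral>\<^sup>+t. ennreal \<bar>Rcdf \<rho> t - Rcdf \<gamma> t\<bar> \<partial>lborel)"
    by (rule quantile_coupling[OF M11_D(1)[OF \<rho>] M11_D(1)[OF \<gamma>]])
  then have cost: "(\<integral>\<^sup>+z. ennreal \<bar>fst z - snd z\<bar> \<partial>\<pi>) = ennreal (W1 \<rho> \<gamma>)" using W1_eq(1)[OF \<rho> \<gamma>] by simp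
  note c = couplingsD[OF \<pi>]
  interpret P: prob_space \<pi> by fact
  have m [measurable]: "fst \<in> borel_measurable \<pi>" "snd \<in> borel_measurable \<pi>" using c by (auto intro: measurable_R_plus_borel)
  have fm [measurable]: "f \<in> borel_measurable borel" using f(1) by (rule borel_measurable_continuous_onI)
  have fr: "f \<in> borel_measurable (restrict_space borel R_plus)" by (rule measurable_restrict_space1) measurable
  have 1: "(\<integral>x. f x \<partial>\<rho>) = (\<integral>z. f (fst z) \<partial>\<pi>)" unfolding c(4)[symmetric] by (rule integral_distr[OF c(2) fr])
  have 2: "(\<integral>x. f x \<partial>\<gamma>) = (\<integral>z. f (snd z) \<partial>\<pi>)" unfolding c(5)[symmetric] by (rule integral_distr[OF c(3) fr])
  have i: "integrable \<pi> (\<lambda>z. f (fst z))" "integrable \<pi> (\<lambda>z. f (snd z))"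
    using f(2) by (auto intro!: P.integrable_const_bound[where B=1] AE_I2)
  have ic: "integrable \<pi> (\<lambda>z. \<bar>fst z - snd z\<bar>)" using cost by (intro integrableI_nonneg) auto
  have "\<bar>(\<integral>x. f x \<partial>\<rho>) - (\<integral>x. f x \<partial>\<gamma>)\<bar> = \<bar>\<integral>z. f (fst z) - f (snd z) \<partial>\<pi>\<bar>"
    unfolding 1 2 using i by simp
  also have "\<dots> \<le> (\<integral>z. \<bar>f (fst z) - f (snd z)\<bar> \<partial>\<pi>)" using integral_norm_bound[of \<pi> "\<lambda>z. f (fst z) - f (snd z)"] by simp
  also have "\<dots> \<le> (\<integral>z. L * \<bar>fst z - snd z\<bar> \<partial>\<pi>)"
    using i ic f(3) by (intro integral_mono) auto
  also have "\<dots> = L * (\<integral>z. \<bar>fst z - snd z\<bar> \<partial>\<pi>)" by simp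
  also have "(\<integral>z. \<bar>fst z - snd z\<bar> \<partial>\<pi>) = W1 \<rho> \<gamma>"
    by (subst integral_eq_nn_integral) (auto simp: cost W1_nonneg)
  finally show ?thesis .
qed

lemma wconv_W1:
  assumes \<rho>: "\<rho> \<in> M11" and P: "\<And>m. P m \<in> M11" and lim: "((\<lambda>m. W1 (P m) \<rho>) \<longlongrightarrow> 0) F"
  shows "wconv R_plus F P \<rho>"
proof (rule wconv_UNIV_testI)
  fix f :: "real \<Rightarrow> real" and L
  assume f: "\<And>x. 0 \<le> f x" "\<And>x. f x \<le> 1" "\<And>x y. \<bar>f x - f y\<bar> \<le> L * dist x y" "continuous_on UNIV f"
  have "\<bar>(\<integral>z. f z \<partial>P m) - (\<integral>z. f z \<partial>\<rho>)\<bar> \<le> \<bar>L\<bar> * W1 (P m) \<rho>" for m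
  proof (rule W1_lipschitz[OF P \<rho> f(4)])
    show "\<bar>f x - f y\<bar> \<le> \<bar>L\<bar> * \<bar>x - y\<bar>" for x y
    proof -
      have "\<bar>f x - f y\<bar> \<le> L * \<bar>x - y\<bar>" using f(3)[of x y] by (simp add: dist_real_def)
      also have "\<dots> \<le> \<bar>L\<bar> * \<bar>x - y\<bar>" by (intro mult_right_mono) auto
      finally show ?thesis .
    qed
  qed (use f in auto)
  moreover have "((\<lambda>m. \<bar>L\<bar> * W1 (P m) \<rho>) \<longlongrightarrow> 0) F" using tendsto_mult_left[OF lim, of "\<bar>L\<bar>"] by simp
  ultimately show "((\<lambda>m. \<integral>z. f z \<partial>P m) \<longlongrightarrow> (\<integral>z. f z \<partial>\<rho>)) F"
    by - (rule LIM_zero_cancel, rule Lim_null_comparison[OF always_eventually], auto)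
qed (use assms M11_D in auto)

text \<open>That distance 0 implies equality comes from uniqueness of weak limits, applied to a
  constant sequence.\<close>

lemma Metric_space_M11: "Metric_space M11 W1"
proof
  show "W1 x y = 0 \<longleftrightarrow> x = y" if xy: "x \<in> M11" "y \<in> M11" for x y
  proof
    assume "W1 x y = 0"
    then have "wconv R_plus sequentially (\<lambda>_. x) y" by (intro wconv_W1 xy) simp
    then show "x = y" by (intro wconv_const_eq[where E=R_plus and F=sequentially]) (use xy M11_D in auto)
  qed (simp add: W1_self xy)
qed (auto intro: W1_nonneg W1_commute W1_triangle)

section \<open>The distance \<open>\<Delta>\<close>\<close>

lemma M11_timesD:
  assumes "\<rho> \<in> M11_times"
  shows "\<rho> \<in> borel_probs R_plus_times" "marginal1 \<rho> \<in> M11" "marginal2 \<rho> \<in> borel_probs UNIV"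
  using assms marginal1_borel_probs[of \<rho>] marginal2_borel_probs[of \<rho>] by (auto simp: M11_times_def M11_def)

locale product_metric =
  fixes \<delta> :: "(real \<times> 's::polish_space) metric"
  assumes mspace_eq: "mspace \<delta> = R_plus_times"
    and mtopology_eq: "mtopology_of \<delta> = top_of_set R_plus_times"
begin

sublocale dm: Metric_space R_plus_times "mdist \<delta>"
  using Metric_space_mspace_mdist[of \<delta>] by (simp add: mspace_eq)

lemma openin_dm: "openin dm.mtopology S \<longleftrightarrow> openin (top_of_set R_plus_times) S"
  using mtopology_eq by (simp add: mtopology_of_def mspace_eq)

lemma lipschitz_continuous:
  assumes f: "\<And>z z'. z \<in> R_plus_times \<Longrightarrow> z' \<in> R_plus_times \<Longrightarrow> \<bar>f z - f z'\<bar> \<le> L * mdist \<delta> z z'"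
  shows "continuous_on R_plus_times f"
  unfolding continuous_openin_preimage_eq
proof (intro allI impI)
  fix T :: "real set" assume T: "open T"
  show "openin (top_of_set R_plus_times) (R_plus_times \<inter> f -` T)"
    unfolding openin_dm[symmetric] dm.openin_mtopology
  proof (intro conjI allI impI)
    fix z assume z: "z \<in> R_plus_times \<inter> f -` T"
    then obtain e where e: "e > 0" "ball (f z) e \<subseteq> T" using T openE by blast
    have "dm.mball z (e / (\<bar>L\<bar> + 1)) \<subseteq> R_plus_times \<inter> f -` T"
    proof
      fix z' assume "z' \<in> dm.mball z (e / (\<bar>L\<bar> + 1))"
      then have z': "z' \<in> R_plus_times" "mdist \<delta> z z' < e / (\<bar>L\<bar> + 1)" by auto
      have "\<bar>f z - f z'\<bar> \<le> L * mdist \<delta> z z'" using f z z' by auto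
      also have "\<dots> \<le> (\<bar>L\<bar> + 1) * mdist \<delta> z z'" by (intro mult_right_mono) auto
      also have "\<dots> < e" using z'(2) by (simp add: field_simps)
      finally have "f z' \<in> ball (f z) e" by (simp add: dist_real_def)
      then show "z' \<in> R_plus_times \<inter> f -` T" using e z' by auto
    qed
    moreover have "e / (\<bar>L\<bar> + 1) > 0" using e by simp
    ultimately show "\<exists>r>0. dm.mball z r \<subseteq> R_plus_times \<inter> f -` T" by blast
  qed auto
qed

definition BL :: "(real \<times> 's \<Rightarrow> real) set" where
  "BL = {f. continuous_on (mspace \<delta>) f \<and> bounded (f ` mspace \<delta>) \<and> sup_norm (mspace \<delta>) f + lip_seminorm \<delta> f \<le> 1}"

lemma BL_D:
  assumes "f \<in> BL"
  shows "continuous_on R_plus_times f" "\<And>z. z \<in> R_plus_times \<Longrightarrow> \<bar>f z\<bar> \<le> 1"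
    "\<And>z z'. z \<in> R_plus_times \<Longrightarrow> z' \<in> R_plus_times \<Longrightarrow> \<bar>f z - f z'\<bar> \<le> mdist \<delta> z z'"
proof -
  have s: "sup_norm R_plus_times f + lip_seminorm \<delta> f \<le> 1" using assms by (simp add: BL_def mspace_eq)
  show "continuous_on R_plus_times f" using assms by (simp add: BL_def mspace_eq)
  show "\<bar>f z\<bar> \<le> 1" if "z \<in> R_plus_times" for z
  proof -
    have "ennreal \<bar>f z\<bar> \<le> sup_norm R_plus_times f" unfolding sup_norm_def using that by (rule SUP_upper)
    also have "\<dots> \<le> sup_norm R_plus_times f + lip_seminorm \<delta> f" by simp
    also note s
    finally show ?thesis by simp
  qed
  show "\<bar>f z - f z'\<bar> \<le> mdist \<delta> z z'" if z: "z \<in> R_plus_times" "z' \<in> R_plus_times" for z z'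
  proof (cases "z = z'")
    case False
    have "(case (z, z') of (x, y) \<Rightarrow> ennreal (\<bar>f x - f y\<bar> / mdist \<delta> x y)) \<le> lip_seminorm \<delta> f"
      unfolding lip_seminorm_def using z False by (intro SUP_upper) (auto simp: mspace_eq)
    also have "\<dots> \<le> sup_norm R_plus_times f + lip_seminorm \<delta> f" by simp
    also note s
    finally have "\<bar>f z - f z'\<bar> / mdist \<delta> z z' \<le> 1" by simp
    moreover have "mdist \<delta> z z' > 0" using False z dm.nonneg[of z z'] dm.zero[OF z] by linarith
    ultimately show ?thesis by (simp add: field_simps)
  qed simp
qed

lemma BL_I:
  assumes "\<And>z. z \<in> R_plus_times \<Longrightarrow> \<bar>f z\<bar> \<le> B"
    "\<And>z z'. z \<in> R_plus_times \<Longrightarrow> z' \<in> R_plus_times \<Longrightarrow> \<bar>f z - f z'\<bar> \<le> L * mdist \<delta> z z'"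
    "B \<ge> 0" "L \<ge> 0" "B + L \<le> 1"
  shows "f \<in> BL"
proof -
  have "sup_norm R_plus_times f \<le> ennreal B" unfolding sup_norm_def using assms by (intro SUP_least ennreal_leI) auto
  moreover have "lip_seminorm \<delta> f \<le> ennreal L" unfolding lip_seminorm_def
  proof (rule SUP_least)
    fix p assume "p \<in> {(x, y). x \<in> mspace \<delta> \<and> y \<in> mspace \<delta> \<and> x \<noteq> y}"
    then obtain x y where p: "p = (x,y)" "x \<in> R_plus_times" "y \<in> R_plus_times" "x \<noteq> y" by (auto simp: mspace_eq)
    have "mdist \<delta> x y > 0" using p dm.nonneg[of x y] dm.zero[OF p(2,3)] by linarith
    then have "\<bar>f x - f y\<bar> / mdist \<delta> x y \<le> L" using assms(2)[OF p(2,3)] by (simp add: field_simps)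
    then show "(case p of (x, y) \<Rightarrow> ennreal (\<bar>f x - f y\<bar> / mdist \<delta> x y)) \<le> ennreal L" using p by (simp add: ennreal_leI)
  qed
  ultimately have "sup_norm R_plus_times f + lip_seminorm \<delta> f \<le> ennreal B + ennreal L" by (rule add_mono)
  also have "\<dots> = ennreal (B + L)" using assms(3,4) by (rule ennreal_plus[symmetric])
  also have "\<dots> \<le> ennreal 1" using assms(5) by (rule ennreal_leI)
  also have "\<dots> = 1" by simp
  finally have "sup_norm R_plus_times f + lip_seminorm \<delta> f \<le> 1" .
  moreover have "bounded (f ` R_plus_times)" using assms(1) by (intro boundedI[of _ B]) auto
  ultimately show ?thesis unfolding BL_def mspace_eq using lipschitz_continuous[OF assms(2)] by simp
qed

lemma BL_integrable:
  assumes \<rho>: "\<rho> \<in> borel_probs R_plus_times" and f: "f \<in> BL"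
  shows "integrable \<rho> f" "\<bar>\<integral>z. f z \<partial>\<rho>\<bar> \<le> 1"
proof -
  note r = borel_probsD[OF \<rho>]
  interpret prob_space \<rho> by fact
  have "f \<in> borel_measurable \<rho>"
    by (subst measurable_cong_sets[OF r(2) refl]) (rule borel_measurable_continuous_on_restrict[OF BL_D(1)[OF f]])
  then show i: "integrable \<rho> f" using BL_D(2)[OF f] r(3) by (intro integrable_const_bound[where B=1] AE_I2) auto
  have "\<bar>\<integral>z. f z \<partial>\<rho>\<bar> \<le> (\<integral>z. \<bar>f z\<bar> \<partial>\<rho>)" using integral_norm_bound[of \<rho> f] by simp
  also have "\<dots> \<le> (\<integral>z. 1 \<partial>\<rho>)" using i BL_D(2)[OF f] r(3) by (intro integral_mono) auto
  finally show "\<bar>\<integral>z. f z \<partial>\<rho>\<bar> \<le> 1" by (simp add: prob_space)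
qed

text \<open>Members of \<open>BL\<close> are bounded by 1, so the supremum is at most 2 and
  \<open>enn2real\<close> is faithful.\<close>

lemma beta_BL_eq:
  assumes "\<rho> \<in> borel_probs R_plus_times" "\<gamma> \<in> borel_probs R_plus_times"
  shows "ennreal (beta_BL \<delta> \<rho> \<gamma>) = (SUP f\<in>BL. ennreal \<bar>(\<integral>z. f z \<partial>\<rho>) - (\<integral>z. f z \<partial>\<gamma>)\<bar>)"
proof -
  have "(SUP f\<in>BL. ennreal \<bar>(\<integral>z. f z \<partial>\<rho>) - (\<integral>z. f z \<partial>\<gamma>)\<bar>) \<le> ennreal 2"
  proof (intro SUP_least ennreal_leI)
    fix f assume "f \<in> BL"
    then show "\<bar>(\<integral>z. f z \<partial>\<rho>) - (\<integral>z. f z \<partial>\<gamma>)\<bar> \<le> 2"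
      using BL_integrable(2)[OF assms(1), of f] BL_integrable(2)[OF assms(2), of f] by linarith
  qed
  then have "(SUP f\<in>BL. ennreal \<bar>(\<integral>z. f z \<partial>\<rho>) - (\<integral>z. f z \<partial>\<gamma>)\<bar>) < top"
    by (rule le_less_trans) (rule ennreal_less_top)
  then show ?thesis unfolding beta_BL_def BL_def[symmetric] by (rule ennreal_enn2real)
qed

lemma beta_BL_nonneg: "0 \<le> beta_BL \<delta> \<rho> \<gamma>"
  by (simp add: beta_BL_def)

lemma beta_BL_le:
  assumes "\<rho> \<in> borel_probs R_plus_times" "\<gamma> \<in> borel_probs R_plus_times" "c \<ge> 0"
    and "\<And>f. f \<in> BL \<Longrightarrow> \<bar>(\<integral>z. f z \<partial>\<rho>) - (\<integral>z. f z \<partial>\<gamma>)\<bar> \<le> c"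
  shows "beta_BL \<delta> \<rho> \<gamma> \<le> c"
proof -
  have "ennreal (beta_BL \<delta> \<rho> \<gamma>) \<le> ennreal c"
    unfolding beta_BL_eq[OF assms(1,2)] by (intro SUP_least ennreal_leI assms)
  then show ?thesis using assms(3) by simp
qed

lemma beta_BL_ge:
  assumes "\<rho> \<in> borel_probs R_plus_times" "\<gamma> \<in> borel_probs R_plus_times" "f \<in> BL"
  shows "\<bar>(\<integral>z. f z \<partial>\<rho>) - (\<integral>z. f z \<partial>\<gamma>)\<bar> \<le> beta_BL \<delta> \<rho> \<gamma>"
proof -
  have "ennreal \<bar>(\<integral>z. f z \<partial>\<rho>) - (\<integral>z. f z \<partial>\<gamma>)\<bar> \<le> ennreal (beta_BL \<delta> \<rho> \<gamma>)"
    unfolding beta_BL_eq[OF assms(1,2)] using assms(3) by (rule SUP_upper)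
  then show ?thesis by (simp add: beta_BL_nonneg)
qed

lemma beta_BL_triangle:
  assumes "\<rho> \<in> borel_probs R_plus_times" "\<gamma> \<in> borel_probs R_plus_times" "\<theta> \<in> borel_probs R_plus_times"
  shows "beta_BL \<delta> \<rho> \<theta> \<le> beta_BL \<delta> \<rho> \<gamma> + beta_BL \<delta> \<gamma> \<theta>"
proof (rule beta_BL_le[OF assms(1,3)])
  fix f assume f: "f \<in> BL"
  show "\<bar>(\<integral>z. f z \<partial>\<rho>) - (\<integral>z. f z \<partial>\<theta>)\<bar> \<le> beta_BL \<delta> \<rho> \<gamma> + beta_BL \<delta> \<gamma> \<theta>"
    using beta_BL_ge[OF assms(1,2) f] beta_BL_ge[OF assms(2,3) f] by linarith
qed (simp add: beta_BL_nonneg)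

lemma beta_BL_commute: "beta_BL \<delta> \<rho> \<gamma> = beta_BL \<delta> \<gamma> \<rho>"
  unfolding beta_BL_def by (simp add: abs_minus_commute)

text \<open>Bump functions for \<delta> are multiples of members of \<open>BL\<close>, so their
  integrals converge.\<close>

lemma wconv_beta_BL:
  assumes \<rho>: "\<rho> \<in> borel_probs R_plus_times" and P: "\<And>m. P m \<in> borel_probs R_plus_times"
    and lim: "((\<lambda>m. beta_BL \<delta> (P m) \<rho>) \<longlongrightarrow> 0) F"
  shows "wconv R_plus_times F P \<rho>"
proof (rule wconvI_test[OF \<rho> P])
  fix U :: "(real \<times> 's) set" assume U: "open U"
  have "openin dm.mtopology (U \<inter> R_plus_times)"
    unfolding openin_dm by (subst Int_commute, rule openin_open_Int[OF U])
  from dm.bump_functions[OF this] obtain f :: "nat \<Rightarrow> real \<times> 's \<Rightarrow> real" where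
    ff: "\<forall>k. (\<forall>x\<in>R_plus_times. 0 \<le> f k x \<and> f k x \<le> indicator (U \<inter> R_plus_times) x) \<and>
     (\<forall>x\<in>R_plus_times. \<forall>y\<in>R_plus_times. \<bar>f k x - f k y\<bar> \<le> real k * mdist \<delta> x y) \<and>
     (\<forall>x\<in>R_plus_times. (\<lambda>k. f k x) \<longlonglongrightarrow> indicator (U \<inter> R_plus_times) x)" by blast
  have ind: "indicator (U \<inter> R_plus_times) x = (indicator U x :: real)" if "x \<in> R_plus_times" for x :: "real \<times> 's"
    using that by (auto simp: indicator_def)
  have f1: "0 \<le> f k x" "f k x \<le> indicator U x" "(\<lambda>k. f k x) \<longlonglongrightarrow> indicator U x" if "x \<in> R_plus_times" for k x
    using ff that unfolding ind[OF that, symmetric] by blast+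
  have f2: "\<bar>f k x - f k y\<bar> \<le> real k * mdist \<delta> x y" if "x \<in> R_plus_times" "y \<in> R_plus_times" for k x y
    using ff that by blast
  have fle: "\<bar>f k x\<bar> \<le> 1" if "x \<in> R_plus_times" for k x
  proof -
    have "f k x \<le> indicator U x" using f1 that by blast
    also have "\<dots> \<le> 1" by (simp add: indicator_def)
    finally show ?thesis using f1(1)[OF that] by simp
  qed
  have lim': "((\<lambda>m. \<integral>z. f k z \<partial>P m) \<longlongrightarrow> (\<integral>z. f k z \<partial>\<rho>)) F" for k
  proof -
    let ?c = "real k + 1"
    \<comment> \<open>After division by k + 1 the sup norm is at most 1 / (k + 1) and the Lipschitz
      constant at most k / (k + 1); the two add up to 1.\<close>
    have g: "(\<lambda>z. f k z / ?c) \<in> BL"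
    proof (rule BL_I[where B="1 / ?c" and L="real k / ?c"])
      show "\<bar>f k z / ?c\<bar> \<le> 1 / ?c" if "z \<in> R_plus_times" for z
        using fle[OF that] by (simp add: divide_right_mono)
      show "\<bar>f k z / ?c - f k z' / ?c\<bar> \<le> real k / ?c * mdist \<delta> z z'" if "z \<in> R_plus_times" "z' \<in> R_plus_times" for z z'
      proof -
        have "\<bar>f k z / ?c - f k z' / ?c\<bar> = \<bar>f k z - f k z'\<bar> / ?c" by (simp flip: diff_divide_distrib)
        also have "\<dots> \<le> real k * mdist \<delta> z z' / ?c" using f2[OF that] by (intro divide_right_mono) auto
        finally show ?thesis by simp
      qed
    qed (auto simp: field_simps)
    have "\<bar>(\<integral>z. f k z \<partial>P m) - (\<integral>z. f k z \<partial>\<rho>)\<bar> \<le> ?c * beta_BL \<delta> (P m) \<rho>" for m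
    proof -
      have "\<bar>(\<integral>z. f k z / ?c \<partial>P m) - (\<integral>z. f k z / ?c \<partial>\<rho>)\<bar> \<le> beta_BL \<delta> (P m) \<rho>"
        by (rule beta_BL_ge[OF P \<rho> g])
      then have "\<bar>(\<integral>z. f k z \<partial>P m) - (\<integral>z. f k z \<partial>\<rho>)\<bar> / ?c \<le> beta_BL \<delta> (P m) \<rho>"
        by (simp flip: diff_divide_distrib)
      then show ?thesis by (simp add: field_simps)
    qed
    moreover have "((\<lambda>m. ?c * beta_BL \<delta> (P m) \<rho>) \<longlongrightarrow> 0) F" using tendsto_mult_left[OF lim, of ?c] by simp
    ultimately show ?thesis
      by - (rule LIM_zero_cancel, rule Lim_null_comparison[OF always_eventually], auto)
  qed
  have lip: "continuous_on R_plus_times (f k)" for k using f2 by (rule lipschitz_continuous)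
  show "\<exists>f :: nat \<Rightarrow> real \<times> 's \<Rightarrow> real. \<forall>k. f k \<in> borel_measurable (restrict_space borel R_plus_times) \<and>
       (\<forall>z\<in>R_plus_times. 0 \<le> f k z \<and> f k z \<le> indicator U z) \<and> (\<forall>z\<in>R_plus_times. (\<lambda>k. f k z) \<longlonglongrightarrow> indicator U z) \<and>
       ((\<lambda>m. \<integral>z. f k z \<partial>P m) \<longlongrightarrow> (\<integral>z. f k z \<partial>\<rho>)) F"
    by (intro exI[of _ f] allI conjI ballI f1 lim' borel_measurable_continuous_on_restrict lip)
qed

lemma beta_BL_self: "\<rho> \<in> borel_probs R_plus_times \<Longrightarrow> beta_BL \<delta> \<rho> \<rho> = 0"
  using beta_BL_le[of \<rho> \<rho> 0] beta_BL_nonneg[of \<rho> \<rho>] by simp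

sublocale D: Metric_space "M11_times :: (real \<times> 's) measure set" "Delta \<delta>"
proof
  fix x y z :: "(real \<times> 's) measure"
  show "0 \<le> Delta \<delta> x y" by (simp add: Delta_def W1_nonneg beta_BL_nonneg)
  show "Delta \<delta> x y = Delta \<delta> y x" by (simp add: Delta_def W1_commute[of "marginal1 x"] beta_BL_commute[of x])
  show "Delta \<delta> x y = 0 \<longleftrightarrow> x = y" if xy: "x \<in> M11_times" "y \<in> M11_times"
  proof
    assume "Delta \<delta> x y = 0"
    then have "beta_BL \<delta> x y = 0" using W1_nonneg[of "marginal1 x" "marginal1 y"] beta_BL_nonneg[of x y] by (simp add: Delta_def)
    then have "wconv R_plus_times sequentially (\<lambda>_. x) y" by (intro wconv_beta_BL M11_timesD xy) simp
    then show "x = y" by (intro wconv_const_eq[where E=R_plus_times and F=sequentially]) (use xy M11_timesD in auto)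
  qed (use xy in \<open>simp add: Delta_def W1_self M11_timesD beta_BL_self\<close>)
  show "Delta \<delta> x z \<le> Delta \<delta> x y + Delta \<delta> y z" if "x \<in> M11_times" "y \<in> M11_times" "z \<in> M11_times"
  proof -
    have "W1 (marginal1 x) (marginal1 z) \<le> W1 (marginal1 x) (marginal1 y) + W1 (marginal1 y) (marginal1 z)"
      using that M11_timesD by (intro W1_triangle) auto
    moreover have "beta_BL \<delta> x z \<le> beta_BL \<delta> x y + beta_BL \<delta> y z" using that M11_timesD by (intro beta_BL_triangle) auto
    ultimately show ?thesis by (simp add: Delta_def)
  qed
qed

lemma Delta_tendsto_D:
  assumes "((\<lambda>m. Delta \<delta> (P m) \<rho>) \<longlongrightarrow> 0) F"
  shows "((\<lambda>m. W1 (marginal1 (P m)) (marginal1 \<rho>)) \<longlongrightarrow> 0) F" "((\<lambda>m. beta_BL \<delta> (P m) \<rho>) \<longlongrightarrow> 0) F"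
proof -
  show "((\<lambda>m. W1 (marginal1 (P m)) (marginal1 \<rho>)) \<longlongrightarrow> 0) F"
    by (rule tendsto_sandwich[OF _ _ tendsto_const assms]) (auto simp: Delta_def W1_nonneg beta_BL_nonneg)
  show "((\<lambda>m. beta_BL \<delta> (P m) \<rho>) \<longlongrightarrow> 0) F"
    by (rule tendsto_sandwich[OF _ _ tendsto_const assms]) (auto simp: Delta_def W1_nonneg beta_BL_nonneg)
qed

end

text \<open>Local constancy on each factor gives local constancy on a box, and the exceptional null
  sets lift from the marginals.\<close>

lemma clab_product:
  fixes \<rho> :: "(real \<times> 's::polish_space) measure"
  assumes \<rho>: "\<rho> \<in> borel_probs R_plus_times" and a: "clab (marginal1 \<rho>) a" and b: "clab (marginal2 \<rho>) b"
  shows "clab \<rho> (\<lambda>z. prod_encode (a (fst z), b (snd z)))"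
  unfolding clab_def
proof (intro conjI)
  note r = borel_probsD[OF \<rho>] and n = marginal1_borel_probs[OF \<rho>] and m = marginal2_borel_probs[OF \<rho>]
  note fin = clab_finite_range(1)[OF n a] clab_finite_range(2)[OF m b]
  show "finite ((\<lambda>z. prod_encode (a (fst z), b (snd z))) ` space \<rho>)"
    by (rule finite_subset[of _ "prod_encode ` (a ` R_plus \<times> range b)"]) (use fin r in auto)
  have "(\<lambda>z. (a (fst z), b (snd z))) \<in> \<rho> \<rightarrow>\<^sub>M count_space UNIV"
    by (rule lab_measurable[OF r(2) clab_measurable[OF n a] clab_measurable_UNIV[OF m b]])
  then show "(\<lambda>z. prod_encode (a (fst z), b (snd z))) \<in> \<rho> \<rightarrow>\<^sub>M count_space UNIV"
    by (rule measurable_compose) simp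
  have fm: "fst \<in> \<rho> \<rightarrow>\<^sub>M restrict_space borel R_plus" by (subst measurable_cong_sets[OF r(2) refl]) simp
  have sm: "snd \<in> \<rho> \<rightarrow>\<^sub>M borel" by (subst measurable_cong_sets[OF r(2) refl]) simp
  have "AE w in marginal1 \<rho>. loc_const R_plus a w" "AE y in marginal2 \<rho>. loc_const UNIV b y"
    using a b borel_probsD(3)[OF n] borel_probsD(3)[OF m] by (auto simp: clab_def)
  then have "AE z in \<rho>. loc_const R_plus a (fst z)" "AE z in \<rho>. loc_const UNIV b (snd z)"
    unfolding marginal1_def marginal2_def by (auto dest: AE_distrD[OF fm] AE_distrD[OF sm])
  then show "AE z in \<rho>. loc_const (space \<rho>) (\<lambda>z. prod_encode (a (fst z), b (snd z))) z"
  proof eventually_elim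
    fix z assume "loc_const R_plus a (fst z)" "loc_const UNIV b (snd z)"
    then obtain U V where UV: "open U" "fst z \<in> U" "\<forall>y\<in>U\<inter>R_plus. a y = a (fst z)"
      "open V" "snd z \<in> V" "\<forall>y\<in>V. b y = b (snd z)" unfolding loc_const_def Int_UNIV_right by blast
    have "\<forall>y\<in>(U\<times>V) \<inter> space \<rho>. prod_encode (a (fst y), b (snd y)) = prod_encode (a (fst z), b (snd z))"
    proof
      fix y assume "y \<in> (U\<times>V) \<inter> space \<rho>"
      then have y: "fst y \<in> U \<inter> R_plus" "snd y \<in> V" using r(3) by (auto simp: mem_Times_iff)
      have "a (fst y) = a (fst z)" using UV(3) y(1) by blast
      moreover have "b (snd y) = b (snd z)" using UV(6) y(2) by blast
      ultimately have "a (fst y) = a (fst z)" "b (snd y) = b (snd z)" .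
      then show "prod_encode (a (fst y), b (snd y)) = prod_encode (a (fst z), b (snd z))" by simp
    qed
    moreover have "z \<in> U \<times> V" using UV by (simp add: mem_Times_iff)
    ultimately show "loc_const (space \<rho>) (\<lambda>z. prod_encode (a (fst z), b (snd z))) z"
      unfolding loc_const_def using open_Times[OF UV(1,4)] by blast
  qed
qed

lemma wconv_labset:
  fixes \<rho> :: "(real \<times> 's::polish_space) measure"
  assumes \<rho>: "\<rho> \<in> borel_probs R_plus_times" and P: "\<And>m. P m \<in> borel_probs R_plus_times"
    and w: "wconv R_plus_times F P \<rho>" and a: "clab (marginal1 \<rho>) a" and b: "clab (marginal2 \<rho>) b"
  shows "((\<lambda>m. measure (P m) (labset a b S)) \<longlongrightarrow> measure \<rho> (labset a b S)) F"
proof -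
  have "labset a b S = {z\<in>R_plus_times. prod_encode (a (fst z), b (snd z)) \<in> prod_encode ` S}"
    by (auto simp: labset_def inj_image_mem_iff)
  then show ?thesis using wconv_cell[OF \<rho> P w clab_product[OF \<rho> a b]] by simp
qed

lemma wconv_marginal2:
  fixes \<rho> :: "(real \<times> 's::polish_space) measure"
  assumes \<rho>: "\<rho> \<in> borel_probs R_plus_times" and P: "\<And>m. P m \<in> borel_probs R_plus_times"
    and w: "wconv R_plus_times F P \<rho>"
  shows "wconv UNIV F (\<lambda>m. marginal2 (P m)) (marginal2 \<rho>)"
  unfolding wconv_def
proof (intro allI impI)
  fix U :: "'s set" and c assume U: "open U" and c: "c < measure (marginal2 \<rho>) (U \<inter> UNIV)"
  have "measure (marginal2 \<rho>') (U \<inter> UNIV) = measure \<rho>' ((UNIV \<times> U) \<inter> R_plus_times)"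
    if "\<rho>' \<in> borel_probs R_plus_times" for \<rho>'
    using measure_marginal2[OF that borel_open[OF U]] by (simp add: Times_Int_Times)
  note eq = this
  have "open (UNIV \<times> U :: (real \<times> 's) set)" using U by (intro open_Times) auto
  then have "\<forall>\<^sub>F m in F. c < measure (P m) ((UNIV \<times> U) \<inter> R_plus_times)"
    using w c unfolding eq[OF \<rho>] wconv_def by blast
  then show "\<forall>\<^sub>F m in F. c < measure (marginal2 (P m)) (U \<inter> UNIV)" by (simp only: eq[OF P])
qed

text \<open>Refine the two-cell labellings of the members of \<open>F\<close> one after
  another.\<close>

lemma clab_finite:
  fixes \<nu> :: "'a::topological_space measure"
  assumes "finite F" "\<And>A. A \<in> F \<Longrightarrow> clab \<nu> (\<lambda>y. of_bool (y \<in> A))"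
  shows "\<exists>a. clab \<nu> a \<and> (\<forall>x y. a x = a y \<longrightarrow> (\<forall>A\<in>F. x \<in> A \<longleftrightarrow> y \<in> A))"
  using assms
proof (induction F rule: finite_induct)
  case empty
  show ?case by (intro exI[of _ "\<lambda>_. 0"]) (auto intro: clab_const)
next
  case (insert A F)
  have "\<exists>a. clab \<nu> a \<and> (\<forall>x y. a x = a y \<longrightarrow> (\<forall>A\<in>F. x \<in> A \<longleftrightarrow> y \<in> A))"
    by (rule insert.IH) (rule insert.prems, simp)
  then obtain a where a0: "clab \<nu> a" "\<forall>x y. a x = a y \<longrightarrow> (\<forall>A\<in>F. x \<in> A \<longleftrightarrow> y \<in> A)" by (elim exE conjE)
  then have a: "clab \<nu> a" "\<And>x y. a x = a y \<Longrightarrow> (\<forall>A\<in>F. x \<in> A \<longleftrightarrow> y \<in> A)" by iprover+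
  have "clab \<nu> (\<lambda>x. prod_encode (a x, of_bool (x \<in> A)))" by (intro clab_pair a(1) insert.prems) simp
  moreover have "\<forall>x y. prod_encode (a x, of_bool (x \<in> A)) = prod_encode (a y, of_bool (y \<in> A)) \<longrightarrow>
      (\<forall>B\<in>insert A F. x \<in> B \<longleftrightarrow> y \<in> B)"
  proof (intro allI impI)
    fix x y assume "prod_encode (a x, of_bool (x \<in> A)) = prod_encode (a y, of_bool (y \<in> A))"
    then have "a x = a y" "(x \<in> A) = (y \<in> A)" by (simp_all add: of_bool_eq_iff)
    then show "\<forall>B\<in>insert A F. x \<in> B \<longleftrightarrow> y \<in> B" using a(2)[of x y] by blast
  qed
  ultimately show ?case by (intro exI[of _ "\<lambda>x. prod_encode (a x, of_bool (x \<in> A))"] conjI)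
qed

section \<open>Fine labellings and the bounded Lipschitz distance\<close>

context product_metric
begin

text \<open>Boxes of \<delta>-diameter below \<open>e\<close> with continuity sets as sides cover
  the space, countably many of them by Lindelof. Finitely many carry \<open>\<rho>\<close>-mass
  above 1 - e, and the labels \<open>a\<close> and \<open>b\<close> record membership in their
  sides.\<close>

lemma fine_labels:
  fixes \<rho> :: "(real \<times> 's) measure"
  assumes \<nu>: "\<nu> \<in> borel_probs R_plus" and \<mu>: "\<mu> \<in> borel_probs UNIV" and \<rho>: "\<rho> \<in> borel_probs R_plus_times" and e: "e > 0"
  obtains a b S where "clab \<nu> a" "clab \<mu> b" "measure \<rho> (labset a b S) > 1 - e"
    "\<And>z z'. z \<in> labset a b S \<Longrightarrow> z' \<in> R_plus_times \<Longrightarrow> a (fst z) = a (fst z') \<Longrightarrow> b (snd z) = b (snd z') \<Longrightarrow> mdist \<delta> z z' < e"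
proof -
  note r = borel_probsD[OF \<rho>]
  interpret R: prob_space \<rho> by fact
  define small where "small W \<longleftrightarrow> (\<forall>z\<in>W\<inter>R_plus_times. \<forall>z'\<in>W\<inter>R_plus_times. mdist \<delta> z z' < e)" for W :: "(real \<times> 's) set"
  define G where "G = {(A,B). open A \<and> open B \<and> clab \<nu> (\<lambda>y. of_bool (y \<in> A)) \<and> clab \<mu> (\<lambda>y. of_bool (y \<in> B)) \<and> small (A \<times> B)}"
  have cov: "\<exists>p\<in>G. z \<in> (\<lambda>(A,B). A \<times> B) p" if z: "z \<in> R_plus_times" for z
  proof -
    have "openin dm.mtopology (dm.mball z (e/2))" by simp
    then obtain W where W: "open W" "dm.mball z (e/2) = R_plus_times \<inter> W"
      unfolding openin_dm openin_open by blast
    have "z \<in> W" using W z e dm.centre_in_mball_iff[of z "e/2"] by auto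
    then obtain U V where UV: "open U" "open V" "z \<in> U \<times> V" "U \<times> V \<subseteq> W" using W(1) open_prod_elim by metis
    then have zU: "fst z \<in> U" "snd z \<in> V" by auto
    obtain A where A: "open A" "fst z \<in> A" "A \<subseteq> U" "clab \<nu> (\<lambda>y. of_bool (y \<in> A))"
      using clab_ball[OF \<nu> UV(1) zU(1)] by metis
    obtain B where B: "open B" "snd z \<in> B" "B \<subseteq> V" "clab \<mu> (\<lambda>y. of_bool (y \<in> B))"
      using clab_ball[OF \<mu> UV(2) zU(2)] by metis
    have "small (A \<times> B)" unfolding small_def
    proof (intro ballI)
      fix z1 z2 assume "z1 \<in> A \<times> B \<inter> R_plus_times" "z2 \<in> A \<times> B \<inter> R_plus_times"
      then have "z1 \<in> R_plus_times \<inter> W" "z2 \<in> R_plus_times \<inter> W" using A B UV by auto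
      then have m: "mdist \<delta> z z1 < e/2" "mdist \<delta> z z2 < e/2" "z1 \<in> R_plus_times" "z2 \<in> R_plus_times"
        unfolding W(2)[symmetric] by auto
      have "mdist \<delta> z1 z2 \<le> mdist \<delta> z1 z + mdist \<delta> z z2" using m z by (intro dm.triangle) auto
      then show "mdist \<delta> z1 z2 < e" using m dm.commute[of z1 z] by simp
    qed
    then have "(A,B) \<in> G" using A B by (simp add: G_def)
    moreover have "z \<in> A \<times> B" using A B by (simp add: mem_Times_iff)
    ultimately show ?thesis by (intro bexI[of _ "(A,B)"]) auto
  qed
  have "open T" if "T \<in> (\<lambda>(A,B). A \<times> B) ` G" for T using that by (auto simp: G_def intro: open_Times)
  then obtain F' where F': "F' \<subseteq> (\<lambda>(A,B). A \<times> B) ` G" "countable F'" "\<Union>F' = \<Union>((\<lambda>(A,B). A \<times> B) ` G)"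
    by (rule Lindelof)
  then obtain F where F: "countable F" "F \<subseteq> G" "F' = (\<lambda>(A,B). A \<times> B) ` F"
    using countable_subset_image[of F' "\<lambda>(A,B). A \<times> B" G] by auto
  have Fcov: "R_plus_times \<subseteq> (\<Union>p\<in>F. (\<lambda>(A,B). A \<times> B) p)"
    using cov F F'(3) by fastforce
  have "F \<noteq> {}" using Fcov by auto
  define p where "p = from_nat_into F"
  have pF: "range p = F" unfolding p_def using F(1) \<open>F \<noteq> {}\<close> by (rule range_from_nat_into[rotated])
  define Q where "Q k = (\<lambda>(A,B). A \<times> B) (p k) \<inter> R_plus_times" for k
  have pG: "p k \<in> G" for k using pF F(2) by auto
  have Qs: "Q k \<in> sets \<rho>" for k
  proof -
    have "open ((\<lambda>(A,B). A \<times> B) (p k))" using pG[of k] by (auto simp: G_def intro: open_Times)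
    then show ?thesis unfolding Q_def r(2) by (intro Int_sets_restrict_borel borel_open)
  qed
  have "z \<in> (\<Union>k. Q k)" if z: "z \<in> R_plus_times" for z
  proof -
    obtain q where q: "q \<in> F" "z \<in> (\<lambda>(A,B). A \<times> B) q" using Fcov z by (elim subsetD[THEN UN_E])
    then obtain k where "q = p k" unfolding pF[symmetric] by (elim rangeE)
    then show ?thesis using q z unfolding Q_def by (intro UN_I[of k]) auto
  qed
  then have "(\<Union>k. Q k) = R_plus_times" by (intro antisym subsetI) (auto simp: Q_def)
  moreover have "(\<Union>k. \<Union>i<k. Q i) = (\<Union>k. Q k)" by (intro equalityI subsetI) (blast intro: lessI)+
  ultimately have QU: "(\<Union>k. \<Union>i<k. Q i) = space \<rho>" using r(3) by simp
  have "(\<lambda>k. measure \<rho> (\<Union>i<k. Q i)) \<longlonglongrightarrow> measure \<rho> (\<Union>k. \<Union>i<k. Q i)"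
    by (intro R.finite_Lim_measure_incseq) (auto simp: incseq_def Qs intro: less_le_trans)
  then have "\<forall>\<^sub>F k in sequentially. 1 - e < measure \<rho> (\<Union>i<k. Q i)"
    unfolding QU using e by (intro order_tendstoD(1)) (auto simp: R.prob_space)
  then obtain k where k: "1 - e < measure \<rho> (\<Union>i<k. Q i)" by (auto simp: eventually_sequentially)
  define FA where "FA = (\<lambda>i. fst (p i)) ` {..<k}"
  define FB where "FB = (\<lambda>i. snd (p i)) ` {..<k}"
  have finFA: "finite FA" by (simp add: FA_def)
  have cFA: "clab \<nu> (\<lambda>y. of_bool (y \<in> A))" if A: "A \<in> FA" for A
  proof -
    obtain i where "A = fst (p i)" using A by (auto simp: FA_def)
    then show ?thesis using pG[of i] by (simp add: G_def case_prod_unfold)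
  qed
  have "\<exists>a. clab \<nu> a \<and> (\<forall>x y. a x = a y \<longrightarrow> (\<forall>A\<in>FA. x \<in> A \<longleftrightarrow> y \<in> A))"
    by (rule clab_finite[OF finFA cFA])
  then obtain a where a0: "clab \<nu> a" "\<forall>x y. a x = a y \<longrightarrow> (\<forall>A\<in>FA. x \<in> A \<longleftrightarrow> y \<in> A)" by (elim exE conjE)
  then have a: "clab \<nu> a" "\<And>x y. a x = a y \<Longrightarrow> (\<forall>A\<in>FA. x \<in> A \<longleftrightarrow> y \<in> A)" by iprover+
  have finFB: "finite FB" by (simp add: FB_def)
  have cFB: "clab \<mu> (\<lambda>y. of_bool (y \<in> B))" if B: "B \<in> FB" for B
  proof -
    obtain i where "B = snd (p i)" using B by (auto simp: FB_def)
    then show ?thesis using pG[of i] by (simp add: G_def case_prod_unfold)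
  qed
  have "\<exists>b. clab \<mu> b \<and> (\<forall>x y. b x = b y \<longrightarrow> (\<forall>A\<in>FB. x \<in> A \<longleftrightarrow> y \<in> A))"
    by (rule clab_finite[OF finFB cFB])
  then obtain b where b0: "clab \<mu> b" "\<forall>x y. b x = b y \<longrightarrow> (\<forall>A\<in>FB. x \<in> A \<longleftrightarrow> y \<in> A)" by (elim exE conjE)
  then have b: "clab \<mu> b" "\<And>x y. b x = b y \<Longrightarrow> (\<forall>A\<in>FB. x \<in> A \<longleftrightarrow> y \<in> A)" by iprover+
  \<comment> \<open>The pairs of labels met by the chosen boxes. As labels decide membership in
    every side, two points that share a pair of labels from \<open>S\<close> lie in a common
    box.\<close>
  define S where "S = (\<lambda>z. (a (fst z), b (snd z))) ` (\<Union>i<k. Q i)"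
  have key: "\<exists>i<k. z \<in> Q i \<and> z' \<in> Q i" if z: "z \<in> labset a b S" "z' \<in> R_plus_times" "a (fst z) = a (fst z')" "b (snd z) = b (snd z')" for z z'
  proof -
    obtain i z0 where i: "i < k" "z0 \<in> Q i" "a (fst z) = a (fst z0)" "b (snd z) = b (snd z0)" "z \<in> R_plus_times"
      using z(1) by (auto simp: labset_def S_def)
    have in_: "y \<in> Q i" if y: "y \<in> R_plus_times" "a (fst y) = a (fst z0)" "b (snd y) = b (snd z0)" for y
    proof -
      have "fst z0 \<in> fst (p i)" "snd z0 \<in> snd (p i)" using i(2) by (auto simp: Q_def case_prod_unfold)
      moreover have "fst (p i) \<in> FA" "snd (p i) \<in> FB" using i(1) by (auto simp: FA_def FB_def)
      ultimately have "fst y \<in> fst (p i)" "snd y \<in> snd (p i)" using a(2)[OF y(2)] b(2)[OF y(3)] by blast+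
      then show ?thesis using y(1) by (simp add: Q_def case_prod_unfold mem_Times_iff)
    qed
    show ?thesis using i in_[of z] in_[of z'] z by metis
  qed
  show thesis
  proof (rule that[OF a(1) b(1)])
    have "(\<Union>i<k. Q i) \<subseteq> labset a b S"
    proof
      fix z assume z: "z \<in> (\<Union>i<k. Q i)"
      then have "z \<in> R_plus_times" by (auto simp: Q_def)
      then show "z \<in> labset a b S" using z unfolding labset_def S_def by blast
    qed
    moreover have "labset a b S \<in> sets \<rho>"
      by (rule labset_sets[OF r(2) clab_measurable[OF \<nu> a(1)] clab_measurable_UNIV[OF \<mu> b(1)]])
    ultimately have "measure \<rho> (\<Union>i<k. Q i) \<le> measure \<rho> (labset a b S)" by (intro R.finite_measure_mono)
    then show "1 - e < measure \<rho> (labset a b S)" using k by simp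
    fix z z' assume z: "z \<in> labset a b S" "z' \<in> R_plus_times" "a (fst z) = a (fst z')" "b (snd z) = b (snd z')"
    obtain i where "i < k" "z \<in> Q i" "z' \<in> Q i" using key[OF z] by blast
    moreover have "small ((\<lambda>(A,B). A \<times> B) (p i))" using pG[of i] by (auto simp: G_def)
    ultimately show "mdist \<delta> z z' < e" by (auto simp: small_def Q_def)
  qed
qed

text \<open>A test function is replaced by its value at one representative of each good cell and by
  0 on the others. This costs \<open>e\<close> plus the mass of the bad cells, in all 2 e under
  \<open>\<rho>\<close> and 3 e under \<open>\<rho>'\<close>. The comparison of the two tables costs
  another \<open>e\<close>; hence 6 e.\<close>

lemma beta_BL_close:
  fixes \<rho> \<rho>' :: "(real \<times> 's) measure"
  assumes \<rho>: "\<rho> \<in> borel_probs R_plus_times" and \<rho>': "\<rho>' \<in> borel_probs R_plus_times"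
    and am: "a \<in> restrict_space borel R_plus \<rightarrow>\<^sub>M count_space UNIV" and bm: "b \<in> borel \<rightarrow>\<^sub>M count_space UNIV"
    and I: "finite I" "a ` R_plus \<subseteq> I" and J: "finite J" "range b \<subseteq> J"
    and good: "measure \<rho> (labset a b S) > 1 - e"
    and small: "\<And>z z'. z \<in> labset a b S \<Longrightarrow> z' \<in> R_plus_times \<Longrightarrow> a (fst z) = a (fst z') \<Longrightarrow> b (snd z) = b (snd z') \<Longrightarrow> mdist \<delta> z z' < e"
    and close: "(\<Sum>i\<in>I. \<Sum>j\<in>J. \<bar>ltab \<rho>' a b i j - ltab \<rho> a b i j\<bar>) \<le> e"
  shows "beta_BL \<delta> \<rho>' \<rho> \<le> 6 * e"
proof -
  note r = borel_probsD[OF \<rho>] and r' = borel_probsD[OF \<rho>']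
  interpret R: prob_space \<rho> by fact
  interpret R': prob_space \<rho>' by fact
  have e0: "0 \<le> e" using close by (rule order_trans[rotated]) (intro sum_nonneg abs_ge_zero)
  have ls: "labset a b T \<in> sets (restrict_space borel R_plus_times)" for T by (rule labset_sets[OF refl am bm])
  define rep where "rep k = (SOME z. z \<in> labset a b {k})" for k
  let ?c = "\<lambda>z :: real \<times> 's. (a (fst z), b (snd z))"
  have integral_cells: "(\<integral>z. h (?c z) \<partial>N) = (\<Sum>i\<in>I. \<Sum>j\<in>J. h (i,j) * ltab N a b i j)"
    and integrable_cells: "integrable N (\<lambda>z. h (?c z))" if N: "N \<in> borel_probs R_plus_times" for N :: "(real \<times> 's) measure" and h :: "_ \<Rightarrow> real"
  proof -
    note n = borel_probsD[OF N]
    interpret N: prob_space N by fact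
    have eq: "h (?c z) = (\<Sum>k\<in>I\<times>J. h k * indicator (labset a b {k}) z)" if "z \<in> space N" for z
    proof -
      have z: "z \<in> R_plus_times" using that n by simp
      then have c: "?c z \<in> I \<times> J" using I J by auto
      have "(\<Sum>k\<in>I\<times>J. h k * indicator (labset a b {k}) z) = (\<Sum>k\<in>I\<times>J. if k = ?c z then h k else 0)"
        using z by (intro sum.cong) (auto simp: labset_def indicator_def)
      also have "\<dots> = h (?c z)" using c I J by simp
      finally show ?thesis by simp
    qed
    have i: "integrable N (\<lambda>z. h k * indicator (labset a b {k}) z)" for k
      using ls n(2) by (intro integrable_mult_right integrable_real_indicator) (auto simp: less_top[symmetric])
    show "integrable N (\<lambda>z. h (?c z))"
      by (subst Bochner_Integration.integrable_cong[OF refl eq], assumption) (intro Bochner_Integration.integrable_sum i)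
    have "(\<integral>z. h (?c z) \<partial>N) = (\<integral>z. (\<Sum>k\<in>I\<times>J. h k * indicator (labset a b {k}) z) \<partial>N)"
      by (rule Bochner_Integration.integral_cong[OF refl eq])
    also have "\<dots> = (\<Sum>k\<in>I\<times>J. h k * measure N (labset a b {k}))"
      using ls n(2) by (subst Bochner_Integration.integral_sum[OF i]) auto
    also have "\<dots> = (\<Sum>i\<in>I. \<Sum>j\<in>J. h (i,j) * ltab N a b i j)"
      by (subst sum.cartesian_product) (auto simp: ltab_def intro!: sum.cong)
    finally show "(\<integral>z. h (?c z) \<partial>N) = (\<Sum>i\<in>I. \<Sum>j\<in>J. h (i,j) * ltab N a b i j)" .
  qed
  have diff: "\<bar>(\<integral>z. h (?c z) \<partial>\<rho>') - (\<integral>z. h (?c z) \<partial>\<rho>)\<bar> \<le> e" if h: "\<And>k. \<bar>h k\<bar> \<le> 1" for h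
  proof -
    have "(\<integral>z. h (?c z) \<partial>\<rho>') - (\<integral>z. h (?c z) \<partial>\<rho>) = (\<Sum>i\<in>I. \<Sum>j\<in>J. h (i,j) * (ltab \<rho>' a b i j - ltab \<rho> a b i j))"
      unfolding integral_cells[OF \<rho>'] integral_cells[OF \<rho>] by (simp add: sum_subtractf right_diff_distrib)
    also have "\<bar>\<dots>\<bar> \<le> (\<Sum>i\<in>I. \<bar>\<Sum>j\<in>J. h (i,j) * (ltab \<rho>' a b i j - ltab \<rho> a b i j)\<bar>)" by (rule sum_abs)
    also have "\<dots> \<le> (\<Sum>i\<in>I. \<Sum>j\<in>J. \<bar>h (i,j) * (ltab \<rho>' a b i j - ltab \<rho> a b i j)\<bar>)" by (intro sum_mono sum_abs)
    also have "\<dots> \<le> (\<Sum>i\<in>I. \<Sum>j\<in>J. \<bar>ltab \<rho>' a b i j - ltab \<rho> a b i j\<bar>)"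
      using h by (intro sum_mono) (simp add: abs_mult mult_left_le_one_le)
    finally show ?thesis using close by simp
  qed
  have bad: "(\<integral>z. indicator (- S) (?c z) \<partial>\<rho>) \<le> e"
  proof -
    have "(\<integral>z. indicator (- S) (?c z) \<partial>\<rho>) = (\<integral>z. indicator (space \<rho> - labset a b S) z \<partial>\<rho>)"
      using r(3) by (intro Bochner_Integration.integral_cong) (auto simp: labset_def indicator_def)
    also have "\<dots> = measure \<rho> ((space \<rho> - labset a b S) \<inter> space \<rho>)" by simp
    also have "(space \<rho> - labset a b S) \<inter> space \<rho> = space \<rho> - labset a b S" by blast
    also have "measure \<rho> (space \<rho> - labset a b S) = 1 - measure \<rho> (labset a b S)" using ls r(2) by (intro R.prob_compl) simp
    finally show ?thesis using good by simp
  qed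
  have bad': "(\<integral>z. indicator (- S) (?c z) \<partial>\<rho>') \<le> 2 * e"
    using diff[of "indicator (- S)"] bad by (auto simp: indicator_def abs_le_iff)
  show ?thesis
  proof (rule beta_BL_le[OF \<rho>' \<rho>])
    fix f assume f: "f \<in> BL"
    define h where "h k = (if k \<in> S \<and> labset a b {k} \<noteq> {} then f (rep k) else 0)" for k
    have rep: "rep k \<in> labset a b {k}" if "labset a b {k} \<noteq> {}" for k unfolding rep_def using that by (meson ex_in_conv someI_ex)
    have h1: "\<bar>h k\<bar> \<le> 1" for k
      using BL_D(2)[OF f, of "rep k"] rep[of k] by (auto simp: h_def labset_def)
    have fh: "\<bar>f z - h (?c z)\<bar> \<le> e + indicator (- S) (?c z)" if z: "z \<in> R_plus_times" for z
    proof (cases "?c z \<in> S")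
      case True
      have zl: "z \<in> labset a b {?c z}" using z by (simp add: labset_def)
      then have ne: "labset a b {?c z} \<noteq> {}" by blast
      have rp: "rep (?c z) \<in> labset a b {?c z}" by (rule rep[OF ne])
      have zS: "z \<in> labset a b S" using z True by (simp add: labset_def)
      have "\<bar>f z - f (rep (?c z))\<bar> \<le> mdist \<delta> z (rep (?c z))" using rp z by (intro BL_D(3)[OF f]) (auto simp: labset_def)
      also have "\<dots> < e" using rp by (intro small[OF zS]) (auto simp: labset_def)
      finally show ?thesis using True ne by (simp add: h_def)
    next
      case False
      then show ?thesis using BL_D(2)[OF f z] e0 by (simp add: h_def)
    qed
    have int: "\<bar>(\<integral>z. f z \<partial>N) - (\<integral>z. h (?c z) \<partial>N)\<bar> \<le> e + (\<integral>z. indicator (- S) (?c z) \<partial>N)" if N: "N \<in> borel_probs R_plus_times" for N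
    proof -
      interpret N: prob_space N using borel_probsD[OF N] by simp
      note i = BL_integrable(1)[OF N f] integrable_cells[OF N, of h] integrable_cells[OF N, of "indicator (- S)"]
      have "\<bar>(\<integral>z. f z \<partial>N) - (\<integral>z. h (?c z) \<partial>N)\<bar> = \<bar>\<integral>z. f z - h (?c z) \<partial>N\<bar>" using i by simp
      also have "\<dots> \<le> (\<integral>z. \<bar>f z - h (?c z)\<bar> \<partial>N)" using integral_norm_bound[of N "\<lambda>z. f z - h (?c z)"] by simp
      also have "\<dots> \<le> (\<integral>z. e + indicator (- S) (?c z) \<partial>N)"
      proof (rule integral_mono)
        show "integrable N (\<lambda>z. \<bar>f z - h (?c z)\<bar>)" using i by auto
        show "integrable N (\<lambda>z. e + indicator (- S) (?c z))" using i by auto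
      qed (use fh borel_probsD(3)[OF N] in auto)
      also have "\<dots> = e + (\<integral>z. indicator (- S) (?c z) \<partial>N)" using i by (simp add: N.prob_space)
      finally show ?thesis .
    qed
    show "\<bar>(\<integral>z. f z \<partial>\<rho>') - (\<integral>z. f z \<partial>\<rho>)\<bar> \<le> 6 * e"
      using int[OF \<rho>] int[OF \<rho>'] bad bad' diff[of h, OF h1] by linarith
  qed (use e0 in simp)
qed

end

section \<open>Compactness and goodness of the rate function\<close>

text \<open>A proper open subset is exhausted by superlevel sets of the distance to its complement,
  at levels with \<open>Q\<close>-null boundary. These sets are cells of continuity labellings, so
  the masses of such cells determine the measure.\<close>

lemma borel_probs_eq_clab:
  fixes P Q :: "'a::metric_space measure"
  assumes P: "P \<in> borel_probs E" and Q: "Q \<in> borel_probs E" and E: "E \<in> sets borel"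
    and eq: "\<And>a T. clab Q a \<Longrightarrow> measure P {z\<in>E. a z \<in> T} = measure Q {z\<in>E. a z \<in> T}"
  shows "P = Q"
proof (rule borel_probs_eqI[OF P Q E])
  note p = borel_probsD[OF P] and q = borel_probsD[OF Q]
  interpret P: prob_space P by fact
  interpret Q: prob_space Q by fact
  fix U :: "'a set" assume U: "open U"
  show "measure P (U \<inter> E) = measure Q (U \<inter> E)"
  proof (cases "U = UNIV")
    case True
    then show ?thesis using P.prob_space Q.prob_space p q by simp
  next
    case False
    define g where "g x = infdist x (- U)" for x
    have gc: "continuous_on UNIV g" unfolding g_def by (intro continuous_intros)
    \<comment> \<open>The levels come from disjoint intervals, so that they decrease to 0.\<close>
    have "\<exists>r. 1 / real (k+2) < r \<and> r < 1 / real (k+1) \<and> clab Q (\<lambda>x. of_bool (g x < r))" for k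
      using clab_threshold[OF Q gc, of "1 / real (k+2)" "1 / real (k+1)"] by (auto simp: frac_less2)
    then obtain r where r: "\<And>k. 1 / real (k+2) < r k" "\<And>k. r k < 1 / real (k+1)" "\<And>k. clab Q (\<lambda>x. of_bool (g x < r k))"
      by metis
    define C where "C k = {z\<in>E. of_bool (g z < r k) \<in> {0::nat}}" for k
    have C: "C k = {z\<in>E. r k \<le> g z}" for k by (auto simp: C_def)
    have eqC: "measure P (C k) = measure Q (C k)" for k unfolding C_def by (rule eq[OF r(3)])
    have dec: "r (Suc k) \<le> r k" for k using r(2)[of "Suc k"] r(1)[of k] by simp
    have rd: "decseq r" by (rule decseq_SucI) (rule dec)
    have inc: "incseq C"
    proof (rule incseq_SucI, rule subsetI)
      fix k z assume "z \<in> C k"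
      then show "z \<in> C (Suc k)" using dec[of k] by (simp add: C)
    qed
    have UC: "(\<Union>k. C k) = U \<inter> E"
    proof (intro equalityI subsetI)
      fix x assume "x \<in> (\<Union>k. C k)"
      then obtain k where k: "x \<in> E" "r k \<le> g x" by (auto simp: C)
      have "0 < r k" using r(1)[of k] by (rule order.strict_trans[rotated]) simp
      then have "infdist x (- U) \<noteq> 0" using k by (simp add: g_def)
      then have "x \<notin> - U" by (rule contrapos_nn) (rule infdist_zero)
      then show "x \<in> U \<inter> E" using k by simp
    next
      fix x assume x: "x \<in> U \<inter> E"
      have "g x > 0" unfolding g_def
        using x U False by (subst infdist_pos_not_in_closed) (auto simp: closed_Compl)
      then obtain k where "inverse (real (Suc k)) < g x" using reals_Archimedean by blast
      then have "r k \<le> g x" using r(2)[of k] by (simp add: inverse_eq_divide)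
      then show "x \<in> (\<Union>k. C k)" using x by (auto simp: C)
    qed
    have Cs: "C k \<in> sets (restrict_space borel E)" for k
    proof -
      have "closed {z. r k \<le> g z}" by (intro closed_Collect_le continuous_intros gc)
      then have "{z. r k \<le> g z} \<inter> E \<in> sets (restrict_space borel E)" by (intro Int_sets_restrict_borel borel_closed)
      moreover have "{z. r k \<le> g z} \<inter> E = C k" by (auto simp: C)
      ultimately show ?thesis by simp
    qed
    have "(\<lambda>k. measure P (C k)) \<longlonglongrightarrow> measure P (U \<inter> E)"
      unfolding UC[symmetric] by (rule P.finite_Lim_measure_incseq) (use Cs p(2) inc in auto)
    moreover have "(\<lambda>k. measure P (C k)) \<longlonglongrightarrow> measure Q (U \<inter> E)"
      unfolding eqC UC[symmetric] by (rule Q.finite_Lim_measure_incseq) (use Cs q(2) inc in auto)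
    ultimately show ?thesis by (rule LIMSEQ_unique)
  qed
qed

text \<open>Inner regularity is applied outside a null set containing the exceptional points, so
  \<open>pr\<close> holds at every point of the compact set. It will be local constancy of countably
  many labellings at once.\<close>

lemma tight_in_AE:
  fixes Q :: "'a::polish_space measure"
  assumes Q: "Q \<in> borel_probs E" and E: "E \<in> sets borel" and ae: "AE z in Q. pr z" and e: "e > 0"
  shows "\<exists>K. compact K \<and> K \<subseteq> E \<and> (\<forall>z\<in>K. pr z) \<and> measure Q K > 1 - e"
proof -
  note q = borel_probsD[OF Q]
  interpret Q: prob_space Q by fact
  have idm: "(\<lambda>x. x) \<in> Q \<rightarrow>\<^sub>M borel"
    by (subst measurable_cong_sets[OF q(2) refl]) (rule measurable_restrict_space1, simp)
  define M where "M = distr Q borel (\<lambda>x. x)"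
  interpret M: prob_space M unfolding M_def by (rule Q.prob_space_distr[OF idm])
  obtain N where N: "{z\<in>space Q. \<not> pr z} \<subseteq> N" "N \<in> sets Q" "emeasure Q N = 0" using ae by (auto elim: AE_E)
  have NB: "E - N \<in> sets borel"
  proof -
    have "E - N \<in> sets Q" using N(2) q(3) sets.compl_sets[OF N(2)] by simp
    then show ?thesis using q(2) E by (simp add: sets_restrict_space_iff)
  qed
  have MB: "emeasure M B = emeasure Q (B \<inter> E)" if "B \<in> sets borel" for B
    unfolding M_def using that idm q(3) by (subst emeasure_distr) (auto simp: vimage_def)
  have "emeasure M (E - N) = emeasure Q (space Q - N)" using MB[OF NB] q(3) by (simp add: Int_absorb2)
  also have "\<dots> = 1" using N sets.sets_into_space[OF N(2)] by (subst emeasure_Diff) (auto simp: Q.emeasure_space_1)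
  finally have "emeasure M (E - N) = 1" .
  moreover have "emeasure M (E - N) = (SUP K\<in>{K. K \<subseteq> E - N \<and> compact K}. emeasure M K)"
  proof (rule inner_regular[OF _ _ NB])
    show "sets M = sets borel" by (simp add: M_def)
    show "emeasure M (space M) \<noteq> \<infinity>" using M.emeasure_space_1 by simp
  qed
  ultimately have "ennreal (1 - e) < (SUP K\<in>{K. K \<subseteq> E - N \<and> compact K}. emeasure M K)"
    using e by (metis ennreal_less_one_iff diff_less_eq less_add_same_cancel1)
  then obtain K where K: "K \<subseteq> E - N" "compact K" "ennreal (1 - e) < emeasure M K" by (auto simp: less_SUP_iff)
  have Kb: "K \<in> sets borel" using K by (intro borel_compact)
  have "emeasure M K = ennreal (measure Q K)" using MB[OF Kb] K by (simp add: Int_absorb2 Q.emeasure_eq_measure subset_iff)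
  then have "1 - e < measure Q K" using K(3) measure_nonneg[of Q K]
    by (cases "1 - e \<ge> 0") (simp add: ennreal_less_iff, linarith)
  then show ?thesis using K N q by (intro exI[of _ K]) auto
qed

text \<open>Tychonoff's theorem for a power of the unit interval. The index set may be uncountable,
  so a finer filter takes the place of a convergent subsequence.\<close>

lemma cluster_filter:
  fixes f :: "nat \<Rightarrow> 'k \<Rightarrow> real"
  assumes "\<And>m R. 0 \<le> f m R \<and> f m R \<le> 1"
  obtains F p where "F \<noteq> bot" "F \<le> sequentially" "\<And>R. ((\<lambda>m. f m R) \<longlongrightarrow> p R) F"
proof -
  have "compactin (product_topology (\<lambda>_::'k. euclidean) UNIV) (PiE UNIV (\<lambda>_. {0..1::real}))"
    by (subst compactin_PiE) auto
  then have c: "compact (PiE UNIV (\<lambda>_::'k. {0..1::real}))" by (simp add: euclidean_product_topology)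
  have "eventually (\<lambda>g. g \<in> PiE UNIV (\<lambda>_::'k. {0..1::real})) (filtermap f sequentially)"
    using assms by (auto simp: eventually_filtermap PiE_UNIV_domain)
  then obtain p where p: "inf (nhds p) (filtermap f sequentially) \<noteq> bot"
    using c[unfolded compact_filter] by (metis filtermap_bot_iff sequentially_bot)
  \<comment> \<open>Neighbourhoods of the cluster point are pulled back to indices; along this
    filter every coordinate converges.\<close>
  define F where "F = inf (filtercomap f (nhds p)) sequentially"
  have "F \<noteq> bot"
  proof
    assume "F = bot"
    then have "eventually (\<lambda>_. False) F" by simp
    then obtain A B where AB: "eventually A (filtercomap f (nhds p))" "eventually B sequentially" "\<And>x. A x \<Longrightarrow> B x \<Longrightarrow> False"
      unfolding F_def eventually_inf by blast
    from AB(1) obtain R where R: "eventually R (nhds p)" "\<And>x. R (f x) \<Longrightarrow> A x" unfolding eventually_filtercomap by blast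
    have "eventually (\<lambda>g. \<not> R g) (filtermap f sequentially)"
      unfolding eventually_filtermap using AB(2) by eventually_elim (use AB(3) R(2) in blast)
    then have "eventually (\<lambda>_. False) (inf (nhds p) (filtermap f sequentially))"
      unfolding eventually_inf using R(1) by blast
    then show False using p by (simp add: trivial_limit_def)
  qed
  moreover have "F \<le> sequentially" unfolding F_def by simp
  moreover have "((\<lambda>m. f m R) \<longlongrightarrow> p R) F" for R
  proof -
    have "filterlim f (nhds p) F" unfolding F_def filterlim_iff_le_filtercomap by simp
    then show ?thesis
      by (rule continuous_on_tendsto_compose[OF continuous_on_product_coordinates]) auto
  qed
  ultimately show thesis by (rule that)
qed

section \<open>Cluster points of couplings with convergent marginals\<close>

context product_metric
begin

text \<open>
  Along a filter on which the masses of all sets converge, the limits form an additive set function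
  on the algebra of labelled sets. Tightness of the marginals makes it continuous at \<open>{}\<close>, so
  that it extends to a measure.
\<close>

theorem coupling_cluster_point:
  fixes \<rho>s :: "nat \<Rightarrow> (real \<times> 's) measure"
  assumes rs: "\<And>m. \<rho>s m \<in> borel_probs R_plus_times"
    and \<nu>: "\<nu> \<in> borel_probs R_plus" and \<mu>: "\<mu> \<in> borel_probs UNIV"
    and w1: "wconv R_plus sequentially (\<lambda>m. marginal1 (\<rho>s m)) \<nu>"
    and w2: "wconv UNIV sequentially (\<lambda>m. marginal2 (\<rho>s m)) \<mu>"
  obtains \<rho> F where "\<rho> \<in> borel_probs R_plus_times" "marginal1 \<rho> = \<nu>" "marginal2 \<rho> = \<mu>" "F \<noteq> bot" "F \<le> sequentially"
    "((\<lambda>m. beta_BL \<delta> (\<rho>s m) \<rho>) \<longlongrightarrow> 0) F"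
proof -
  note r = borel_probsD[OF rs]
  interpret RS: prob_space "\<rho>s m" for m by (rule r(1))
  obtain F p where F: "F \<noteq> bot" "F \<le> sequentially" and lim: "\<And>R. ((\<lambda>m. measure (\<rho>s m) R) \<longlongrightarrow> p R) F"
    using cluster_filter[of "\<lambda>m R. measure (\<rho>s m) R"] RS.prob_le_1 by (metis measure_nonneg)
  let ?Z = "R_plus_times :: (real \<times> 's) set"
  let ?B = "sets (restrict_space borel ?Z)"
  have p_add: "p (R \<union> R') = p R + p R'" if "R \<in> ?B" "R' \<in> ?B" "R \<inter> R' = {}" for R R'
  proof (rule tendsto_unique[OF F(1) lim])
    have "measure (\<rho>s m) (R \<union> R') = measure (\<rho>s m) R + measure (\<rho>s m) R'" for m
      using that r(2) by (intro RS.finite_measure_Union) auto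
    then show "((\<lambda>m. measure (\<rho>s m) (R \<union> R')) \<longlongrightarrow> p R + p R') F"
      by (simp only:) (intro tendsto_add lim)
  qed
  have p0: "0 \<le> p R" for R
    by (rule tendsto_lowerbound[OF lim _ F(1)]) (simp add: measure_nonneg)
  have p_sub: "p R \<le> p R1 + p R2" if "R1 \<in> ?B" "R2 \<in> ?B" "R \<subseteq> R1 \<union> R2" for R R1 R2
  proof (rule tendsto_le[OF F(1) tendsto_add[OF lim lim] lim], intro always_eventually allI)
    fix m
    have "measure (\<rho>s m) R \<le> measure (\<rho>s m) (R1 \<union> R2)" using that r(2) by (intro RS.finite_measure_mono) auto
    also have "\<dots> \<le> measure (\<rho>s m) R1 + measure (\<rho>s m) R2" using that r(2) by (intro measure_Un_le) auto
    finally show "measure (\<rho>s m) R \<le> measure (\<rho>s m) R1 + measure (\<rho>s m) R2" .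
  qed
  have pZ: "p ?Z = 1"
    using RS.prob_space r(3) by (intro tendsto_unique[OF F(1) lim]) simp
  have pempty: "p {} = 0" by (intro tendsto_unique[OF F(1) lim]) simp
  have lB: "labset a b S \<in> ?B" if "clab \<nu> a" "clab \<mu> b" for a b S
    by (rule labset_sets[OF refl clab_measurable[OF \<nu> that(1)] clab_measurable_UNIV[OF \<mu> that(2)]])
  \<comment> \<open>On label sets that depend on one coordinate only, \<open>p\<close> is the mass
    under the limiting marginal. This controls \<open>p\<close> off compact sets and later
    identifies the marginals of the extension.\<close>
  have p1: "p (labset a b (T \<times> UNIV)) = measure \<nu> {w\<in>R_plus. a w \<in> T}" if a: "clab \<nu> a" for a b T
  proof (rule tendsto_unique[OF F(1) lim])
    have "labset a b (T \<times> UNIV) = {w\<in>R_plus. a w \<in> T} \<times> UNIV" by (auto simp: labset_def)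
    moreover have "{w\<in>R_plus. a w \<in> T} \<in> sets (restrict_space borel R_plus)"
      using measurable_sets[OF clab_measurable[OF \<nu> a], of T] by (simp add: space_restrict_space vimage_def Int_def conj_commute)
    ultimately have "measure (\<rho>s m) (labset a b (T \<times> UNIV)) = measure (marginal1 (\<rho>s m)) {w\<in>R_plus. a w \<in> T}" for m
      using measure_marginal1[OF rs] by simp
    then show "((\<lambda>m. measure (\<rho>s m) (labset a b (T \<times> UNIV))) \<longlongrightarrow> measure \<nu> {w\<in>R_plus. a w \<in> T}) F"
      using wconv_cell[OF \<nu> marginal1_borel_probs[OF rs] wconv_mono[OF w1 F(2)] a] by simp
  qed
  have p2: "p (labset a b (UNIV \<times> T)) = measure \<mu> {y\<in>UNIV. b y \<in> T}" if b: "clab \<mu> b" for a b T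
  proof (rule tendsto_unique[OF F(1) lim])
    have "labset a b (UNIV \<times> T) = R_plus \<times> {y\<in>UNIV. b y \<in> T}" by (auto simp: labset_def)
    moreover have "{y\<in>UNIV. b y \<in> T} \<in> sets borel"
      using measurable_sets[OF clab_measurable_UNIV[OF \<mu> b], of T] by (simp add: vimage_def)
    ultimately have "measure (\<rho>s m) (labset a b (UNIV \<times> T)) = measure (marginal2 (\<rho>s m)) {y\<in>UNIV. b y \<in> T}" for m
      using measure_marginal2[OF rs] by simp
    then show "((\<lambda>m. measure (\<rho>s m) (labset a b (UNIV \<times> T))) \<longlongrightarrow> measure \<mu> {y\<in>UNIV. b y \<in> T}) F"
      using wconv_cell[OF \<mu> marginal2_borel_probs[OF rs] wconv_mono[OF w2 F(2)] b] by simp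
  qed
  interpret alg: algebra ?Z "labalg \<nu> \<mu>" by (rule algebra_labalg)
  have labB: "R \<in> ?B" if "R \<in> labalg \<nu> \<mu>" for R using that lB by (auto simp: labalg_def)
  have cont: "(\<lambda>i. ennreal (p (A i))) \<longlonglongrightarrow> 0" if A: "range A \<subseteq> labalg \<nu> \<mu>" "decseq A" "(\<Inter>i. A i) = {}" for A
  proof -
    have AB: "A i \<in> ?B" for i using A(1) labB by auto
    have mono: "p (A j) \<le> p (A i)" if "i \<le> j" for i j
      using p_sub[OF AB[of i] AB[of i], of "A j"] p_sub[OF AB[of i] sets.empty_sets, of "A j"] A(2) that pempty by (auto simp: decseq_def)
    have small: "\<exists>n. p (A n) < e" if e: "e > 0" for e
    proof -
      have "\<forall>i. \<exists>a b S. A i = labset a b S \<and> clab \<nu> a \<and> clab \<mu> b"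
      proof
        fix i
        have "A i \<in> labalg \<nu> \<mu>" using A(1) by blast
        then show "\<exists>a b S. A i = labset a b S \<and> clab \<nu> a \<and> clab \<mu> b" unfolding labalg_def by blast
      qed
      then obtain a b S where abS: "\<And>i. A i = labset (a i) (b i) (S i)" "\<And>i. clab \<nu> (a i)" "\<And>i. clab \<mu> (b i)" by metis
      have aeK: "AE w in \<nu>. \<forall>i. loc_const R_plus (a i) w"
        using abS(2) borel_probsD(3)[OF \<nu>] by (auto simp: clab_def AE_all_countable)
      have e4: "e/4 > 0" using e by simp
      have "R_plus \<in> sets (borel :: real measure)" by simp
      from tight_in_AE[OF \<nu> this aeK e4] obtain K where K': "compact K" "K \<subseteq> R_plus"
        "\<forall>w\<in>K. \<forall>i. loc_const R_plus (a i) w" "measure \<nu> K > 1 - e/4"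
        by (elim exE conjE)
      note K = K'(1,2) K'(3)[rule_format] K'(4)
      have aeL: "AE y in \<mu>. \<forall>i. loc_const UNIV (b i) y"
        using abS(3) borel_probsD(3)[OF \<mu>] by (auto simp: clab_def AE_all_countable)
      have "UNIV \<in> sets (borel :: 's measure)" by simp
      from tight_in_AE[OF \<mu> this aeL e4] obtain L where L': "compact L" "L \<subseteq> UNIV"
        "\<forall>y\<in>L. \<forall>i. loc_const UNIV (b i) y" "measure \<mu> L > 1 - e/4"
        by (elim exE conjE)
      note L = L'(1) L'(3)[rule_format] L'(4)
      \<comment> \<open>On \<open>K \<times> L\<close> all labels are locally constant, so each
        point outside \<open>A i\<close> has a neighbourhood that misses \<open>A i\<close> within
        \<open>K \<times> L\<close>. The \<open>A i\<close> decrease to the empty set, so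
        compactness gives one \<open>n\<close> for which \<open>A n\<close> misses
        \<open>K \<times> L\<close>.\<close>
      define O' where "O' i = \<Union>{W. open W \<and> W \<inter> (K \<times> L) \<inter> A i = {}}" for i
      have O_open: "open (O' i)" for i unfolding O'_def by auto
      have cov: "K \<times> L \<subseteq> (\<Union>i. O' i)"
      proof
        fix z assume z: "z \<in> K \<times> L"
        have "z \<notin> (\<Inter>i. A i)" using A(3) by simp
        then obtain i where i: "z \<notin> A i" by auto
        have l1: "loc_const R_plus (a i) (fst z)" using K(3)[of "fst z" i] z by (simp add: mem_Times_iff)
        have l2: "loc_const UNIV (b i) (snd z)" using L(2)[of "snd z" i] z by (simp add: mem_Times_iff)
        obtain U where U: "open U" "fst z \<in> U" "\<forall>y\<in>U\<inter>R_plus. a i y = a i (fst z)"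
          using l1[unfolded loc_const_def] by (elim exE conjE) (rule that)
        obtain V where V: "open V" "snd z \<in> V" "\<forall>y\<in>V. b i y = b i (snd z)"
          using l2[unfolded loc_const_def Int_UNIV_right] by (elim exE conjE) (rule that)
        note UV = U V
        have lab: "(a i (fst z), b i (snd z)) \<notin> S i" using i z K(2) by (auto simp: abS(1) labset_def)
        have "(U \<times> V) \<inter> (K \<times> L) \<inter> A i = {}"
        proof (rule ccontr)
          assume "(U \<times> V) \<inter> (K \<times> L) \<inter> A i \<noteq> {}"
          then obtain y where y: "fst y \<in> U" "snd y \<in> V" "y \<in> A i" by auto
          then have "fst y \<in> U \<inter> R_plus" "(a i (fst y), b i (snd y)) \<in> S i" by (auto simp: abS(1) labset_def)
          moreover have "a i (fst y) = a i (fst z)" using UV(3) calculation(1) by blast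
          moreover have "b i (snd y) = b i (snd z)" using UV(6) y(2) by blast
          ultimately show False using lab by metis
        qed
        moreover have "open (U \<times> V)" "z \<in> U \<times> V" using UV by (auto intro: open_Times simp: mem_Times_iff)
        ultimately have "z \<in> O' i" unfolding O'_def by blast
        then show "z \<in> (\<Union>i. O' i)" by blast
      qed
      have cpt: "compact (K \<times> L)" using K L by (intro compact_Times)
      obtain D where D: "finite D" "K \<times> L \<subseteq> (\<Union>i\<in>D. O' i)"
        by (rule compactE_image[OF cpt, of UNIV O']) (use cov O_open in auto)
      have "\<exists>n. \<forall>i\<in>D. i \<le> n" using D(1) by (rule finite_nat_set_iff_bounded_le[THEN iffD1])
      then obtain n where n': "\<forall>i\<in>D. i \<le> n" ..
      note n = n'[rule_format]
      have empty: "A n \<inter> (K \<times> L) = {}"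
      proof (rule ccontr)
        assume "A n \<inter> (K \<times> L) \<noteq> {}"
        then obtain z where z: "z \<in> A n" "z \<in> K \<times> L" by blast
        obtain i where i: "i \<in> D" "z \<in> O' i" using subsetD[OF D(2) z(2)] by (elim UN_E)
        obtain W where W: "z \<in> W" "W \<inter> (K \<times> L) \<inter> A i = {}" using i(2) unfolding O'_def by blast
        have "z \<notin> A i"
        proof
          assume "z \<in> A i"
          then have "z \<in> W \<inter> (K \<times> L) \<inter> A i" using W(1) z(2) by (intro IntI)
          then show False using W(2) by simp
        qed
        moreover have "A n \<subseteq> A i" using A(2) n[OF i(1)] by (auto simp: decseq_def)
        ultimately show False using z by blast
      qed
      \<comment> \<open>If for a point of \<open>A n\<close> both labels occurred, one on
        \<open>K\<close> and one on \<open>L\<close>, points of \<open>K\<close> and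
        \<open>L\<close> with these labels would form a pair in \<open>A n\<close> and
        \<open>K \<times> L\<close>. So one of the labels is foreign to its compact set, and such
        label sets have small mass under the marginals.\<close>
      let ?R1 = "labset (a n) (b n) ((- (a n ` K)) \<times> UNIV)" and ?R2 = "labset (a n) (b n) (UNIV \<times> (- (b n ` L)))"
      have "A n \<subseteq> ?R1 \<union> ?R2"
      proof
        fix z assume z: "z \<in> A n"
        show "z \<in> ?R1 \<union> ?R2"
        proof (rule ccontr)
          assume "z \<notin> ?R1 \<union> ?R2"
          moreover have z': "z \<in> R_plus_times" "(a n (fst z), b n (snd z)) \<in> S n"
            using z unfolding abS(1) labset_def by simp_all
          ultimately have "a n (fst z) \<in> a n ` K" and "b n (snd z) \<in> b n ` L" by (simp_all add: labset_def)
          then obtain w y where wy: "a n (fst z) = a n w" "w \<in> K" "b n (snd z) = b n y" "y \<in> L" by (elim imageE)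
          have "(w, y) \<in> A n" unfolding abS(1) labset_def using z'(2) wy K(2) by auto
          then show False using wy empty by blast
        qed
      qed
      then have "p (A n) \<le> p ?R1 + p ?R2" using lB[OF abS(2,3)] by (intro p_sub)
      also have "p ?R1 = measure \<nu> {w\<in>R_plus. a n w \<in> - (a n ` K)}" by (rule p1[OF abS(2)])
      also have "p ?R2 = measure \<mu> {y\<in>UNIV. b n y \<in> - (b n ` L)}" by (rule p2[OF abS(3)])
      also have "measure \<nu> {w\<in>R_plus. a n w \<in> - (a n ` K)} \<le> e/4"
      proof -
        interpret N: prob_space \<nu> using borel_probsD[OF \<nu>] by simp
        have Ks: "K \<in> sets \<nu>" using K(1,2) borel_probsD(2)[OF \<nu>] by (simp add: sets_restrict_space_iff borel_compact)
        have "measure \<nu> {w\<in>R_plus. a n w \<in> - (a n ` K)} \<le> measure \<nu> (space \<nu> - K)"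
          by (rule N.finite_measure_mono[OF _ sets.compl_sets[OF Ks]]) (use borel_probsD(3)[OF \<nu>] in auto)
        also have "\<dots> = 1 - measure \<nu> K" by (rule N.prob_compl[OF Ks])
        finally show ?thesis using K(4) by simp
      qed
      also have "measure \<mu> {y\<in>UNIV. b n y \<in> - (b n ` L)} \<le> e/4"
      proof -
        interpret N: prob_space \<mu> using borel_probsD[OF \<mu>] by simp
        have Ls: "L \<in> sets \<mu>" using L(1) borel_probsD(2)[OF \<mu>] by (simp add: borel_compact)
        have "measure \<mu> {y\<in>UNIV. b n y \<in> - (b n ` L)} \<le> measure \<mu> (space \<mu> - L)"
          by (rule N.finite_measure_mono[OF _ sets.compl_sets[OF Ls]]) (use borel_probsD(3)[OF \<mu>] in auto)
        also have "\<dots> = 1 - measure \<mu> L" by (rule N.prob_compl[OF Ls])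
        finally show ?thesis using L(3) by simp
      qed
      finally show ?thesis using e by (intro exI[of _ n]) simp
    qed
    have "(\<lambda>i. p (A i)) \<longlonglongrightarrow> 0"
    proof (rule order_tendstoI)
      fix c :: real assume "c < 0"
      then show "\<forall>\<^sub>F i in sequentially. c < p (A i)" using p0 by (auto intro!: always_eventually less_le_trans[of c 0])
    next
      fix c :: real assume "0 < c"
      then obtain n where "p (A n) < c" using small by blast
      then show "\<forall>\<^sub>F i in sequentially. p (A i) < c"
        unfolding eventually_sequentially using mono by (intro exI[of _ n] allI impI) (rule le_less_trans)
    qed
    then show ?thesis using tendsto_ennrealI by fastforce
  qed
  have "\<exists>\<kappa>. (\<forall>R\<in>labalg \<nu> \<mu>. \<kappa> R = ennreal (p R)) \<and> measure_space ?Z (sigma_sets ?Z (labalg \<nu> \<mu>)) \<kappa>"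
  proof (rule alg.caratheodory_empty_continuous)
    show "positive (labalg \<nu> \<mu>) (\<lambda>R. ennreal (p R))" by (simp add: positive_def pempty)
    show "additive (labalg \<nu> \<mu>) (\<lambda>R. ennreal (p R))"
      unfolding additive_def using p_add labB p0 by (auto simp: ennreal_plus)
  qed (use cont in auto)
  then obtain \<kappa> where \<kappa>: "\<And>R. R \<in> labalg \<nu> \<mu> \<Longrightarrow> \<kappa> R = ennreal (p R)" "measure_space ?Z (sigma_sets ?Z (labalg \<nu> \<mu>)) \<kappa>" by blast
  define \<rho> where "\<rho> = measure_of ?Z (sigma_sets ?Z (labalg \<nu> \<mu>)) \<kappa>"
  have sa: "sigma_algebra ?Z (sigma_sets ?Z (labalg \<nu> \<mu>))" using \<kappa>(2) by (simp add: measure_space_def)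
  have sets_\<rho>: "sets \<rho> = ?B"
    unfolding \<rho>_def using sigma_algebra.sets_measure_of_eq[OF sa] sigma_labalg[OF \<nu> \<mu>] by simp
  have space_\<rho>: "space \<rho> = ?Z" using sets_eq_imp_space_eq[OF sets_\<rho>] by (simp add: space_restrict_space)
  have em: "emeasure \<rho> R = ennreal (p R)" if "R \<in> labalg \<nu> \<mu>" for R
  proof -
    have "emeasure \<rho> R = \<kappa> R"
      unfolding \<rho>_def using \<kappa>(2) that by (intro emeasure_measure_of_sigma) (auto simp: measure_space_def)
    then show ?thesis using \<kappa>(1)[OF that] by simp
  qed
  have mp: "measure \<rho> (labset a b S) = p (labset a b S)" if "clab \<nu> a" "clab \<mu> b" for a b S
  proof -
    have "labset a b S \<in> labalg \<nu> \<mu>" using that unfolding labalg_def by blast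
    then show ?thesis using em p0 by (simp add: measure_def)
  qed
  have \<rho>: "\<rho> \<in> borel_probs ?Z"
  proof -
    have "emeasure \<rho> (space \<rho>) = 1" using em[OF alg.top] pZ space_\<rho> by simp
    then show ?thesis using sets_\<rho> by (auto simp: borel_probs_def intro: prob_spaceI)
  qed
  have "marginal1 \<rho> = \<nu>"
  proof (rule borel_probs_eq_clab[OF marginal1_borel_probs[OF \<rho>] \<nu>])
    fix a :: "real \<Rightarrow> nat" and T assume a: "clab \<nu> a"
    let ?b = "\<lambda>_::'s. 0"
    have "labset a ?b (T \<times> UNIV) = {w\<in>R_plus. a w \<in> T} \<times> UNIV" by (auto simp: labset_def)
    moreover have "{w\<in>R_plus. a w \<in> T} \<in> sets (restrict_space borel R_plus)"
      using measurable_sets[OF clab_measurable[OF \<nu> a], of T] by (simp add: space_restrict_space vimage_def Int_def conj_commute)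
    ultimately have "measure (marginal1 \<rho>) {w\<in>R_plus. a w \<in> T} = measure \<rho> (labset a ?b (T \<times> UNIV))"
      using measure_marginal1[OF \<rho>] by simp
    also have "\<dots> = measure \<nu> {w\<in>R_plus. a w \<in> T}" using mp[OF a clab_const] p1[OF a] by simp
    finally show "measure (marginal1 \<rho>) {w\<in>R_plus. a w \<in> T} = measure \<nu> {w\<in>R_plus. a w \<in> T}" .
  qed simp
  moreover have "marginal2 \<rho> = \<mu>"
  proof (rule borel_probs_eq_clab[OF marginal2_borel_probs[OF \<rho>] \<mu>])
    fix b :: "'s \<Rightarrow> nat" and T assume b: "clab \<mu> b"
    let ?a = "\<lambda>_::real. 0"
    have "labset ?a b (UNIV \<times> T) = R_plus \<times> {y\<in>UNIV. b y \<in> T}" by (auto simp: labset_def)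
    moreover have "{y\<in>UNIV. b y \<in> T} \<in> sets borel"
      using measurable_sets[OF clab_measurable_UNIV[OF \<mu> b], of T] by (simp add: vimage_def)
    ultimately have "measure (marginal2 \<rho>) {y\<in>UNIV. b y \<in> T} = measure \<rho> (labset ?a b (UNIV \<times> T))"
      using measure_marginal2[OF \<rho>] by simp
    also have "\<dots> = measure \<mu> {y\<in>UNIV. b y \<in> T}" using mp[OF clab_const b] p2[OF b] by simp
    finally show "measure (marginal2 \<rho>) {y\<in>UNIV. b y \<in> T} = measure \<mu> {y\<in>UNIV. b y \<in> T}" .
  qed simp
  moreover have "((\<lambda>m. beta_BL \<delta> (\<rho>s m) \<rho>) \<longlongrightarrow> 0) F"
  proof (rule order_tendstoI)
    fix c :: real assume "c < 0"
    then show "\<forall>\<^sub>F m in F. c < beta_BL \<delta> (\<rho>s m) \<rho>" using beta_BL_nonneg by (auto intro!: always_eventually less_le_trans[of c 0])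
  next
    fix c :: real assume c: "0 < c"
    \<comment> \<open>\<open>beta_BL_close\<close> yields 6 e, which has to be below
      \<open>c\<close>.\<close>
    define e where "e = c / 7"
    have e: "e > 0" using c by (simp add: e_def)
    obtain a b S where ab: "clab \<nu> a" "clab \<mu> b" and good: "measure \<rho> (labset a b S) > 1 - e"
      and small: "\<And>z z'. z \<in> labset a b S \<Longrightarrow> z' \<in> R_plus_times \<Longrightarrow> a (fst z) = a (fst z') \<Longrightarrow> b (snd z) = b (snd z') \<Longrightarrow> mdist \<delta> z z' < e"
      by (rule fine_labels[OF \<nu> \<mu> \<rho> e]) blast
    note fin = clab_finite_range(1)[OF \<nu> ab(1)] clab_finite_range(2)[OF \<mu> ab(2)]
    have "((\<lambda>m. \<Sum>i\<in>a ` R_plus. \<Sum>j\<in>range b. \<bar>ltab (\<rho>s m) a b i j - ltab \<rho> a b i j\<bar>) \<longlongrightarrow>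
       (\<Sum>i\<in>a ` R_plus. \<Sum>j\<in>range b. \<bar>ltab \<rho> a b i j - ltab \<rho> a b i j\<bar>)) F"
      unfolding ltab_def mp[OF ab] by (intro tendsto_intros lim)
    then have "\<forall>\<^sub>F m in F. (\<Sum>i\<in>a ` R_plus. \<Sum>j\<in>range b. \<bar>ltab (\<rho>s m) a b i j - ltab \<rho> a b i j\<bar>) < e"
      using e by (intro order_tendstoD(2)) auto
    then show "\<forall>\<^sub>F m in F. beta_BL \<delta> (\<rho>s m) \<rho> < c"
    proof eventually_elim
      case (elim m)
      have "beta_BL \<delta> (\<rho>s m) \<rho> \<le> 6 * e"
        by (rule beta_BL_close[OF \<rho> rs clab_measurable[OF \<nu> ab(1)] clab_measurable_UNIV[OF \<mu> ab(2)] fin(1) order_refl fin(2) order_refl good small less_imp_le[OF elim]])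
      then show ?case using e by (simp add: e_def)
    qed
  qed
  ultimately show thesis using that \<rho> F by blast
qed

end

context product_metric
begin

lemma M11_times_I: "\<rho> \<in> borel_probs R_plus_times \<Longrightarrow> marginal1 \<rho> \<in> M11 \<Longrightarrow> \<rho> \<in> M11_times"
  by (auto simp: M11_times_def M11_def)

text \<open>In the end only one real sequence, the distance to the cluster point, has to tend to 0,
  so the filter can be exchanged for a subsequence.\<close>

lemma cluster_subseq:
  assumes "F \<noteq> bot" "F \<le> sequentially" "((\<lambda>m. g m) \<longlongrightarrow> (0::real)) F"
  obtains r where "strict_mono (r :: nat \<Rightarrow> nat)" "\<And>k. g (r k) < 1 / real (Suc k)"
proof -
  have "\<exists>m>n. g m < 1 / real (Suc k)" for n k
  proof -
    have "\<forall>\<^sub>F m in F. g m < 1 / real (Suc k)" using assms(3) by (rule order_tendstoD(2)) simp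
    moreover have "\<forall>\<^sub>F m in F. n < m" using assms(2) eventually_gt_at_top[of n] by (rule filter_leD)
    ultimately have "\<forall>\<^sub>F m in F. n < m \<and> g m < 1 / real (Suc k)" by eventually_elim simp
    then show ?thesis using eventually_happens[of _ F] assms(1) by blast
  qed
  then have "\<forall>n k. \<exists>m. n < m \<and> g m < 1 / real (Suc k)" by blast
  then obtain f where f: "\<And>n k. n < f n k \<and> g (f n k) < 1 / real (Suc k)" by metis
  define r where "r = rec_nat (f 0 0) (\<lambda>k n. f n (Suc k))"
  have r0: "g (r 0) < 1 / real (Suc 0)" unfolding r_def using f by (simp del: of_nat_Suc)
  have rS: "r k < r (Suc k) \<and> g (r (Suc k)) < 1 / real (Suc (Suc k))" for k
    unfolding r_def using f by (simp del: of_nat_Suc)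
  have "strict_mono r" using rS by (intro strict_monoI_Suc) blast
  moreover have "g (r k) < 1 / real (Suc k)" for k using r0 rS by (cases k) auto
  ultimately show thesis by (rule that)
qed

lemma Delta_compact:
  fixes \<rho>s :: "nat \<Rightarrow> (real \<times> 's) measure"
  assumes rs: "\<And>m. \<rho>s m \<in> M11_times" and \<nu>: "\<nu> \<in> M11" and \<mu>: "\<mu> \<in> borel_probs UNIV"
    and w1: "(\<lambda>m. W1 (marginal1 (\<rho>s m)) \<nu>) \<longlonglongrightarrow> 0"
    and w2: "wconv UNIV sequentially (\<lambda>m. marginal2 (\<rho>s m)) \<mu>"
  obtains \<rho> r where "\<rho> \<in> M11_times" "marginal1 \<rho> = \<nu>" "marginal2 \<rho> = \<mu>" "strict_mono (r :: nat \<Rightarrow> nat)"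
    "limitin D.mtopology (\<rho>s \<circ> r) \<rho> sequentially"
proof -
  obtain \<rho> F where \<rho>: "\<rho> \<in> borel_probs R_plus_times" "marginal1 \<rho> = \<nu>" "marginal2 \<rho> = \<mu>" and F: "F \<noteq> bot" "F \<le> sequentially"
    and lim: "((\<lambda>m. beta_BL \<delta> (\<rho>s m) \<rho>) \<longlongrightarrow> 0) F"
    by (rule coupling_cluster_point[OF M11_timesD(1)[OF rs] M11_D(1)[OF \<nu>] \<mu> wconv_W1[OF \<nu> M11_timesD(2)[OF rs] w1] w2])
  have "((\<lambda>m. W1 (marginal1 (\<rho>s m)) \<nu>) \<longlongrightarrow> 0) F" using w1 F(2) by (rule tendsto_mono[rotated])
  then have "((\<lambda>m. Delta \<delta> (\<rho>s m) \<rho>) \<longlongrightarrow> 0 + 0) F"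
    unfolding Delta_def \<rho>(2) using lim by (rule tendsto_add)
  then have "((\<lambda>m. Delta \<delta> (\<rho>s m) \<rho>) \<longlongrightarrow> 0) F" by simp
  then obtain r where r: "strict_mono (r :: nat \<Rightarrow> nat)" "\<And>k. Delta \<delta> (\<rho>s (r k)) \<rho> < 1 / real (Suc k)"
    by (rule cluster_subseq[OF F]) blast
  have M: "\<rho> \<in> M11_times" using \<rho> \<nu> by (intro M11_times_I) auto
  have "(\<lambda>k. Delta \<delta> (\<rho>s (r k)) \<rho>) \<longlonglongrightarrow> 0"
  proof (rule tendsto_sandwich[OF _ _ tendsto_const])
    show "\<forall>\<^sub>F k in sequentially. Delta \<delta> (\<rho>s (r k)) \<rho> \<le> 1 / real (Suc k)" using r(2) by (intro always_eventually allI less_imp_le)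
    show "(\<lambda>k. 1 / real (Suc k)) \<longlonglongrightarrow> 0" using LIMSEQ_inverse_real_of_nat by (simp add: inverse_eq_divide)
  qed simp
  then have "limitin D.mtopology (\<rho>s \<circ> r) \<rho> sequentially"
    unfolding D.limitin_metric using M rs by (auto simp: tendsto_iff dist_real_def)
  then show thesis using that M \<rho> r by blast
qed

lemma limitin_Delta:
  assumes "limitin D.mtopology \<rho>s \<rho> sequentially" and rs: "\<And>m. \<rho>s m \<in> M11_times"
  shows "(\<lambda>m. Delta \<delta> (\<rho>s m) \<rho>) \<longlonglongrightarrow> 0" "\<rho> \<in> M11_times"
  using assms unfolding D.limitin_metric by (auto simp: tendsto_iff dist_real_def)

end

lemma ereal_add_less: "ereal h < x \<Longrightarrow> ereal i < y \<Longrightarrow> ereal (h + i) < x + y"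
  by (cases x; cases y) auto

lemma labels_tendsto_MI:
  fixes \<rho> :: "(real \<times> 's::polish_space) measure"
  assumes \<rho>: "\<rho> \<in> borel_probs R_plus_times" and P: "\<And>m. P m \<in> borel_probs R_plus_times"
    and w: "wconv R_plus_times F P \<rho>" and a: "clab (marginal1 \<rho>) a" and b: "clab (marginal2 \<rho>) b"
  shows "((\<lambda>m. MI I J (ltab (P m) a b)) \<longlongrightarrow> MI I J (ltab \<rho> a b)) F"
  unfolding ltab_def by (intro tendsto_MI wconv_labset[OF \<rho> P w a b])

section \<open>Lower semicontinuity and compact level sets of the rate function\<close>

locale rate_setting = product_metric \<delta> for \<delta> :: "(real \<times> 's::polish_space) metric" +
  fixes I_W :: "real measure \<Rightarrow> ereal" and \<mu> :: "'s measure"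
  assumes \<mu>: "\<mu> \<in> borel_probs UNIV" and good: "good_rate_function M11_topology I_W"
begin

interpretation W: Metric_space M11 W1 by (rule Metric_space_M11)

lemma topspace_M11: "topspace M11_topology = M11" by (simp add: M11_topology_def)

lemma I_W_nonneg: "\<nu> \<in> M11 \<Longrightarrow> 0 \<le> I_W \<nu>"
  using good by (auto simp: good_rate_function_def rate_function_def topspace_M11)

lemma I_W_lsc:
  assumes "\<nu> \<in> M11" "c < I_W \<nu>"
  obtains e where "e > 0" "\<And>\<nu>'. \<nu>' \<in> M11 \<Longrightarrow> W1 \<nu> \<nu>' < e \<Longrightarrow> c < I_W \<nu>'"
proof -
  have "openin W.mtopology {y \<in> M11. c < I_W y}"
    using good by (simp add: good_rate_function_def rate_function_def lower_semicontinuous_def topspace_M11 flip: M11_topology_def)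
  then obtain e where "e > 0" "W.mball \<nu> e \<subseteq> {y \<in> M11. c < I_W y}" using assms by (auto simp: W.openin_mtopology)
  then show thesis using assms by (intro that[of e]) auto
qed

abbreviation "J \<equiv> rate_J I_W \<mu>"

lemma J_nonneg: "\<rho> \<in> M11_times \<Longrightarrow> 0 \<le> J \<rho>"
  using entropy_nonneg[OF M11_timesD(1)] I_W_nonneg[OF M11_timesD(2)] by (auto simp: rate_J_def intro!: add_nonneg_nonneg)

text \<open>A number below the sum splits into one below the entropy and one below
  \<open>I_W\<close>, either of which may be infinite; a continuity labelling then witnesses the
  first. Such witnesses survive small changes of \<open>\<rho>\<close>, which serves both lower
  semicontinuity and the local upper bound.\<close>

lemma J_local:
  fixes c :: real
  assumes \<rho>: "\<rho> \<in> M11_times" and m2: "marginal2 \<rho> = \<mu>" and c: "ereal c < J \<rho>"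
  obtains a b h i where "clab (marginal1 \<rho>) a" "clab \<mu> b" "c < h + i"
    "h < MI (a ` R_plus) (range b) (ltab \<rho> a b)" "ereal i < I_W (marginal1 \<rho>)"
proof -
  note r = M11_timesD[OF \<rho>]
  let ?H = "relative_entropy \<rho> (marginal1 \<rho> \<Otimes>\<^sub>M \<mu>)"
  have J: "J \<rho> = ?H + I_W (marginal1 \<rho>)" by (simp add: rate_J_def m2)
  have H0: "0 \<le> ?H" using entropy_nonneg[OF r(1)] m2 by simp
  have I0: "0 \<le> I_W (marginal1 \<rho>)" by (rule I_W_nonneg[OF r(2)])
  have "\<exists>h i. ereal h < ?H \<and> ereal i < I_W (marginal1 \<rho>) \<and> c < h + i"
  proof (cases ?H)
    case (real x)
    show ?thesis
    proof (cases "I_W (marginal1 \<rho>)")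
      case (real y)
      \<comment> \<open>A third of the gap: lowering both terms by \<open>d\<close> leaves their sum
        at c + d.\<close>
      define d where "d = (x + y - c) / 3"
      have "d > 0" "x + y = c + 3 * d" using c J \<open>?H = ereal x\<close> real by (simp_all add: d_def field_simps)
      then show ?thesis using real \<open>?H = ereal x\<close>
        by - (rule exI[of _ "x - d"], rule exI[of _ "y - d"], auto)
    next
      case PInf
      then show ?thesis using real by - (rule exI[of _ "x - 1"], rule exI[of _ "c - x + 2"], auto)
    qed (use I0 in auto)
  next
    case PInf
    then show ?thesis
    proof (cases "I_W (marginal1 \<rho>)")
      case (real y)
      then show ?thesis using PInf by - (rule exI[of _ "c - y + 2"], rule exI[of _ "y - 1"], auto)
    next
      case PInf': PInf
      then show ?thesis using PInf by - (rule exI[of _ "c + 1"], rule exI[of _ "0"], auto)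
    qed (use I0 in auto)
  qed (use H0 in auto)
  then obtain h i where hi: "ereal h < ?H" "ereal i < I_W (marginal1 \<rho>)" "c < h + i" by blast
  have "\<exists>a b. clab (marginal1 \<rho>) a \<and> clab \<mu> b \<and> h < MI (a ` R_plus) (range b) (ltab \<rho> a b)"
  proof (rule ccontr)
    assume "\<not> ?thesis"
    then have "relative_entropy \<rho> (marginal1 \<rho> \<Otimes>\<^sub>M marginal2 \<rho>) \<le> ereal h"
      using m2 by (intro entropy_le_MI[OF r(1)]) (auto simp: not_less)
    then show False using hi(1) m2 by simp
  qed
  then show thesis using that hi by blast
qed

text \<open>The mutual information of a fixed continuity labelling of the limit converges, and along
  the sequence it is at most the entropy. With lower semicontinuity of \<open>I_W\<close> and
  continuity of the second marginal this prevents \<open>J\<close> from exceeding \<open>c\<close>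
  at the limit.\<close>

lemma J_seq_closed:
  fixes \<rho>s :: "nat \<Rightarrow> (real \<times> 's) measure" and c :: real
  assumes rs: "\<And>m. \<rho>s m \<in> M11_times" and lim: "limitin D.mtopology \<rho>s \<rho> sequentially" and le: "\<And>m. J (\<rho>s m) \<le> ereal c"
  shows "J \<rho> \<le> ereal c"
proof -
  note L = limitin_Delta[OF lim rs]
  note D = Delta_tendsto_D[OF L(1)]
  note r = M11_timesD[OF L(2)] and rm = M11_timesD[OF rs]
  have w: "wconv R_plus_times sequentially \<rho>s \<rho>" by (rule wconv_beta_BL[OF r(1) rm(1) D(2)])
  have m2: "marginal2 (\<rho>s m) = \<mu>" for m using le[of m] by (auto simp: rate_J_def split: if_splits)
  have m: "marginal2 \<rho> = \<mu>"
  proof -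
    have "wconv UNIV sequentially (\<lambda>_. \<mu>) (marginal2 \<rho>)"
      using wconv_marginal2[OF r(1) rm(1) w] by (simp add: m2)
    then show ?thesis by (intro wconv_const_eq[symmetric, where E=UNIV and F=sequentially]) (use \<mu> r in auto)
  qed
  show ?thesis
  proof (rule ccontr)
    assume "\<not> J \<rho> \<le> ereal c"
    then have "ereal c < J \<rho>" by simp
    then obtain a b h i where ab: "clab (marginal1 \<rho>) a" "clab \<mu> b" "c < h + i"
      "h < MI (a ` R_plus) (range b) (ltab \<rho> a b)" "ereal i < I_W (marginal1 \<rho>)"
      by (rule J_local[OF L(2) m])
    note fin = clab_finite_range(1)[OF M11_D(1)[OF r(2)] ab(1)] clab_finite_range(2)[OF \<mu> ab(2)]
    note mm = clab_measurable[OF M11_D(1)[OF r(2)] ab(1)] clab_measurable_UNIV[OF \<mu> ab(2)]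
    have "\<forall>\<^sub>F k in sequentially. h < MI (a ` R_plus) (range b) (ltab (\<rho>s k) a b)"
      using labels_tendsto_MI[OF r(1) rm(1) w ab(1)] ab(2,4) m by (intro order_tendstoD(1)) auto
    moreover obtain e where e: "e > 0" "\<And>\<nu>'. \<nu>' \<in> M11 \<Longrightarrow> W1 (marginal1 \<rho>) \<nu>' < e \<Longrightarrow> ereal i < I_W \<nu>'"
      by (rule I_W_lsc[OF r(2) ab(5)]) blast
    have "\<forall>\<^sub>F k in sequentially. W1 (marginal1 (\<rho>s k)) (marginal1 \<rho>) < e"
      using D(1) e(1) by (rule order_tendstoD(2))
    ultimately have "\<forall>\<^sub>F k in sequentially. False"
    proof eventually_elim
      case (elim k)
      have "ereal h < relative_entropy (\<rho>s k) (marginal1 (\<rho>s k) \<Otimes>\<^sub>M \<mu>)"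
        using MI_le_entropy[OF rm(1)[of k] fin order_refl order_refl mm] elim(1) m2 by (metis ereal_less_eq(3) less_ereal.simps(1) order_less_le_trans)
      moreover have "ereal i < I_W (marginal1 (\<rho>s k))"
        using e(2)[OF rm(2)[of k]] elim(2) W1_commute by metis
      ultimately have "ereal (h + i) < J (\<rho>s k)" using ereal_add_less by (simp add: rate_J_def m2)
      then have "ereal (h + i) < ereal c" using le[of k] by (rule order_less_le_trans)
      then show False using ab(3) by simp
    qed
    then show False by simp
  qed
qed

text \<open>Entropy is nonnegative, so the first marginals of a level set of \<open>J\<close> lie in
  a level set of \<open>I_W\<close>, which is compact. Along a subsequence they converge, and
  \<open>Delta_compact\<close> lifts this to the measures on pairs.\<close>

lemma good_J: "good_rate_function (M11_times_topology \<delta>) J"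
  unfolding good_rate_function_def rate_function_def
proof (intro conjI allI)
  have ts: "topspace (M11_times_topology \<delta>) = M11_times" by (simp add: M11_times_topology_def)
  show "\<forall>y\<in>topspace (M11_times_topology \<delta>). 0 \<le> J y" using J_nonneg by (simp add: ts)
  have closed: "closedin D.mtopology {y \<in> M11_times. J y \<le> ereal c}" for c
    unfolding D.metric_closedin_iff_sequentially_closed
  proof (intro conjI allI impI)
    fix \<sigma> l assume *: "range \<sigma> \<subseteq> {y \<in> M11_times. J y \<le> ereal c} \<and> limitin D.mtopology \<sigma> l sequentially"
    then have s: "\<And>m. \<sigma> m \<in> M11_times" "\<And>m. J (\<sigma> m) \<le> ereal c" by auto
    show "l \<in> {y \<in> M11_times. J y \<le> ereal c}"
      using J_seq_closed[OF s(1) conjunct2[OF *] s(2)] limitin_Delta(2)[OF conjunct2[OF *] s(1)] by simp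
  qed auto
  show "lower_semicontinuous (M11_times_topology \<delta>) J"
    unfolding lower_semicontinuous_def ts unfolding M11_times_topology_def
  proof
    fix c :: ereal
    show "openin D.mtopology {y \<in> M11_times. c < J y}"
    proof (cases c)
      case (real x)
      have "{y \<in> M11_times. c < J y} = topspace D.mtopology - {y \<in> M11_times. J y \<le> ereal x}" using real by auto
      then show ?thesis using closed[of x] by (simp only: closedin_def)
    next
      case PInf
      then show ?thesis by simp
    next
      case MInf
      then have "{y \<in> M11_times. c < J y} = topspace D.mtopology"
      proof -
        have "c < J y" if "y \<in> M11_times" for y using J_nonneg[OF that] MInf by (cases "J y") auto
        then show ?thesis by auto
      qed
      then show ?thesis by (simp only: openin_topspace)
    qed
  qed
  fix c :: real
  show "compactin (M11_times_topology \<delta>) {y \<in> topspace (M11_times_topology \<delta>). J y \<le> ereal c}"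
    unfolding ts unfolding M11_times_topology_def D.compactin_sequentially
  proof (intro conjI allI impI)
    fix \<sigma> :: "nat \<Rightarrow> (real \<times> 's) measure" assume "range \<sigma> \<subseteq> {y \<in> M11_times. J y \<le> ereal c}"
    then have s: "\<And>m. \<sigma> m \<in> M11_times" "\<And>m. J (\<sigma> m) \<le> ereal c" by auto
    have m2: "marginal2 (\<sigma> m) = \<mu>" for m using s(2)[of m] by (auto simp: rate_J_def split: if_splits)
    have IW: "I_W (marginal1 (\<sigma> m)) \<le> ereal c" for m
    proof -
      have "I_W (marginal1 (\<sigma> m)) \<le> J (\<sigma> m)"
        using entropy_nonneg[OF M11_timesD(1)[OF s(1)[of m]]] by (simp add: rate_J_def m2 add_increasing)
      then show ?thesis using s(2)[of m] by simp
    qed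
    have "compactin W.mtopology {y \<in> M11. I_W y \<le> ereal c}"
      using good by (simp add: good_rate_function_def topspace_M11 flip: M11_topology_def)
    moreover have "range (\<lambda>m. marginal1 (\<sigma> m)) \<subseteq> {y \<in> M11. I_W y \<le> ereal c}" using IW M11_timesD(2)[OF s(1)] by auto
    ultimately obtain \<nu> r where \<nu>: "\<nu> \<in> M11" and r: "strict_mono (r :: nat \<Rightarrow> nat)" "limitin W.mtopology ((\<lambda>m. marginal1 (\<sigma> m)) \<circ> r) \<nu> sequentially"
      unfolding W.compactin_sequentially by blast
    have l: "(\<lambda>m. W1 (marginal1 ((\<sigma> \<circ> r) m)) \<nu>) \<longlonglongrightarrow> 0"
      using r(2) by (auto simp: W.limitin_metric tendsto_iff dist_real_def W1_nonneg elim!: eventually_mono)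
    have w2: "wconv UNIV sequentially (\<lambda>m. marginal2 ((\<sigma> \<circ> r) m)) \<mu>" by (simp add: m2 wconv_def)
    have sr: "(\<sigma> \<circ> r) m \<in> M11_times" for m using s(1) by simp
    obtain \<rho> r' where \<rho>: "\<rho> \<in> M11_times" "strict_mono (r' :: nat \<Rightarrow> nat)" "limitin D.mtopology ((\<sigma> \<circ> r) \<circ> r') \<rho> sequentially"
      by (rule Delta_compact[OF sr \<nu> \<mu> l w2]) blast
    have "J \<rho> \<le> ereal c" by (rule J_seq_closed[OF _ \<rho>(3)]) (use s in auto)
    then show "\<exists>l r. l \<in> {y \<in> M11_times. J y \<le> ereal c} \<and> strict_mono r \<and> limitin D.mtopology (\<sigma> \<circ> r) l sequentially"
      using \<rho> r by (intro exI[of _ \<rho>] exI[of _ "r \<circ> r'"]) (auto simp: comp_assoc strict_mono_o)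
  qed auto
qed

end

section \<open>Large deviation bounds on an exponential scale\<close>

text \<open>The passage to exponential form removes the value - \<infinity> of \<open>elog\<close>
  at 0 from all later estimates.\<close>

lemma scaled_elog_le_iff:
  assumes "p \<ge> 0" "n \<ge> 1"
  shows "ereal (1 / real n) * elog p \<le> ereal t \<longleftrightarrow> p \<le> exp (real n * t)"
proof (cases "p = 0")
  case False
  then have p: "p > 0" using assms by simp
  have "1 / real n * ln p \<le> t \<longleftrightarrow> ln p \<le> real n * t" using assms by (simp add: field_simps)
  also have "\<dots> \<longleftrightarrow> p \<le> exp (real n * t)" using p by (metis exp_le_cancel_iff exp_ln)
  finally show ?thesis using p by (simp add: elog_def)
qed (use assms in \<open>simp add: elog_def\<close>)

lemma scaled_elog_ge_iff:
  assumes "p \<ge> 0" "n \<ge> 1"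
  shows "ereal t \<le> ereal (1 / real n) * elog p \<longleftrightarrow> exp (real n * t) \<le> p"
proof (cases "p = 0")
  case False
  then have p: "p > 0" using assms by simp
  have "t \<le> 1 / real n * ln p \<longleftrightarrow> real n * t \<le> ln p" using assms by (simp add: field_simps)
  also have "\<dots> \<longleftrightarrow> exp (real n * t) \<le> p" using p by (metis exp_le_cancel_iff exp_ln)
  finally show ?thesis using p by (simp add: elog_def)
qed (use assms in \<open>simp add: elog_def not_le\<close>)

lemma openin_borel_of: "openin X U \<Longrightarrow> U \<in> sets (borel_of X)"
  by (auto simp: borel_of_def sets_measure_of_conv dest: openin_subset intro: sigma_sets.Basic)

lemma space_borel_of [simp]: "space (borel_of X) = topspace X"
  by (auto simp: borel_of_def space_measure_of_conv)

lemma closedin_borel_of: "closedin X C \<Longrightarrow> C \<in> sets (borel_of X)"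
proof -
  assume C: "closedin X C"
  then have "C = space (borel_of X) - (topspace X - C)" using closedin_subset[OF C] by auto
  moreover have "topspace X - C \<in> sets (borel_of X)" using C by (intro openin_borel_of) (simp add: closedin_def)
  ultimately show ?thesis by (metis sets.compl_sets)
qed

lemma LDP_closed_upper:
  assumes "LDP X P I" "closedin X C" "\<And>y. y \<in> C \<Longrightarrow> ereal c \<le> I y" "e > 0"
  shows "\<forall>\<^sub>F n in sequentially. measure (P n) C \<le> exp (- real n * (c - e))"
proof -
  have "limsup (\<lambda>n. ereal (1 / real n) * elog (measure (P n) C)) \<le> - (INF y\<in>X closure_of C. I y)"
    using assms(1) closedin_borel_of[OF assms(2)] by (simp add: LDP_def)
  also have "X closure_of C = C" using assms(2) by (simp add: closure_of_closedin)
  also have "- (INF y\<in>C. I y) \<le> - ereal c" 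
    unfolding ereal_minus_le_minus by (rule INF_greatest) (rule assms(3))
  also have "\<dots> < ereal (- (c - e))" using assms(4) by simp
  finally have "\<forall>\<^sub>F n in sequentially. ereal (1 / real n) * elog (measure (P n) C) < ereal (- (c - e))"
    by (rule Limsup_lessD)
  then show ?thesis using eventually_ge_at_top[of 1]
  proof eventually_elim
    case (elim n)
    then have "ereal (1 / real n) * elog (measure (P n) C) \<le> ereal (- (c - e))" by simp
    then have "measure (P n) C \<le> exp (real n * (- (c - e)))" using elim by (subst (asm) scaled_elog_le_iff) auto
    then show ?case by (simp add: algebra_simps)
  qed
qed

lemma LDP_open_lower:
  assumes "LDP X P I" "openin X U" "y \<in> U" "I y \<le> ereal c" "e > 0"
  shows "\<forall>\<^sub>F n in sequentially. exp (- real n * (c + e)) \<le> measure (P n) U"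
proof -
  have "ereal (- (c + e)) < - ereal c" using assms(5) by simp
  also have "- ereal c \<le> - (INF y\<in>U. I y)"
    unfolding ereal_minus_le_minus using assms(3,4) by (rule INF_lower2)
  also have "U = X interior_of U" using assms(2) by (simp add: interior_of_openin)
  also have "- (INF y\<in>X interior_of U. I y) \<le> liminf (\<lambda>n. ereal (1 / real n) * elog (measure (P n) U))"
    using assms(1) openin_borel_of[OF assms(2)] by (simp add: LDP_def)
  finally have "\<forall>\<^sub>F n in sequentially. ereal (- (c + e)) < ereal (1 / real n) * elog (measure (P n) U)"
    by (rule less_LiminfD)
  then show ?thesis using eventually_ge_at_top[of 1]
  proof eventually_elim
    case (elim n)
    then have "ereal (- (c + e)) \<le> ereal (1 / real n) * elog (measure (P n) U)" by simp
    then have "exp (real n * (- (c + e))) \<le> measure (P n) U" using elim by (subst (asm) scaled_elog_ge_iff) auto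
    then show ?case by (simp add: algebra_simps)
  qed
qed

text \<open>Monotonicity reduces a general set to its interior and its closure, and points of
  infinite rate impose no lower bound. The strict inequality assumed in \<open>upper\<close> is the
  form in which \<open>local_upper\<close> can be applied at every point of the closed set.\<close>

lemma LDP_I:
  assumes P: "\<And>n. n \<ge> 1 \<Longrightarrow> prob_space (P n) \<and> sets (P n) = sets (borel_of X)"
    and rate: "rate_function X I"
    and upper: "\<And>C c e. closedin X C \<Longrightarrow> (\<And>y. y \<in> C \<Longrightarrow> ereal c < I y) \<Longrightarrow> e > 0 \<Longrightarrow>
       \<forall>\<^sub>F n in sequentially. measure (P n) C \<le> exp (- real n * (c - e))"
    and lower: "\<And>U y c e. openin X U \<Longrightarrow> y \<in> U \<Longrightarrow> I y = ereal c \<Longrightarrow> e > 0 \<Longrightarrow>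
       \<forall>\<^sub>F n in sequentially. exp (- real n * (c + e)) \<le> measure (P n) U"
  shows "LDP X P I"
  unfolding LDP_def
proof (intro conjI ballI)
  show "\<forall>n\<ge>1. prob_space (P n) \<and> sets (P n) = sets (borel_of X)" using P by blast
  show "rate_function X I" by fact
  fix A assume A: "A \<in> sets (borel_of X)"
  then have As: "A \<subseteq> topspace X" using sets.sets_into_space by fastforce
  let ?l = "\<lambda>n. ereal (1 / real n) * elog (measure (P n) A)"
  show "liminf ?l \<le> limsup ?l" by (rule Liminf_le_Limsup) simp
  have mono: "measure (P n) B \<le> measure (P n) B'" if "n \<ge> 1" "B \<in> sets (borel_of X)" "B' \<in> sets (borel_of X)" "B \<subseteq> B'" for n B B'
  proof -
    interpret prob_space "P n" using P that by simp
    show ?thesis using that P by (intro finite_measure_mono) auto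
  qed
  have Inn: "0 \<le> I y" if "y \<in> topspace X" for y using rate that by (auto simp: rate_function_def)
  show "- (INF y\<in>X interior_of A. I y) \<le> liminf ?l"
  proof (subst ereal_uminus_le_reorder, rule INF_greatest)
    fix y assume y: "y \<in> X interior_of A"
    then have yX: "y \<in> topspace X" using interior_of_subset_topspace by fastforce
    show "- liminf ?l \<le> I y"
    proof (cases "I y")
      case (real c)
      have "ereal (- c) \<le> liminf ?l"
      proof (rule ereal_le_epsilon2)
        fix e :: real assume e: "0 < e"
        have "\<forall>\<^sub>F n in sequentially. exp (- real n * (c + e)) \<le> measure (P n) (X interior_of A)"
          by (rule lower[OF openin_interior_of y real e])
        then have "\<forall>\<^sub>F n in sequentially. ereal (- (c + e)) \<le> ?l n" using eventually_ge_at_top[of 1]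
        proof eventually_elim
          case (elim n)
          note elim(1)
          also have "measure (P n) (X interior_of A) \<le> measure (P n) A"
            by (rule mono[OF elim(2) openin_borel_of[OF openin_interior_of] A interior_of_subset])
          finally have "exp (real n * (- (c + e))) \<le> measure (P n) A" by (simp add: algebra_simps)
          then show ?case using elim by (subst scaled_elog_ge_iff) auto
        qed
        then have "ereal (- (c + e)) \<le> liminf ?l" by (rule Liminf_bounded)
        then have "ereal (- (c + e)) + ereal e \<le> liminf ?l + ereal e" by (rule add_right_mono)
        then show "ereal (- c) \<le> liminf ?l + ereal e" by simp
      qed
      then show ?thesis by (subst ereal_uminus_le_reorder) (simp add: real)
    qed (use Inn[OF yX] in auto)
  qed
  show "limsup ?l \<le> - (INF y\<in>X closure_of A. I y)"
  proof (rule ccontr)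
    let ?s = "INF y\<in>X closure_of A. I y"
    assume "\<not> limsup ?l \<le> - ?s"
    then have "- ?s < limsup ?l" by simp
    \<comment> \<open>Two reals fit between the claimed bound and the limsup: \<open>z1\<close>
      yields the strict lower bound on the rate, and z - z1 serves as the error.\<close>
    then obtain z where z: "- ?s < ereal z" "ereal z < limsup ?l" using ereal_dense2 by blast
    obtain z1 where z1: "- ?s < ereal z1" "ereal z1 < ereal z" using ereal_dense2[OF z(1)] by blast
    have "- ereal z1 < ?s" using z1(1) by (subst (asm) ereal_uminus_less_reorder)
    then have "ereal (- z1) < ?s" by simp
    then have I: "ereal (- z1) < I y" if "y \<in> X closure_of A" for y
      using INF_lower[OF that, of I] by (rule order_less_le_trans)
    have e: "0 < z - z1" using z1(2) by simp
    have "\<forall>\<^sub>F n in sequentially. measure (P n) (X closure_of A) \<le> exp (- real n * (- z1 - (z - z1)))"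
      by (rule upper[OF closedin_closure_of I e])
    then have "\<forall>\<^sub>F n in sequentially. ?l n \<le> ereal z" using eventually_ge_at_top[of 1]
    proof eventually_elim
      case (elim n)
      have "measure (P n) A \<le> measure (P n) (X closure_of A)"
        by (rule mono[OF elim(2) A closedin_borel_of[OF closedin_closure_of] closure_of_subset[OF As]])
      also note elim(1)
      finally have "measure (P n) A \<le> exp (real n * z)" by simp
      then show ?case using elim by (subst scaled_elog_le_iff) auto
    qed
    then have "limsup ?l \<le> ereal z" by (rule Limsup_bounded)
    then show False using z(2) by simp
  qed
qed

section \<open>Empirical measures\<close>

text \<open>As the image of the uniform measure on {1..n} the empirical measure inherits the rules
  for \<open>distr\<close>.\<close>

lemma empirical_eq_distr:
  assumes "n \<ge> 1" and z: "\<And>i. i \<in> {1..n} \<Longrightarrow> z i \<in> space B"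
  shows "empirical_measure B n z = distr (uniform_count_measure {1..n}) B z"
proof -
  let ?U = "uniform_count_measure {1..n}"
  have zm: "z \<in> ?U \<rightarrow>\<^sub>M B"
    using z by (auto simp: measurable_def space_uniform_count_measure sets_uniform_count_measure)
  have eq: "(\<Sum>i=1..n. emeasure (return B (z i)) A) / of_nat n = emeasure (distr ?U B z) A" if A: "A \<in> sets B" for A
  proof -
    have "(\<Sum>i=1..n. emeasure (return B (z i)) A) = (\<Sum>i=1..n. ennreal (indicator A (z i)))"
      using A by (intro sum.cong refl) (simp add: indicator_def)
    also have "\<dots> = ennreal (\<Sum>i=1..n. indicator A (z i))" by (intro sum_ennreal) simp
    also have "(\<Sum>i=1..n. indicator A (z i)) = real (card {i\<in>{1..n}. z i \<in> A})"
      by (simp add: indicator_def sum.If_cases Int_def)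
    also have "ennreal (real (card {i\<in>{1..n}. z i \<in> A})) / of_nat n = ennreal (real (card {i\<in>{1..n}. z i \<in> A}) / real n)"
      using assms(1) by (simp add: divide_ennreal ennreal_of_nat_eq_real_of_nat)
    also have "\<dots> = emeasure ?U (z -` A \<inter> space ?U)"
      by (subst emeasure_uniform_count_measure) (auto simp: space_uniform_count_measure vimage_def Int_def conj_commute)
    also have "\<dots> = emeasure (distr ?U B z) A" using zm A by (simp add: emeasure_distr)
    finally show ?thesis .
  qed
  have "empirical_measure B n z = measure_of (space B) (sets B) (emeasure (distr ?U B z))"
    unfolding empirical_measure_def using eq by (intro measure_of_eq sets.space_closed) (simp add: sets.sigma_sets_eq)
  also have "\<dots> = distr ?U B z" using measure_of_of_measure[of "distr ?U B z"] by simp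
  finally show ?thesis .
qed

lemma prob_space_uniform_interval: "n \<ge> (1::nat) \<Longrightarrow> prob_space (uniform_count_measure {1..n})"
  by (intro prob_space_uniform_count_measure) auto

lemma empirical_facts:
  assumes "n \<ge> 1" and zB: "\<forall>i\<in>{1..n}. z i \<in> space B"
  shows "prob_space (empirical_measure B n z)" "sets (empirical_measure B n z) = sets B" "space (empirical_measure B n z) = space B"
    "A \<in> sets B \<Longrightarrow> measure (empirical_measure B n z) A = real (card {i\<in>{1..n}. z i \<in> A}) / real n"
    "f \<in> borel_measurable B \<Longrightarrow> (\<integral>y. f y \<partial>empirical_measure B n z) = (\<Sum>i=1..n. f (z i)) / real n"
    "g \<in> B \<rightarrow>\<^sub>M C \<Longrightarrow> distr (empirical_measure B n z) C g = empirical_measure C n (\<lambda>i. g (z i))"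
    "h \<in> borel_measurable B \<Longrightarrow> (\<And>y. y \<in> space B \<Longrightarrow> 0 \<le> h y) \<Longrightarrow>
       (\<integral>\<^sup>+y. ennreal (h y) \<partial>empirical_measure B n z) = ennreal ((\<Sum>i=1..n. h (z i)) / real n)"
proof -
  let ?U = "uniform_count_measure {1..n}"
  note z = zB[rule_format]
  interpret U: prob_space ?U by (rule prob_space_uniform_interval[OF assms(1)])
  have zm: "z \<in> ?U \<rightarrow>\<^sub>M B"
    using z by (auto simp: measurable_def space_uniform_count_measure sets_uniform_count_measure)
  have eq: "empirical_measure B n z = distr ?U B z" by (rule empirical_eq_distr[OF assms(1) z])
  show "prob_space (empirical_measure B n z)" by (subst eq) (rule U.prob_space_distr[OF zm])
  show "sets (empirical_measure B n z) = sets B" "space (empirical_measure B n z) = space B" by (simp_all add: eq)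
  show "measure (empirical_measure B n z) A = real (card {i\<in>{1..n}. z i \<in> A}) / real n" if "A \<in> sets B"
  proof -
    have "z -` A \<inter> space ?U = {i\<in>{1..n}. z i \<in> A}" by (auto simp: space_uniform_count_measure)
    moreover have sub: "{i\<in>{1..n}. z i \<in> A} \<subseteq> {1..n}" by blast
    ultimately show ?thesis
      unfolding eq using measure_distr[OF zm that] measure_uniform_count_measure[OF finite_atLeastAtMost sub] by simp
  qed
  show int: "(\<integral>y. f y \<partial>empirical_measure B n z) = (\<Sum>i=1..n. f (z i)) / real n" if "f \<in> borel_measurable B" for f :: "_ \<Rightarrow> real"
    unfolding eq using that zm by (subst integral_distr) (auto simp: integral_uniform_count_measure)
  show "distr (empirical_measure B n z) C g = empirical_measure C n (\<lambda>i. g (z i))" if g: "g \<in> B \<rightarrow>\<^sub>M C"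
  proof -
    have "empirical_measure C n (\<lambda>i. g (z i)) = distr ?U C (\<lambda>i. g (z i))"
      using z measurable_space[OF g] by (intro empirical_eq_distr assms(1)) auto
    then show ?thesis unfolding eq using distr_distr[OF g zm] by (simp add: comp_def)
  qed
  show "(\<integral>\<^sup>+y. ennreal (h y) \<partial>empirical_measure B n z) = ennreal ((\<Sum>i=1..n. h (z i)) / real n)"
    if h: "h \<in> borel_measurable B" "\<And>y. y \<in> space B \<Longrightarrow> 0 \<le> h y" for h
  proof -
    have "(\<integral>\<^sup>+y. ennreal (h y) \<partial>empirical_measure B n z) = (\<integral>\<^sup>+i. ennreal (h (z i)) \<partial>?U)"
      unfolding eq using h zm by (subst nn_integral_distr) auto
    also have "\<dots> = ennreal (\<integral>i. h (z i) \<partial>?U)"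
    proof (rule nn_integral_eq_integral)
      show "integrable ?U (\<lambda>i. h (z i))"
        unfolding uniform_count_measure_def by (rule integrable_point_measure_finite) simp
      show "AE i in ?U. 0 \<le> h (z i)" using h(2) z by (intro AE_I2) (simp add: space_uniform_count_measure)
    qed
    also have "(\<integral>i. h (z i) \<partial>?U) = (\<Sum>i=1..n. h (z i)) / real n" by (simp add: integral_uniform_count_measure)
    finally show ?thesis .
  qed
qed

lemma empirical_cong:
  assumes "\<And>i. i \<in> {1..n} \<Longrightarrow> z i = z' i"
  shows "empirical_measure B n z = empirical_measure B n z'"
proof -
  have "(\<lambda>A. (\<Sum>i=1..n. emeasure (return B (z i)) A) / of_nat n) = (\<lambda>A. (\<Sum>i=1..n. emeasure (return B (z' i)) A) / of_nat n)"
    using assms by (intro ext arg_cong2[where f="(/)"] sum.cong refl) auto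
  then show ?thesis by (simp only: empirical_measure_def)
qed

lemma empirical_permutes:
  assumes "\<sigma> permutes {1..n}"
  shows "empirical_measure B n (\<lambda>i. z (\<sigma> i)) = empirical_measure B n z"
proof -
  have "(\<Sum>i=1..n. emeasure (return B (z (\<sigma> i))) A) = (\<Sum>i=1..n. emeasure (return B (z i)) A)" for A
    using sum.permute[OF assms, of "\<lambda>i. emeasure (return B (z i)) A"] by (simp add: comp_def)
  then show ?thesis by (simp only: empirical_measure_def)
qed

section \<open>Empirical measures as functions of the weight vector\<close>

definition weights :: "nat \<Rightarrow> (nat \<Rightarrow> real) set" where
  "weights n = {w. (\<forall>i\<in>{1..n}. 0 \<le> w i) \<and> (\<Sum>i=1..n. w i) = real n}"

abbreviation "emp1 n w \<equiv> empirical_measure (restrict_space borel R_plus) n w"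

abbreviation emp2 :: "nat \<Rightarrow> (nat \<Rightarrow> real) \<Rightarrow> (nat \<Rightarrow> 's::polish_space) \<Rightarrow> (real \<times> 's) measure" where
  "emp2 n w x \<equiv> empirical_measure (restrict_space borel R_plus_times) n (\<lambda>i. (w i, x i))"

lemma emp1_M11:
  assumes n: "n \<ge> 1" and w: "w \<in> weights n"
  shows "emp1 n w \<in> M11"
proof -
  have z: "\<forall>i\<in>{1..n}. w i \<in> space (restrict_space borel R_plus)"
    using w by (auto simp: weights_def space_restrict_space)
  note f = empirical_facts[OF n z]
  have "(\<integral>\<^sup>+x. ennreal x \<partial>emp1 n w) = ennreal ((\<Sum>i=1..n. w i) / real n)"
    by (rule f(7)) (auto simp: space_restrict_space intro: measurable_restrict_space1)
  also have "\<dots> = 1" using w n by (simp add: weights_def)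
  finally show ?thesis using f(1,2) by (simp add: M11_def borel_probs_def)
qed

lemma emp2_facts:
  fixes x :: "nat \<Rightarrow> 's::polish_space"
  assumes n: "n \<ge> 1" and w: "w \<in> weights n"
  shows "emp2 n w x \<in> borel_probs R_plus_times" "marginal1 (emp2 n w x) = emp1 n w"
    "marginal2 (emp2 n w x) = empirical_measure borel n x" "emp2 n w x \<in> M11_times"
proof -
  have z: "\<forall>i\<in>{1..n}. (w i, x i) \<in> space (restrict_space borel R_plus_times)"
    using w by (auto simp: weights_def space_restrict_space)
  note f = empirical_facts[OF n z]
  show b: "emp2 n w x \<in> borel_probs R_plus_times" using f(1,2) by (simp add: borel_probs_def)
  show m1: "marginal1 (emp2 n w x) = emp1 n w"
    unfolding marginal1_def using f(6)[OF fst_measurable_R_plus] by simp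
  show "marginal2 (emp2 n w x) = empirical_measure borel n x"
    unfolding marginal2_def using f(6)[OF snd_measurable_R_plus] by simp
  show "emp2 n w x \<in> M11_times" using b m1 emp1_M11[OF n w] by (simp add: M11_times_def M11_def)
qed

lemma weights_permutes:
  assumes "\<sigma> permutes {1..n}" "w \<in> weights n"
  shows "(\<lambda>i. w (\<sigma> i)) \<in> weights n"
  using assms sum.permute[OF assms(1), of w] permutes_in_image[OF assms(1)] by (auto simp: weights_def comp_def)

text \<open>The link between combinatorics and measures: the cell masses after a permutation of the
  weights are its normalised contingency table.\<close>

lemma ltab_emp2:
  fixes x :: "nat \<Rightarrow> 's::polish_space" and a b :: "_ \<Rightarrow> nat"
  assumes n: "n \<ge> 1" and w: "w \<in> weights n" and s: "\<sigma> permutes {1..n}"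
    and m: "a \<in> restrict_space borel R_plus \<rightarrow>\<^sub>M count_space UNIV" "b \<in> borel \<rightarrow>\<^sub>M count_space UNIV"
  shows "ltab (emp2 n (\<lambda>i. w (\<sigma> i)) x) a b = ptab n (\<lambda>i. a (w i)) (\<lambda>i. b (x i)) \<sigma>"
proof (intro ext)
  fix i j
  have wp: "(\<lambda>i. w (\<sigma> i)) \<in> weights n" by (rule weights_permutes[OF s w])
  have z: "\<forall>i\<in>{1..n}. (w (\<sigma> i), x i) \<in> space (restrict_space borel R_plus_times)"
    using wp by (auto simp: weights_def space_restrict_space)
  have "labset a b {(i,j)} \<in> sets (restrict_space borel R_plus_times)" by (rule labset_sets[OF refl m])
  then have "ltab (emp2 n (\<lambda>i. w (\<sigma> i)) x) a b i j = real (card {k\<in>{1..n}. (w (\<sigma> k), x k) \<in> labset a b {(i,j)}}) / real n"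
    unfolding ltab_def by (rule empirical_facts(4)[OF n z])
  also have "{k\<in>{1..n}. (w (\<sigma> k), x k) \<in> labset a b {(i,j)}} = {k\<in>{1..n}. a (w (\<sigma> k)) = i \<and> b (x k) = j}"
    using wp by (auto simp: labset_def weights_def)
  finally show "ltab (emp2 n (\<lambda>i. w (\<sigma> i)) x) a b i j = ptab n (\<lambda>i. a (w i)) (\<lambda>i. b (x i)) \<sigma> i j"
    by (simp add: ptab_def tables_def)
qed

text \<open>Couple equal indices.\<close>

lemma W1_emp1:
  assumes n: "n \<ge> 1" and w: "w \<in> weights n" "w' \<in> weights n"
  shows "W1 (emp1 n w) (emp1 n w') \<le> (\<Sum>i=1..n. \<bar>w i - w' i\<bar>) / real n"
proof -
  let ?B = "restrict_space borel (R_plus \<times> R_plus) :: (real \<times> real) measure"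
  have z: "\<forall>i\<in>{1..n}. (w i, w' i) \<in> space ?B"
    using w by (auto simp: weights_def space_restrict_space)
  note f = empirical_facts[OF n z]
  have fm: "fst \<in> ?B \<rightarrow>\<^sub>M restrict_space borel R_plus"
    by (rule measurable_restrict_space3[OF borel_measurable_continuous_onI[OF continuous_on_fst[OF continuous_on_id]]]) auto
  have sm: "snd \<in> ?B \<rightarrow>\<^sub>M restrict_space borel R_plus"
    by (rule measurable_restrict_space3[OF borel_measurable_continuous_onI[OF continuous_on_snd[OF continuous_on_id]]]) auto
  have c: "empirical_measure ?B n (\<lambda>i. (w i, w' i)) \<in> couplings (emp1 n w) (emp1 n w')"
    unfolding couplings_def borel_probs_def using f(1,2) f(6)[OF fm] f(6)[OF sm] by simp
  have m: "(\<lambda>z. \<bar>fst z - snd z\<bar>) \<in> borel_measurable ?B"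
    using measurable_R_plus_borel[OF fm] measurable_R_plus_borel[OF sm] by measurable
  have "(\<integral>\<^sup>+z. ennreal \<bar>fst z - snd z\<bar> \<partial>empirical_measure ?B n (\<lambda>i. (w i, w' i))) = ennreal ((\<Sum>i=1..n. \<bar>w i - w' i\<bar>) / real n)"
    using f(7)[OF m] by simp
  then show ?thesis by (intro W1_le_cost[OF emp1_M11[OF n w(1)] emp1_M11[OF n w(2)] c]) (auto intro!: divide_nonneg_nonneg sum_nonneg)
qed

context product_metric
begin

lemma beta_BL_emp2:
  assumes n: "n \<ge> 1" and w: "w \<in> weights n" "w' \<in> weights n"
  shows "beta_BL \<delta> (emp2 n w x) (emp2 n w' x) \<le> (\<Sum>i=1..n. mdist \<delta> (w i, x i) (w' i, x i)) / real n"
proof (rule beta_BL_le[OF emp2_facts(1)[OF n w(1)] emp2_facts(1)[OF n w(2)]])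
  show "0 \<le> (\<Sum>i=1..n. mdist \<delta> (w i, x i) (w' i, x i)) / real n" by (intro divide_nonneg_nonneg sum_nonneg) auto
  fix f assume f: "f \<in> BL"
  have fm: "f \<in> borel_measurable (restrict_space borel R_plus_times)"
    by (rule borel_measurable_continuous_on_restrict[OF BL_D(1)[OF f]])
  have z: "(w i, x i) \<in> R_plus_times" "(w' i, x i) \<in> R_plus_times" if "i \<in> {1..n}" for i
    using w that by (auto simp: weights_def)
  have I: "(\<integral>z. f z \<partial>emp2 n w x) = (\<Sum>i=1..n. f (w i, x i)) / real n"
    by (rule empirical_facts(5)[OF n _ fm]) (use z in \<open>simp add: space_restrict_space\<close>)
  have I': "(\<integral>z. f z \<partial>emp2 n w' x) = (\<Sum>i=1..n. f (w' i, x i)) / real n"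
    by (rule empirical_facts(5)[OF n _ fm]) (use z in \<open>simp add: space_restrict_space\<close>)
  have "\<bar>(\<integral>z. f z \<partial>emp2 n w x) - (\<integral>z. f z \<partial>emp2 n w' x)\<bar> = \<bar>\<Sum>i=1..n. f (w i, x i) - f (w' i, x i)\<bar> / real n"
    unfolding I I' by (simp add: sum_subtractf flip: diff_divide_distrib)
  also have "\<dots> \<le> (\<Sum>i=1..n. mdist \<delta> (w i, x i) (w' i, x i)) / real n"
    using z by (intro divide_right_mono order_trans[OF sum_abs] sum_mono BL_D(3)[OF f]) auto
  finally show "\<bar>(\<integral>z. f z \<partial>emp2 n w x) - (\<integral>z. f z \<partial>emp2 n w' x)\<bar> \<le> (\<Sum>i=1..n. mdist \<delta> (w i, x i) (w' i, x i)) / real n" .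
qed

text \<open>Both parts of \<open>Delta\<close> are bounded by averages over the indices, and at each
  of the \<open>n\<close> points small changes of the weight are small for \<delta>, which induces
  the product topology.\<close>

lemma emp2_continuous:
  assumes n: "n \<ge> 1" and w: "w \<in> weights n" and e: "e > 0"
  shows "\<exists>h>0. \<forall>w'\<in>weights n. (\<forall>i\<in>{1..n}. \<bar>w' i - w i\<bar> < h) \<longrightarrow> Delta \<delta> (emp2 n w x) (emp2 n w' x) < e"
proof -
  have "\<exists>h>0. \<forall>v\<ge>0. \<bar>v - w i\<bar> < h \<longrightarrow> mdist \<delta> (w i, x i) (v, x i) < e/2" if i: "i \<in> {1..n}" for i
  proof -
    have z: "(w i, x i) \<in> R_plus_times" using w i by (auto simp: weights_def)
    have "openin dm.mtopology (dm.mball (w i, x i) (e/2))" by simp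
    then obtain U where U: "open U" "dm.mball (w i, x i) (e/2) = R_plus_times \<inter> U"
      unfolding openin_dm openin_open by blast
    have "(w i, x i) \<in> dm.mball (w i, x i) (e/2)" using z e by (subst dm.centre_in_mball_iff) auto
    then have "(w i, x i) \<in> U" using U(2) by blast
    then obtain A B where AB: "open A" "open B" "(w i, x i) \<in> A \<times> B" "A \<times> B \<subseteq> U" using U(1) open_prod_elim by metis
    have "w i \<in> A" using AB by simp
    then obtain h where h: "h > 0" "ball (w i) h \<subseteq> A" using AB(1) openE by blast
    have "mdist \<delta> (w i, x i) (v, x i) < e/2" if v: "v \<ge> 0" "\<bar>v - w i\<bar> < h" for v
    proof -
      have "v \<in> ball (w i) h" using v(2) by (simp add: dist_real_def abs_minus_commute)
      then have "(v, x i) \<in> A \<times> B" using h AB(3) by auto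
      then have "(v, x i) \<in> R_plus_times \<inter> U" using AB(4) v(1) by auto
      then show ?thesis unfolding U(2)[symmetric] by simp
    qed
    then show ?thesis using h(1) by blast
  qed
  then obtain h where h: "\<And>i. i \<in> {1..n} \<Longrightarrow> h i > 0"
    "\<And>i v. i \<in> {1..n} \<Longrightarrow> v \<ge> 0 \<Longrightarrow> \<bar>v - w i\<bar> < h i \<Longrightarrow> mdist \<delta> (w i, x i) (v, x i) < e/2" by metis
  define H where "H = min (e/2) (Min (h ` {1..n}))"
  have H: "H > 0" using h(1) n e by (simp add: H_def)
  have Hle: "H \<le> h i" if "i \<in> {1..n}" for i using that by (auto simp: H_def intro: min.coboundedI2)
  have "Delta \<delta> (emp2 n w x) (emp2 n w' x) < e" if w': "w' \<in> weights n" "\<forall>i\<in>{1..n}. \<bar>w' i - w i\<bar> < H" for w'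
  proof -
    have n0: "real n > 0" using n by simp
    have ne: "{1..n} \<noteq> {}" using n by simp
    have "(\<Sum>i=1..n. \<bar>w i - w' i\<bar>) < (\<Sum>i=1..n. e/2)"
    proof (rule sum_strict_mono)
      fix i assume i: "i \<in> {1..n}"
      then have "\<bar>w' i - w i\<bar> < H" using w'(2) by blast
      also have "H \<le> e/2" by (simp add: H_def)
      finally show "\<bar>w i - w' i\<bar> < e/2" by (simp add: abs_minus_commute)
    qed (use ne in auto)
    then have "(\<Sum>i=1..n. \<bar>w i - w' i\<bar>) / real n < (\<Sum>i=1..n. e/2) / real n" using n0 by (rule divide_strict_right_mono)
    also have "\<dots> = e/2" using n by simp
    finally have 1: "(\<Sum>i=1..n. \<bar>w i - w' i\<bar>) / real n < e/2" .
    have "(\<Sum>i=1..n. mdist \<delta> (w i, x i) (w' i, x i)) < (\<Sum>i=1..n. e/2)"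
    proof (rule sum_strict_mono)
      fix i assume i: "i \<in> {1..n}"
      then have "\<bar>w' i - w i\<bar> < h i" using w'(2) Hle[OF i] by (meson less_le_trans)
      moreover have "w' i \<ge> 0" using w'(1) i by (simp add: weights_def)
      ultimately show "mdist \<delta> (w i, x i) (w' i, x i) < e/2" using h(2)[OF i] by blast
    qed (use ne in auto)
    then have "(\<Sum>i=1..n. mdist \<delta> (w i, x i) (w' i, x i)) / real n < (\<Sum>i=1..n. e/2) / real n" using n0 by (rule divide_strict_right_mono)
    also have "\<dots> = e/2" using n by simp
    finally have 2: "(\<Sum>i=1..n. mdist \<delta> (w i, x i) (w' i, x i)) / real n < e/2" .
    show ?thesis unfolding Delta_def emp2_facts(2)[OF n w] emp2_facts(2)[OF n w'(1)]
      using W1_emp1[OF n w w'(1)] beta_BL_emp2[OF n w w'(1), of x] 1 2 by linarith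
  qed
  then show ?thesis using H by blast
qed

text \<open>Measurability for the Borel sets of \<open>Delta\<close> comes from continuity in the
  weights: the preimage of an open set \<open>U\<close> is cut out of the weight vectors by an open
  set \<open>V\<close> of real sequences.\<close>

lemma emp2_measurable:
  fixes u :: "'u \<Rightarrow> nat \<Rightarrow> real"
  assumes n: "n \<ge> 1" and um: "\<And>i. i \<in> {1..n} \<Longrightarrow> (\<lambda>\<omega>. u \<omega> i) \<in> borel_measurable N"
    and uw: "\<And>\<omega>. \<omega> \<in> space N \<Longrightarrow> u \<omega> \<in> weights n"
  shows "(\<lambda>\<omega>. emp2 n (u \<omega>) x) \<in> N \<rightarrow>\<^sub>M borel_of (M11_times_topology \<delta>)"
  unfolding borel_of_def M11_times_topology_def D.topspace_mtopology
proof (rule measurable_measure_of)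
  show "{U. openin D.mtopology U} \<subseteq> Pow M11_times" using openin_subset by fastforce
  show "(\<lambda>\<omega>. emp2 n (u \<omega>) x) \<in> space N \<rightarrow> M11_times" using emp2_facts(4)[OF n uw] by blast
  fix U assume "U \<in> {U. openin D.mtopology U}"
  then have U: "openin D.mtopology U" by simp
  define G where "G = {(w, h). \<forall>w'\<in>weights n. (\<forall>i\<in>{1..n}. \<bar>w' i - w i\<bar> < h) \<longrightarrow> emp2 n w' x \<in> U}"
  define V where "V = (\<Union>(w,h)\<in>G. {w'. \<forall>i\<in>{1..n}. \<bar>w' i - w i\<bar> < h})"
  have "open {w' :: nat \<Rightarrow> real. \<forall>i\<in>{1..n}. \<bar>w' i - w i\<bar> < h}" for w h
  proof -
    have "open {w' :: nat \<Rightarrow> real. \<bar>w' i - w i\<bar> < h}" for i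
      by (intro open_Collect_less continuous_intros continuous_on_product_coordinates)
    then have "open (\<Inter>i\<in>{1..n}. {w' :: nat \<Rightarrow> real. \<bar>w' i - w i\<bar> < h})" by (intro open_INT) auto
    moreover have "(\<Inter>i\<in>{1..n}. {w' :: nat \<Rightarrow> real. \<bar>w' i - w i\<bar> < h}) = {w'. \<forall>i\<in>{1..n}. \<bar>w' i - w i\<bar> < h}" by auto
    ultimately show ?thesis by simp
  qed
  then have V: "open V" unfolding V_def by (intro open_UN) auto
  have iff: "emp2 n w x \<in> U \<longleftrightarrow> w \<in> V" if w: "w \<in> weights n" for w
  proof
    assume "emp2 n w x \<in> U"
    then obtain e where e: "e > 0" "D.mball (emp2 n w x) e \<subseteq> U" using U by (auto simp: D.openin_mtopology)
    obtain h where h: "h > 0" "\<forall>w'\<in>weights n. (\<forall>i\<in>{1..n}. \<bar>w' i - w i\<bar> < h) \<longrightarrow> Delta \<delta> (emp2 n w x) (emp2 n w' x) < e"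
      using emp2_continuous[OF n w e(1)] by blast
    have "emp2 n w' x \<in> U" if "w' \<in> weights n" "\<forall>i\<in>{1..n}. \<bar>w' i - w i\<bar> < h" for w'
    proof -
      have "emp2 n w' x \<in> D.mball (emp2 n w x) e"
        unfolding D.in_mball using h(2) that emp2_facts(4)[OF n w] emp2_facts(4)[OF n that(1)] by blast
      then show ?thesis using e(2) by blast
    qed
    then have "(w,h) \<in> G" by (simp add: G_def)
    moreover have "w \<in> {w'. \<forall>i\<in>{1..n}. \<bar>w' i - w i\<bar> < h}" using h(1) by simp
    ultimately show "w \<in> V" unfolding V_def by blast
  next
    assume "w \<in> V"
    then obtain w0 h where "(w0,h) \<in> G" "\<forall>i\<in>{1..n}. \<bar>w i - w0 i\<bar> < h" unfolding V_def by blast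
    then show "emp2 n w x \<in> U" using w unfolding G_def by blast
  qed
  \<comment> \<open>Only the coordinates in {1..n} are known to be measurable; with 0 elsewhere the
    whole sequence is.\<close>
  define u' where "u' \<omega> = (\<lambda>i. if i \<in> {1..n} then u \<omega> i else 0)" for \<omega>
  have u'w: "u' \<omega> \<in> weights n" if "\<omega> \<in> space N" for \<omega> using uw[OF that] by (auto simp: weights_def u'_def)
  have u'e: "emp2 n (u' \<omega>) x = emp2 n (u \<omega>) x" for \<omega> by (rule empirical_cong) (simp add: u'_def)
  have "u' \<in> borel_measurable N"
  proof (rule measurable_coordinatewise_then_product)
    fix i show "(\<lambda>\<omega>. u' \<omega> i) \<in> borel_measurable N" using um[of i] by (cases "i \<in> {1..n}") (auto simp: u'_def)
  qed
  then have "u' -` V \<inter> space N \<in> sets N" using V by (intro measurable_sets) auto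
  moreover have "(\<lambda>\<omega>. emp2 n (u \<omega>) x) -` U \<inter> space N = u' -` V \<inter> space N"
  proof -
    have "emp2 n (u \<omega>) x \<in> U \<longleftrightarrow> u' \<omega> \<in> V" if "\<omega> \<in> space N" for \<omega>
      using iff[OF u'w[OF that]] unfolding u'e .
    then show ?thesis by blast
  qed
  ultimately show "(\<lambda>\<omega>. emp2 n (u \<omega>) x) -` U \<inter> space N \<in> sets N" by simp
qed

text \<open>Exchangeability equates laws on the product space of vectors. The empirical measure
  factors through its measurable subset of weight vectors, where it is measurable, so the equality
  carries over to its law.\<close>

lemma exchangeable_emp2:
  assumes n: "n \<ge> 1" and "prob_space M" and Wm: "\<And>i. i \<in> {1..n} \<Longrightarrow> W i \<in> borel_measurable M"
    and Ww: "\<And>\<omega>. \<omega> \<in> space M \<Longrightarrow> (\<lambda>i. W i \<omega>) \<in> weights n"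
    and ex: "exchangeable M n W" and s: "\<sigma> permutes {1..n}"
  shows "distr M (borel_of (M11_times_topology \<delta>)) (\<lambda>\<omega>. emp2 n (\<lambda>i. W (\<sigma> i) \<omega>) x) =
     distr M (borel_of (M11_times_topology \<delta>)) (\<lambda>\<omega>. emp2 n (\<lambda>i. W i \<omega>) x)"
proof -
  let ?P = "Pi\<^sub>M {1..n} (\<lambda>_. borel :: real measure)"
  let ?D = "weights n \<inter> space ?P"
  let ?N = "restrict_space ?P ?D" and ?X = "borel_of (M11_times_topology \<delta>)"
  have co: "(\<lambda>u. u i) \<in> borel_measurable ?P" if "i \<in> {1..n}" for i
    using that by (rule measurable_component_singleton)
  have "{u\<in>space ?P. 0 \<le> u i} \<in> sets ?P" if "i \<in> {1..n}" for i
    using co[OF that] by measurable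
  then have "{u\<in>space ?P. \<forall>i\<in>{1..n}. 0 \<le> u i} \<in> sets ?P" by (intro sets.sets_Collect_finite_All) auto
  moreover have "(\<lambda>u. \<Sum>i=1..n. u i) \<in> borel_measurable ?P" by (intro borel_measurable_sum co)
  then have "(\<lambda>u. \<Sum>i=1..n. u i) -` {real n} \<inter> space ?P \<in> sets ?P" by (rule measurable_sets) simp
  moreover have "?D = {u\<in>space ?P. \<forall>i\<in>{1..n}. 0 \<le> u i} \<inter> ((\<lambda>u. \<Sum>i=1..n. u i) -` {real n} \<inter> space ?P)"
    by (auto simp: weights_def)
  ultimately have DP: "?D \<in> sets ?P" by simp
  have spN: "space ?N = ?D" using DP by (simp add: space_restrict_space sets.Int_space_eq1 Int_absorb2 Int_commute)
  have Vm: "(\<lambda>u. emp2 n u x) \<in> ?N \<rightarrow>\<^sub>M ?X"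
    by (rule emp2_measurable[OF n]) (use co spN in \<open>auto intro: measurable_restrict_space1\<close>)
  have Tm: "(\<lambda>\<omega>. \<lambda>i\<in>{1..n}. W (\<tau> i) \<omega>) \<in> M \<rightarrow>\<^sub>M ?N" "(\<lambda>\<omega>. \<lambda>i\<in>{1..n}. W (\<tau> i) \<omega>) \<in> M \<rightarrow>\<^sub>M ?P"
    if t: "\<tau> permutes {1..n}" for \<tau>
  proof -
    show P: "(\<lambda>\<omega>. \<lambda>i\<in>{1..n}. W (\<tau> i) \<omega>) \<in> M \<rightarrow>\<^sub>M ?P"
      using permutes_in_image[OF t] by (intro measurable_restrict Wm) auto
    have "(\<lambda>i\<in>{1..n}. W (\<tau> i) \<omega>) \<in> weights n" if "\<omega> \<in> space M" for \<omega>
      using weights_permutes[OF t Ww[OF that]] by (simp add: weights_def)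
    then show "(\<lambda>\<omega>. \<lambda>i\<in>{1..n}. W (\<tau> i) \<omega>) \<in> M \<rightarrow>\<^sub>M ?N"
      using P measurable_space[OF P] by (intro measurable_restrict_space2) auto
  qed
  have id: "id permutes {1..n}" by (rule permutes_id)
  have eqN: "distr M ?N (\<lambda>\<omega>. \<lambda>i\<in>{1..n}. W (\<sigma> i) \<omega>) = distr M ?N (\<lambda>\<omega>. \<lambda>i\<in>{1..n}. W (id i) \<omega>)"
  proof (rule measure_eqI)
    fix A assume "A \<in> sets (distr M ?N (\<lambda>\<omega>. \<lambda>i\<in>{1..n}. W (\<sigma> i) \<omega>))"
    then have A: "A \<in> sets ?N" by simp
    then have AP: "A \<in> sets ?P" using DP by (simp add: sets_restrict_space_iff)
    have "emeasure (distr M ?N (\<lambda>\<omega>. \<lambda>i\<in>{1..n}. W (\<tau> i) \<omega>)) A = emeasure (distr M ?P (\<lambda>\<omega>. \<lambda>i\<in>{1..n}. W (\<tau> i) \<omega>)) A"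
      if t: "\<tau> permutes {1..n}" for \<tau>
      by (simp only: emeasure_distr[OF Tm(1)[OF t] A] emeasure_distr[OF Tm(2)[OF t] AP])
    note this[OF s] this[OF id]
    moreover have "distr M ?P (\<lambda>\<omega>. \<lambda>i\<in>{1..n}. W (\<sigma> i) \<omega>) = distr M ?P (\<lambda>\<omega>. \<lambda>i\<in>{1..n}. W (id i) \<omega>)"
      using ex s by (simp add: exchangeable_def)
    ultimately show "emeasure (distr M ?N (\<lambda>\<omega>. \<lambda>i\<in>{1..n}. W (\<sigma> i) \<omega>)) A = emeasure (distr M ?N (\<lambda>\<omega>. \<lambda>i\<in>{1..n}. W (id i) \<omega>)) A"
      by simp
  qed simp
  have fac: "distr M ?X (\<lambda>\<omega>. emp2 n (\<lambda>i. W (\<tau> i) \<omega>) x) = distr (distr M ?N (\<lambda>\<omega>. \<lambda>i\<in>{1..n}. W (\<tau> i) \<omega>)) ?X (\<lambda>u. emp2 n u x)"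
    if t: "\<tau> permutes {1..n}" for \<tau>
  proof -
    have "emp2 n (\<lambda>i. W (\<tau> i) \<omega>) x = emp2 n (\<lambda>i\<in>{1..n}. W (\<tau> i) \<omega>) x" for \<omega>
      by (rule empirical_cong) simp
    then show ?thesis by (simp only: distr_distr[OF Vm Tm(1)[OF t]] comp_def)
  qed
  show ?thesis using fac[OF s] fac[OF id] eqN by simp
qed

end

section \<open>The large deviation bounds\<close>

lemma (in Metric_space) sequence_counterexample:
  assumes "x \<in> M" "\<And>r. r > 0 \<Longrightarrow> \<exists>y\<in>M. d x y < r \<and> \<not> pr y"
  obtains y where "\<And>n. y n \<in> M" "\<And>n. \<not> pr (y n)" "(\<lambda>n. d (y n) x) \<longlonglongrightarrow> 0"
proof -
  have "\<forall>n. \<exists>y\<in>M. d x y < 1 / real (Suc n) \<and> \<not> pr y" using assms(2) by simp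
  then obtain y where y: "\<And>n. y n \<in> M" "\<And>n. d x (y n) < 1 / real (Suc n)" "\<And>n. \<not> pr (y n)" by metis
  have "(\<lambda>n. d (y n) x) \<longlonglongrightarrow> 0"
  proof (rule tendsto_sandwich[OF _ _ tendsto_const])
    show "\<forall>\<^sub>F n in sequentially. d (y n) x \<le> 1 / real (Suc n)"
      using y(2) by (intro always_eventually allI) (simp add: commute less_imp_le)
    show "(\<lambda>k. 1 / real (Suc k)) \<longlonglongrightarrow> 0" using LIMSEQ_inverse_real_of_nat by (simp add: inverse_eq_divide)
  qed simp
  then show thesis using that y by blast
qed

section \<open>Averaging over permutations and the large deviation bounds for the pairs\<close>

locale array_setting = rate_setting \<delta> I_W \<mu>
  for \<delta> :: "(real \<times> 's::polish_space) metric" and I_W :: "real measure \<Rightarrow> ereal" and \<mu> :: "'s measure" +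
  fixes M :: "'w measure" and x :: "nat \<Rightarrow> nat \<Rightarrow> 's" and W :: "nat \<Rightarrow> nat \<Rightarrow> 'w \<Rightarrow> real"
  assumes M: "prob_space M"
    and xlim: "weakly_converges (\<lambda>n. empirical_measure borel n (x n)) \<mu>"
    and Wm: "\<And>n i. n \<ge> 1 \<Longrightarrow> i \<in> {1..n} \<Longrightarrow> W n i \<in> M \<rightarrow>\<^sub>M restrict_space borel R_plus"
    and Wsum: "\<And>n \<omega>. n \<ge> 1 \<Longrightarrow> \<omega> \<in> space M \<Longrightarrow> (\<Sum>i=1..n. W n i \<omega>) = real n"
    and Wex: "\<And>n. n \<ge> 1 \<Longrightarrow> exchangeable M n (W n)"
    and WLDP: "LDP_rv M M11_topology (\<lambda>n \<omega>. emp1 n (\<lambda>i. W n i \<omega>)) I_W"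
begin

interpretation W: Metric_space M11 W1 by (rule Metric_space_M11)
interpretation M: prob_space M by (rule M)

abbreviation "X \<equiv> M11_times_topology \<delta>"
definition "Lw n \<omega> = emp1 n (\<lambda>i. W n i \<omega>)"
definition "Vs n \<sigma> \<omega> = emp2 n (\<lambda>i. W n (\<sigma> i) \<omega>) (x n)"
definition "Q n = distr M (borel_of M11_topology) (Lw n)"
definition "Pn n = distr M (borel_of X) (\<lambda>\<omega>. emp2 n (\<lambda>i. W n i \<omega>) (x n))"

lemma W_borel: "n \<ge> 1 \<Longrightarrow> i \<in> {1..n} \<Longrightarrow> W n i \<in> borel_measurable M"
  using Wm measurable_R_plus_borel by blast

lemma W_weights: "n \<ge> 1 \<Longrightarrow> \<omega> \<in> space M \<Longrightarrow> (\<lambda>i. W n i \<omega>) \<in> weights n"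
  using measurable_space[OF Wm] Wsum by (auto simp: weights_def space_restrict_space)

lemma Vs_measurable:
  assumes n: "n \<ge> 1" and s: "\<sigma> permutes {1..n}"
  shows "Vs n \<sigma> \<in> M \<rightarrow>\<^sub>M borel_of X"
  unfolding Vs_def
proof (rule emp2_measurable[OF n])
  show "(\<lambda>\<omega>. W n (\<sigma> i) \<omega>) \<in> borel_measurable M" if "i \<in> {1..n}" for i
    using W_borel[OF n] permutes_in_image[OF s] that by auto
  show "(\<lambda>i. W n (\<sigma> i) \<omega>) \<in> weights n" if "\<omega> \<in> space M" for \<omega>
    by (rule weights_permutes[OF s W_weights[OF n that]])
qed

lemma Vs_prob:
  assumes n: "n \<ge> 1" and s: "\<sigma> permutes {1..n}" and E: "E \<in> sets (borel_of X)"
  shows "measure M {\<omega>\<in>space M. Vs n \<sigma> \<omega> \<in> E} = measure (Pn n) E"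
proof -
  have "distr M (borel_of X) (Vs n \<sigma>) = Pn n"
    unfolding Vs_def Pn_def
    by (rule exchangeable_emp2[OF n M W_borel[OF n] W_weights[OF n] Wex[OF n] s]) auto
  moreover have "measure (distr M (borel_of X) (Vs n \<sigma>)) E = measure M (Vs n \<sigma> -` E \<inter> space M)"
    by (rule measure_distr[OF Vs_measurable[OF n s] E])
  moreover have "Vs n \<sigma> -` E \<inter> space M = {\<omega>\<in>space M. Vs n \<sigma> \<omega> \<in> E}" by auto
  ultimately show ?thesis by simp
qed

text \<open>This takes the place of conditioning on the weights. For each fixed permutation the
  permuted empirical measure has the law \<open>Pn n\<close>, so n! times the mass of
  \<open>E\<close> is the expected number of permutations that lead into \<open>E\<close>.\<close>

lemma average_permutations:
  assumes n: "n \<ge> 1" and E: "E \<in> sets (borel_of X)"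
  shows "integrable M (\<lambda>\<omega>. real (card {\<sigma>. \<sigma> permutes {1..n} \<and> Vs n \<sigma> \<omega> \<in> E}))"
    and "(\<integral>\<omega>. real (card {\<sigma>. \<sigma> permutes {1..n} \<and> Vs n \<sigma> \<omega> \<in> E}) \<partial>M) = fact n * measure (Pn n) E"
proof -
  let ?S = "{\<sigma>. \<sigma> permutes {1..n}}"
  let ?A = "\<lambda>\<sigma>. {\<omega>\<in>space M. Vs n \<sigma> \<omega> \<in> E}"
  have fin: "finite ?S" by (rule finite_permutations) simp
  have card: "real (card {\<sigma>. \<sigma> permutes {1..n} \<and> Vs n \<sigma> \<omega> \<in> E}) = (\<Sum>\<sigma>\<in>?S. indicator (?A \<sigma>) \<omega>)" if "\<omega> \<in> space M" for \<omega>
    using that fin by (simp add: indicator_def sum.If_cases Int_def)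
  have As: "?A \<sigma> \<in> sets M" if "\<sigma> \<in> ?S" for \<sigma>
  proof -
    have "Vs n \<sigma> -` E \<inter> space M \<in> sets M" using Vs_measurable[OF n] that E by (intro measurable_sets) auto
    moreover have "Vs n \<sigma> -` E \<inter> space M = ?A \<sigma>" by auto
    ultimately show ?thesis by simp
  qed
  have i: "integrable M (indicator (?A \<sigma>) :: _ \<Rightarrow> real)" if "\<sigma> \<in> ?S" for \<sigma>
    using As[OF that] by (intro integrable_real_indicator) (auto simp: less_top[symmetric])
  show "integrable M (\<lambda>\<omega>. real (card {\<sigma>. \<sigma> permutes {1..n} \<and> Vs n \<sigma> \<omega> \<in> E}))"
    by (subst Bochner_Integration.integrable_cong[OF refl card], assumption) (intro Bochner_Integration.integrable_sum i)
  have "(\<integral>\<omega>. real (card {\<sigma>. \<sigma> permutes {1..n} \<and> Vs n \<sigma> \<omega> \<in> E}) \<partial>M) = (\<integral>\<omega>. (\<Sum>\<sigma>\<in>?S. indicator (?A \<sigma>) \<omega>) \<partial>M)"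
    by (rule Bochner_Integration.integral_cong[OF refl card])
  also have "\<dots> = (\<Sum>\<sigma>\<in>?S. \<integral>\<omega>. indicator (?A \<sigma>) \<omega> \<partial>M)"
    by (rule Bochner_Integration.integral_sum) (rule i)
  also have "\<dots> = (\<Sum>\<sigma>\<in>?S. measure (Pn n) E)"
  proof (rule sum.cong[OF refl])
    fix \<sigma> assume s: "\<sigma> \<in> ?S"
    have "(\<integral>\<omega>. indicator (?A \<sigma>) \<omega> \<partial>M) = measure M (?A \<sigma> \<inter> space M)" by simp
    also have "?A \<sigma> \<inter> space M = ?A \<sigma>" by blast
    also have "measure M (?A \<sigma>) = measure (Pn n) E" using s by (intro Vs_prob[OF n _ E]) simp
    finally show "(\<integral>\<omega>. indicator (?A \<sigma>) \<omega> \<partial>M) = measure (Pn n) E" .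
  qed
  also have "\<dots> = fact n * measure (Pn n) E" using card_permutations[OF card_atLeastAtMost finite_atLeastAtMost, of 1 n] by simp
  finally show "(\<integral>\<omega>. real (card {\<sigma>. \<sigma> permutes {1..n} \<and> Vs n \<sigma> \<omega> \<in> E}) \<partial>M) = fact n * measure (Pn n) E" .
qed

lemma Lw_measurable: "n \<ge> 1 \<Longrightarrow> Lw n \<in> M \<rightarrow>\<^sub>M borel_of M11_topology"
  using WLDP by (simp add: LDP_rv_def Lw_def[abs_def])

lemma Q_LDP: "LDP M11_topology Q I_W"
  using WLDP by (simp add: LDP_rv_def Q_def[abs_def] Lw_def[abs_def])

lemma measure_Q:
  assumes "n \<ge> 1" "A \<in> sets (borel_of M11_topology)"
  shows "measure (Q n) A = measure M {\<omega>\<in>space M. Lw n \<omega> \<in> A}" "{\<omega>\<in>space M. Lw n \<omega> \<in> A} \<in> sets M"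
proof -
  have e: "Lw n -` A \<inter> space M = {\<omega>\<in>space M. Lw n \<omega> \<in> A}" by auto
  show "measure (Q n) A = measure M {\<omega>\<in>space M. Lw n \<omega> \<in> A}"
    unfolding Q_def using measure_distr[OF Lw_measurable[OF assms(1)] assms(2)] e by simp
  show "{\<omega>\<in>space M. Lw n \<omega> \<in> A} \<in> sets M" using measurable_sets[OF Lw_measurable[OF assms(1)] assms(2)] e by simp
qed

text \<open>A count valid for every weight vector becomes a probability bound. The indicator
  confines it to those weights from which \<open>E\<close> can be reached.\<close>

lemma upper_transfer:
  assumes n: "n \<ge> 1" and E: "E \<in> sets (borel_of X)" and A: "A \<in> sets (borel_of M11_topology)"
    and q: "\<And>w. w \<in> weights n \<Longrightarrow>
      real (card {\<sigma>. \<sigma> permutes {1..n} \<and> emp2 n (\<lambda>i. w (\<sigma> i)) (x n) \<in> E}) \<le> fact n * (q * indicator A (emp1 n w))"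
  shows "measure (Pn n) E \<le> q * measure (Q n) A"
proof -
  note mQ = measure_Q[OF n A]
  let ?B = "{\<omega>\<in>space M. Lw n \<omega> \<in> A}"
  have Bs: "?B \<inter> space M = ?B" by blast
  have iB: "integrable M (indicator ?B :: _ \<Rightarrow> real)"
    using mQ(2) by (intro integrable_real_indicator) (auto simp: less_top[symmetric])
  have "fact n * measure (Pn n) E \<le> (\<integral>\<omega>. fact n * (q * indicator ?B \<omega>) \<partial>M)"
    unfolding average_permutations(2)[OF n E, symmetric]
  proof (rule integral_mono[OF average_permutations(1)[OF n E]])
    show "integrable M (\<lambda>\<omega>. fact n * (q * indicator ?B \<omega>))" using iB by auto
    fix \<omega> assume w: "\<omega> \<in> space M"
    then have "indicator A (emp1 n (\<lambda>i. W n i \<omega>)) = (indicator ?B \<omega> :: real)" by (simp add: indicator_def Lw_def)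
    then show "real (card {\<sigma>. \<sigma> permutes {1..n} \<and> Vs n \<sigma> \<omega> \<in> E}) \<le> fact n * (q * indicator ?B \<omega>)"
      using q[OF W_weights[OF n w]] by (simp only: Vs_def)
  qed
  also have "\<dots> = fact n * (q * measure M ?B)" using mQ(2) by (simp add: Bs)
  finally show ?thesis using mQ(1) by simp
qed

lemma lower_transfer:
  assumes n: "n \<ge> 1" and E: "E \<in> sets (borel_of X)" and A: "A \<in> sets (borel_of M11_topology)"
    and q: "\<And>w. w \<in> weights n \<Longrightarrow> emp1 n w \<in> A \<Longrightarrow>
      fact n * q \<le> real (card {\<sigma>. \<sigma> permutes {1..n} \<and> emp2 n (\<lambda>i. w (\<sigma> i)) (x n) \<in> E})"
  shows "q * measure (Q n) A \<le> measure (Pn n) E"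
proof -
  note mQ = measure_Q[OF n A]
  let ?B = "{\<omega>\<in>space M. Lw n \<omega> \<in> A}"
  have Bs: "?B \<inter> space M = ?B" by blast
  have iB: "integrable M (indicator ?B :: _ \<Rightarrow> real)"
    using mQ(2) by (intro integrable_real_indicator) (auto simp: less_top[symmetric])
  have "fact n * (q * measure M ?B) = (\<integral>\<omega>. fact n * (q * indicator ?B \<omega>) \<partial>M)" using mQ(2) by (simp add: Bs)
  also have "\<dots> \<le> fact n * measure (Pn n) E"
    unfolding average_permutations(2)[OF n E, symmetric]
  proof (rule integral_mono[OF _ average_permutations(1)[OF n E]])
    show "integrable M (\<lambda>\<omega>. fact n * (q * indicator ?B \<omega>))" using iB by auto
    fix \<omega> assume w: "\<omega> \<in> space M"
    show "fact n * (q * indicator ?B \<omega>) \<le> real (card {\<sigma>. \<sigma> permutes {1..n} \<and> Vs n \<sigma> \<omega> \<in> E})"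
    proof (cases "Lw n \<omega> \<in> A")
      case True
      then show ?thesis using q[OF W_weights[OF n w]] w by (simp add: Vs_def Lw_def)
    qed simp
  qed
  finally show ?thesis using mQ(1) by simp
qed

lemma openin_X: "openin X U \<longleftrightarrow> openin D.mtopology U" and closedin_X: "closedin X C \<longleftrightarrow> closedin D.mtopology C"
  by (simp_all add: M11_times_topology_def)

lemma openin_Y: "openin M11_topology U \<longleftrightarrow> openin W.mtopology U" and closedin_Y: "closedin M11_topology C \<longleftrightarrow> closedin W.mtopology C"
  by (simp_all add: M11_topology_def)

text \<open>Two things must happen near \<open>\<rho>\<close>. The weights are close to the first
  marginal, which costs \<open>i\<close> by their large deviation principle, and the matching has a
  table of mutual information above \<open>h\<close>, which costs \<open>h\<close> uniformly in the
  weights. As h + i exceeds \<open>c\<close>, the remaining errors fit into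
  \<open>e\<close>.\<close>

lemma local_upper:
  fixes c :: real
  assumes \<rho>: "\<rho> \<in> M11_times" and m2: "marginal2 \<rho> = \<mu>" and c: "ereal c < J \<rho>"
  shows "\<exists>r>0. \<forall>e>0. \<forall>\<^sub>F n in sequentially. measure (Pn n) (D.mball \<rho> r) \<le> exp (- real n * (c - e))"
proof -
  note r = M11_timesD[OF \<rho>]
  obtain a b h i where ab: "clab (marginal1 \<rho>) a" "clab \<mu> b" "c < h + i"
    "h < MI (a ` R_plus) (range b) (ltab \<rho> a b)" "ereal i < I_W (marginal1 \<rho>)"
    by (rule J_local[OF \<rho> m2 c])
  let ?I = "a ` R_plus" and ?J = "range b"
  note fin = clab_finite_range(1)[OF M11_D(1)[OF r(2)] ab(1)] clab_finite_range(2)[OF \<mu> ab(2)]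
  note mm = clab_measurable[OF M11_D(1)[OF r(2)] ab(1)] clab_measurable_UNIV[OF \<mu> ab(2)]
  have "\<exists>e1>0. \<forall>\<nu>'\<in>M11. W1 (marginal1 \<rho>) \<nu>' < e1 \<longrightarrow> ereal i < I_W \<nu>'"
    by (rule I_W_lsc[OF r(2) ab(5)]) blast
  then obtain e1 where e1: "e1 > 0" "\<forall>\<nu>'\<in>M11. W1 (marginal1 \<rho>) \<nu>' < e1 \<longrightarrow> ereal i < I_W \<nu>'" by blast
  \<comment> \<open>The labels have null boundary for \<open>\<rho>\<close>, so a lower bound on
    their mutual information is an open condition at \<open>\<rho>\<close>.\<close>
  have "\<exists>r1>0. \<forall>\<rho>'\<in>M11_times. Delta \<delta> \<rho> \<rho>' < r1 \<longrightarrow> h < MI ?I ?J (ltab \<rho>' a b)"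
  proof (rule ccontr)
    assume "\<not> ?thesis"
    then have "\<exists>\<rho>'\<in>M11_times. Delta \<delta> \<rho> \<rho>' < r1 \<and> \<not> h < MI ?I ?J (ltab \<rho>' a b)" if "r1 > 0" for r1 using that by blast
    then obtain \<rho>s where rs: "\<And>n. \<rho>s n \<in> M11_times" "\<And>n. \<not> h < MI ?I ?J (ltab (\<rho>s n) a b)" "(\<lambda>n. Delta \<delta> (\<rho>s n) \<rho>) \<longlonglongrightarrow> 0"
      by (rule D.sequence_counterexample[OF \<rho>]) blast+
    have w: "wconv R_plus_times sequentially \<rho>s \<rho>"
      by (rule wconv_beta_BL[OF r(1) M11_timesD(1)[OF rs(1)] Delta_tendsto_D(2)[OF rs(3)]])
    have "clab (marginal2 \<rho>) b" using ab(2) m2 by simp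
    then have "(\<lambda>k. MI ?I ?J (ltab (\<rho>s k) a b)) \<longlonglongrightarrow> MI ?I ?J (ltab \<rho> a b)"
      by (rule labels_tendsto_MI[OF r(1) M11_timesD(1)[OF rs(1)] w ab(1)])
    then have "\<forall>\<^sub>F k in sequentially. h < MI ?I ?J (ltab (\<rho>s k) a b)" using ab(4) by (rule order_tendstoD(1))
    then show False using rs(2) by simp
  qed
  then obtain r1 where r1: "r1 > 0" "\<forall>\<rho>'\<in>M11_times. Delta \<delta> \<rho> \<rho>' < r1 \<longrightarrow> h < MI ?I ?J (ltab \<rho>' a b)" by blast
  \<comment> \<open>\<open>Delta\<close> dominates \<open>W1\<close> of the first marginals, so
    first marginals of this ball stay within e1 / 2 of that of \<open>\<rho>\<close>, where
    \<open>I_W\<close> still exceeds \<open>i\<close>.\<close>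
  define r' where "r' = min r1 (e1/2)"
  have r': "r' > 0" using r1 e1 by (simp add: r'_def)
  let ?E = "D.mball \<rho> r'" and ?C = "W.mcball (marginal1 \<rho>) (e1/2)"
  have E: "?E \<in> sets (borel_of X)" by (intro openin_borel_of) (simp add: openin_X)
  have Ccl: "closedin M11_topology ?C" by (simp add: closedin_Y)
  have CI: "ereal i \<le> I_W \<nu>" if "\<nu> \<in> ?C" for \<nu> using that e1 by (intro less_imp_le) auto
  have "\<forall>\<^sub>F n in sequentially. measure (Pn n) ?E \<le> exp (- real n * (c - e))" if e: "e > 0" for e
  proof -
    have "\<forall>\<^sub>F n in sequentially. measure (Q n) ?C \<le> exp (- real n * (i - e/2))"
      by (rule LDP_closed_upper[OF Q_LDP Ccl CI]) (use e in auto)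
    moreover have "\<forall>\<^sub>F n in sequentially. (2 * table_error ?I ?J) * fact_error n \<le> e/2 * real n" using e by (intro eventually_fact_error_le) simp
    ultimately show ?thesis using eventually_ge_at_top[of 1]
    proof eventually_elim
      case (elim n)
      note n = elim(3)
      let ?q = "exp (- real n * h + 2 * table_error ?I ?J * fact_error n)"
      have "measure (Pn n) ?E \<le> ?q * measure (Q n) ?C"
      proof (rule upper_transfer[OF n E closedin_borel_of[OF Ccl]])
        fix w assume w: "w \<in> weights n"
        let ?T = "{\<sigma>. \<sigma> permutes {1..n} \<and> emp2 n (\<lambda>i. w (\<sigma> i)) (x n) \<in> ?E}"
        show "real (card ?T) \<le> fact n * (?q * indicator ?C (emp1 n w))"
        proof (cases "?T = {}")
          case True
          then have "real (card ?T) = 0" by (simp only: card.empty of_nat_0)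
          then show ?thesis by simp
        next
          case False
          \<comment> \<open>The first marginal is the same for all permutations, so one successful
            permutation already locates the weights.\<close>
          then obtain \<sigma> where s: "\<sigma> permutes {1..n}" "emp2 n (\<lambda>i. w (\<sigma> i)) (x n) \<in> ?E" by blast
          have "W1 (marginal1 \<rho>) (emp1 n w) \<le> Delta \<delta> \<rho> (emp2 n (\<lambda>i. w (\<sigma> i)) (x n))"
            using beta_BL_nonneg by (simp add: Delta_def emp2_facts(2)[OF n weights_permutes[OF s(1) w]] empirical_permutes[OF s(1)])
          also have "\<dots> < r'" using s(2) by simp
          finally have "emp1 n w \<in> ?C" using emp1_M11[OF n w] r(2) by (simp add: r'_def)
          moreover have "card ?T \<le> card {\<sigma>. \<sigma> permutes {1..n} \<and> h < MI ?I ?J (ptab n (\<lambda>i. a (w i)) (\<lambda>i. b (x n i)) \<sigma>)}"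
          proof (rule card_mono)
            show "finite {\<sigma>. \<sigma> permutes {1..n} \<and> h < MI ?I ?J (ptab n (\<lambda>i. a (w i)) (\<lambda>i. b (x n i)) \<sigma>)}"
              by (rule finite_subset[OF _ finite_permutations[of "{1..n}"]]) auto
            show "?T \<subseteq> {\<sigma>. \<sigma> permutes {1..n} \<and> h < MI ?I ?J (ptab n (\<lambda>i. a (w i)) (\<lambda>i. b (x n i)) \<sigma>)}"
            proof (rule subsetI)
              fix \<tau> assume "\<tau> \<in> ?T"
              then have t: "\<tau> permutes {1..n}" "emp2 n (\<lambda>i. w (\<tau> i)) (x n) \<in> ?E" by auto
              have "h < MI ?I ?J (ltab (emp2 n (\<lambda>i. w (\<tau> i)) (x n)) a b)" using r1(2) t(2) by (simp add: r'_def)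
              then show "\<tau> \<in> {\<sigma>. \<sigma> permutes {1..n} \<and> h < MI ?I ?J (ptab n (\<lambda>i. a (w i)) (\<lambda>i. b (x n i)) \<sigma>)}"
                using t(1) ltab_emp2[OF n w t(1) mm] by simp
            qed
          qed
          moreover have "real (card {\<sigma>. \<sigma> permutes {1..n} \<and> h < MI ?I ?J (ptab n (\<lambda>i. a (w i)) (\<lambda>i. b (x n i)) \<sigma>)}) \<le> fact n * ?q"
            by (rule card_permutes_MI_upper[OF fin n]) (use w in \<open>auto simp: weights_def\<close>)
          ultimately show ?thesis by (simp add: indicator_def)
        qed
      qed
      also have "\<dots> \<le> ?q * exp (- real n * (i - e/2))" using elim(1) by (intro mult_left_mono) auto
      also have "\<dots> = exp ((- real n * h + 2 * table_error ?I ?J * fact_error n) + (- real n * (i - e/2)))" by (rule exp_add[symmetric])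
      also have "\<dots> \<le> exp (- real n * (c - e))"
        unfolding exp_le_cancel_iff
      proof -
        have "real n * c \<le> real n * (h + i)" using ab(3) by (intro mult_left_mono) auto
        then show "(- real n * h + 2 * table_error ?I ?J * fact_error n) + (- real n * (i - e/2)) \<le> - real n * (c - e)"
          using elim(2) by (simp add: algebra_simps)
      qed
      finally show ?case .
    qed
  qed
  then show ?thesis using r' by blast
qed

text \<open>The indices pass through a map with values at least 1, because for n = 0 the empirical
  measure is not a probability measure.\<close>

lemma x_wconv:
  assumes f: "filterlim f sequentially sequentially" "\<And>m :: nat. f m \<ge> 1"
  shows "wconv UNIV sequentially (\<lambda>m. empirical_measure borel (f m) (x (f m))) \<mu>"
proof (rule weakly_converges_wconv[OF \<mu>])
  show "empirical_measure borel (f m) (x (f m)) \<in> borel_probs UNIV" for m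
    using empirical_facts(1,2)[OF f(2)[of m], of "x (f m)" borel] by (simp add: borel_probs_UNIV)
  show "weakly_converges (\<lambda>m. empirical_measure borel (f m) (x (f m))) \<mu>"
    unfolding weakly_converges_def
  proof (intro allI impI)
    fix g :: "'s \<Rightarrow> real" assume "continuous_on UNIV g \<and> bounded (range g)"
    then have "(\<lambda>n. \<integral>y. g y \<partial>empirical_measure borel n (x n)) \<longlonglongrightarrow> (\<integral>y. g y \<partial>\<mu>)"
      using xlim by (simp add: weakly_converges_def)
    then show "(\<lambda>m. \<integral>y. g y \<partial>empirical_measure borel (f m) (x (f m))) \<longlonglongrightarrow> (\<integral>y. g y \<partial>\<mu>)"
      using f(1) by (rule filterlim_compose)
  qed
qed

lemma x_cells:
  assumes b: "clab \<mu> b"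
  shows "(\<lambda>n. real (card {s\<in>{1..n}. b (x n s) = j}) / real n) \<longlonglongrightarrow> measure \<mu> {y. b y = j}"
proof -
  have P: "empirical_measure borel (Suc m) (x (Suc m)) \<in> borel_probs UNIV" for m
    using empirical_facts(1,2)[of "Suc m" "x (Suc m)" borel] by (simp add: borel_probs_UNIV)
  have S: "{y. b y = j} \<in> sets borel" using measurable_sets[OF clab_measurable_UNIV[OF \<mu> b], of "{j}"] by (simp add: vimage_def)
  have "wconv UNIV sequentially (\<lambda>m. empirical_measure borel (Suc m) (x (Suc m))) \<mu>"
    by (rule x_wconv[OF filterlim_Suc]) simp
  then have "(\<lambda>m. measure (empirical_measure borel (Suc m) (x (Suc m))) {z\<in>UNIV. b z \<in> {j}}) \<longlonglongrightarrow> measure \<mu> {z\<in>UNIV. b z \<in> {j}}"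
    by (rule wconv_cell[OF \<mu> P _ b])
  moreover have "measure (empirical_measure borel (Suc m) (x (Suc m))) {z\<in>UNIV. b z \<in> {j}} =
      real (card {s\<in>{1..Suc m}. b (x (Suc m) s) = j}) / real (Suc m)" for m
    using empirical_facts(4)[of "Suc m" "x (Suc m)" borel, OF _ _ S] by simp
  ultimately have "(\<lambda>m. real (card {s\<in>{1..Suc m}. b (x (Suc m) s) = j}) / real (Suc m)) \<longlonglongrightarrow> measure \<mu> {y. b y = j}"
    by (simp only: singleton_iff UNIV_I simp_thms)
  then show ?thesis by (rule LIMSEQ_imp_Suc)
qed

text \<open>Off the compact set of pairs \<open>(\<nu>, \<mu>)\<close> with \<open>\<nu> \<in> K\<close>, a closed set can be visited only
  when the empirical measure of the weights stays away from \<open>K\<close>.\<close>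

lemma closed_set_avoids:
  assumes K: "compactin W.mtopology K" and C: "closedin D.mtopology C"
    and no: "\<And>\<rho>. \<rho> \<in> C \<Longrightarrow> marginal1 \<rho> \<in> K \<Longrightarrow> marginal2 \<rho> \<noteq> \<mu>"
  shows "\<exists>r>0. \<forall>\<^sub>F n in sequentially. \<forall>w\<in>weights n. emp2 n w (x n) \<in> C \<longrightarrow> (\<forall>\<nu>\<in>K. r \<le> W1 (emp1 n w) \<nu>)"
proof (rule ccontr)
  assume neg: "\<not> ?thesis"
  have KM: "K \<subseteq> M11" using compactin_subset_topspace[OF K] by simp
  \<comment> \<open>A counterexample at scale 1 / (k + 1) with index beyond \<open>k\<close>. By
    compactness of \<open>K\<close> the points \<open>\<nu>\<close> converge along a subsequence,
    and the first marginals follow them.\<close>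
  define P where "P k n w \<nu> \<longleftrightarrow> Suc k \<le> n \<and> w \<in> weights n \<and> emp2 n w (x n) \<in> C \<and> \<nu> \<in> K \<and> W1 (emp1 n w) \<nu> < 1 / real (Suc k)" for k n w \<nu>
  have "\<exists>n w \<nu>. P k n w \<nu>" for k
  proof (rule ccontr)
    assume "\<not> ?thesis"
    then have "\<forall>n\<ge>Suc k. \<forall>w\<in>weights n. emp2 n w (x n) \<in> C \<longrightarrow> (\<forall>\<nu>\<in>K. 1 / real (Suc k) \<le> W1 (emp1 n w) \<nu>)"
      by (auto simp: P_def not_less simp del: of_nat_Suc)
    then have "\<forall>\<^sub>F n in sequentially. \<forall>w\<in>weights n. emp2 n w (x n) \<in> C \<longrightarrow> (\<forall>\<nu>\<in>K. 1 / real (Suc k) \<le> W1 (emp1 n w) \<nu>)"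
      unfolding eventually_sequentially by (rule exI)
    moreover have "1 / real (Suc k) > 0" by simp
    ultimately show False using neg by blast
  qed
  from choice[OF allI[OF this]] obtain N where "\<forall>k. \<exists>w \<nu>. P k (N k) w \<nu>" by (rule exE)
  from choice[OF this] obtain w where "\<forall>k. \<exists>\<nu>. P k (N k) (w k) \<nu>" by (rule exE)
  from choice[OF this] obtain \<nu>s where "\<forall>k. P k (N k) (w k) (\<nu>s k)" by (rule exE)
  then have N: "\<And>k. Suc k \<le> N k" and w: "\<And>k. w k \<in> weights (N k)" and inC: "\<And>k. emp2 (N k) (w k) (x (N k)) \<in> C"
    and \<nu>s: "\<And>k. \<nu>s k \<in> K" and close: "\<And>k. W1 (emp1 (N k) (w k)) (\<nu>s k) < 1 / real (Suc k)"
    by (simp_all add: P_def del: of_nat_Suc)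
  have N1: "N k \<ge> 1" for k using N[of k] by simp
  have "range \<nu>s \<subseteq> K" using \<nu>s by blast
  then obtain \<nu> r where \<nu>: "\<nu> \<in> K" and r: "strict_mono (r :: nat \<Rightarrow> nat)" "limitin W.mtopology (\<nu>s \<circ> r) \<nu> sequentially"
    using K unfolding W.compactin_sequentially by blast
  have \<nu>M: "\<nu> \<in> M11" "\<And>k. \<nu>s k \<in> M11" using \<nu> \<nu>s KM by auto
  have l: "(\<lambda>m. W1 (\<nu>s (r m)) \<nu>) \<longlonglongrightarrow> 0"
    using r(2) by (auto simp: W.limitin_metric tendsto_iff dist_real_def W1_nonneg elim!: eventually_mono)
  define \<rho>s where "\<rho>s m = emp2 (N (r m)) (w (r m)) (x (N (r m)))" for m
  note f2 = emp2_facts[OF N1 w]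
  have rs: "\<rho>s m \<in> M11_times" for m unfolding \<rho>s_def by (rule f2(4))
  have w1: "(\<lambda>m. W1 (marginal1 (\<rho>s m)) \<nu>) \<longlonglongrightarrow> 0"
  proof (rule tendsto_sandwich[OF _ _ tendsto_const])
    show "\<forall>\<^sub>F m in sequentially. W1 (marginal1 (\<rho>s m)) \<nu> \<le> 1 / real (Suc (r m)) + W1 (\<nu>s (r m)) \<nu>"
    proof (intro always_eventually allI)
      fix m
      have "W1 (marginal1 (\<rho>s m)) \<nu> \<le> W1 (emp1 (N (r m)) (w (r m))) (\<nu>s (r m)) + W1 (\<nu>s (r m)) \<nu>"
        unfolding \<rho>s_def f2(2) by (rule W1_triangle[OF emp1_M11[OF N1 w] \<nu>M(2) \<nu>M(1)])
      then show "W1 (marginal1 (\<rho>s m)) \<nu> \<le> 1 / real (Suc (r m)) + W1 (\<nu>s (r m)) \<nu>" using close[of "r m"] by linarith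
    qed
    have "(\<lambda>k. 1 / real (Suc k)) \<longlonglongrightarrow> 0" using LIMSEQ_inverse_real_of_nat by (simp add: inverse_eq_divide)
    then have "(\<lambda>m. 1 / real (Suc (r m))) \<longlonglongrightarrow> 0" using filterlim_subseq[OF r(1)] by (rule filterlim_compose)
    from tendsto_add[OF this l] show "(\<lambda>m. 1 / real (Suc (r m)) + W1 (\<nu>s (r m)) \<nu>) \<longlonglongrightarrow> 0" by simp
  qed (simp add: W1_nonneg)
  have "filterlim (\<lambda>m. N (r m)) sequentially sequentially"
  proof (rule filterlim_at_top_mono[OF filterlim_subseq[OF r(1)]])
    show "\<forall>\<^sub>F m in sequentially. r m \<le> N (r m)" using N Suc_leD by (intro always_eventually allI) blast
  qed
  then have w2: "wconv UNIV sequentially (\<lambda>m. marginal2 (\<rho>s m)) \<mu>"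
    unfolding \<rho>s_def f2(3) using N1 by (rule x_wconv)
  obtain \<rho> r' where \<rho>: "marginal1 \<rho> = \<nu>" "marginal2 \<rho> = \<mu>" "limitin D.mtopology (\<rho>s \<circ> (r' :: nat \<Rightarrow> nat)) \<rho> sequentially"
    by (rule Delta_compact[OF rs \<nu>M(1) \<mu> w1 w2]) blast
  have "range (\<rho>s \<circ> r') \<subseteq> C" using inC by (auto simp: \<rho>s_def)
  then have "\<rho> \<in> C" using C \<rho>(3) unfolding D.metric_closedin_iff_sequentially_closed by blast
  then show False using no \<rho> \<nu> by blast
qed

text \<open>The second marginal is fixed and the first ranges over a compact set, so
  \<open>Delta_compact\<close> supplies convergent subsequences; their limits remain in
  \<open>C\<close>.\<close>

lemma compactin_pairs:
  assumes K: "compactin W.mtopology K" and C: "closedin D.mtopology C"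
  shows "compactin D.mtopology {\<rho>\<in>C. marginal1 \<rho> \<in> K \<and> marginal2 \<rho> = \<mu>}"
  unfolding D.compactin_sequentially
proof (intro conjI allI impI)
  have CM: "C \<subseteq> M11_times" using closedin_subset[OF C] by simp
  have KM: "K \<subseteq> M11" using compactin_subset_topspace[OF K] by simp
  show "{\<rho>\<in>C. marginal1 \<rho> \<in> K \<and> marginal2 \<rho> = \<mu>} \<subseteq> M11_times" using CM by blast
  fix \<sigma> :: "nat \<Rightarrow> (real \<times> 's) measure" assume "range \<sigma> \<subseteq> {\<rho>\<in>C. marginal1 \<rho> \<in> K \<and> marginal2 \<rho> = \<mu>}"
  then have s: "\<And>m. \<sigma> m \<in> C" "\<And>m. marginal1 (\<sigma> m) \<in> K" and m2: "\<And>m. marginal2 (\<sigma> m) = \<mu>" by auto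
  have "range (\<lambda>m. marginal1 (\<sigma> m)) \<subseteq> K" using s by blast
  then obtain \<nu> r where \<nu>: "\<nu> \<in> K" and r: "strict_mono (r :: nat \<Rightarrow> nat)" "limitin W.mtopology ((\<lambda>m. marginal1 (\<sigma> m)) \<circ> r) \<nu> sequentially"
    using K unfolding W.compactin_sequentially by blast
  have \<nu>M: "\<nu> \<in> M11" using \<nu> KM by blast
  have l: "(\<lambda>m. W1 (marginal1 ((\<sigma> \<circ> r) m)) \<nu>) \<longlonglongrightarrow> 0"
    using r(2) by (auto simp: W.limitin_metric tendsto_iff dist_real_def W1_nonneg elim!: eventually_mono)
  have w2: "wconv UNIV sequentially (\<lambda>m. marginal2 ((\<sigma> \<circ> r) m)) \<mu>" by (simp add: m2 wconv_def)
  have sr: "(\<sigma> \<circ> r) m \<in> M11_times" for m using s(1) CM by auto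
  obtain \<rho> r' where \<rho>: "marginal1 \<rho> = \<nu>" "marginal2 \<rho> = \<mu>" "strict_mono (r' :: nat \<Rightarrow> nat)" "limitin D.mtopology ((\<sigma> \<circ> r) \<circ> r') \<rho> sequentially"
    by (rule Delta_compact[OF sr \<nu>M \<mu> l w2]) blast
  have "range ((\<sigma> \<circ> r) \<circ> r') \<subseteq> C" using s(1) by auto
  then have "\<rho> \<in> C" using C \<rho>(4) unfolding D.metric_closedin_iff_sequentially_closed by blast
  then show "\<exists>l r. l \<in> {\<rho>\<in>C. marginal1 \<rho> \<in> K \<and> marginal2 \<rho> = \<mu>} \<and> strict_mono r \<and> limitin D.mtopology (\<sigma> \<circ> r) l sequentially"
    using \<rho> r \<nu> by - (rule exI[of _ \<rho>], rule exI[of _ "r \<circ> r'"], auto simp: comp_assoc strict_mono_o)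
qed

lemma Pn_prob: "n \<ge> 1 \<Longrightarrow> prob_space (Pn n)" and sets_Pn: "sets (Pn n) = sets (borel_of X)"
  and emp2_W_measurable: "n \<ge> 1 \<Longrightarrow> (\<lambda>\<omega>. emp2 n (\<lambda>i. W n i \<omega>) (x n)) \<in> M \<rightarrow>\<^sub>M borel_of X"
proof -
  show m: "(\<lambda>\<omega>. emp2 n (\<lambda>i. W n i \<omega>) (x n)) \<in> M \<rightarrow>\<^sub>M borel_of X" if "n \<ge> 1"
    by (rule emp2_measurable[OF that W_borel[OF that] W_weights[OF that]])
  show "prob_space (Pn n)" if "n \<ge> 1" unfolding Pn_def by (rule M.prob_space_distr[OF m[OF that]])
  show "sets (Pn n) = sets (borel_of X)" by (simp add: Pn_def)
qed

text \<open>A substitute for exponential tightness. With \<open>?K\<close> a level set of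
  \<open>I_W\<close>, the members of \<open>C\<close> with marginals in \<open>?K\<close> and equal
  to \<open>\<mu>\<close> form a compact set, covered by finitely many balls from
  \<open>local_upper\<close>. What is left of \<open>C\<close> can be reached only if the weights
  avoid a neighbourhood of \<open>?K\<close>, and this alone costs \<open>c\<close>.\<close>

lemma closed_upper:
  fixes c e :: real
  assumes C: "closedin X C" and c: "\<And>\<rho>. \<rho> \<in> C \<Longrightarrow> ereal c < J \<rho>" and e: "e > 0"
  shows "\<forall>\<^sub>F n in sequentially. measure (Pn n) C \<le> exp (- real n * (c - e))"
proof -
  have C': "closedin D.mtopology C" using C by (simp only: closedin_X)
  have CM: "C \<subseteq> M11_times" using closedin_subset[OF C'] by simp
  let ?K = "{\<nu> \<in> M11. I_W \<nu> \<le> ereal c}"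
  let ?KK = "{\<rho>\<in>C. marginal1 \<rho> \<in> ?K \<and> marginal2 \<rho> = \<mu>}"
  have K: "compactin W.mtopology ?K"
    using good by (simp add: good_rate_function_def topspace_M11 flip: M11_topology_def)
  note KK = compactin_pairs[OF K C']
  have "\<forall>\<rho>\<in>?KK. \<exists>r>0. \<forall>e>0. \<forall>\<^sub>F n in sequentially. measure (Pn n) (D.mball \<rho> r) \<le> exp (- real n * (c - e))"
    using CM by (intro ballI local_upper c) auto
  from bchoice[OF this] obtain R where R0: "\<forall>\<rho>\<in>?KK. R \<rho> > 0 \<and>
      (\<forall>e>0. \<forall>\<^sub>F n in sequentially. measure (Pn n) (D.mball \<rho> (R \<rho>)) \<le> exp (- real n * (c - e)))" by (rule exE)
  have R: "R \<rho> > 0" "e > 0 \<Longrightarrow> \<forall>\<^sub>F n in sequentially. measure (Pn n) (D.mball \<rho> (R \<rho>)) \<le> exp (- real n * (c - e))"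
    if "\<rho> \<in> ?KK" for \<rho> e
    using bspec[OF R0 that] by blast+
  let ?B = "\<lambda>\<rho>. D.mball \<rho> (R \<rho>)"
  have cover: "?KK \<subseteq> \<Union>(?B ` ?KK)"
  proof
    fix \<rho> assume \<rho>: "\<rho> \<in> ?KK"
    then have "\<rho> \<in> ?B \<rho>" using R(1)[OF \<rho>] CM by (subst D.centre_in_mball_iff) auto
    then show "\<rho> \<in> \<Union>(?B ` ?KK)" using \<rho> by blast
  qed
  have "\<exists>\<F>. finite \<F> \<and> \<F> \<subseteq> ?B ` ?KK \<and> ?KK \<subseteq> \<Union>\<F>"
    by (rule compactinD[OF KK _ cover]) auto
  then obtain T where T: "finite T" "T \<subseteq> ?KK" "?KK \<subseteq> \<Union>(?B ` T)"
    by (elim exE conjE) (drule (1) finite_subset_image, blast)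
  define C1 where "C1 = C - \<Union>(?B ` T)"
  have C1: "closedin D.mtopology C1"
    unfolding C1_def by (intro closedin_diff C' openin_Union) auto
  have "\<exists>r>0. \<forall>\<^sub>F n in sequentially. \<forall>w\<in>weights n. emp2 n w (x n) \<in> C1 \<longrightarrow> (\<forall>\<nu>\<in>?K. r \<le> W1 (emp1 n w) \<nu>)"
    by (rule closed_set_avoids[OF K C1]) (unfold C1_def, use T(3) in blast)
  then obtain r where r: "r > 0"
    "\<forall>\<^sub>F n in sequentially. \<forall>w\<in>weights n. emp2 n w (x n) \<in> C1 \<longrightarrow> (\<forall>\<nu>\<in>?K. r \<le> W1 (emp1 n w) \<nu>)" by blast
  define A where "A = M11 - \<Union>((\<lambda>\<nu>. W.mball \<nu> r) ` ?K)"
  have A: "closedin M11_topology A"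
  proof -
    have "closedin W.mtopology (topspace W.mtopology - \<Union>((\<lambda>\<nu>. W.mball \<nu> r) ` ?K))"
      by (intro closedin_diff closedin_topspace openin_Union) auto
    then show ?thesis by (simp add: A_def closedin_Y)
  qed
  have "ereal c \<le> I_W \<nu>" if \<nu>: "\<nu> \<in> A" for \<nu>
  proof (rule ccontr)
    assume "\<not> ?thesis"
    then have "\<nu> \<in> ?K" using \<nu> by (auto simp: A_def)
    moreover have "\<nu> \<in> W.mball \<nu> r" using \<nu> r(1) by (subst W.centre_in_mball_iff) (auto simp: A_def)
    ultimately show False using \<nu> unfolding A_def by blast
  qed
  then have Q: "\<forall>\<^sub>F n in sequentially. measure (Q n) A \<le> exp (- real n * (c - e/2))"
    by (rule LDP_closed_upper[OF Q_LDP A]) (use e in auto)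
  have balls: "\<forall>\<^sub>F n in sequentially. \<forall>\<rho>\<in>T. measure (Pn n) (?B \<rho>) \<le> exp (- real n * (c - e/2))"
  proof (rule eventually_ball_finite[OF T(1)], rule ballI)
    fix \<rho> assume "\<rho> \<in> T"
    then show "\<forall>\<^sub>F n in sequentially. measure (Pn n) (?B \<rho>) \<le> exp (- real n * (c - e/2))"
      using T(2) e by (intro R(2)) auto
  qed
  \<comment> \<open>The index threshold makes 1 + card T at most exp (n e / 2), which pays for the
    number of balls and the remainder.\<close>
  show ?thesis
    using Q balls r(2) eventually_ge_at_top[of "max 1 (nat \<lceil>2 * real (card T) / e\<rceil>)"]
  proof eventually_elim
    case (elim n)
    have n: "n \<ge> 1" using elim(4) by simp
    interpret P: prob_space "Pn n" by (rule Pn_prob[OF n])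
    have Bs: "?B \<rho> \<in> sets (Pn n)" for \<rho> unfolding sets_Pn by (intro openin_borel_of) (simp add: openin_X)
    have C1s: "C1 \<in> sets (borel_of X)" using C1 by (intro closedin_borel_of) (simp only: closedin_X)
    have As: "A \<in> sets (borel_of M11_topology)" by (rule closedin_borel_of[OF A])
    \<comment> \<open>For the remainder the trivial count n! serves; the whole cost lies in the
      weights.\<close>
    have "measure (Pn n) C1 \<le> 1 * measure (Q n) A"
    proof (rule upper_transfer[OF n C1s As])
      fix w assume w: "w \<in> weights n"
      let ?T = "{\<sigma>. \<sigma> permutes {1..n} \<and> emp2 n (\<lambda>i. w (\<sigma> i)) (x n) \<in> C1}"
      show "real (card ?T) \<le> fact n * (1 * indicator A (emp1 n w))"
      proof (cases "?T = {}")
        case True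
        then have "real (card ?T) = 0" by (simp only: card.empty of_nat_0)
        then show ?thesis by simp
      next
        case False
        then obtain \<sigma> where s: "\<sigma> permutes {1..n}" "emp2 n (\<lambda>i. w (\<sigma> i)) (x n) \<in> C1" by blast
        have "\<forall>\<nu>\<in>?K. r \<le> W1 (emp1 n w) \<nu>"
          using bspec[OF elim(3) weights_permutes[OF s(1) w]] s(2) unfolding empirical_permutes[OF s(1)] by blast
        then have wA: "emp1 n w \<in> A" using emp1_M11[OF n w] by (auto simp: A_def W1_commute[of "emp1 n w"] not_less)
        have "card ?T \<le> card {\<sigma>. \<sigma> permutes {1..n}}"
          by (intro card_mono finite_permutations) auto
        also have "\<dots> = fact n"
          using card_permutations[OF card_atLeastAtMost finite_atLeastAtMost, of 1 n] by simp
        finally have "real (card ?T) \<le> real (fact n)" by (simp only: of_nat_le_iff)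
        then show ?thesis using wA by (simp only: indicator_simps of_nat_fact mult_1 mult_1_right)
      qed
    qed
    then have C1b: "measure (Pn n) C1 \<le> exp (- real n * (c - e/2))" using elim(1) by simp
    have "measure (Pn n) C \<le> measure (Pn n) (C1 \<union> \<Union>(?B ` T))"
      using C1s Bs T(1) by (intro P.finite_measure_mono sets.Un sets.finite_UN) (auto simp: C1_def sets_Pn)
    also have "\<dots> \<le> measure (Pn n) C1 + measure (Pn n) (\<Union>(?B ` T))"
      using C1s Bs T(1) by (intro measure_Un_le sets.finite_UN) (auto simp: sets_Pn)
    also have "measure (Pn n) (\<Union>(?B ` T)) \<le> (\<Sum>\<rho>\<in>T. measure (Pn n) (?B \<rho>))"
      by (rule measure_UNION_le[OF T(1) Bs])
    also have "\<dots> \<le> (\<Sum>\<rho>\<in>T. exp (- real n * (c - e/2)))" using elim(2) by (intro sum_mono) blast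
    finally have "measure (Pn n) C \<le> (1 + real (card T)) * exp (- real n * (c - e/2))"
      using C1b by (simp add: algebra_simps)
    also have "\<dots> \<le> exp (real n * (e/2)) * exp (- real n * (c - e/2))"
    proof (rule mult_right_mono)
      have "2 * real (card T) / e \<le> real n" using elim(4) by linarith
      then have "real (card T) \<le> real n * (e/2)" using e by (simp add: field_simps)
      then show "1 + real (card T) \<le> exp (real n * (e/2))" using exp_ge_add_one_self[of "real n * (e/2)"] by linarith
    qed simp
    also have "\<dots> = exp (- real n * (c - e))" by (simp add: algebra_simps flip: exp_add)
    finally show ?case .
  qed
qed

text \<open>For all weights near the first marginal of \<open>\<rho>\<close> the label margins are
  close to those of its table. So \<open>card_permutes_lower\<close> applies to them uniformly, and
  each permutation it counts leads into the ball of radius \<open>R\<close>. The mutual information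
  of the labelling is at most the entropy, so the total cost is at most h + i up to errors.\<close>

lemma open_lower:
  fixes c e :: real
  assumes U: "openin X U" and \<rho>U: "\<rho> \<in> U" and c: "J \<rho> = ereal c" and e: "e > 0"
  shows "\<forall>\<^sub>F n in sequentially. exp (- real n * (c + e)) \<le> measure (Pn n) U"
proof -
  have U': "openin D.mtopology U" using U by (simp only: openin_X)
  have \<rho>: "\<rho> \<in> M11_times" using openin_subset[OF U'] \<rho>U by auto
  note r = M11_timesD[OF \<rho>]
  have m2: "marginal2 \<rho> = \<mu>" using c by (auto simp: rate_J_def split: if_splits)
  let ?\<nu> = "marginal1 \<rho>"
  let ?H = "relative_entropy \<rho> (?\<nu> \<Otimes>\<^sub>M \<mu>)"
  have H0: "0 \<le> ?H" using entropy_nonneg[OF r(1)] m2 by simp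
  have I0: "0 \<le> I_W ?\<nu>" by (rule I_W_nonneg[OF r(2)])
  have "?H + I_W ?\<nu> = ereal c" using c by (simp add: rate_J_def m2)
  then obtain h i where h: "?H = ereal h" and i: "I_W ?\<nu> = ereal i" and hi: "h + i = c"
    using H0 I0 by (cases ?H; cases "I_W ?\<nu>") auto
  obtain R where R: "R > 0" "D.mball \<rho> R \<subseteq> U" using U' \<rho>U by (auto simp: D.openin_mtopology)
  \<comment> \<open>\<open>beta_BL_close\<close> takes 6 \<open>\<epsilon>\<close>, which is below R
    / 2; the other half of \<open>R\<close> is reserved for \<open>W1\<close>.\<close>
  define \<epsilon> where "\<epsilon> = R / 14"
  have \<epsilon>: "\<epsilon> > 0" using R by (simp add: \<epsilon>_def)
  obtain a b S where ab: "clab ?\<nu> a" "clab \<mu> b" and goodS: "measure \<rho> (labset a b S) > 1 - \<epsilon>"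
    and small: "\<And>z z'. z \<in> labset a b S \<Longrightarrow> z' \<in> R_plus_times \<Longrightarrow> a (fst z) = a (fst z') \<Longrightarrow> b (snd z) = b (snd z') \<Longrightarrow> mdist \<delta> z z' < \<epsilon>"
    by (rule fine_labels[OF M11_D(1)[OF r(2)] \<mu> r(1) \<epsilon>]) blast
  let ?I = "a ` R_plus" and ?J = "range b" and ?p = "ltab \<rho> a b"
  note fin = clab_finite_range(1)[OF M11_D(1)[OF r(2)] ab(1)] clab_finite_range(2)[OF \<mu> ab(2)]
  note mm = clab_measurable[OF M11_D(1)[OF r(2)] ab(1)] clab_measurable_UNIV[OF \<mu> ab(2)]
  note sums = ltab_sums[OF r(1) fin order_refl order_refl mm]
  define k where "k = real (card ?I * card ?J)"
  have k: "k \<ge> 0" by (simp add: k_def)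
  \<comment> \<open>The bound e / 4 keeps the exponent in check; the other one keeps the deviation
    summed over all cells below \<open>\<epsilon>\<close>.\<close>
  define e' where "e' = min (e/4) (\<epsilon> / (k + 1))"
  have e': "e' > 0" "e' \<le> e/4" "k * e' \<le> \<epsilon>"
  proof -
    show "e' > 0" using e \<epsilon> k by (simp add: e'_def)
    show "e' \<le> e/4" by (simp only: e'_def min.cobounded1)
    have "k * e' \<le> k * (\<epsilon> / (k + 1))" using k by (intro mult_left_mono) (auto simp: e'_def)
    also have "\<dots> \<le> \<epsilon>" using k \<epsilon> by (simp add: field_simps)
    finally show "k * e' \<le> \<epsilon>" .
  qed
  obtain d n0 where d: "d > 0" and low: "\<And>n a' b'. n \<ge> n0 \<Longrightarrow> a' ` {1..n} \<subseteq> ?I \<Longrightarrow> b' ` {1..n} \<subseteq> ?J \<Longrightarrow>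
       (\<And>i. i \<in> ?I \<Longrightarrow> \<bar>real (card {s\<in>{1..n}. a' s = i}) / real n - (\<Sum>j\<in>?J. ?p i j)\<bar> < d) \<Longrightarrow>
       (\<And>j. j \<in> ?J \<Longrightarrow> \<bar>real (card {s\<in>{1..n}. b' s = j}) / real n - (\<Sum>i\<in>?I. ?p i j)\<bar> < d) \<Longrightarrow>
       fact n * exp (- real n * (MI ?I ?J ?p + e')) \<le>
         real (card {\<sigma>. \<sigma> permutes {1..n} \<and> (\<forall>i\<in>?I. \<forall>j\<in>?J. \<bar>ptab n a' b' \<sigma> i j - ?p i j\<bar> < e')})"
    by (rule card_permutes_lower[OF fin ltab_nonneg sums(3) e'(1)]) blast
  let ?cell = "\<lambda>i. {w\<in>R_plus. a w = i}"
  \<comment> \<open>The cells of \<open>a\<close> have null boundary, so convergence in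
    \<open>W1\<close> makes their masses converge; being finitely many, they do so
    uniformly.\<close>
  have "\<exists>s>0. \<forall>\<nu>'\<in>M11. W1 ?\<nu> \<nu>' < s \<longrightarrow> (\<forall>i\<in>?I. \<bar>measure \<nu>' (?cell i) - measure ?\<nu> (?cell i)\<bar> < d)"
  proof (rule ccontr)
    assume "\<not> ?thesis"
    then have "\<exists>\<nu>'\<in>M11. W1 ?\<nu> \<nu>' < s \<and> \<not> (\<forall>i\<in>?I. \<bar>measure \<nu>' (?cell i) - measure ?\<nu> (?cell i)\<bar> < d)" if "s > 0" for s
      using that by blast
    then obtain \<nu>s where ns: "\<And>n. \<nu>s n \<in> M11" "\<And>n. \<not> (\<forall>i\<in>?I. \<bar>measure (\<nu>s n) (?cell i) - measure ?\<nu> (?cell i)\<bar> < d)"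
      "(\<lambda>n. W1 (\<nu>s n) ?\<nu>) \<longlonglongrightarrow> 0"
      by (rule W.sequence_counterexample[OF r(2)]) blast+
    have w: "wconv R_plus sequentially \<nu>s ?\<nu>" by (rule wconv_W1[OF r(2) ns(1,3)])
    have "\<forall>\<^sub>F n in sequentially. \<bar>measure (\<nu>s n) (?cell i) - measure ?\<nu> (?cell i)\<bar> < d" for i
      using tendstoD[OF wconv_cell[OF M11_D(1)[OF r(2)] M11_D(1)[OF ns(1)] w ab(1), of "{i}"] d] by (simp add: dist_real_def)
    then have "\<forall>\<^sub>F n in sequentially. \<forall>i\<in>?I. \<bar>measure (\<nu>s n) (?cell i) - measure ?\<nu> (?cell i)\<bar> < d"
      by (intro eventually_ball_finite fin(1)) blast
    from eventually_happens'[OF sequentially_bot this] show False using ns(2) by blast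
  qed
  then obtain s where s: "s > 0" "\<And>\<nu>' i. \<nu>' \<in> M11 \<Longrightarrow> W1 ?\<nu> \<nu>' < s \<Longrightarrow> i \<in> ?I \<Longrightarrow> \<bar>measure \<nu>' (?cell i) - measure ?\<nu> (?cell i)\<bar> < d"
    by blast
  define s' where "s' = min s (R/2)"
  let ?A = "W.mball ?\<nu> s'"
  have A: "openin M11_topology ?A" by (simp add: openin_Y)
  have "?\<nu> \<in> ?A" using r(2) s R by (subst W.centre_in_mball_iff) (auto simp: s'_def)
  then have "\<forall>\<^sub>F n in sequentially. exp (- real n * (i + e/4)) \<le> measure (Q n) ?A"
    by (rule LDP_open_lower[OF Q_LDP A]) (use e i in auto)
  moreover have "\<forall>\<^sub>F n in sequentially. \<forall>j\<in>?J. \<bar>real (card {s\<in>{1..n}. b (x n s) = j}) / real n - measure \<mu> {y. b y = j}\<bar> < d"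
    using tendstoD[OF x_cells[OF ab(2)] d] by (intro eventually_ball_finite fin(2)) (simp add: dist_real_def)
  ultimately show ?thesis using eventually_ge_at_top[of "max 1 n0"]
  proof eventually_elim
    case (elim n)
    have n: "n \<ge> 1" and n0: "n \<ge> n0" using elim(3) by simp_all
    let ?q = "exp (- real n * (MI ?I ?J ?p + e'))"
    have "?q * measure (Q n) ?A \<le> measure (Pn n) U"
    proof (rule lower_transfer[OF n openin_borel_of[OF U] openin_borel_of[OF A]])
      fix w assume w: "w \<in> weights n" and wA: "emp1 n w \<in> ?A"
      let ?L = "{\<sigma>. \<sigma> permutes {1..n} \<and> (\<forall>i\<in>?I. \<forall>j\<in>?J. \<bar>ptab n (\<lambda>i. a (w i)) (\<lambda>i. b (x n i)) \<sigma> i j - ?p i j\<bar> < e')}"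
      let ?T = "{\<sigma>. \<sigma> permutes {1..n} \<and> emp2 n (\<lambda>i. w (\<sigma> i)) (x n) \<in> U}"
      have wd: "W1 ?\<nu> (emp1 n w) < s" "W1 ?\<nu> (emp1 n w) < R/2" using wA by (auto simp: s'_def)
      have z: "\<forall>i\<in>{1..n}. w i \<in> space (restrict_space borel R_plus)"
        using w by (auto simp: weights_def space_restrict_space)
      have "fact n * ?q \<le> real (card ?L)"
      proof (rule low[OF n0])
        show "(\<lambda>i. a (w i)) ` {1..n} \<subseteq> ?I" using w by (auto simp: weights_def)
        show "(\<lambda>i. b (x n i)) ` {1..n} \<subseteq> ?J" by auto
        show "\<bar>real (card {s\<in>{1..n}. b (x n s) = j}) / real n - (\<Sum>i\<in>?I. ?p i j)\<bar> < d" if "j \<in> ?J" for j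
          using elim(2) that by (simp only: sums(2) m2)
        fix i assume "i \<in> ?I"
        then have "\<bar>measure (emp1 n w) (?cell i) - measure ?\<nu> (?cell i)\<bar> < d" by (rule s(2)[OF emp1_M11[OF n w] wd(1)])
        moreover have "measure (emp1 n w) (?cell i) = real (card {k\<in>{1..n}. w k \<in> ?cell i}) / real n"
          by (rule empirical_facts(4)[OF n z sums(4)])
        moreover have "{k\<in>{1..n}. w k \<in> ?cell i} = {s\<in>{1..n}. a (w s) = i}" using w by (auto simp: weights_def)
        ultimately show "\<bar>real (card {s\<in>{1..n}. a (w s) = i}) / real n - (\<Sum>j\<in>?J. ?p i j)\<bar> < d" by (simp only: sums(1))
      qed
      also have "real (card ?L) \<le> real (card ?T)"
        unfolding of_nat_le_iff
      proof (rule card_mono)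
        show "finite ?T" by (rule finite_subset[OF _ finite_permutations[of "{1..n}"]]) auto
        show "?L \<subseteq> ?T"
        proof (rule subsetI)
          fix \<sigma> assume "\<sigma> \<in> ?L"
          then have sp: "\<sigma> permutes {1..n}" and cl: "\<forall>i\<in>?I. \<forall>j\<in>?J. \<bar>ptab n (\<lambda>i. a (w i)) (\<lambda>i. b (x n i)) \<sigma> i j - ?p i j\<bar> < e'" by auto
          let ?\<rho>' = "emp2 n (\<lambda>i. w (\<sigma> i)) (x n)"
          note f2 = emp2_facts[OF n weights_permutes[OF sp w], of "x n"]
          have "(\<Sum>i\<in>?I. \<Sum>j\<in>?J. \<bar>ltab ?\<rho>' a b i j - ?p i j\<bar>) \<le> (\<Sum>i\<in>?I. \<Sum>j\<in>?J. e')"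
            unfolding ltab_emp2[OF n w sp mm] using cl by (intro sum_mono less_imp_le) blast
          also have "\<dots> = k * e'" by (simp add: k_def)
          finally have cs: "(\<Sum>i\<in>?I. \<Sum>j\<in>?J. \<bar>ltab ?\<rho>' a b i j - ?p i j\<bar>) \<le> \<epsilon>" using e'(3) by linarith
          have "beta_BL \<delta> ?\<rho>' \<rho> \<le> 6 * \<epsilon>"
            by (rule beta_BL_close[OF r(1) f2(1) mm fin(1) order_refl fin(2) order_refl goodS _ cs]) (rule small)
          moreover have "marginal1 ?\<rho>' = emp1 n w" unfolding f2(2) by (rule empirical_permutes[OF sp])
          ultimately have "Delta \<delta> \<rho> ?\<rho>' < R"
            using wd(2) R(1) by (simp add: Delta_def beta_BL_commute[of \<rho>] \<epsilon>_def)
          then have "?\<rho>' \<in> D.mball \<rho> R" using \<rho> f2(4) by simp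
          then show "\<sigma> \<in> ?T" using sp R(2) by blast
        qed
      qed
      finally show "fact n * ?q \<le> real (card ?T)" .
    qed
    moreover have "?q * exp (- real n * (i + e/4)) \<le> ?q * measure (Q n) ?A" using elim(1) by (intro mult_left_mono) auto
    moreover have "exp (- real n * (c + e)) \<le> exp (- real n * (MI ?I ?J ?p + e') + - real n * (i + e/4))"
    proof -
      have "ereal (MI ?I ?J ?p) \<le> ereal h"
        using MI_le_entropy[OF r(1) fin order_refl order_refl mm] by (simp only: m2 h)
      then have "(MI ?I ?J ?p + e') + (i + e/4) \<le> c + e" using hi e' e by simp
      then have "real n * ((MI ?I ?J ?p + e') + (i + e/4)) \<le> real n * (c + e)" by (intro mult_left_mono) auto
      then show ?thesis by (simp add: algebra_simps)
    qed
    moreover have "exp (- real n * (MI ?I ?J ?p + e') + - real n * (i + e/4)) = ?q * exp (- real n * (i + e/4))" by (rule exp_add)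
    ultimately show ?case by linarith
  qed
qed

lemma LDP_pairs: "LDP_rv M X (\<lambda>n \<omega>. emp2 n (\<lambda>i. W n i \<omega>) (x n)) J"
  unfolding LDP_rv_def Pn_def[symmetric]
proof (intro conjI allI impI)
  show "(\<lambda>\<omega>. emp2 n (\<lambda>i. W n i \<omega>) (x n)) \<in> M \<rightarrow>\<^sub>M borel_of X" if "n \<ge> 1" for n by (rule emp2_W_measurable[OF that])
  show "LDP X Pn J"
  proof (rule LDP_I)
    show "rate_function X J" using good_J by (simp add: good_rate_function_def)
  qed (use Pn_prob sets_Pn closed_upper open_lower in auto)
qed

end

theorem theorem1p1:
  fixes M :: "'w measure"
    and x :: "nat \<Rightarrow> nat \<Rightarrow> 's::polish_space"
    and \<mu> :: "'s measure"
    and W :: "nat \<Rightarrow> nat \<Rightarrow> 'w \<Rightarrow> real"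
    and I_W :: "real measure \<Rightarrow> ereal"
    and \<delta> :: "(real \<times> 's) metric"
  assumes "prob_space M"
    and "mspace \<delta> = R_plus_times"
    and "mtopology_of \<delta> = top_of_set R_plus_times"
    and "\<mu> \<in> borel_probs UNIV"
    and "weakly_converges (\<lambda>n. empirical_measure borel n (x n)) \<mu>"
    and "\<And>n i. n \<ge> 1 \<Longrightarrow> i \<in> {1..n} \<Longrightarrow> W n i \<in> M \<rightarrow>\<^sub>M restrict_space borel R_plus"
    and "\<And>n \<omega>. n \<ge> 1 \<Longrightarrow> \<omega> \<in> space M \<Longrightarrow> (\<Sum>i=1..n. W n i \<omega>) = real n"
    and "\<And>n. n \<ge> 1 \<Longrightarrow> exchangeable M n (W n)"
    and "LDP_rv M M11_topology
           (\<lambda>n \<omega>. empirical_measure (restrict_space borel R_plus) n (\<lambda>i. W n i \<omega>)) I_W"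
    and "good_rate_function M11_topology I_W"
  shows "LDP_rv M (M11_times_topology \<delta>)
           (\<lambda>n \<omega>. empirical_measure (restrict_space borel R_plus_times) n (\<lambda>i. (W n i \<omega>, x n i)))
           (rate_J I_W \<mu>)
         \<and> good_rate_function (M11_times_topology \<delta>) (rate_J I_W \<mu>)"
proof -
  interpret array_setting \<delta> I_W \<mu> M x W
    by (intro array_setting.intro rate_setting.intro product_metric.intro rate_setting_axioms.intro array_setting_axioms.intro; fact)
  show ?thesis using LDP_pairs good_J by blast
qed

end
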